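(* Let $(\mathfrak l,\theta_{\mathfrak l})$ be a Lie algebra with involution, let $(\rho,\mathfrak a)$ be an orthogonal $(\mathfrak l,\theta_{\mathfrak l})$-module and let $[\alpha,\gamma]\in\mathcal H^2_Q(\mathfrak l,\theta_{\mathfrak l},\mathfrak a)$. Then the quadratic extension $\mathfrak d_{\alpha,\gamma}(\mathfrak l,\theta_{\mathfrak l},\mathfrak a)$ is admissible if and only if (i) $[\mathfrak l_-,\mathfrak l_-]=\mathfrak l_+$, (ii) the representation $\rho$ is semi-simple, and (iii) $[\alpha,\gamma]\in\mathcal H^2_Q(\mathfrak l,\theta_{\mathfrak l},\mathfrak a)_\sharp$.
   Context: All Lie algebras and vector spaces are finite-dimensional over $\mathbb R$; a scalar product is a non-degenerate symmetric bilinear form, possibly indefinite. A Lie algebra with involution is a pair $(\mathfrak l,\theta_{\mathfrak l})$, $\theta_{\mathfrak l}\in\mathrm{Aut}(\mathfrak l)$, $\theta_{\mathfrak l}^2=\mathrm{Id}$. Subscripts $\pm$ denote $\pm1$-eigenspaces of an involution. A metric Lie algebra with involution $(\mathfrak g,\theta,\langle\cdot,\cdot\rangle)$ is a Lie algebra with ad-invariant scalar product and an isometric involutive automorphism; it is a symmetric triple if $[\mathfrak g_-,\mathfrak g_-]=\mathfrak g_+$ (equivalently, $\mathfrak g_+$ acts faithfully on $\mathfrak g_-$). **Modules and quadratic cohomology.** An orthogonal $(\mathfrak l,\theta_{\mathfrak l})$-module is $(\rho,\mathfrak a,\langle\cdot,\cdot\rangle_{\mathfrak a},\theta_{\mathfrak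 a})$ with $\rho$ a representation of $\mathfrak l$ on $\mathfrak a$ by skew-adjoint maps and $\theta_{\mathfrak a}$ an involutive isometry with $\theta_{\mathfrak a}\circ\rho(\theta_{\mathfrak l}(L))=\rho(L)\circ\theta_{\mathfrak a}$ for all $L\in\mathfrak l$. $C^p(\mathfrak l,\mathfrak a)=\mathrm{Hom}(\bigwedge^p\mathfrak l,\mathfrak a)$ and $C^p(\mathfrak l)=\mathrm{Hom}(\bigwedge^p\mathfrak l,\mathbb R)$ carry the Chevalley–Eilenberg differentials $d$; $\langle\alpha\wedge\tau\rangle\in C^{p+q}(\mathfrak l)$ is the (shuffle) wedge product of $\alpha\in C^p(\mathfrak l,\mathfrak a)$, $\tau\in C^q(\mathfrak l,\mathfrak a)$ composed with $\langle\cdot,\cdot\rangle_{\mathfrak a}$. The involution $\Theta$ is $(\Theta\alpha)(L_1,\dots)=\theta_{\mathfrak a}(\alpha(\theta_{\mathfrak l}L_1,\dots))$ on $C^p(\mathfrak l,\mathfrak a)$ and $(\Theta\gamma)(L_1,\dots)=\gamma(\theta_{\mathfrak l}L_1,\dots)$ on $C^p(\mathfrak l)$. Put $\mathcal Z^2_Q(\mathfrak l,\mathfrak a)_+=\{(\alpha,\gamma)\in C^2(\mathfrak l,\mathfrak a)_+\oplus C^3(\mathfrak l)_+\mid d\alpha=0,\ d\gamma=\frac12\langle\alpha\wedge\alpha\rangle\}$. The group $\mathcal C^1_Q(\mathfrak l,\mathfrak a)_+=C^1(\mathfrak l,\mathfrak a)_+\oplus C^2(\mathfrak l)_+$ with product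 $(\tau_1,\sigma_1)*(\tau_2,\sigma_2)=(\tau_1+\tau_2,\sigma_1+\sigma_2+\frac12\langle\tau_1\wedge\tau_2\rangle)$ acts on it by $(\alpha,\gamma)(\tau,\sigma)=(\alpha+d\tau,\ \gamma+d\sigma+\langle(\alpha+\frac12d\tau)\wedge\tau\rangle)$, and $\mathcal H^2_Q(\mathfrak l,\theta_{\mathfrak l},\mathfrak a)$ is the set of orbits $[\alpha,\gamma]$. **Standard model.** For $(\alpha,\gamma)\in\mathcal Z^2_Q(\mathfrak l,\mathfrak a)_+$, $\mathfrak d_{\alpha,\gamma}(\mathfrak l,\theta_{\mathfrak l},\mathfrak a)$ is the metric Lie algebra with involution on $\mathfrak d=\mathfrak l^*\oplus\mathfrak a\oplus\mathfrak l$ with $\langle Z_1+A_1+L_1,Z_2+A_2+L_2\rangle=\langle A_1,A_2\rangle_{\mathfrak a}+Z_1(L_2)+Z_2(L_1)$, $\theta=\theta_{\mathfrak l}^*\oplus\theta_{\mathfrak a}\oplus\theta_{\mathfrak l}$ and antisymmetric bracket $[\mathfrak l^*,\mathfrak l^*\oplus\mathfrak a]=0$, $[L_1,L_2]=\gamma(L_1,L_2,\cdot)+\alpha(L_1,L_2)+[L_1,L_2]_{\mathfrak l}$, $[L,A]=\rho(L)A-\langle A,\alpha(L,\cdot)\rangle_{\mathfrak a}$, $[L,Z]=-Z([L,\cdot]_{\mathfrak l})$, $[A_1,A_2]=\langle\rho(\cdot)A_1,A_2\rangle_{\mathfrak a}$. It is regarded as a quadratic extension of $(\mathfrak l,\theta_{\mathfrak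 l})$ by $\mathfrak a$ with isotropic ideal $\mathfrak i=\mathfrak l^*$, the sequence being $0\to\mathfrak a\to\mathfrak d/\mathfrak l^*\cong\mathfrak a\oplus\mathfrak l\to\mathfrak l\to0$. **Canonical ideal; admissible extensions.** For a Lie algebra $\mathfrak g$ put $S_0(\mathfrak g)=0$, $R_0(\mathfrak g)=\mathfrak g$; $S_k(\mathfrak g)$ is the largest ideal containing $S_{k-1}(\mathfrak g)$ such that the $\mathfrak g$-module $S_k(\mathfrak g)/S_{k-1}(\mathfrak g)$ is semi-simple; $R_k(\mathfrak g)$ is the smallest ideal contained in $R_{k-1}(\mathfrak g)$ such that $R_{k-1}(\mathfrak g)/R_k(\mathfrak g)$ is semi-simple. Put $\mathfrak i(\mathfrak g)=\sum_{k\ge1}S_k(\mathfrak g)\cap R_k(\mathfrak g)$. A quadratic extension with underlying metric Lie algebra with involution $\mathfrak g$ and isotropic ideal $\mathfrak i$ is balanced if $\mathfrak i=\mathfrak i(\mathfrak g)$; it is admissible if it is balanced and $\mathfrak g$ is a symmetric triple. Thus $\mathfrak d_{\alpha,\gamma}(\mathfrak l,\theta_{\mathfrak l},\mathfrak a)$ is admissible iff $\mathfrak l^*=\mathfrak i(\mathfrak d)$ and $\mathfrak d$ is a symmetric triple. **Admissible classes.** Let $(\mathfrak l,\theta_{\mathfrak l})$ satisfy $[\mathfrak l_-,\mathfrak l_-]=\mathfrak l_+$, let $(\rho,\mathfrak a)$ be semi-simple and $(\alpha,\gamma)\in\mathcal Z^2_Q(\mathfrak l,\mathfrak a)_+$.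 Let $\alpha=\alpha_0+\alpha_1$ according to $\mathfrak a=\mathfrak a^{\mathfrak l}\oplus\rho(\mathfrak l)\mathfrak a$. Regard $[\cdot,\cdot]_{\mathfrak l}$ and $\alpha_0$ as linear maps on $\bigwedge^2\mathfrak l$, and let $[\cdot,\cdot]_{\mathfrak l_-}$ be the restriction of the bracket to $\bigwedge^2\mathfrak l_-$. Conditions: - $(A_0)$: if $L_0\in\mathfrak z(\mathfrak l)\cap\ker\rho$ is such that there exist $A_0\in\mathfrak a$, $Z_0\in\mathfrak l^*$ with $\alpha(L,L_0)=\rho(L)A_0$ and $\gamma(L,L_0,\cdot)=-\langle A_0,\alpha(L,\cdot)\rangle_{\mathfrak a}+Z_0([L,\cdot])$ in $\mathfrak l^*$ for all $L\in\mathfrak l$, then $L_0=0$. - $(B_0)$: the subspace $\alpha_0(\ker[\cdot,\cdot]_{\mathfrak l})\subset\mathfrak a^{\mathfrak l}$ is non-degenerate. - $(T_2)$: $\mathfrak a^{\mathfrak l}_+=\alpha_0(\ker[\cdot,\cdot]_{\mathfrak l_-})$. - $(A_k)$, $k\ge1$: if $\mathfrak k\subset S_1(\mathfrak l)\cap R_k(\mathfrak l)$ is an ideal of $\mathfrak l$ such that there exist $\Phi_1\in\mathrm{Hom}(\mathfrak k,\mathfrak a)$, $\Phi_2\in\mathrm{Hom}(\mathfrak k,R_k(\mathfrak l)^* )$ with $\alpha(L,K)=\rho(L)\Phi_1(K)-\Phi_1([L,K])$ and $\gamma(L,K,\cdot)=-\langle\Phi_1(K),\alpha(L,\cdot)\rangle_{\mathfrak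 a}+\Phi_2(K)([L,\cdot])+\Phi_2([L,K])(\cdot)$ in $R_k(\mathfrak l)^*$ for all $L\in\mathfrak l,K\in\mathfrak k$, then $\mathfrak k=0$. - $(B_k)$, $k\ge1$: let $\mathfrak b_k\subset\mathfrak a$ be the maximal $\mathfrak l$-submodule such that for some $\Phi\in\mathrm{Hom}(R_k(\mathfrak l),\mathfrak a)$ one has $\langle\alpha(L,K),B\rangle_{\mathfrak a}=\langle\rho(L)\Phi(K)-\Phi([L,K]),B\rangle_{\mathfrak a}$ for all $L\in\mathfrak l,K\in R_k(\mathfrak l),B\in\mathfrak b_k$; then $\mathfrak b_k$ is non-degenerate. $\mathcal H^2_Q(\mathfrak l,\theta_{\mathfrak l},\mathfrak a)_\sharp$ is the set of classes $[\alpha,\gamma]$ for which $(T_2)$, $(A_k)$, $(B_k)$, $0\le k\le m$, hold, where $m$ is such that $R_{m+1}(\mathfrak l)=0$ (this depends only on the class). *)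

theory Defs
  imports "HOL-Analysis.Analysis"
begin

section \<open>Linear algebra\<close>

text \<open>Vector spaces are whole types of class \<^class>\<open>real_vector\<close> subject to the predicate
  below; in contrast to \<^class>\<open>euclidean_space\<close> this does not exclude the zero space.\<close>

definition fin_dim :: "'v::real_vector itself \<Rightarrow> bool" where
  "fin_dim _ \<longleftrightarrow> (\<exists>B::'v set. finite B \<and> span B = UNIV)"

typedef (overloaded) 'v dual = "{f::'v::real_vector \<Rightarrow> real. linear f}"
  morphisms dual_app dual_of
  by (rule exI[of _ "\<lambda>_. 0"]) (simp add: linear_zero)

lemma linear_dual_app: "linear (dual_app Z)"
  using dual_app by blast

lemma dual_app_dual_of: "linear f \<Longrightarrow> dual_app (dual_of f) = f"
  by (simp add: dual_of_inverse)

instantiation dual :: (real_vector) real_vector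
begin

definition "0 = dual_of (\<lambda>_. 0)"
definition "Y + Z = dual_of (\<lambda>x. dual_app Y x + dual_app Z x)"
definition "Y - Z = dual_of (\<lambda>x. dual_app Y x - dual_app Z x)"
definition "- Z = dual_of (\<lambda>x. - dual_app Z x)"
definition "r *\<^sub>R Z = dual_of (\<lambda>x. r * dual_app Z x)"

lemma dual_app_0: "dual_app 0 = (\<lambda>_. 0)"
  by (simp add: zero_dual_def dual_app_dual_of linear_zero)

lemma dual_app_add: "dual_app (Y + Z) = (\<lambda>x. dual_app Y x + dual_app Z x)"
  by (simp add: plus_dual_def dual_app_dual_of linear_compose_add linear_dual_app)

lemma dual_app_diff: "dual_app (Y - Z) = (\<lambda>x. dual_app Y x - dual_app Z x)"
  by (simp add: minus_dual_def dual_app_dual_of linear_compose_sub linear_dual_app)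

lemma dual_app_uminus: "dual_app (- Z) = (\<lambda>x. - dual_app Z x)"
  by (simp add: uminus_dual_def dual_app_dual_of linear_compose_neg linear_dual_app)

lemma dual_app_scaleR: "dual_app (r *\<^sub>R Z) = (\<lambda>x. r * dual_app Z x)"
  using linear_compose_scale_right[OF linear_dual_app, of r Z]
  by (simp add: scaleR_dual_def dual_app_dual_of)

instance
  by standard
    (simp_all add: dual_app_inject[symmetric] dual_app_0 dual_app_add dual_app_diff
      dual_app_uminus dual_app_scaleR fun_eq_iff algebra_simps)

end

definition linear_on :: "'v::real_vector set \<Rightarrow> ('v \<Rightarrow> 'w::real_vector) \<Rightarrow> bool" where
  "linear_on U f \<longleftrightarrow>
    (\<forall>x\<in>U. \<forall>y\<in>U. f (x + y) = f x + f y) \<and> (\<forall>r. \<forall>x\<in>U. f (r *\<^sub>R x) = r *\<^sub>R f x)"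

definition plus_space :: "('v::real_vector \<Rightarrow> 'v) \<Rightarrow> 'v set" where
  "plus_space \<theta> = {x. \<theta> x = x}"

definition minus_space :: "('v::real_vector \<Rightarrow> 'v) \<Rightarrow> 'v set" where
  "minus_space \<theta> = {x. \<theta> x = - x}"

definition nondegenerate_on :: "('v \<Rightarrow> 'v \<Rightarrow> real) \<Rightarrow> 'v::real_vector set \<Rightarrow> bool" where
  "nondegenerate_on ip U \<longleftrightarrow> (\<forall>x\<in>U. (\<forall>y\<in>U. ip x y = 0) \<longrightarrow> x = 0)"

definition scalar_product :: "('v::real_vector \<Rightarrow> 'v \<Rightarrow> real) \<Rightarrow> bool" where
  "scalar_product ip \<longleftrightarrow>
    bilinear ip \<and> (\<forall>x y. ip x y = ip y x) \<and> nondegenerate_on ip UNIV"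

definition involution :: "('v::real_vector \<Rightarrow> 'v) \<Rightarrow> bool" where
  "involution \<theta> \<longleftrightarrow> linear \<theta> \<and> (\<forall>x. \<theta> (\<theta> x) = x)"


section \<open>Lie algebras, representations and symmetric triples\<close>

definition lie_algebra :: "('g::real_vector \<Rightarrow> 'g \<Rightarrow> 'g) \<Rightarrow> bool" where
  "lie_algebra br \<longleftrightarrow>
    fin_dim TYPE('g) \<and> bilinear br \<and> (\<forall>x. br x x = 0) \<and>
    (\<forall>x y z. br x (br y z) + br y (br z x) + br z (br x y) = 0)"

definition lie_algebra_with_involution ::
  "('g::real_vector \<Rightarrow> 'g \<Rightarrow> 'g) \<Rightarrow> ('g \<Rightarrow> 'g) \<Rightarrow> bool" where
  "lie_algebra_with_involution br \<theta> \<longleftrightarrow>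
    lie_algebra br \<and> involution \<theta> \<and> (\<forall>x y. \<theta> (br x y) = br (\<theta> x) (\<theta> y))"

definition lie_span :: "('g::real_vector \<Rightarrow> 'g \<Rightarrow> 'g) \<Rightarrow> 'g set \<Rightarrow> 'g set" where
  "lie_span br U = span {br x y | x y. x \<in> U \<and> y \<in> U}"

definition metric_lie_algebra_with_involution ::
  "('g::real_vector \<Rightarrow> 'g \<Rightarrow> 'g) \<Rightarrow> ('g \<Rightarrow> 'g) \<Rightarrow> ('g \<Rightarrow> 'g \<Rightarrow> real) \<Rightarrow> bool" where
  "metric_lie_algebra_with_involution br \<theta> ip \<longleftrightarrow>
    lie_algebra_with_involution br \<theta> \<and> scalar_product ip \<and>
    (\<forall>x y z. ip (br x y) z = - ip y (br x z)) \<and> (\<forall>x y. ip (\<theta> x) (\<theta> y) = ip x y)"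

definition symmetric_triple ::
  "('g::real_vector \<Rightarrow> 'g \<Rightarrow> 'g) \<Rightarrow> ('g \<Rightarrow> 'g) \<Rightarrow> ('g \<Rightarrow> 'g \<Rightarrow> real) \<Rightarrow> bool" where
  "symmetric_triple br \<theta> ip \<longleftrightarrow>
    metric_lie_algebra_with_involution br \<theta> ip \<and> lie_span br (minus_space \<theta>) = plus_space \<theta>"

definition representation ::
  "('l::real_vector \<Rightarrow> 'l \<Rightarrow> 'l) \<Rightarrow> ('l \<Rightarrow> 'a::real_vector \<Rightarrow> 'a) \<Rightarrow> bool" where
  "representation br \<rho> \<longleftrightarrow>
    bilinear \<rho> \<and> (\<forall>L L' A. \<rho> (br L L') A = \<rho> L (\<rho> L' A) - \<rho> L' (\<rho> L A))"

definition orthogonal_module ::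
  "('l::real_vector \<Rightarrow> 'l \<Rightarrow> 'l) \<Rightarrow> ('l \<Rightarrow> 'l) \<Rightarrow> ('l \<Rightarrow> 'a::real_vector \<Rightarrow> 'a) \<Rightarrow>
    ('a \<Rightarrow> 'a \<Rightarrow> real) \<Rightarrow> ('a \<Rightarrow> 'a) \<Rightarrow> bool" where
  "orthogonal_module br \<theta>l \<rho> ip \<theta>a \<longleftrightarrow>
    fin_dim TYPE('a) \<and> representation br \<rho> \<and> scalar_product ip \<and>
    (\<forall>L A B. ip (\<rho> L A) B = - ip A (\<rho> L B)) \<and>
    involution \<theta>a \<and> (\<forall>A B. ip (\<theta>a A) (\<theta>a B) = ip A B) \<and>
    (\<forall>L A. \<theta>a (\<rho> (\<theta>l L) A) = \<rho> L (\<theta>a A))"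

text \<open>For the adjoint representation \<^term>\<open>br\<close> of a Lie algebra on itself, submodules are
  precisely the ideals.\<close>

definition submodule :: "('l \<Rightarrow> 'v \<Rightarrow> 'v) \<Rightarrow> 'v::real_vector set \<Rightarrow> bool" where
  "submodule \<rho> U \<longleftrightarrow> subspace U \<and> (\<forall>L. \<forall>x\<in>U. \<rho> L x \<in> U)"

abbreviation lie_ideal :: "('g \<Rightarrow> 'g \<Rightarrow> 'g) \<Rightarrow> 'g::real_vector set \<Rightarrow> bool" where
  "lie_ideal br \<equiv> submodule br"

text \<open>Semi-simplicity of the quotient module \<open>U/W\<close>: every submodule of \<open>U/W\<close> has a complementary
  submodule. The submodules of \<open>U/W\<close> are the \<open>V/W\<close> with \<open>W \<subseteq> V \<subseteq> U\<close> a submodule, and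
  \<open>U/W = V/W \<oplus> V'/W\<close> means \<open>V + V' = U\<close> and \<open>V \<inter> V' = W\<close>.\<close>

definition semisimple_quotient :: "('l \<Rightarrow> 'v \<Rightarrow> 'v) \<Rightarrow> 'v::real_vector set \<Rightarrow> 'v set \<Rightarrow> bool" where
  "semisimple_quotient \<rho> U W \<longleftrightarrow>
    (\<forall>V. submodule \<rho> V \<and> W \<subseteq> V \<and> V \<subseteq> U \<longrightarrow>
      (\<exists>V'. submodule \<rho> V' \<and> W \<subseteq> V' \<and> V' \<subseteq> U \<and>
        {x + y | x y. x \<in> V \<and> y \<in> V'} = U \<and> V \<inter> V' = W))"

definition semisimple :: "('l \<Rightarrow> 'v \<Rightarrow> 'v::real_vector) \<Rightarrow> bool" where
  "semisimple \<rho> \<longleftrightarrow> semisimple_quotient \<rho> UNIV {0}"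


section \<open>The canonical isotropic ideal and admissibility\<close>

primrec S_ideal :: "('g \<Rightarrow> 'g \<Rightarrow> 'g) \<Rightarrow> nat \<Rightarrow> 'g::real_vector set" where
  "S_ideal br 0 = {0}"
| "S_ideal br (Suc k) =
    (GREATEST J. lie_ideal br J \<and> S_ideal br k \<subseteq> J \<and> semisimple_quotient br J (S_ideal br k))"

primrec R_ideal :: "('g \<Rightarrow> 'g \<Rightarrow> 'g) \<Rightarrow> nat \<Rightarrow> 'g::real_vector set" where
  "R_ideal br 0 = UNIV"
| "R_ideal br (Suc k) =
    (LEAST J. lie_ideal br J \<and> J \<subseteq> R_ideal br k \<and> semisimple_quotient br (R_ideal br k) J)"

definition canonical_ideal :: "('g \<Rightarrow> 'g \<Rightarrow> 'g) \<Rightarrow> 'g::real_vector set" where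
  "canonical_ideal br = span (\<Union>k\<in>{1..}. S_ideal br k \<inter> R_ideal br k)"

text \<open>Of a quadratic extension only the underlying metric Lie algebra with involution and the
  isotropic ideal \<open>I\<close> enter the next definitions.\<close>

definition balanced :: "('g \<Rightarrow> 'g \<Rightarrow> 'g) \<Rightarrow> 'g::real_vector set \<Rightarrow> bool" where
  "balanced br I \<longleftrightarrow> I = canonical_ideal br"

definition admissible ::
  "('g::real_vector \<Rightarrow> 'g \<Rightarrow> 'g) \<Rightarrow> ('g \<Rightarrow> 'g) \<Rightarrow> ('g \<Rightarrow> 'g \<Rightarrow> real) \<Rightarrow> 'g set \<Rightarrow> bool" where
  "admissible br \<theta> ip I \<longleftrightarrow> balanced br I \<and> symmetric_triple br \<theta> ip"


section \<open>Quadratic cohomology\<close>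

text \<open>\<open>C1\<close>, \<open>C2\<close>, \<open>C3\<close> are the (alternating multilinear) cochains with values in a module;
  the \<open>\<Theta>\<close>-invariant ones are cut out by \<open>\<theta>l\<close> and the involution \<open>\<theta>v\<close> of the coefficient module,
  which is \<^term>\<open>id\<close> for coefficients in \<open>\<real>\<close>.\<close>

definition C1_plus ::
  "('l \<Rightarrow> 'l) \<Rightarrow> ('v \<Rightarrow> 'v) \<Rightarrow> ('l::real_vector \<Rightarrow> 'v::real_vector) set" where
  "C1_plus \<theta>l \<theta>v = {\<tau>. linear \<tau> \<and> (\<forall>x. \<theta>v (\<tau> (\<theta>l x)) = \<tau> x)}"

definition C2_plus ::
  "('l \<Rightarrow> 'l) \<Rightarrow> ('v \<Rightarrow> 'v) \<Rightarrow> ('l::real_vector \<Rightarrow> 'l \<Rightarrow> 'v::real_vector) set" where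
  "C2_plus \<theta>l \<theta>v =
    {\<alpha>. bilinear \<alpha> \<and> (\<forall>x. \<alpha> x x = 0) \<and> (\<forall>x y. \<theta>v (\<alpha> (\<theta>l x) (\<theta>l y)) = \<alpha> x y)}"

definition C3_plus ::
  "('l \<Rightarrow> 'l) \<Rightarrow> ('v \<Rightarrow> 'v) \<Rightarrow> ('l::real_vector \<Rightarrow> 'l \<Rightarrow> 'l \<Rightarrow> 'v::real_vector) set" where
  "C3_plus \<theta>l \<theta>v =
    {\<gamma>. (\<forall>x. bilinear (\<gamma> x)) \<and> (\<forall>y z. linear (\<lambda>x. \<gamma> x y z)) \<and>
      (\<forall>x y. \<gamma> x x y = 0) \<and> (\<forall>x y. \<gamma> x y y = 0) \<and>
      (\<forall>x y z. \<theta>v (\<gamma> (\<theta>l x) (\<theta>l y) (\<theta>l z)) = \<gamma> x y z)}"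

text \<open>Chevalley--Eilenberg differentials on \<open>C1\<close>, \<open>C2\<close>, \<open>C3\<close>, i.e. the formula
  \<open>\<Sum>i. (-1)^i \<rho>(L\<^sub>i) \<alpha>(..no L\<^sub>i..) + \<Sum>i<j. (-1)^(i+j) \<alpha>([L\<^sub>i,L\<^sub>j], ..no L\<^sub>i, L\<^sub>j..)\<close>
  (indices from 0) in the three degrees needed.\<close>

definition ce_d1 ::
  "('l \<Rightarrow> 'l \<Rightarrow> 'l) \<Rightarrow> ('l \<Rightarrow> 'v \<Rightarrow> 'v) \<Rightarrow> ('l \<Rightarrow> 'v) \<Rightarrow> 'l \<Rightarrow> 'l \<Rightarrow> 'v::real_vector" where
  "ce_d1 br \<rho> \<tau> x y = \<rho> x (\<tau> y) - \<rho> y (\<tau> x) - \<tau> (br x y)"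

definition ce_d2 ::
  "('l \<Rightarrow> 'l \<Rightarrow> 'l) \<Rightarrow> ('l \<Rightarrow> 'v \<Rightarrow> 'v) \<Rightarrow> ('l \<Rightarrow> 'l \<Rightarrow> 'v) \<Rightarrow> 'l \<Rightarrow> 'l \<Rightarrow> 'l \<Rightarrow> 'v::real_vector" where
  "ce_d2 br \<rho> \<alpha> x y z =
    \<rho> x (\<alpha> y z) - \<rho> y (\<alpha> x z) + \<rho> z (\<alpha> x y)
    - \<alpha> (br x y) z + \<alpha> (br x z) y - \<alpha> (br y z) x"

definition ce_d3 ::
  "('l \<Rightarrow> 'l \<Rightarrow> 'l) \<Rightarrow> ('l \<Rightarrow> 'v \<Rightarrow> 'v) \<Rightarrow> ('l \<Rightarrow> 'l \<Rightarrow> 'l \<Rightarrow> 'v) \<Rightarrow>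
    'l \<Rightarrow> 'l \<Rightarrow> 'l \<Rightarrow> 'l \<Rightarrow> 'v::real_vector" where
  "ce_d3 br \<rho> \<gamma> x y z w =
    \<rho> x (\<gamma> y z w) - \<rho> y (\<gamma> x z w) + \<rho> z (\<gamma> x y w) - \<rho> w (\<gamma> x y z)
    - \<gamma> (br x y) z w + \<gamma> (br x z) y w - \<gamma> (br x w) y z
    - \<gamma> (br y z) x w + \<gamma> (br y w) x z - \<gamma> (br z w) x y"

definition triv_rep :: "'l \<Rightarrow> real \<Rightarrow> real" where
  "triv_rep L r = 0"

text \<open>\<open>wedge_pq ip\<close> is the shuffle product of a \<open>p\<close>- and a \<open>q\<close>-cochain composed with \<open>ip\<close>.\<close>

definition wedge_11 ::
  "('a \<Rightarrow> 'a \<Rightarrow> real) \<Rightarrow> ('l \<Rightarrow> 'a) \<Rightarrow> ('l \<Rightarrow> 'a) \<Rightarrow> 'l \<Rightarrow> 'l \<Rightarrow> real" where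
  "wedge_11 ip \<tau> \<tau>' x y = ip (\<tau> x) (\<tau>' y) - ip (\<tau> y) (\<tau>' x)"

definition wedge_21 ::
  "('a \<Rightarrow> 'a \<Rightarrow> real) \<Rightarrow> ('l \<Rightarrow> 'l \<Rightarrow> 'a) \<Rightarrow> ('l \<Rightarrow> 'a) \<Rightarrow> 'l \<Rightarrow> 'l \<Rightarrow> 'l \<Rightarrow> real" where
  "wedge_21 ip \<alpha> \<tau> x y z = ip (\<alpha> x y) (\<tau> z) - ip (\<alpha> x z) (\<tau> y) + ip (\<alpha> y z) (\<tau> x)"

definition wedge_22 ::
  "('a \<Rightarrow> 'a \<Rightarrow> real) \<Rightarrow> ('l \<Rightarrow> 'l \<Rightarrow> 'a) \<Rightarrow> ('l \<Rightarrow> 'l \<Rightarrow> 'a) \<Rightarrow>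
    'l \<Rightarrow> 'l \<Rightarrow> 'l \<Rightarrow> 'l \<Rightarrow> real" where
  "wedge_22 ip \<alpha> \<beta> x y z w =
    ip (\<alpha> x y) (\<beta> z w) - ip (\<alpha> x z) (\<beta> y w) + ip (\<alpha> x w) (\<beta> y z)
    + ip (\<alpha> y z) (\<beta> x w) - ip (\<alpha> y w) (\<beta> x z) + ip (\<alpha> z w) (\<beta> x y)"

definition Z2Q_plus ::
  "('l::real_vector \<Rightarrow> 'l \<Rightarrow> 'l) \<Rightarrow> ('l \<Rightarrow> 'l) \<Rightarrow> ('l \<Rightarrow> 'a::real_vector \<Rightarrow> 'a) \<Rightarrow>
    ('a \<Rightarrow> 'a \<Rightarrow> real) \<Rightarrow> ('a \<Rightarrow> 'a) \<Rightarrow> (('l \<Rightarrow> 'l \<Rightarrow> 'a) \<times> ('l \<Rightarrow> 'l \<Rightarrow> 'l \<Rightarrow> real)) set" where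
  "Z2Q_plus br \<theta>l \<rho> ip \<theta>a =
    {(\<alpha>, \<gamma>). \<alpha> \<in> C2_plus \<theta>l \<theta>a \<and> \<gamma> \<in> C3_plus \<theta>l id \<and>
      (\<forall>x y z. ce_d2 br \<rho> \<alpha> x y z = 0) \<and>
      (\<forall>x y z w. ce_d3 br triv_rep \<gamma> x y z w = (1/2) * wedge_22 ip \<alpha> \<alpha> x y z w)}"

definition C1Q_act ::
  "('l::real_vector \<Rightarrow> 'l \<Rightarrow> 'l) \<Rightarrow> ('l \<Rightarrow> 'a::real_vector \<Rightarrow> 'a) \<Rightarrow> ('a \<Rightarrow> 'a \<Rightarrow> real) \<Rightarrow>
    ('l \<Rightarrow> 'l \<Rightarrow> 'a) \<times> ('l \<Rightarrow> 'l \<Rightarrow> 'l \<Rightarrow> real) \<Rightarrow> ('l \<Rightarrow> 'a) \<times> ('l \<Rightarrow> 'l \<Rightarrow> real) \<Rightarrow>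
    ('l \<Rightarrow> 'l \<Rightarrow> 'a) \<times> ('l \<Rightarrow> 'l \<Rightarrow> 'l \<Rightarrow> real)" where
  "C1Q_act br \<rho> ip = (\<lambda>(\<alpha>, \<gamma>) (\<tau>, \<sigma>).
    (\<lambda>x y. \<alpha> x y + ce_d1 br \<rho> \<tau> x y,
     \<lambda>x y z. \<gamma> x y z + ce_d2 br triv_rep \<sigma> x y z
       + wedge_21 ip (\<lambda>u v. \<alpha> u v + (1/2) *\<^sub>R ce_d1 br \<rho> \<tau> u v) \<tau> x y z))"

text \<open>The orbit of a cocycle. Of the group structure on the pairs \<open>(\<tau>, \<sigma>)\<close> only the action enters.\<close>

definition H2Q_class ::
  "('l::real_vector \<Rightarrow> 'l \<Rightarrow> 'l) \<Rightarrow> ('l \<Rightarrow> 'l) \<Rightarrow> ('l \<Rightarrow> 'a::real_vector \<Rightarrow> 'a) \<Rightarrow>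
    ('a \<Rightarrow> 'a \<Rightarrow> real) \<Rightarrow> ('a \<Rightarrow> 'a) \<Rightarrow>
    ('l \<Rightarrow> 'l \<Rightarrow> 'a) \<times> ('l \<Rightarrow> 'l \<Rightarrow> 'l \<Rightarrow> real) \<Rightarrow> (('l \<Rightarrow> 'l \<Rightarrow> 'a) \<times> ('l \<Rightarrow> 'l \<Rightarrow> 'l \<Rightarrow> real)) set" where
  "H2Q_class br \<theta>l \<rho> ip \<theta>a c =
    {C1Q_act br \<rho> ip c (\<tau>, \<sigma>) | \<tau> \<sigma>. \<tau> \<in> C1_plus \<theta>l \<theta>a \<and> \<sigma> \<in> C2_plus \<theta>l id}"


section \<open>The standard model\<close>

definition model_bracket ::
  "('l::real_vector \<Rightarrow> 'l \<Rightarrow> 'l) \<Rightarrow> ('l \<Rightarrow> 'a::real_vector \<Rightarrow> 'a) \<Rightarrow> ('a \<Rightarrow> 'a \<Rightarrow> real) \<Rightarrow>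
    ('l \<Rightarrow> 'l \<Rightarrow> 'a) \<Rightarrow> ('l \<Rightarrow> 'l \<Rightarrow> 'l \<Rightarrow> real) \<Rightarrow>
    'l dual \<times> 'a \<times> 'l \<Rightarrow> 'l dual \<times> 'a \<times> 'l \<Rightarrow> 'l dual \<times> 'a \<times> 'l" where
  "model_bracket br \<rho> ip \<alpha> \<gamma> = (\<lambda>(Z\<^sub>1, A\<^sub>1, L\<^sub>1) (Z\<^sub>2, A\<^sub>2, L\<^sub>2).
    (dual_of (\<lambda>L. \<gamma> L\<^sub>1 L\<^sub>2 L - ip A\<^sub>2 (\<alpha> L\<^sub>1 L) + ip A\<^sub>1 (\<alpha> L\<^sub>2 L)
        - dual_app Z\<^sub>2 (br L\<^sub>1 L) + dual_app Z\<^sub>1 (br L\<^sub>2 L) + ip (\<rho> L A\<^sub>1) A\<^sub>2),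
     \<alpha> L\<^sub>1 L\<^sub>2 + \<rho> L\<^sub>1 A\<^sub>2 - \<rho> L\<^sub>2 A\<^sub>1,
     br L\<^sub>1 L\<^sub>2))"

definition model_involution ::
  "('l::real_vector \<Rightarrow> 'l) \<Rightarrow> ('a \<Rightarrow> 'a) \<Rightarrow> 'l dual \<times> 'a \<times> 'l \<Rightarrow> 'l dual \<times> 'a \<times> 'l" where
  "model_involution \<theta>l \<theta>a = (\<lambda>(Z, A, L). (dual_of (\<lambda>X. dual_app Z (\<theta>l X)), \<theta>a A, \<theta>l L))"

definition model_product ::
  "('a \<Rightarrow> 'a \<Rightarrow> real) \<Rightarrow> 'l::real_vector dual \<times> 'a \<times> 'l \<Rightarrow> 'l dual \<times> 'a \<times> 'l \<Rightarrow> real" where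
  "model_product ip = (\<lambda>(Z\<^sub>1, A\<^sub>1, L\<^sub>1) (Z\<^sub>2, A\<^sub>2, L\<^sub>2).
    ip A\<^sub>1 A\<^sub>2 + dual_app Z\<^sub>1 L\<^sub>2 + dual_app Z\<^sub>2 L\<^sub>1)"

definition model_ideal :: "('l::real_vector dual \<times> 'a::real_vector \<times> 'l) set" where
  "model_ideal = {(Z, 0, 0) | Z. True}"


section \<open>Admissible cohomology classes\<close>

definition invariants :: "('l \<Rightarrow> 'a \<Rightarrow> 'a) \<Rightarrow> 'a::real_vector set" where
  "invariants \<rho> = {A. \<forall>L. \<rho> L A = 0}"

text \<open>The component \<open>\<alpha>\<^sub>0\<close> of \<open>\<alpha>\<close> with respect to \<open>\<aa> = \<aa>\<^sup>\<ll> \<oplus> \<rho>(\<ll>)\<aa>\<close>, for semi-simple \<open>\<rho>\<close>.\<close>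

definition alpha0 ::
  "('l \<Rightarrow> 'a \<Rightarrow> 'a) \<Rightarrow> ('l \<Rightarrow> 'l \<Rightarrow> 'a) \<Rightarrow> 'l \<Rightarrow> 'l \<Rightarrow> 'a::real_vector" where
  "alpha0 \<rho> \<alpha> x y =
    (THE A. A \<in> invariants \<rho> \<and> \<alpha> x y - A \<in> span {\<rho> L B | L B. True})"

text \<open>A list of pairs \<open>(x\<^sub>i, y\<^sub>i)\<close> denotes the element \<open>\<Sum>i. x\<^sub>i \<and> y\<^sub>i\<close> of the exterior square; every
  element is of this form. \<open>ext_lift \<beta>\<close> is the linear map induced by an alternating bilinear \<open>\<beta>\<close>,
  and \<open>ext_ker U \<beta>\<close> the kernel of its restriction to the exterior square of the subspace \<open>U\<close>.\<close>

definition ext_lift :: "('l \<Rightarrow> 'l \<Rightarrow> 'v::real_vector) \<Rightarrow> ('l \<times> 'l) list \<Rightarrow> 'v" where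
  "ext_lift \<beta> ps = (\<Sum>(x, y)\<leftarrow>ps. \<beta> x y)"

definition ext_ker :: "'l set \<Rightarrow> ('l \<Rightarrow> 'l \<Rightarrow> 'v::real_vector) \<Rightarrow> ('l \<times> 'l) list set" where
  "ext_ker U \<beta> = {ps. set ps \<subseteq> U \<times> U \<and> ext_lift \<beta> ps = 0}"

definition cond_A0 ::
  "('l::real_vector \<Rightarrow> 'l \<Rightarrow> 'l) \<Rightarrow> ('l \<Rightarrow> 'a::real_vector \<Rightarrow> 'a) \<Rightarrow> ('a \<Rightarrow> 'a \<Rightarrow> real) \<Rightarrow>
    ('l \<Rightarrow> 'l \<Rightarrow> 'a) \<Rightarrow> ('l \<Rightarrow> 'l \<Rightarrow> 'l \<Rightarrow> real) \<Rightarrow> bool" where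
  "cond_A0 br \<rho> ip \<alpha> \<gamma> \<longleftrightarrow>
    (\<forall>L\<^sub>0. (\<forall>L. br L L\<^sub>0 = 0) \<and> (\<forall>A. \<rho> L\<^sub>0 A = 0) \<and>
      (\<exists>A\<^sub>0. \<exists>Z\<^sub>0::'l dual. \<forall>L. \<alpha> L L\<^sub>0 = \<rho> L A\<^sub>0 \<and>
        (\<forall>X. \<gamma> L L\<^sub>0 X = - ip A\<^sub>0 (\<alpha> L X) + dual_app Z\<^sub>0 (br L X)))
      \<longrightarrow> L\<^sub>0 = 0)"

definition cond_B0 ::
  "('l::real_vector \<Rightarrow> 'l \<Rightarrow> 'l) \<Rightarrow> ('l \<Rightarrow> 'a::real_vector \<Rightarrow> 'a) \<Rightarrow> ('a \<Rightarrow> 'a \<Rightarrow> real) \<Rightarrow>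
    ('l \<Rightarrow> 'l \<Rightarrow> 'a) \<Rightarrow> bool" where
  "cond_B0 br \<rho> ip \<alpha> \<longleftrightarrow> nondegenerate_on ip (ext_lift (alpha0 \<rho> \<alpha>) ` ext_ker UNIV br)"

definition cond_T2 ::
  "('l::real_vector \<Rightarrow> 'l \<Rightarrow> 'l) \<Rightarrow> ('l \<Rightarrow> 'l) \<Rightarrow> ('l \<Rightarrow> 'a::real_vector \<Rightarrow> 'a) \<Rightarrow> ('a \<Rightarrow> 'a) \<Rightarrow>
    ('l \<Rightarrow> 'l \<Rightarrow> 'a) \<Rightarrow> bool" where
  "cond_T2 br \<theta>l \<rho> \<theta>a \<alpha> \<longleftrightarrow>
    invariants \<rho> \<inter> plus_space \<theta>a = ext_lift (alpha0 \<rho> \<alpha>) ` ext_ker (minus_space \<theta>l) br"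

definition cond_A ::
  "('l::real_vector \<Rightarrow> 'l \<Rightarrow> 'l) \<Rightarrow> ('l \<Rightarrow> 'a::real_vector \<Rightarrow> 'a) \<Rightarrow> ('a \<Rightarrow> 'a \<Rightarrow> real) \<Rightarrow>
    ('l \<Rightarrow> 'l \<Rightarrow> 'a) \<Rightarrow> ('l \<Rightarrow> 'l \<Rightarrow> 'l \<Rightarrow> real) \<Rightarrow> nat \<Rightarrow> bool" where
  "cond_A br \<rho> ip \<alpha> \<gamma> k \<longleftrightarrow>
    (\<forall>\<kk>. lie_ideal br \<kk> \<and> \<kk> \<subseteq> S_ideal br 1 \<inter> R_ideal br k \<and>
      (\<exists>\<Phi>\<^sub>1::'l \<Rightarrow> 'a. \<exists>\<Phi>\<^sub>2::'l \<Rightarrow> 'l \<Rightarrow> real.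
        linear_on \<kk> \<Phi>\<^sub>1 \<and>
        (\<forall>K\<in>\<kk>. linear_on (R_ideal br k) (\<Phi>\<^sub>2 K)) \<and>
        (\<forall>X\<in>R_ideal br k. linear_on \<kk> (\<lambda>K. \<Phi>\<^sub>2 K X)) \<and>
        (\<forall>L. \<forall>K\<in>\<kk>. \<alpha> L K = \<rho> L (\<Phi>\<^sub>1 K) - \<Phi>\<^sub>1 (br L K) \<and>
          (\<forall>X\<in>R_ideal br k.
            \<gamma> L K X = - ip (\<Phi>\<^sub>1 K) (\<alpha> L X) + \<Phi>\<^sub>2 K (br L X) + \<Phi>\<^sub>2 (br L K) X)))
      \<longrightarrow> \<kk> = {0})"

definition b_submodule ::
  "('l::real_vector \<Rightarrow> 'l \<Rightarrow> 'l) \<Rightarrow> ('l \<Rightarrow> 'a::real_vector \<Rightarrow> 'a) \<Rightarrow> ('a \<Rightarrow> 'a \<Rightarrow> real) \<Rightarrow>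
    ('l \<Rightarrow> 'l \<Rightarrow> 'a) \<Rightarrow> nat \<Rightarrow> 'a set" where
  "b_submodule br \<rho> ip \<alpha> k =
    (GREATEST \<bb>. submodule \<rho> \<bb> \<and>
      (\<exists>\<Phi>::'l \<Rightarrow> 'a. linear_on (R_ideal br k) \<Phi> \<and>
        (\<forall>L. \<forall>K\<in>R_ideal br k. \<forall>B\<in>\<bb>. ip (\<alpha> L K) B = ip (\<rho> L (\<Phi> K) - \<Phi> (br L K)) B)))"

definition cond_B ::
  "('l::real_vector \<Rightarrow> 'l \<Rightarrow> 'l) \<Rightarrow> ('l \<Rightarrow> 'a::real_vector \<Rightarrow> 'a) \<Rightarrow> ('a \<Rightarrow> 'a \<Rightarrow> real) \<Rightarrow>
    ('l \<Rightarrow> 'l \<Rightarrow> 'a) \<Rightarrow> nat \<Rightarrow> bool" where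
  "cond_B br \<rho> ip \<alpha> k \<longleftrightarrow> nondegenerate_on ip (b_submodule br \<rho> ip \<alpha> k)"

text \<open>The bound \<open>m\<close> exists as the \<open>R\<^sub>k\<close> strictly decrease until they vanish; the conditions with
  \<open>k > m\<close> hold trivially, so the choice of \<open>m\<close> is immaterial.\<close>

definition H2Q_sharp ::
  "('l::real_vector \<Rightarrow> 'l \<Rightarrow> 'l) \<Rightarrow> ('l \<Rightarrow> 'l) \<Rightarrow> ('l \<Rightarrow> 'a::real_vector \<Rightarrow> 'a) \<Rightarrow>
    ('a \<Rightarrow> 'a \<Rightarrow> real) \<Rightarrow> ('a \<Rightarrow> 'a) \<Rightarrow>
    (('l \<Rightarrow> 'l \<Rightarrow> 'a) \<times> ('l \<Rightarrow> 'l \<Rightarrow> 'l \<Rightarrow> real)) set set" where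
  "H2Q_sharp br \<theta>l \<rho> ip \<theta>a =
    {H2Q_class br \<theta>l \<rho> ip \<theta>a (\<alpha>, \<gamma>) | \<alpha> \<gamma>.
      (\<alpha>, \<gamma>) \<in> Z2Q_plus br \<theta>l \<rho> ip \<theta>a \<and>
      cond_T2 br \<theta>l \<rho> \<theta>a \<alpha> \<and> cond_A0 br \<rho> ip \<alpha> \<gamma> \<and> cond_B0 br \<rho> ip \<alpha> \<and>
      (\<exists>m. R_ideal br (m + 1) = {0} \<and>
        (\<forall>k\<in>{1..m}. cond_A br \<rho> ip \<alpha> \<gamma> k \<and> cond_B br \<rho> ip \<alpha> k))}"

end

theory Submission
  imports "Jordan_Normal_Form.Jordan_Normal_Form_Existence" Defs
begin

text \<open>
  Write \<open>\<dd> = \<ll>\<^sup>* \<oplus> \<aa> \<oplus> \<ll>\<close> for the standard model. The idea is to translate both halves of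
  admissibility into statements about small ideals of \<open>\<dd>\<close>, and to recognise the maps \<open>\<Phi>\<close> in the
  conditions on \<open>(\<alpha>, \<gamma>)\<close> as the \<open>\<ll>\<^sup>*\<close>- and \<open>\<aa>\<close>-components of linear sections of such ideals.

  Balancedness. The invariant scalar product exchanges the two filtrations, \<open>S\<^sub>k(\<dd>) = R\<^sub>k(\<dd>)\<^sup>\<bottom>\<close>
  (\<open>S_ideal_perp\<close>). Therefore \<open>\<ii>(\<dd>)\<^sup>\<bottom>\<close> is the intersection of the \<open>S\<^sub>k + R\<^sub>k\<close>, and going down
  the filtration by the \<open>R\<^sub>k\<close> one sees that it is spanned by the ideals \<open>S\<^bsub>k+1\<^esub> \<inter> R\<^sub>k\<close>
  (\<open>perp_canonical_subset\<close>). Because \<open>(\<ll>\<^sup>*)\<^sup>\<bottom> = \<ll>\<^sup>* \<oplus> \<aa>\<close>, the equation \<open>\<ii>(\<dd>) = \<ll>\<^sup>*\<close> holds if and only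
  if for all \<open>k\<close>

    \<^item> \<open>P\<^sub>k\<close>: the ideal \<open>S\<^bsub>k+1\<^esub> \<inter> R\<^sub>k\<close> projects to \<open>0\<close> in \<open>\<ll>\<close>, and

    \<^item> \<open>Q\<^sub>k\<close>: the ideal \<open>S\<^sub>k \<inter> R\<^sub>k\<close> is contained in \<open>\<ll>\<^sup>*\<close>

  (\<open>balanced_iff\<close>). Modulo \<open>S\<^sub>k\<close> the ideal \<open>S\<^bsub>k+1\<^esub> \<inter> R\<^sub>k\<close> is semi-simple, so it contains an ideal
  that complements the kernel of its projection to \<open>\<ll>\<close>; a linear section of the projection of this
  ideal is of the form \<open>K \<mapsto> (\<Phi>\<^sub>2(K), -\<Phi>\<^sub>1(K), K)\<close> with \<open>\<Phi>\<^sub>1\<close>, \<open>\<Phi>\<^sub>2\<close> as in \<open>A\<^sub>k\<close>. In this way \<open>A\<^sub>k\<close>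
  and \<open>Q\<^sub>k\<close> give \<open>P\<^sub>k\<close>. Likewise the \<open>\<aa>\<close>-components of \<open>S\<^bsub>k+1\<^esub> \<inter> R\<^bsub>k+1\<^esub>\<close> lie in \<open>\<bb>\<^sub>k\<close>, while \<open>\<bb>\<^sub>k\<close> is
  the \<open>\<aa>\<close>-part of an ideal in \<open>S\<^bsub>k+1\<^esub>\<close>, and \<open>S\<^bsub>k+1\<^esub>\<close> is orthogonal to \<open>R\<^bsub>k+1\<^esub>\<close>; so \<open>B\<^sub>k\<close>, \<open>P\<^sub>k\<close> and
  \<open>Q\<^sub>k\<close> give \<open>Q\<^bsub>k+1\<^esub>\<close>. The induction starts with \<open>A\<^sub>0\<close> and \<open>B\<^sub>0\<close>, which speak of central elements of
  \<open>\<dd>\<close>. Conversely, the maps \<open>\<Phi>\<close> in \<open>A\<^sub>k\<close> and \<open>B\<^sub>k\<close> define ideals of \<open>\<dd>\<close> inside \<open>S\<^bsub>k+1\<^esub>\<close>, on which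
  balancedness forces the conclusions of the conditions. That the sets defined by \<open>\<Phi>\<close> are ideals relies
  on the fact that \<open>R\<^sub>1(\<ll>)\<close> acts trivially on semi-simple modules (\<open>R1_annihilates_semisimple\<close>). This is the
  only general theorem on Lie algebras that enters: on a simple module, an ideal that
  acts through elements of \<open>[\<ll>, \<ll>]\<close> and is isotropic for the trace form acts by nilpotent operators
  (\<open>commutator_sum_nilpotent\<close>, by Jordan normal forms), hence trivially (\<open>engel\<close>), and consequently
  \<open>\<ll>\<close> modulo the annihilator of the module is semi-simple under the adjoint action.

  Symmetric triples. An element of \<open>\<dd>\<^sub>+\<close> orthogonal to \<open>[\<dd>\<^sub>-, \<dd>\<^sub>-]\<close> commutes with \<open>\<dd>\<^sub>-\<close>. If
  \<open>[\<ll>\<^sub>-, \<ll>\<^sub>-] = \<ll>\<^sub>+\<close> and \<open>\<rho>\<close> is semi-simple, it is even central in \<open>\<dd>\<close>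
  (\<open>centralizer_of_minus\<close>); then \<open>A\<^sub>0\<close> annuls its \<open>\<ll>\<close>-component, \<open>T\<^sub>2\<close> its \<open>\<aa>\<close>-component, and
  \<open>[\<ll>\<^sub>-, \<ll>\<^sub>-] = \<ll>\<^sub>+\<close> the rest.

  Choice of the cocycle. The class of \<open>(\<alpha>, \<gamma>)\<close> belongs to \<open>\<H>\<^sub>\<sharp>\<close> as soon as some representative
  satisfies the conditions. Admissibility does not depend on the representative, because the action of
  \<open>(\<tau>, \<sigma>)\<close> is realised by a shearing isomorphism between the two standard models (\<open>shear_hom\<close>).
\<close>

hide_const (open) VectorSpace.subspace LinearCombinations.submodule

section \<open>Sums of commutators in Jordan normal form\<close>

text \<open>Matrices are treated here as functions of two indices, of which only the values below \<open>n\<close> matter.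
  This allows the parts of a matrix belonging to different eigenvalues of the commutator with \<open>J\<close> to
  be cut out entry by entry.\<close>

definition entry_comm :: "nat \<Rightarrow> (nat \<Rightarrow> nat \<Rightarrow> complex) \<Rightarrow> (nat \<Rightarrow> nat \<Rightarrow> complex) \<Rightarrow> nat \<Rightarrow> nat \<Rightarrow> complex" where
  "entry_comm n J u i j = (\<Sum>k<n. J i k * u k j) - (\<Sum>k<n. u i k * J k j)"

text \<open>The two properties of a Jordan normal form that are used. The second one makes the decomposition of
  matrices according to the values of \<open>J i i - J j j\<close> invariant under the commutator with \<open>J\<close>.\<close>

locale jordan_shape =
  fixes n :: nat and J :: "nat \<Rightarrow> nat \<Rightarrow> complex"
  assumes upper: "i < n \<Longrightarrow> j < i \<Longrightarrow> J i j = 0"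
    and block: "i < n \<Longrightarrow> j < n \<Longrightarrow> J i j \<noteq> 0 \<Longrightarrow> J i i = J j j"
begin

text \<open>The projection to the generalised eigenspace of the commutator with \<open>J\<close> for the eigenvalue \<open>\<mu>\<close>.\<close>

definition weight_part :: "complex \<Rightarrow> (nat \<Rightarrow> nat \<Rightarrow> complex) \<Rightarrow> nat \<Rightarrow> nat \<Rightarrow> complex" where
  "weight_part \<mu> u i j = (if J i i - J j j = \<mu> then u i j else 0)"

definition shift :: "complex \<Rightarrow> (nat \<Rightarrow> nat \<Rightarrow> complex) \<Rightarrow> nat \<Rightarrow> nat \<Rightarrow> complex" where
  "shift \<nu> u i j = entry_comm n J u i j - \<nu> * u i j"

definition agree :: "(nat \<Rightarrow> nat \<Rightarrow> complex) \<Rightarrow> (nat \<Rightarrow> nat \<Rightarrow> complex) \<Rightarrow> bool" where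
  "agree u v \<longleftrightarrow> (\<forall>i<n. \<forall>j<n. u i j = v i j)"

lemma agree_entry_comm: "agree u v \<Longrightarrow> agree (entry_comm n J u) (entry_comm n J v)"
  by (auto simp: agree_def entry_comm_def intro!: arg_cong2[where f="(-)"] sum.cong)

lemma agree_entry_comm_pow: "agree u v \<Longrightarrow> agree ((entry_comm n J ^^ k) u) ((entry_comm n J ^^ k) v)"
  by (induction k) (auto intro: agree_entry_comm)

lemma agree_shift: "agree u v \<Longrightarrow> agree (shift \<nu> u) (shift \<nu> v)"
  using agree_entry_comm[of u v] by (auto simp: agree_def shift_def)

lemma agree_shift_pow: "agree u v \<Longrightarrow> agree ((shift \<nu> ^^ k) u) ((shift \<nu> ^^ k) v)"
  by (induction k) (auto intro: agree_shift)

lemma agree_trans: "agree u v \<Longrightarrow> agree v w \<Longrightarrow> agree u w"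
  by (auto simp: agree_def)

lemma agree_sym: "agree u v \<Longrightarrow> agree v u"
  by (auto simp: agree_def)

lemma weight_part_entry_comm: "agree (entry_comm n J (weight_part \<mu> u)) (weight_part \<mu> (entry_comm n J u))"
  unfolding agree_def
proof (intro allI impI)
  fix i j assume ij: "i < n" "j < n"
  have 1: "J i k * weight_part \<mu> u k j = (if J i i - J j j = \<mu> then J i k * u k j else 0)" if "k < n" for k
    using block[OF ij(1) that] by (cases "J i k = 0") (auto simp: weight_part_def)
  have 2: "weight_part \<mu> u i k * J k j = (if J i i - J j j = \<mu> then u i k * J k j else 0)" if "k < n" for k
    using block[OF that ij(2)] by (cases "J k j = 0") (auto simp: weight_part_def)
  show "entry_comm n J (weight_part \<mu> u) i j = weight_part \<mu> (entry_comm n J u) i j"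
    by (simp add: entry_comm_def weight_part_def[of _ "entry_comm n J u"] 1 2)
qed

lemma weight_part_shift: "agree (shift \<nu> (weight_part \<mu> u)) (weight_part \<mu> (shift \<nu> u))"
  using weight_part_entry_comm[of \<mu> u] by (auto simp: agree_def shift_def weight_part_def)

lemma weight_part_shift_pow: "agree ((shift \<nu> ^^ k) (weight_part \<mu> u)) (weight_part \<mu> ((shift \<nu> ^^ k) u))"
proof (induction k)
  case (Suc k)
  show ?case using agree_trans[OF agree_shift[OF Suc] weight_part_shift] by simp
qed (simp add: agree_def)

lemma shift_zero: "shift \<nu> (\<lambda>_ _. 0) = (\<lambda>_ _. 0)"
  by (auto simp: shift_def entry_comm_def fun_eq_iff)

lemma shift_pow_zero: "(shift \<nu> ^^ k) (\<lambda>_ _. 0) = (\<lambda>_ _. 0)"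
  by (induction k) (auto simp: shift_zero)

lemma entry_comm_lin: "entry_comm n J (\<lambda>i j. a * u i j + b * v i j)
    = (\<lambda>i j. a * entry_comm n J u i j + b * entry_comm n J v i j)"
  by (simp add: entry_comm_def fun_eq_iff algebra_simps sum.distrib sum_distrib_left)

lemma entry_comm_pow_lin: "(entry_comm n J ^^ k) (\<lambda>i j. a * u i j + b * v i j)
    = (\<lambda>i j. a * (entry_comm n J ^^ k) u i j + b * (entry_comm n J ^^ k) v i j)"
  by (induction k) (auto simp: entry_comm_lin)

lemma shift_commute: "shift \<nu> (shift \<mu> u) = shift \<mu> (shift \<nu> u)"
proof -
  have "shift a (shift b u) i j = entry_comm n J (entry_comm n J u) i j - (a + b) * entry_comm n J u i j + a * b * u i j"
    for a b i j
    using entry_comm_lin[of 1 "entry_comm n J u" "-b" u]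
    by (simp add: shift_def[abs_def] algebra_simps)
  from this[of \<nu> \<mu>] this[of \<mu> \<nu>] show ?thesis
    by (intro ext) (simp only: add.commute mult.commute)
qed

text \<open>All entries on the diagonals \<open>j - i < d - n\<close> are zero. Every matrix has height \<open>0\<close>, and height
  \<open>2 * n\<close> means zero; the offset \<open>n\<close> keeps the condition within the natural numbers.\<close>

definition height :: "nat \<Rightarrow> (nat \<Rightarrow> nat \<Rightarrow> complex) \<Rightarrow> bool" where
  "height d u \<longleftrightarrow> (\<forall>i<n. \<forall>j<n. j + n < i + d \<longrightarrow> u i j = 0)"

text \<open>On matrices of weight \<open>\<mu>\<close> the diagonal of \<open>J\<close> acts by \<open>\<mu>\<close>, so that the shifted commutator only
  involves the strictly upper triangular part of \<open>J\<close>, which moves entries to higher diagonals.\<close>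

lemma height_shift:
  assumes h: "height d u" and s: "agree (weight_part \<mu> u) u"
  shows "height (Suc d) (shift \<mu> u)"
  unfolding height_def
proof (intro allI impI)
  fix i j assume ij: "i < n" "j < n" and l: "j + n < i + Suc d"
  have 1: "J i k * u k j = (if k = i then J i i * u i j else 0)" if "k < n" for k
    using upper[OF ij(1), of k] h that ij l
    by (cases "k < i"; cases "k = i") (auto simp: height_def)
  have 2: "u i k * J k j = (if k = j then u i j * J j j else 0)" if "k < n" for k
    using upper[OF that, of j] h that ij l
    by (cases "k > j"; cases "k = j") (auto simp: height_def)
  have 3: "u i j = (if J i i - J j j = \<mu> then u i j else 0)"
    using s ij by (auto simp: agree_def weight_part_def split: if_splits)
  have "entry_comm n J u i j = (J i i - J j j) * u i j"
  proof -
    have "(\<Sum>k<n. J i k * u k j) = (\<Sum>k<n. if k = i then J i i * u i j else 0)"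
      by (rule sum.cong) (use 1 in auto)
    moreover have "(\<Sum>k<n. u i k * J k j) = (\<Sum>k<n. if k = j then u i j * J j j else 0)"
      by (rule sum.cong) (use 2 in auto)
    ultimately show ?thesis
      using ij by (simp add: entry_comm_def left_diff_distrib mult.commute[of "u i j"])
  qed
  then show "shift \<mu> u i j = 0"
    using 3 by (auto simp: shift_def split: if_splits)
qed

lemma height_shift_pow:
  assumes s: "agree (weight_part \<mu> u) u"
  shows "height k ((shift \<mu> ^^ k) u) \<and> agree (weight_part \<mu> ((shift \<mu> ^^ k) u)) ((shift \<mu> ^^ k) u)"
proof (induction k)
  case 0 then show ?case using s by (auto simp: height_def)
next
  case (Suc k)
  then show ?case
    using height_shift[of k "(shift \<mu> ^^ k) u" \<mu>]
      agree_trans[OF agree_sym[OF weight_part_shift] agree_shift, of \<mu> "(shift \<mu> ^^ k) u" "(shift \<mu> ^^ k) u" \<mu>]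
    by auto
qed

lemma shift_nilpotent:
  assumes "agree (weight_part \<mu> u) u"
  shows "agree ((shift \<mu> ^^ (2 * n)) u) (\<lambda>_ _. 0)"
  using height_shift_pow[OF assms, of "2*n"] by (auto simp: agree_def height_def)

text \<open>\<open>W\<close> is a subspace that is stable under the commutator with \<open>J\<close>. It contains the weight parts of its
  elements, as they are values of polynomials in the commutator; the proof removes one weight at a time
  instead of writing these polynomials down.\<close>

context
  fixes W :: "(nat \<Rightarrow> nat \<Rightarrow> complex) \<Rightarrow> bool"
  assumes W_lin: "W u \<Longrightarrow> W v \<Longrightarrow> W (\<lambda>i j. a * u i j + b * v i j)"
    and W_comm: "W u \<Longrightarrow> W (entry_comm n J u)"
    and W_agree: "W u \<Longrightarrow> agree u v \<Longrightarrow> W v"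
begin

lemma W_shift: "W u \<Longrightarrow> W (shift \<nu> u)"
  using W_lin[OF W_comm, of u u 1 "-\<nu>"] by (simp add: shift_def[abs_def])

lemma W_shift_pow: "W u \<Longrightarrow> W ((shift \<nu> ^^ k) u)"
  by (induction k) (auto intro: W_shift)

text \<open>On the weight space of \<open>\<mu> \<noteq> \<nu>\<close> the shift by \<open>\<nu>\<close> is a non-zero scalar plus the nilpotent
  shift by \<open>\<mu>\<close>. Downward induction on the height inverts it within \<open>W\<close>.\<close>

lemma W_unshift:
  assumes "agree (weight_part \<mu> u) u" "W (shift \<nu> u)" "\<mu> \<noteq> \<nu>"
  shows "W u"
proof -
  have "height (2 * n - t) u \<Longrightarrow> agree (weight_part \<mu> u) u \<Longrightarrow> W (shift \<nu> u) \<Longrightarrow> W u" for t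
  proof (induction t arbitrary: u)
    case 0
    then have "agree (\<lambda>i j. 0 * shift \<nu> u i j + 0 * shift \<nu> u i j) u"
      by (auto simp: agree_def height_def)
    then show ?case using W_agree W_lin[OF 0(3) 0(3)] by blast
  next
    case (Suc t)
    have "height (Suc (2 * n - Suc t)) (shift \<mu> u)"
      using height_shift[OF Suc(2,3)] .
    then have h: "height (2 * n - t) (shift \<mu> u)"
      by (auto simp: height_def)
    have a: "agree (weight_part \<mu> (shift \<mu> u)) (shift \<mu> u)"
      using agree_trans[OF agree_sym[OF weight_part_shift] agree_shift[OF Suc(3)]] .
    have "W (shift \<nu> (shift \<mu> u))"
      using W_shift[OF Suc(4), of \<mu>] by (simp add: shift_commute)
    from Suc.IH[OF h a this] have "W (shift \<mu> u)" .
    \<comment> \<open>\<open>(\<mu> - \<nu>) * u\<close> is the difference of the shifts of \<open>u\<close> by \<open>\<nu>\<close> and by \<open>\<mu>\<close>\<close>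
    from W_lin[OF Suc(4) this, of "1 / (\<mu> - \<nu>)" "- (1 / (\<mu> - \<nu>))"]
    show ?case
    proof (rule W_agree)
      have "(1 / (\<mu> - \<nu>)) * (x - \<nu> * y) + - (1 / (\<mu> - \<nu>)) * (x - \<mu> * y) = y" for x y
      proof -
        define c where "c = 1 / (\<mu> - \<nu>)"
        have "c * (x - \<nu> * y) + - c * (x - \<mu> * y) = (c * (\<mu> - \<nu>)) * y"
          by (simp add: algebra_simps)
        also have "c * (\<mu> - \<nu>) = 1" using assms(3) by (simp add: c_def)
        finally show ?thesis by (simp add: c_def)
      qed
      then show "agree (\<lambda>i j. 1 / (\<mu> - \<nu>) * shift \<nu> u i j + - (1 / (\<mu> - \<nu>)) * shift \<mu> u i j) u"
        by (simp add: agree_def shift_def)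
    qed
  qed
  from this[of "2*n"] show ?thesis using assms by (auto simp: height_def)
qed

lemma W_unshift_pow:
  assumes "agree (weight_part \<mu> u) u" "W ((shift \<nu> ^^ k) u)" "\<mu> \<noteq> \<nu>"
  shows "W u"
  using assms
proof (induction k arbitrary: u)
  case (Suc k)
  have "W (shift \<nu> u)"
    by (rule Suc.IH)
      (use Suc.prems agree_trans[OF agree_sym[OF weight_part_shift] agree_shift] in \<open>auto simp: funpow_swap1\<close>)
  then show ?case using W_unshift Suc.prems by blast
qed simp

text \<open>The set \<open>M\<close> contains the other weights that occur in \<open>u\<close>. A high power of the shift by
  \<open>\<nu> \<in> M\<close> kills the part of weight \<open>\<nu>\<close> and can be undone on the part of weight \<open>\<mu>\<close>.\<close>

lemma W_weight_part:
  assumes "finite M" "\<mu> \<notin> M" "W u" "\<And>i j. i < n \<Longrightarrow> j < n \<Longrightarrow> u i j \<noteq> 0 \<Longrightarrow> J i i - J j j \<in> insert \<mu> M"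
  shows "W (weight_part \<mu> u)"
  using assms
proof (induction M arbitrary: u rule: finite_induct)
  case empty
  then have "agree u (weight_part \<mu> u)" by (auto simp: agree_def weight_part_def)
  then show ?case using W_agree empty by blast
next
  case (insert \<nu> M)
  define v where "v = (shift \<nu> ^^ (2 * n)) u"
  have Wv: "W v" unfolding v_def by (rule W_shift_pow) (rule insert.prems)
  have wv: "agree ((shift \<nu> ^^ (2 * n)) (weight_part \<kappa> u)) (weight_part \<kappa> v)" for \<kappa>
    unfolding v_def by (rule weight_part_shift_pow)
  have "agree (weight_part \<kappa> v) (\<lambda>_ _. 0)" if "\<kappa> \<notin> insert \<mu> M" for \<kappa>
  proof (cases "\<kappa> = \<nu>")
    case True
    have "agree (weight_part \<nu> (weight_part \<nu> u)) (weight_part \<nu> u)" by (auto simp: agree_def weight_part_def)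
    from shift_nilpotent[OF this] show ?thesis
      using True agree_trans[OF agree_sym[OF wv]] by blast
  next
    case False
    have "agree (weight_part \<kappa> u) (\<lambda>_ _. 0)"
      unfolding agree_def
    proof (intro allI impI)
      fix i j assume "i < n" "j < n"
      then show "weight_part \<kappa> u i j = 0"
        using insert.prems(3)[of i j] that False by (auto simp: weight_part_def)
    qed
    from agree_shift_pow[OF this] have "agree ((shift \<nu> ^^ (2 * n)) (weight_part \<kappa> u)) (\<lambda>_ _. 0)"
      by (simp add: shift_pow_zero)
    then show ?thesis using agree_trans[OF agree_sym[OF wv]] by blast
  qed
  then have sup: "J i i - J j j \<in> insert \<mu> M" if "i < n" "j < n" "v i j \<noteq> 0" for i j
    using that by (fastforce simp: agree_def weight_part_def)
  have "W (weight_part \<mu> v)"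
    by (rule insert.IH) (use insert.prems Wv sup in auto)
  then have "W ((shift \<nu> ^^ (2 * n)) (weight_part \<mu> u))"
    using W_agree agree_sym[OF wv] by blast
  moreover have "agree (weight_part \<mu> (weight_part \<mu> u)) (weight_part \<mu> u)" by (auto simp: agree_def weight_part_def)
  ultimately show ?case using W_unshift_pow insert.prems(1) by blast
qed

end

text \<open>The matrices that are trace-orthogonal to \<open>A\<close> together with all their iterated commutators with \<open>J\<close>
  form a subspace that is stable under the commutator and contains \<open>[J, B]\<close>. Hence it contains the parts
  of \<open>B\<close> of all non-zero weights \<open>\<mu>\<close>. In the sum below each part is multiplied by the conjugate of its weight,
  so that weight zero does not contribute.\<close>

lemma weighted_trace_zero:
  assumes F: "\<And>k. k \<ge> 1 \<Longrightarrow> (\<Sum>i<n. \<Sum>j<n. A j i * (entry_comm n J ^^ k) B i j) = 0"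
  shows "(\<Sum>i<n. \<Sum>j<n. A j i * B i j * cnj (J i i - J j j)) = 0"
proof -
  define F where "F u = (\<Sum>i<n. \<Sum>j<n. A j i * u i j)" for u :: "nat \<Rightarrow> nat \<Rightarrow> complex"
  define W where "W u \<longleftrightarrow> (\<forall>k. F ((entry_comm n J ^^ k) u) = 0)" for u
  have F_lin: "F (\<lambda>i j. a * u i j + b * v i j) = a * F u + b * F v" for a b u v
    by (simp add: F_def algebra_simps sum.distrib sum_distrib_left)
  have F_agree: "F u = F v" if "agree u v" for u v
    using that by (auto simp: F_def agree_def intro!: sum.cong)
  have W1: "W u \<Longrightarrow> W v \<Longrightarrow> W (\<lambda>i j. a * u i j + b * v i j)" for a b u v
    by (simp add: W_def entry_comm_pow_lin F_lin)
  have W2: "W u \<Longrightarrow> W (entry_comm n J u)" for u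
    unfolding W_def by (metis funpow_Suc_right comp_apply)
  have W3: "W u \<Longrightarrow> agree u v \<Longrightarrow> W v" for u v
    unfolding W_def using F_agree[OF agree_entry_comm_pow] by metis
  have WB: "W (entry_comm n J B)"
    unfolding W_def
  proof
    fix k show "F ((entry_comm n J ^^ k) (entry_comm n J B)) = 0"
      using F[of "Suc k"] unfolding F_def by (simp add: funpow_swap1)
  qed
  define M where "M = (\<lambda>(i, j). J i i - J j j) ` ({..<n} \<times> {..<n})"
  have fM: "finite M" by (simp add: M_def)
  have Fwt: "cnj \<mu> * F (weight_part \<mu> B) = 0" for \<mu>
  proof (cases "\<mu> = 0")
    case False
    have "W (weight_part \<mu> (entry_comm n J B))"
      by (rule W_weight_part[where M = "M - {\<mu>}"]) (use W1 W2 W3 WB fM in \<open>auto simp: M_def\<close>)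
    then have "W (entry_comm n J (weight_part \<mu> B))"
      using W3 agree_sym[OF weight_part_entry_comm] by blast
    then have "W (shift 0 (weight_part \<mu> B))" by (simp add: shift_def[abs_def])
    then have "W (weight_part \<mu> B)"
      by (rule W_unshift[rotated 4]) (use W1 W2 W3 False in \<open>auto simp: agree_def weight_part_def\<close>)
    then have "F ((entry_comm n J ^^ 0) (weight_part \<mu> B)) = 0" unfolding W_def by blast
    then show ?thesis by simp
  qed simp
  have "(\<Sum>i<n. \<Sum>j<n. A j i * B i j * cnj (J i i - J j j))
      = (\<Sum>i<n. \<Sum>j<n. \<Sum>\<mu>\<in>M. cnj \<mu> * (A j i * weight_part \<mu> B i j))"
  proof (intro sum.cong refl)
    fix i j assume "i \<in> {..<n}" "j \<in> {..<n}"
    then have "J i i - J j j \<in> M" by (auto simp: M_def)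
    moreover have "cnj \<mu> * (A j i * weight_part \<mu> B i j) =
        (if \<mu> = J i i - J j j then A j i * B i j * cnj (J i i - J j j) else 0)" for \<mu>
      by (auto simp: weight_part_def)
    ultimately show "A j i * B i j * cnj (J i i - J j j) = (\<Sum>\<mu>\<in>M. cnj \<mu> * (A j i * weight_part \<mu> B i j))"
      using fM by (simp add: sum.delta)
  qed
  also have "\<dots> = (\<Sum>i<n. \<Sum>\<mu>\<in>M. \<Sum>j<n. cnj \<mu> * (A j i * weight_part \<mu> B i j))"
    by (intro sum.cong refl) (rule sum.swap)
  also have "\<dots> = (\<Sum>\<mu>\<in>M. \<Sum>i<n. \<Sum>j<n. cnj \<mu> * (A j i * weight_part \<mu> B i j))"
    by (rule sum.swap)
  also have "\<dots> = (\<Sum>\<mu>\<in>M. cnj \<mu> * F (weight_part \<mu> B))"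
    by (simp add: F_def sum_distrib_left)
  also have "\<dots> = 0" by (simp add: Fwt)
  finally show ?thesis .
qed

text \<open>Pairing \<open>J\<close> with the complex conjugate of its diagonal gives the sum of the squares
  \<open>\<bar>J p p\<bar>\<^sup>2\<close> on one side; on the other side, invariance of the trace turns each commutator into an
  expression that vanishes by \<open>weighted_trace_zero\<close>.\<close>

lemma diagonal_zero:
  assumes J: "\<And>p q. p < n \<Longrightarrow> q < n \<Longrightarrow>
      J p q = (\<Sum>(A, B)\<leftarrow>ps. \<Sum>k<n. A p k * B k q - B p k * A k q)"
    and F: "\<And>A B k. (A, B) \<in> set ps \<Longrightarrow> k \<ge> 1 \<Longrightarrow>
      (\<Sum>i<n. \<Sum>j<n. A j i * (entry_comm n J ^^ k) B i j) = 0"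
    and p: "p < n"
  shows "J p p = 0"
proof -
  have one: "(\<Sum>p<n. (\<Sum>k<n. A p k * B k p - B p k * A k p) * cnj (J p p)) = 0"
    if "(A, B) \<in> set ps" for A B
  proof -
    have "(\<Sum>p<n. (\<Sum>k<n. A p k * B k p - B p k * A k p) * cnj (J p p))
        = (\<Sum>p<n. \<Sum>k<n. A p k * B k p * cnj (J p p)) - (\<Sum>p<n. \<Sum>k<n. A k p * B p k * cnj (J p p))"
      unfolding sum_subtractf[symmetric]
      by (intro sum.cong refl) (simp add: sum_distrib_left sum_distrib_right sum_subtractf[symmetric] algebra_simps)
    also have "(\<Sum>p<n. \<Sum>k<n. A p k * B k p * cnj (J p p)) = (\<Sum>p<n. \<Sum>k<n. A k p * B p k * cnj (J k k))"
      by (subst sum.swap) simp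
    also have "\<dots> - (\<Sum>p<n. \<Sum>k<n. A k p * B p k * cnj (J p p))
        = - (\<Sum>p<n. \<Sum>k<n. A k p * B p k * cnj (J p p - J k k))"
      by (simp add: sum_subtractf[symmetric] sum_negf[symmetric] algebra_simps)
    also have "\<dots> = 0"
      using weighted_trace_zero[of A B] F[OF that] by simp
    finally show ?thesis .
  qed
  have "(\<Sum>p<n. J p p * cnj (J p p)) = (\<Sum>p<n. (\<Sum>(A, B)\<leftarrow>ps. \<Sum>k<n. A p k * B k p - B p k * A k p) * cnj (J p p))"
    using J by (intro sum.cong) auto
  also have "\<dots> = (\<Sum>(A, B)\<leftarrow>ps. \<Sum>p<n. (\<Sum>k<n. A p k * B k p - B p k * A k p) * cnj (J p p))"
    by (induction ps) (auto simp: algebra_simps sum.distrib)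
  also have "\<dots> = 0"
    using one by (induction ps) auto
  finally have "(\<Sum>p<n. J p p * cnj (J p p)) = 0" .
  then have "complex_of_real (\<Sum>p<n. (cmod (J p p))\<^sup>2) = 0"
    by (simp only: of_real_sum complex_norm_square)
  then have "(\<Sum>p<n. (cmod (J p p))\<^sup>2) = 0"
    using of_real_eq_0_iff by blast
  then show ?thesis using p by (simp add: sum_nonneg_eq_0_iff)
qed

end


lemma jordan_matrix_block:
  "i < sum_list (map fst n_as) \<Longrightarrow> j < sum_list (map fst n_as) \<Longrightarrow>
    jordan_matrix n_as $$ (i, j) \<noteq> (0::complex) \<Longrightarrow>
    jordan_matrix n_as $$ (i, i) = jordan_matrix n_as $$ (j, j)"
proof (induction n_as arbitrary: i j)
  case (Cons na n_as)
  obtain m a where na: "na = (m, a)" by force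
  let ?N = "sum_list (map fst n_as)"
  have [simp]: "dim_row (jordan_block m a) = m" "dim_col (jordan_block m a) = m" by auto
  show ?case
    using Cons.prems Cons.IH[of "i - m" "j - m"] unfolding na jordan_matrix_Cons
    by (auto split: if_splits)
qed simp

definition mat_commutator :: "complex mat \<Rightarrow> complex mat \<Rightarrow> complex mat" where
  "mat_commutator X B = X * B - B * X"

definition mat_trace :: "nat \<Rightarrow> complex mat \<Rightarrow> complex" where
  "mat_trace n M = (\<Sum>i<n. M $$ (i, i))"

lemma mat_trace_commute:
  assumes "A \<in> carrier_mat n n" "B \<in> carrier_mat n n"
  shows "mat_trace n (A * B) = mat_trace n (B * A)"
proof -
  have "mat_trace n (A * B) = (\<Sum>i<n. \<Sum>j<n. A $$ (i, j) * B $$ (j, i))"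
    using assms by (auto simp: mat_trace_def scalar_prod_def lessThan_atLeast0 intro!: sum.cong)
  also have "\<dots> = (\<Sum>i<n. \<Sum>j<n. B $$ (i, j) * A $$ (j, i))"
    by (subst sum.swap) (simp add: mult.commute)
  also have "\<dots> = mat_trace n (B * A)"
    using assms by (auto simp: mat_trace_def scalar_prod_def lessThan_atLeast0 intro!: sum.cong)
  finally show ?thesis .
qed

lemma strict_upper_pow:
  assumes J: "J \<in> carrier_mat n n" and z: "\<And>i j. i < n \<Longrightarrow> j \<le> i \<Longrightarrow> J $$ (i, j) = (0::complex)"
  shows "i < n \<Longrightarrow> j < n \<Longrightarrow> j < i + k \<Longrightarrow> (J ^\<^sub>m k) $$ (i, j) = 0"
proof (induction k arbitrary: i j)
  case 0
  then show ?case using J by auto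
next
  case (Suc k)
  have c: "J ^\<^sub>m k \<in> carrier_mat n n" using J by simp
  have "(J ^\<^sub>m Suc k) $$ (i, j) = (\<Sum>l<n. (J ^\<^sub>m k) $$ (i, l) * J $$ (l, j))"
    using J c Suc.prems by (auto simp: scalar_prod_def lessThan_atLeast0 intro!: sum.cong)
  also have "\<dots> = 0"
  proof (rule sum.neutral, rule ballI)
    fix l assume l: "l \<in> {..<n}"
    show "(J ^\<^sub>m k) $$ (i, l) * J $$ (l, j) = 0"
      using Suc.IH[of i l] z[of l j] l Suc.prems by (cases "l < i + k") auto
  qed
  finally show ?case .
qed

lemma sum_list_mult_sum:
  fixes f :: "'x \<Rightarrow> nat \<Rightarrow> nat \<Rightarrow> complex"
  shows "(\<Sum>r<n. \<Sum>s<n. c r * (\<Sum>x\<leftarrow>xs. f x r s) * d s) = (\<Sum>x\<leftarrow>xs. \<Sum>r<n. \<Sum>s<n. c r * f x r s * d s)"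
  by (induction xs) (simp_all add: algebra_simps sum.distrib)

lemma conjugate_entry:
  assumes "Q \<in> carrier_mat n n" "M \<in> carrier_mat n n" "P \<in> carrier_mat n n" "p < n" "q < n"
  shows "(Q * M * P) $$ (p, q) = (\<Sum>r<n. \<Sum>s<n. Q $$ (p, r) * M $$ (r, s) * P $$ (s, q :: nat)) "
proof -
  define R where "R = Q * M"
  have R: "R \<in> carrier_mat n n" using assms by (simp add: R_def)
  have "(Q * M * P) $$ (p, q) = (\<Sum>s<n. R $$ (p, s) * P $$ (s, q))"
    unfolding R_def[symmetric] using assms R
    by (auto simp: scalar_prod_def lessThan_atLeast0 intro!: sum.cong)
  also have "\<dots> = (\<Sum>s<n. (\<Sum>r<n. Q $$ (p, r) * M $$ (r, s)) * P $$ (s, q))"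
    unfolding R_def using assms by (auto simp: scalar_prod_def lessThan_atLeast0 intro!: sum.cong)
  also have "\<dots> = (\<Sum>s<n. \<Sum>r<n. Q $$ (p, r) * M $$ (r, s) * P $$ (s, q))"
    by (simp add: sum_distrib_right)
  finally show ?thesis by (subst sum.swap)
qed

text \<open>The argument behind Cartan's criterion, with a hypothesis on traces that can be verified for ideals of
  a Lie algebra: in Jordan normal form the diagonal of \<open>X\<close> is zero.\<close>

lemma commutator_sum_nilpotent_mat:
  fixes X :: "complex mat"
  assumes X: "X \<in> carrier_mat n n"
    and ps: "\<And>A B. (A, B) \<in> set ps \<Longrightarrow> A \<in> carrier_mat n n \<and> B \<in> carrier_mat n n"
    and sum: "\<And>p q. p < n \<Longrightarrow> q < n \<Longrightarrow> X $$ (p, q) = (\<Sum>(A, B)\<leftarrow>ps. (A * B - B * A) $$ (p, q))"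
    and tr: "\<And>A B k. (A, B) \<in> set ps \<Longrightarrow> k \<ge> 1 \<Longrightarrow> mat_trace n (A * (mat_commutator X ^^ k) B) = 0"
  shows "X ^\<^sub>m n = 0\<^sub>m n n"
proof -
  obtain as where "char_poly X = (\<Prod>a\<leftarrow>as. [:- a, 1:])"
    using char_poly_factorized[OF X] by blast
  then obtain n_as where jnf: "jordan_nf X n_as"
    using jordan_nf_exists[OF X] by blast
  define J where "J = jordan_matrix n_as"
  obtain P Q where wit: "similar_mat_wit X J P Q"
    using jnf unfolding jordan_nf_def similar_mat_def J_def by blast
  have n: "n = dim_row X" using X by simp
  note w = similar_mat_witD[OF n wit]
  note PQ = w(1) and QP = w(2) and XJ = w(3) and Jc = w(5) and Pc = w(6) and Qc = w(7)
  have cm: "A * B \<in> carrier_mat n n" if "A \<in> carrier_mat n n" "B \<in> carrier_mat n n" for A B :: "complex mat"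
    using that by simp
  have dim: "sum_list (map fst n_as) = n"
    using Jc unfolding J_def by (metis carrier_matD(1) jordan_matrix_dim(1))
  interpret jordan_shape n "\<lambda>i j. J $$ (i, j)"
    using jordan_matrix_upper_triangular[of _ n_as] jordan_matrix_block[of _ n_as]
    by unfold_locales (auto simp: J_def dim)
  \<comment> \<open>conjugation with the base change to the Jordan normal form\<close>
  define cj where "cj M = Q * M * P" for M
  have cjc: "cj M \<in> carrier_mat n n" if "M \<in> carrier_mat n n" for M
    using that Pc Qc unfolding cj_def by (intro cm)
  have cj_mult: "cj (M * N) = cj M * cj N" if M: "M \<in> carrier_mat n n" and N: "N \<in> carrier_mat n n" for M N
  proof -
    have "cj M * cj N = Q * M * (P * (Q * N * P))"
      unfolding cj_def using M N Pc Qc by (simp add: assoc_mult_mat[of _ n n _ n _ n])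
    also have "P * (Q * N * P) = (P * Q) * (N * P)"
      using N Pc Qc by (simp add: assoc_mult_mat[of _ n n _ n _ n])
    also have "Q * M * ((P * Q) * (N * P)) = cj (M * N)"
      unfolding cj_def PQ using M N Pc Qc by (simp add: assoc_mult_mat[of _ n n _ n _ n])
    finally show ?thesis by simp
  qed
  have cj_minus: "cj (M - N) = cj M - cj N" if M: "M \<in> carrier_mat n n" and N: "N \<in> carrier_mat n n" for M N
    unfolding cj_def using M N Pc Qc
    by (simp add: mult_minus_distrib_mat[of _ n n _ n] minus_mult_distrib_mat[of _ n n _ _ n])
  have cjX: "cj X = J"
  proof -
    have "cj X = (Q * P) * J * (Q * P)"
      unfolding cj_def XJ using Pc Qc Jc by (simp add: assoc_mult_mat[of _ n n _ n _ n])
    then show ?thesis using Jc by (simp add: QP)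
  qed
  have mc: "mat_commutator X M \<in> carrier_mat n n" if "M \<in> carrier_mat n n" for M
    using that X cm unfolding mat_commutator_def by (intro minus_carrier_mat cm)
  have mcp: "(mat_commutator X ^^ k) M \<in> carrier_mat n n" if "M \<in> carrier_mat n n" for k M
    using that mc by (induction k) auto
  have ent: "(\<lambda>i j. cj (mat_commutator X M) $$ (i, j)) i j = entry_comm n (\<lambda>i j. J $$ (i, j)) (\<lambda>i j. cj M $$ (i, j)) i j"
    if M: "M \<in> carrier_mat n n" and ij: "i < n" "j < n" for M i j
  proof -
    have "cj (mat_commutator X M) = J * cj M - cj M * J"
      unfolding mat_commutator_def using M X cm by (simp add: cj_minus cj_mult cjX)
    then show ?thesis
      using M X Jc cjc[OF M] ij by (auto simp: entry_comm_def scalar_prod_def lessThan_atLeast0)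
  qed
  have entp: "agree (\<lambda>i j. cj ((mat_commutator X ^^ k) M) $$ (i, j))
     ((entry_comm n (\<lambda>i j. J $$ (i, j)) ^^ k) (\<lambda>i j. cj M $$ (i, j)))" if M: "M \<in> carrier_mat n n" for M k
  proof (induction k)
    case (Suc k)
    have "agree (\<lambda>i j. cj (mat_commutator X ((mat_commutator X ^^ k) M)) $$ (i, j))
       (entry_comm n (\<lambda>i j. J $$ (i, j)) (\<lambda>i j. cj ((mat_commutator X ^^ k) M) $$ (i, j)))"
      unfolding agree_def using ent[OF mcp[OF M]] by blast
    then show ?case using agree_trans[OF _ agree_entry_comm[OF Suc]] by simp
  qed (simp add: agree_def)
  have mtr_cj: "mat_trace n (cj M) = mat_trace n M" if M: "M \<in> carrier_mat n n" for M
  proof -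
    have "mat_trace n (cj M) = mat_trace n (P * (Q * M))"
      unfolding cj_def using mat_trace_commute[of "Q * M" n P] M Pc Qc by simp
    also have "P * (Q * M) = M"
      using M Pc Qc PQ by (simp add: assoc_mult_mat[of _ n n _ n _ n, symmetric])
    finally show ?thesis .
  qed
  define qs where "qs = map (\<lambda>(A, B). (\<lambda>i j. cj A $$ (i, j), \<lambda>i j. cj B $$ (i, j))) ps"
  have diag: "J $$ (p, p) = 0" if p: "p < n" for p
  proof (rule diagonal_zero[where ps = qs and p = p])
    fix p q assume pq: "p < n" "q < n"
    have "J $$ (p, q) = cj X $$ (p, q)" by (simp add: cjX)
    also have "\<dots> = (\<Sum>r<n. \<Sum>s<n. Q $$ (p, r) * X $$ (r, s) * P $$ (s, q))"
      unfolding cj_def using conjugate_entry Qc X Pc pq by blast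
    also have "\<dots> = (\<Sum>r<n. \<Sum>s<n. Q $$ (p, r) * (\<Sum>x\<leftarrow>ps. (fst x * snd x - snd x * fst x) $$ (r, s)) * P $$ (s, q))"
      by (intro sum.cong refl) (simp add: sum case_prod_unfold)
    also have "\<dots> = (\<Sum>x\<leftarrow>ps. \<Sum>r<n. \<Sum>s<n. Q $$ (p, r) * (fst x * snd x - snd x * fst x) $$ (r, s) * P $$ (s, q))"
      by (rule sum_list_mult_sum)
    also have "\<dots> = (\<Sum>x\<leftarrow>ps. \<Sum>k<n. cj (fst x) $$ (p, k) * cj (snd x) $$ (k, q) - cj (snd x) $$ (p, k) * cj (fst x) $$ (k, q))"
    proof (intro arg_cong[of _ _ sum_list] map_cong refl)
      fix x assume "x \<in> set ps"
      then have c: "fst x \<in> carrier_mat n n" "snd x \<in> carrier_mat n n" using ps[of "fst x" "snd x"] by auto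
      have "(\<Sum>r<n. \<Sum>s<n. Q $$ (p, r) * (fst x * snd x - snd x * fst x) $$ (r, s) * P $$ (s, q))
        = cj (fst x * snd x - snd x * fst x) $$ (p, q)"
        unfolding cj_def by (rule conjugate_entry[symmetric]) (use c Qc Pc pq cm in auto)
      also have "\<dots> = (cj (fst x) * cj (snd x) - cj (snd x) * cj (fst x)) $$ (p, q)"
        using c cm by (simp add: cj_minus cj_mult)
      also have "\<dots> = (\<Sum>k<n. cj (fst x) $$ (p, k) * cj (snd x) $$ (k, q) - cj (snd x) $$ (p, k) * cj (fst x) $$ (k, q))"
        using cjc[OF c(1)] cjc[OF c(2)] pq
        by (auto simp: scalar_prod_def lessThan_atLeast0 sum_subtractf)
      finally show "(\<Sum>r<n. \<Sum>s<n. Q $$ (p, r) * (fst x * snd x - snd x * fst x) $$ (r, s) * P $$ (s, q)) = \<dots>" .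
    qed
    also have "\<dots> = (\<Sum>(A, B)\<leftarrow>qs. \<Sum>k<n. A p k * B k q - B p k * A k q)"
      by (simp add: qs_def o_def case_prod_unfold)
    finally show "J $$ (p, q) = \<dots>" .
  next
    fix A' B' and k :: nat assume "(A', B') \<in> set qs" and k: "k \<ge> 1"
    then obtain A B where AB: "(A, B) \<in> set ps"
      and A': "A' = (\<lambda>i j. cj A $$ (i, j))" and B': "B' = (\<lambda>i j. cj B $$ (i, j))"
      by (auto simp: qs_def)
    have c: "A \<in> carrier_mat n n" "B \<in> carrier_mat n n" using ps[OF AB] by auto
    define C where "C = (mat_commutator X ^^ k) B"
    have Cc: "C \<in> carrier_mat n n" unfolding C_def using mcp c by blast
    have "(\<Sum>i<n. \<Sum>j<n. A' j i * (entry_comm n (\<lambda>i j. J $$ (i, j)) ^^ k) B' i j)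
        = (\<Sum>i<n. \<Sum>j<n. cj C $$ (i, j) * cj A $$ (j, i))"
      using entp[OF c(2), of k] by (intro sum.cong refl) (simp add: A' B' C_def agree_def)
    also have "\<dots> = mat_trace n (cj C * cj A)"
      using cjc[OF Cc] cjc[OF c(1)]
      by (auto simp: mat_trace_def scalar_prod_def lessThan_atLeast0 intro!: sum.cong)
    also have "\<dots> = mat_trace n (C * A)"
      using Cc c cm by (simp add: cj_mult[symmetric] mtr_cj)
    also have "\<dots> = mat_trace n (A * C)" using mat_trace_commute Cc c by blast
    also have "\<dots> = 0" using tr[OF AB k] by (simp add: C_def)
    finally show "(\<Sum>i<n. \<Sum>j<n. A' j i * (entry_comm n (\<lambda>i j. J $$ (i, j)) ^^ k) B' i j) = 0" .
  qed (rule p)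
  have low: "J $$ (i, j) = 0" if "i < n" "j \<le> i" for i j
    using that diag upper by (cases "j = i") auto
  have Jn: "J ^\<^sub>m n = 0\<^sub>m n n"
    using Jc strict_upper_pow[OF Jc low] by (intro eq_matI) auto
  have "X ^\<^sub>m n = P * J ^\<^sub>m n * Q"
    using similar_mat_wit_pow[OF wit, of n] X unfolding similar_mat_wit_def by (auto simp: Let_def)
  then show ?thesis using Jn Pc Qc by simp
qed

section \<open>Finite-dimensional vector spaces\<close>

lemma fin_dim_basis:
  assumes "fin_dim TYPE('v::real_vector)" "subspace (U::'v set)"
  shows "\<exists>B. finite B \<and> B \<subseteq> U \<and> independent B \<and> span B = U \<and> card B = dim U"
proof -
  obtain T :: "'v set" where T: "finite T" "span T = UNIV"
    using assms(1) unfolding fin_dim_def by blast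
  obtain B where B: "B \<subseteq> U" "independent B" "U \<subseteq> span B" "card B = dim U"
    using real_vector.basis_exists[of U] by blast
  have "finite B" using real_vector.independent_span_bound[OF T(1) B(2)] T(2) by auto
  moreover have "span B = U"
    using B assms(2) by (simp add: real_vector.span_minimal subset_antisym)
  ultimately show ?thesis using B by blast
qed

lemma fin_dim_locale:
  assumes "fin_dim TYPE('v::real_vector)"
  shows "\<exists>B::'v set. finite_dimensional_vector_space (*\<^sub>R) B"
proof -
  obtain B :: "'v set" where "finite B" "independent B" "span B = UNIV"
    using fin_dim_basis[OF assms real_vector.subspace_UNIV] by blast
  then have "finite_dimensional_vector_space (*\<^sub>R) B"
    by unfold_locales (auto simp: dependent_raw_def span_raw_def)
  then show ?thesis by blast
qed

lemma fin_dim_subspace_eqI: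
  assumes fd: "fin_dim TYPE('v::real_vector)" and "subspace (U::'v set)" "subspace V" "U \<subseteq> V" "dim V \<le> dim U"
  shows "U = V"
proof -
  obtain B :: "'v set" where "finite_dimensional_vector_space (*\<^sub>R) B"
    using fin_dim_locale[OF fd] by blast
  from finite_dimensional_vector_space.dim_eq_span[OF this assms(4)] assms(5)
  have "span U = span V" by (simp add: dim_raw_def span_raw_def)
  then show ?thesis using assms by (metis real_vector.span_eq_iff)
qed

lemma fin_dim_dim_mono:
  assumes fd: "fin_dim TYPE('v::real_vector)" and "(U::'v set) \<subseteq> V"
  shows "dim U \<le> dim V"
proof -
  obtain B :: "'v set" where "finite_dimensional_vector_space (*\<^sub>R) B"
    using fin_dim_locale[OF fd] by blast
  from finite_dimensional_vector_space.dim_subset[OF this assms(2)]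
  show ?thesis by (simp add: dim_raw_def)
qed

definition ssum :: "'v::real_vector set \<Rightarrow> 'v set \<Rightarrow> 'v set" where
  "ssum U V = {x + y | x y. x \<in> U \<and> y \<in> V}"

lemma ssumI: "x \<in> U \<Longrightarrow> y \<in> V \<Longrightarrow> x + y \<in> ssum U V"
  by (auto simp: ssum_def)

lemma ssumE:
  assumes "z \<in> ssum U V" obtains x y where "x \<in> U" "y \<in> V" "z = x + y"
  using assms by (auto simp: ssum_def)

lemma subspace_ssum: "subspace U \<Longrightarrow> subspace V \<Longrightarrow> subspace (ssum U V)"
  unfolding ssum_def by (rule real_vector.subspace_sums)

lemma ssum_upper1: "subspace V \<Longrightarrow> U \<subseteq> ssum U V"
  using ssumI[of _ U 0 V] real_vector.subspace_0[of V] by auto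

lemma ssum_upper2: "subspace U \<Longrightarrow> V \<subseteq> ssum U V"
  using ssumI[of 0 U _ V] real_vector.subspace_0[of U] by auto

lemma ssum_commute: "ssum U V = ssum V (U :: 'v::real_vector set)"
proof -
  have "ssum U V \<subseteq> ssum V U" for U V :: "'v set"
  proof
    fix z assume "z \<in> ssum U V"
    then obtain x y where "x \<in> U" "y \<in> V" "z = y + x" by (elim ssumE) (simp add: add.commute)
    then show "z \<in> ssum V U" by (auto intro: ssumI)
  qed
  then show ?thesis by blast
qed

lemma ssum_mono: "U \<subseteq> U' \<Longrightarrow> V \<subseteq> V' \<Longrightarrow> ssum U V \<subseteq> ssum U' V'"
  by (auto simp: ssum_def)

lemma ssum_least: "subspace W \<Longrightarrow> U \<subseteq> W \<Longrightarrow> V \<subseteq> W \<Longrightarrow> ssum U V \<subseteq> W"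
  by (auto simp: ssum_def intro!: real_vector.subspace_add)

lemma fin_dim_minimal:
  assumes fd: "fin_dim TYPE('v::real_vector)" and P0: "P (U0::'v set)"
    and sub: "\<And>U. P U \<Longrightarrow> subspace (U::'v set)"
  shows "\<exists>U. P U \<and> (\<forall>V. P V \<longrightarrow> V \<subseteq> U \<longrightarrow> V = U)"
proof -
  obtain U where U: "P U" "\<And>V. P V \<Longrightarrow> dim U \<le> dim V"
    using ex_has_least_nat[of P U0 dim] P0 by blast
  have "V = U" if "P V" "V \<subseteq> U" for V
    by (rule fin_dim_subspace_eqI[OF fd sub[OF that(1)] sub[OF U(1)] that(2) U(2)[OF that(1)]])
  then show ?thesis using U(1) by blast
qed

lemma fin_dim_maximal:
  assumes fd: "fin_dim TYPE('v::real_vector)" and P0: "P (U0::'v set)"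
    and sub: "\<And>U. P U \<Longrightarrow> subspace (U::'v set)"
  shows "\<exists>U. P U \<and> (\<forall>V. P V \<longrightarrow> U \<subseteq> V \<longrightarrow> V = U)"
proof -
  have "\<exists>U. P U \<and> (\<forall>V. P V \<longrightarrow> dim V \<le> dim U)"
  proof (rule ex_has_greatest_nat[of P U0 dim "Suc (dim (UNIV::'v set))"])
    show "\<forall>y. P y \<longrightarrow> dim y < Suc (dim (UNIV::'v set))"
      using fin_dim_dim_mono[OF fd top_greatest] by (simp add: less_Suc_eq_le)
  qed (rule P0)
  then obtain U where U: "P U" "\<And>V. P V \<Longrightarrow> dim V \<le> dim U" by blast
  have "V = U" if "P V" "U \<subseteq> V" for V
    by (rule fin_dim_subspace_eqI[OF fd sub[OF U(1)] sub[OF that(1)] that(2) U(2)[OF that(1)], symmetric])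
  then show ?thesis using U(1) by blast
qed

text \<open>This justifies the greatest ideals and submodules in the definitions of \<open>S\<^sub>k\<close> and \<open>\<bb>\<^sub>k\<close>.\<close>

lemma fin_dim_greatest:
  assumes fd: "fin_dim TYPE('v::real_vector)" and P0: "P U0"
    and sub: "\<And>U. P U \<Longrightarrow> subspace (U::'v set)"
    and sum: "\<And>U V. P U \<Longrightarrow> P V \<Longrightarrow> P (ssum U V)"
  shows "\<exists>U. P U \<and> (\<forall>V. P V \<longrightarrow> V \<subseteq> U)"
proof -
  obtain U where U: "P U" "\<And>V. P V \<Longrightarrow> U \<subseteq> V \<Longrightarrow> V = U"
    using fin_dim_maximal[OF fd, of P U0] P0 sub by auto
  have "V \<subseteq> U" if "P V" for V
    using U(2)[OF sum[OF U(1) that] ssum_upper1[OF sub[OF that]]] ssum_upper2[OF sub[OF U(1)], of V] by blast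
  then show ?thesis using U(1) by blast
qed

lemma fin_dim_least:
  assumes fd: "fin_dim TYPE('v::real_vector)" and P0: "P U0"
    and sub: "\<And>U. P U \<Longrightarrow> subspace (U::'v set)"
    and int: "\<And>U V. P U \<Longrightarrow> P V \<Longrightarrow> P (U \<inter> V)"
  shows "\<exists>U. P U \<and> (\<forall>V. P V \<longrightarrow> U \<subseteq> V)"
proof -
  obtain U where U: "P U" "\<And>V. P V \<Longrightarrow> V \<subseteq> U \<Longrightarrow> V = U"
    using fin_dim_minimal[OF fd, of P U0] P0 sub by auto
  have "U \<subseteq> V" if "P V" for V
    using U(2)[OF int[OF U(1) that]] by blast
  then show ?thesis using U(1) by blast
qed

lemma subspace_projection:
  assumes "subspace (V::'v::real_vector set)"
  shows "\<exists>g. linear g \<and> (\<forall>x. g x \<in> V) \<and> (\<forall>x\<in>V. g x = x)"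
  using real_vector.linear_exists_right_inverse_on[of "\<lambda>x. x", OF real_vector.linear_ident assms] by auto

lemma disjoint_projection:
  assumes U: "subspace (U::'v::real_vector set)" and V: "subspace V" and d: "U \<inter> V = {0}"
  shows "\<exists>g. linear g \<and> (\<forall>x\<in>U. g x = x) \<and> (\<forall>x\<in>V. g x = 0)"
proof -
  obtain p where p: "linear p" "\<And>x. p x \<in> V" "\<And>x. x \<in> V \<Longrightarrow> p x = x"
    using subspace_projection[OF V] by blast
  define f where "f x = x - p x" for x
  have f: "linear f" unfolding f_def
    using real_vector.linear_compose_sub[OF real_vector.linear_ident p(1)] by simp
  obtain h where h0: "range h \<subseteq> U \<and> linear h \<and> (\<forall>v\<in>f ` U. f (h v) = v)"
    using real_vector.linear_exists_right_inverse_on[OF f U] by (elim exE)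
  then have h: "range h \<subseteq> U" "linear h" "\<And>v. v \<in> f ` U \<Longrightarrow> f (h v) = v" by auto
  have "h (f x) = x" if x: "x \<in> U" for x
  proof -
    have "f (h (f x) - x) = 0"
      using h(3)[of "f x"] x by (simp add: linear_diff[OF f])
    then have "h (f x) - x = p (h (f x) - x)" by (simp add: f_def)
    then have "h (f x) - x \<in> V" using p(2)[of "h (f x) - x"] by simp
    moreover have "h (f x) - x \<in> U" using h(1) x U by (intro real_vector.subspace_diff) auto
    ultimately have "h (f x) - x \<in> U \<inter> V" by (rule IntI[rotated])
    then have "h (f x) - x = 0" unfolding d by simp
    then show ?thesis by simp
  qed
  moreover have "h (f x) = 0" if "x \<in> V" for x
    using p(3)[OF that] linear_0[OF h(2)] by (simp add: f_def)
  moreover have "linear (h \<circ> f)" using linear_compose[OF f h(2)] .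
  ultimately show ?thesis by (intro exI[of _ "h \<circ> f"] conjI ballI) simp_all
qed

text \<open>Induction on the functionals: if \<open>\<phi> k\<close> is not already zero on the common kernel of the others, then
  \<open>f\<close> is corrected by a multiple of \<open>\<phi> k\<close>, the coefficient being the value of \<open>f\<close> at a vector \<open>v\<close> of
  that kernel with \<open>\<phi> k v = 1\<close>.\<close>

lemma functional_combination:
  fixes \<phi> :: "'i \<Rightarrow> 'v::real_vector \<Rightarrow> real"
  assumes "finite I" "subspace D" "\<And>i. i \<in> I \<Longrightarrow> linear (\<phi> i)" "linear f"
    and "\<And>x. x \<in> D \<Longrightarrow> (\<And>i. i \<in> I \<Longrightarrow> \<phi> i x = 0) \<Longrightarrow> f x = 0"
  shows "\<exists>c. \<forall>x\<in>D. f x = (\<Sum>i\<in>I. c i * \<phi> i x)"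
  using assms
proof (induction I arbitrary: f rule: finite_induct)
  case empty
  then show ?case by auto
next
  case (insert k I)
  show ?case
  proof (cases "\<forall>x\<in>D. (\<forall>i\<in>I. \<phi> i x = 0) \<longrightarrow> \<phi> k x = 0")
    case True
    then have "\<exists>c. \<forall>x\<in>D. f x = (\<Sum>i\<in>I. c i * \<phi> i x)"
      using insert.prems by (intro insert.IH) auto
    then obtain c where c: "\<forall>x\<in>D. f x = (\<Sum>i\<in>I. c i * \<phi> i x)" by blast
    have "(\<Sum>i\<in>I. (c(k := 0)) i * \<phi> i x) = (\<Sum>i\<in>I. c i * \<phi> i x)" for x
      using insert.hyps by (intro sum.cong) auto
    then have "\<forall>x\<in>D. f x = (\<Sum>i\<in>insert k I. (c(k := 0)) i * \<phi> i x)"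
      using c insert.hyps by simp
    then show ?thesis by blast
  next
    case False
    then obtain w where w: "w \<in> D" "\<And>i. i \<in> I \<Longrightarrow> \<phi> i w = 0" "\<phi> k w \<noteq> 0" by blast
    define v where "v = (1 / \<phi> k w) *\<^sub>R w"
    have lk: "linear (\<phi> k)" and li: "\<And>i. i \<in> I \<Longrightarrow> linear (\<phi> i)" using insert.prems by auto
    have v: "v \<in> D" "\<And>i. i \<in> I \<Longrightarrow> \<phi> i v = 0" "\<phi> k v = 1"
      using w insert.prems(1) by (auto simp: v_def real_vector.subspace_scale linear_cmul[OF lk] linear_cmul[OF li])
    define f' where "f' x = f x - f v * \<phi> k x" for x
    have lf': "linear f'"
      unfolding f'_def
      by (intro linearI) (auto simp: linear_add[OF insert.prems(3)] linear_add[OF lk]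
          linear_cmul[OF insert.prems(3)] linear_cmul[OF lk] algebra_simps)
    have "\<exists>c. \<forall>x\<in>D. f' x = (\<Sum>i\<in>I. c i * \<phi> i x)"
    proof (rule insert.IH[OF insert.prems(1) _ lf'])
      fix x assume x: "x \<in> D" "\<And>i. i \<in> I \<Longrightarrow> \<phi> i x = 0"
      have "f (x - \<phi> k x *\<^sub>R v) = 0"
      proof (rule insert.prems(4))
        show "x - \<phi> k x *\<^sub>R v \<in> D"
          using x v insert.prems(1) by (simp add: real_vector.subspace_diff real_vector.subspace_scale)
        fix i assume "i \<in> insert k I"
        then show "\<phi> i (x - \<phi> k x *\<^sub>R v) = 0"
          using x v by (auto simp: linear_diff[OF lk] linear_cmul[OF lk] linear_diff[OF li] linear_cmul[OF li])
      qed
      then show "f' x = 0"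
        by (simp add: f'_def linear_diff[OF insert.prems(3)] linear_cmul[OF insert.prems(3)])
    qed (use insert.prems in auto)
    then obtain c where c: "\<forall>x\<in>D. f' x = (\<Sum>i\<in>I. c i * \<phi> i x)" by blast
    have "(\<Sum>i\<in>I. (c(k := f v)) i * \<phi> i x) = (\<Sum>i\<in>I. c i * \<phi> i x)" for x
      using insert.hyps by (intro sum.cong) auto
    then have "\<forall>x\<in>D. f x = (\<Sum>i\<in>insert k I. (c(k := f v)) i * \<phi> i x)"
      using c insert.hyps by (simp add: f'_def algebra_simps)
    then show ?thesis by blast
  qed
qed

text \<open>A representation theorem for possibly degenerate pairings. Taking \<open>J\<close> and \<open>D\<close> to be different
  subspaces, it yields double orthogonal complements, orthogonal decompositions and the representation of
  functionals below.\<close>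

lemma representing_vector:
  fixes b :: "'w::real_vector \<Rightarrow> 'v::real_vector \<Rightarrow> real"
  assumes fd: "fin_dim TYPE('w)" and b: "bilinear b" and J: "subspace J" and D: "subspace D" and f: "linear f"
    and z: "\<And>x. x \<in> D \<Longrightarrow> (\<And>y. y \<in> J \<Longrightarrow> b y x = 0) \<Longrightarrow> f x = 0"
  shows "\<exists>y\<in>J. \<forall>x\<in>D. f x = b y x"
proof -
  obtain S where S: "finite S" "S \<subseteq> J" "span S = J" using fin_dim_basis[OF fd J] by blast
  have lr: "linear (b y)" and ll: "linear (\<lambda>y. b y x)" for x y using b by (auto simp: bilinear_def)
  have "f x = 0" if x: "x \<in> D" "\<And>i. i \<in> S \<Longrightarrow> b i x = 0" for x
  proof (rule z[OF x(1)])
    fix y assume "y \<in> J"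
    then show "b y x = 0" using linear_eq_0_on_span[OF ll x(2)] S(3) by blast
  qed
  then have "\<exists>c. \<forall>x\<in>D. f x = (\<Sum>i\<in>S. c i * b i x)"
    by (intro functional_combination[OF S(1) D lr f]) blast
  then obtain c where c: "\<forall>x\<in>D. f x = (\<Sum>i\<in>S. c i * b i x)" by (elim exE)
  have "(\<Sum>i\<in>S. c i * b i x) = b (\<Sum>i\<in>S. c i *\<^sub>R i) x" for x
    by (simp add: linear_sum[OF ll] linear_cmul[OF ll])
  moreover have "(\<Sum>i\<in>S. c i *\<^sub>R i) \<in> J"
    using S by (intro real_vector.subspace_sum[OF J] real_vector.subspace_scale[OF J]) auto
  ultimately show ?thesis using c by (intro bexI[of _ "\<Sum>i\<in>S. c i *\<^sub>R i"]) simp_all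
qed

definition perp :: "('v \<Rightarrow> 'v \<Rightarrow> real) \<Rightarrow> 'v set \<Rightarrow> 'v set" where
  "perp b U = {x. \<forall>y\<in>U. b x y = 0}"

lemma perp_antimono: "U \<subseteq> V \<Longrightarrow> perp b V \<subseteq> perp b U"
  by (auto simp: perp_def)

lemma subspace_perp:
  assumes "bilinear b" shows "subspace (perp b (U :: 'v::real_vector set))"
  unfolding perp_def real_vector.subspace_def
  by (auto simp: bilinear_ladd[OF assms] bilinear_lzero[OF assms] bilinear_lmul[OF assms])

locale fin_scalar_product =
  fixes b :: "'v::real_vector \<Rightarrow> 'v \<Rightarrow> real"
  assumes fd: "fin_dim TYPE('v)" and sp: "scalar_product b"
begin

lemma bil: "bilinear b" and sym: "b x y = b y x"
  using sp by (auto simp: scalar_product_def)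

lemma nondeg: "(\<And>y. b x y = 0) \<Longrightarrow> x = 0"
  using sp by (auto simp: scalar_product_def nondegenerate_on_def)

lemma perp_perp:
  assumes U: "subspace U" shows "perp b (perp b U) = U"
proof
  show "U \<subseteq> perp b (perp b U)" by (auto simp: perp_def sym)
  show "perp b (perp b U) \<subseteq> U"
  proof
    fix x assume x: "x \<in> perp b (perp b U)"
    have "\<exists>y\<in>U. \<forall>z\<in>UNIV. b x z = b y z"
    proof (rule representing_vector[OF fd bil U real_vector.subspace_UNIV])
      show "linear (b x)" using bil by (auto simp: bilinear_def)
      show "b x z = 0" if "\<And>y. y \<in> U \<Longrightarrow> b y z = 0" for z
      proof -
        have "b z y = 0" if "y \<in> U" for y by (subst sym) (rule \<open>\<And>y. y \<in> U \<Longrightarrow> b y z = 0\<close>[OF that])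
        then have "z \<in> perp b U" by (simp add: perp_def)
        then show ?thesis using x by (auto simp: perp_def)
      qed
    qed
    then obtain y where y: "y \<in> U" "\<And>z. b x z = b y z" by blast
    have "x - y = 0" by (rule nondeg) (simp add: y bilinear_lsub[OF bil])
    then show "x \<in> U" using y by simp
  qed
qed

lemma perp_ssum: "subspace U \<Longrightarrow> subspace V \<Longrightarrow> perp b (ssum U V) = perp b U \<inter> perp b V"
  using ssum_upper1[of V U] ssum_upper2[of U V]
  by (auto simp: perp_def bilinear_radd[OF bil] elim!: ssumE)

lemma perp_Int:
  assumes "subspace U" "subspace V" shows "perp b (U \<inter> V) = ssum (perp b U) (perp b V)"
proof -
  have "U \<inter> V = perp b (ssum (perp b U) (perp b V))"
    using assms by (simp add: perp_ssum subspace_perp[OF bil] perp_perp)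
  then show ?thesis by (simp add: perp_perp subspace_ssum subspace_perp[OF bil])
qed

lemma riesz: "linear f \<Longrightarrow> \<exists>y. \<forall>x. f x = b y x"
proof -
  assume f: "linear f"
  have "\<exists>y\<in>UNIV. \<forall>x\<in>UNIV. f x = b y x"
  proof (rule representing_vector[OF fd bil real_vector.subspace_UNIV real_vector.subspace_UNIV f])
    fix x assume "\<And>y. y \<in> UNIV \<Longrightarrow> b y x = 0"
    then have "x = 0" by (intro nondeg) (simp add: sym)
    then show "f x = 0" using linear_0[OF f] by simp
  qed
  then show ?thesis by blast
qed

end

text \<open>The form is allowed to be degenerate, as the trace form of a module will be, provided that the radical
  of its restriction to \<open>J\<close> lies in the radical of the whole form.\<close>

lemma orthogonal_decomposition:
  fixes b :: "'v::real_vector \<Rightarrow> 'v \<Rightarrow> real"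
  assumes fd: "fin_dim TYPE('v)" and bil: "bilinear b" and sym: "\<And>x y. b x y = b y x" and J: "subspace J"
    and rad: "\<And>x z. z \<in> J \<Longrightarrow> z \<in> perp b J \<Longrightarrow> b x z = 0"
  shows "ssum J (perp b J) = UNIV"
proof -
  have "x \<in> ssum J (perp b J)" for x
  proof -
    have "\<exists>y\<in>J. \<forall>z\<in>J. b x z = b y z"
    proof (rule representing_vector[OF fd bil J J])
      show "linear (b x)" using bil by (auto simp: bilinear_def)
      show "b x z = 0" if "z \<in> J" "\<And>y. y \<in> J \<Longrightarrow> b y z = 0" for z
        using rad[OF that(1)] that sym by (auto simp: perp_def)
    qed
    then obtain y where y: "y \<in> J" "\<And>z. z \<in> J \<Longrightarrow> b x z = b y z" by blast
    then have "x - y \<in> perp b J" by (simp add: perp_def bilinear_lsub[OF bil])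
    from ssumI[OF y(1) this] show ?thesis by simp
  qed
  then show ?thesis by blast
qed

section \<open>Submodules and semi-simple quotients\<close>

lemma submodule_subspace: "submodule \<sigma> U \<Longrightarrow> subspace U"
  by (simp add: submodule_def)

lemma submoduleD: "submodule \<sigma> U \<Longrightarrow> x \<in> U \<Longrightarrow> \<sigma> L x \<in> U"
  by (simp add: submodule_def)

lemma submodule_Int: "submodule \<sigma> U \<Longrightarrow> submodule \<sigma> V \<Longrightarrow> submodule \<sigma> (U \<inter> V)"
  by (auto simp: submodule_def real_vector.subspace_inter)

lemma submodule_UNIV: "submodule \<sigma> UNIV"
  by (simp add: submodule_def)

lemma semisimple_quotient_iff:
  "semisimple_quotient \<sigma> U W \<longleftrightarrow>
    (\<forall>V. submodule \<sigma> V \<and> W \<subseteq> V \<and> V \<subseteq> U \<longrightarrow>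
      (\<exists>V'. submodule \<sigma> V' \<and> W \<subseteq> V' \<and> V' \<subseteq> U \<and> ssum V V' = U \<and> V \<inter> V' = W))"
  by (simp add: semisimple_quotient_def ssum_def)

lemma semisimple_quotientE:
  assumes "semisimple_quotient \<sigma> U W" "submodule \<sigma> V" "W \<subseteq> V" "V \<subseteq> U"
  obtains V' where "submodule \<sigma> V'" "W \<subseteq> V'" "V' \<subseteq> U" "ssum V V' = U" "V \<inter> V' = W"
  using assms unfolding semisimple_quotient_iff by metis

lemma submodule_modular_law: 
  assumes "subspace V" "subspace W" "V \<subseteq> (W::'v::real_vector set)"
  shows "W \<inter> ssum V X \<subseteq> ssum V (W \<inter> X)"
proof
  fix x assume x: "x \<in> W \<inter> ssum V X"
  then obtain v y where vy: "v \<in> V" "y \<in> X" "x = v + y" by (auto elim: ssumE)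
  have "x - v \<in> W" using x vy(1) assms by (intro real_vector.subspace_diff) auto
  then have "y \<in> W" using vy by simp
  then show "x \<in> ssum V (W \<inter> X)" using vy ssumI by blast
qed

lemma semisimple_quotient_refl: "submodule \<sigma> U \<Longrightarrow> semisimple_quotient \<sigma> U U"
  unfolding semisimple_quotient_iff
  using ssum_least[of U U U] ssum_upper1[of U U] by (metis submodule_subspace inf.idem subset_antisym subset_refl)

locale module_action =
  fixes \<sigma> :: "'l \<Rightarrow> 'v::real_vector \<Rightarrow> 'v"
  assumes lin: "linear (\<sigma> L)"
begin

lemma submodule_ssum: "submodule \<sigma> U \<Longrightarrow> submodule \<sigma> V \<Longrightarrow> submodule \<sigma> (ssum U V)"
  unfolding submodule_def
  by (auto simp: subspace_ssum linear_add[OF lin] elim!: ssumE intro!: ssumI)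

lemma submodule_0: "submodule \<sigma> {0}"
  by (simp add: submodule_def linear_0[OF lin])

text \<open>If \<open>X\<close> is a complement of \<open>V\<close> in the large interval, then by the modular law \<open>W' + (U' \<inter> X)\<close> is one in
  the small interval.\<close>

lemma semisimple_quotient_interval:
  assumes "semisimple_quotient \<sigma> U W" "submodule \<sigma> U'" "submodule \<sigma> W'" "W \<subseteq> W'" "W' \<subseteq> U'" "U' \<subseteq> U"
  shows "semisimple_quotient \<sigma> U' W'"
  unfolding semisimple_quotient_iff
proof (intro allI impI, elim conjE)
  fix V assume V: "submodule \<sigma> V" "W' \<subseteq> V" "V \<subseteq> U'"
  obtain X where X: "submodule \<sigma> X" "W \<subseteq> X" "X \<subseteq> U" "ssum V X = U" "V \<inter> X = W"
    by (rule semisimple_quotientE[OF assms(1) V(1)]) (use V assms in auto)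
  define V' where "V' = ssum W' (U' \<inter> X)"
  note sub = V(1)[THEN submodule_subspace] X(1)[THEN submodule_subspace]
    assms(2)[THEN submodule_subspace] assms(3)[THEN submodule_subspace]
  have sV': "submodule \<sigma> V'" unfolding V'_def
    by (intro submodule_ssum submodule_Int assms X)
  have W: "W' \<subseteq> V'" unfolding V'_def using sub by (simp add: ssum_upper1 real_vector.subspace_inter)
  have UX: "U' \<inter> X \<subseteq> V'" unfolding V'_def using sub by (simp add: ssum_upper2)
  have V'U: "V' \<subseteq> U'" unfolding V'_def using sub assms by (intro ssum_least) auto
  have "ssum V V' = U'"
  proof
    show "ssum V V' \<subseteq> U'" using sub V V'U by (intro ssum_least) auto
    have "U' \<subseteq> ssum V (U' \<inter> X)"
      using submodule_modular_law[OF sub(1,3) V(3), of X] X(4) assms(6) by blast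
    also have "\<dots> \<subseteq> ssum V V'" using UX by (intro ssum_mono) auto
    finally show "U' \<subseteq> ssum V V'" .
  qed
  moreover have "V \<inter> V' = W'"
  proof
    have "V \<inter> V' \<subseteq> ssum W' (V \<inter> (U' \<inter> X))"
      unfolding V'_def by (rule submodule_modular_law[OF sub(4,1) V(2)])
    also have "\<dots> \<subseteq> W'" using X(5) assms(4) sub by (intro ssum_least) auto
    finally show "V \<inter> V' \<subseteq> W'" .
    show "W' \<subseteq> V \<inter> V'" using W V by blast
  qed
  ultimately show "\<exists>V'. submodule \<sigma> V' \<and> W' \<subseteq> V' \<and> V' \<subseteq> U' \<and> ssum V V' = U' \<and> V \<inter> V' = W'"
    using sV' W V'U by blast
qed

text \<open>A complement of \<open>V\<close> is the sum of two: one of \<open>V \<inter> U1\<close> in \<open>U1\<close> and, after \<open>V\<close> has been enlarged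
  by the first, one in \<open>U2\<close>. This is what makes \<open>S\<^sub>k\<close> well-defined.\<close>

lemma semisimple_quotient_sum:
  assumes "semisimple_quotient \<sigma> U1 W" "semisimple_quotient \<sigma> U2 W"
    "submodule \<sigma> U1" "submodule \<sigma> U2" "submodule \<sigma> W" "W \<subseteq> U1" "W \<subseteq> U2"
  shows "semisimple_quotient \<sigma> (ssum U1 U2) W"
  unfolding semisimple_quotient_iff
proof (intro allI impI, elim conjE)
  fix V assume V: "submodule \<sigma> V" "W \<subseteq> V" "V \<subseteq> ssum U1 U2"
  obtain X where X: "submodule \<sigma> X" "W \<subseteq> X" "X \<subseteq> U1" "ssum (V \<inter> U1) X = U1" "V \<inter> U1 \<inter> X = W"
    by (rule semisimple_quotientE[OF assms(1) submodule_Int[OF V(1) assms(3)]]) (use V assms in auto)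
  define V' where "V' = ssum V X"
  have sV': "submodule \<sigma> V'" unfolding V'_def by (intro submodule_ssum V X)
  note sub = V(1)[THEN submodule_subspace] X(1)[THEN submodule_subspace] sV'[THEN submodule_subspace]
    assms(3)[THEN submodule_subspace] assms(4)[THEN submodule_subspace] assms(5)[THEN submodule_subspace]
  have U1V': "U1 \<subseteq> V'" using ssum_mono[of "V \<inter> U1" V X X] X(4) unfolding V'_def by blast
  have VV': "V \<subseteq> V'" unfolding V'_def using sub by (simp add: ssum_upper1)
  obtain Y where Y: "submodule \<sigma> Y" "W \<subseteq> Y" "Y \<subseteq> U2" "ssum (V' \<inter> U2) Y = U2" "V' \<inter> U2 \<inter> Y = W"
    by (rule semisimple_quotientE[OF assms(2) submodule_Int[OF sV' assms(4)]]) (use V assms VV' in auto)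
  note sY = Y(1)[THEN submodule_subspace]
  define Z where "Z = ssum X Y"
  have sZ: "submodule \<sigma> Z" unfolding Z_def by (intro submodule_ssum X Y)
  have WZ: "W \<subseteq> Z" unfolding Z_def using X(2) ssum_upper1[OF sY, of X] by blast
  have ZU: "Z \<subseteq> ssum U1 U2" unfolding Z_def using X Y by (intro ssum_mono)
  have "ssum V Z = ssum U1 U2"
  proof
    show "ssum V Z \<subseteq> ssum U1 U2" using ZU V sub by (intro ssum_least subspace_ssum) auto
    have a: "ssum V' Y \<subseteq> ssum V Z"
    proof
      fix z assume "z \<in> ssum V' Y"
      then obtain v x y where "v \<in> V" "x \<in> X" "y \<in> Y" "z = v + x + y"
        unfolding V'_def by (elim ssumE) auto
      then show "z \<in> ssum V Z" unfolding Z_def using ssumI[OF _ ssumI[of x X y Y], of v V] by (simp add: add.assoc)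
    qed
    have s: "subspace (ssum V' Y)" using sub sY by (simp add: subspace_ssum)
    have "U1 \<subseteq> ssum V' Y" using U1V' ssum_upper1[OF sY] by blast
    moreover have "U2 \<subseteq> ssum V' Y" using ssum_mono[of "V' \<inter> U2" V' Y Y] Y(4) by blast
    ultimately have "ssum U1 U2 \<subseteq> ssum V' Y" using s by (intro ssum_least)
    then show "ssum U1 U2 \<subseteq> ssum V Z" using a by blast
  qed
  moreover have "V \<inter> Z = W"
  proof
    show "W \<subseteq> V \<inter> Z" using V WZ by blast
    show "V \<inter> Z \<subseteq> W"
    proof
      fix v assume v: "v \<in> V \<inter> Z"
      then obtain x y where xy: "x \<in> X" "y \<in> Y" "v = x + y" unfolding Z_def by (auto elim: ssumE)
      have "v - x \<in> V'" using v xy(1) VV' X(3) U1V' sub by (intro real_vector.subspace_diff) auto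
      then have "y \<in> V'" using xy by simp
      then have "y \<in> W" using Y xy by auto
      then have "v \<in> X" unfolding xy(3) using xy(1) X sub by (intro real_vector.subspace_add) auto
      then show "v \<in> W" using v X by auto
    qed
  qed
  ultimately show "\<exists>V'. submodule \<sigma> V' \<and> W \<subseteq> V' \<and> V' \<subseteq> ssum U1 U2 \<and> ssum V V' = ssum U1 U2 \<and> V \<inter> V' = W"
    using sZ WZ ZU by blast
qed

text \<open>The lattice dual of \<open>semisimple_quotient_sum\<close>, which makes \<open>R\<^sub>k\<close> well-defined.\<close>

lemma semisimple_quotient_inter:
  assumes "semisimple_quotient \<sigma> U W1" "semisimple_quotient \<sigma> U W2"
    "submodule \<sigma> U" "submodule \<sigma> W1" "submodule \<sigma> W2" "W1 \<subseteq> U" "W2 \<subseteq> U"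
  shows "semisimple_quotient \<sigma> U (W1 \<inter> W2)"
  unfolding semisimple_quotient_iff
proof (intro allI impI, elim conjE)
  fix V assume V: "submodule \<sigma> V" "W1 \<inter> W2 \<subseteq> V" "V \<subseteq> U"
  note sub = V(1)[THEN submodule_subspace] 
    assms(3)[THEN submodule_subspace] assms(4)[THEN submodule_subspace] assms(5)[THEN submodule_subspace]
  obtain X where X: "submodule \<sigma> X" "W1 \<subseteq> X" "X \<subseteq> U" "ssum (ssum V W1) X = U" "ssum V W1 \<inter> X = W1"
    by (rule semisimple_quotientE[OF assms(1) submodule_ssum[OF V(1) assms(4)]
      ssum_upper2[OF sub(1), of W1] ssum_least[OF sub(2) V(3) assms(6)]])
  define V' where "V' = V \<inter> W1"
  have sV': "submodule \<sigma> V'" unfolding V'_def by (intro submodule_Int V assms)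
  note sub = sub sV'[THEN submodule_subspace] X(1)[THEN submodule_subspace]
  obtain Y where Y: "submodule \<sigma> Y" "W2 \<subseteq> Y" "Y \<subseteq> U" "ssum (ssum V' W2) Y = U" "ssum V' W2 \<inter> Y = W2"
  proof (rule semisimple_quotientE[OF assms(2) submodule_ssum[OF sV' assms(5)]])
    show "W2 \<subseteq> ssum V' W2" using ssum_upper2 sub by blast
    show "ssum V' W2 \<subseteq> U" using sub V(3) assms(7) by (intro ssum_least) (auto simp: V'_def)
  qed
  note sub = sub Y(1)[THEN submodule_subspace]
  have "ssum V (X \<inter> Y) = U"
  proof
    show "ssum V (X \<inter> Y) \<subseteq> U" using X V sub by (intro ssum_least) auto
    show "U \<subseteq> ssum V (X \<inter> Y)"
    proof
      fix u assume "u \<in> U"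
      then obtain v w x where u: "v \<in> V" "w \<in> W1" "x \<in> X" "u = v + w + x"
        unfolding X(4)[symmetric] by (elim ssumE) auto
      define x' where "x' = w + x"
      have x': "x' \<in> X" using u(2,3) X(2) sub unfolding x'_def by (intro real_vector.subspace_add) auto
      then have "x' \<in> ssum (ssum V' W2) Y" using X(3) Y(4) by blast
      then obtain v' w' y where u': "v' \<in> V'" "w' \<in> W2" "y \<in> Y" "x' = v' + w' + y"
        by (elim ssumE) auto
      define y' where "y' = w' + y"
      have y': "y' \<in> Y" using u'(2,3) Y(2) sub unfolding y'_def by (intro real_vector.subspace_add) auto
      have "x' - v' \<in> X" using x' u'(1) X(2) sub unfolding V'_def by (intro real_vector.subspace_diff) auto
      then have "y' \<in> X" using u' by (simp add: y'_def)
      moreover have "u = (v + v') + y'" using u u' by (simp add: x'_def y'_def algebra_simps)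
      moreover have "v + v' \<in> V" using u(1) u'(1) sub by (intro real_vector.subspace_add) (auto simp: V'_def)
      ultimately show "u \<in> ssum V (X \<inter> Y)" using y' ssumI by blast
    qed
  qed
  moreover have "V \<inter> (X \<inter> Y) = W1 \<inter> W2"
  proof
    show "W1 \<inter> W2 \<subseteq> V \<inter> (X \<inter> Y)" using V X Y by blast
    show "V \<inter> (X \<inter> Y) \<subseteq> W1 \<inter> W2"
    proof
      fix z assume z: "z \<in> V \<inter> (X \<inter> Y)"
      then have "z \<in> ssum V W1" using ssum_upper1[OF sub(3), of V] by blast
      then have z1: "z \<in> W1" using z X(5) by blast
      then have "z \<in> V'" using z by (simp add: V'_def)
      then have "z \<in> ssum V' W2" using ssum_upper1[OF sub(4), of V'] by blast
      then show "z \<in> W1 \<inter> W2" using z Y(5) z1 by blast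
    qed
  qed
  ultimately show "\<exists>V'. submodule \<sigma> V' \<and> W1 \<inter> W2 \<subseteq> V' \<and> V' \<subseteq> U \<and> ssum V V' = U \<and> V \<inter> V' = W1 \<inter> W2"
    using X Y submodule_Int[OF X(1) Y(1)] by (intro exI[of _ "X \<inter> Y"]) blast
qed

text \<open>Every subspace between \<open>W\<close> and \<open>U\<close> is a submodule, so a complement of vector spaces suffices.\<close>

lemma semisimple_quotient_trivial:
  assumes U: "subspace U" and W: "subspace W" "W \<subseteq> U" and t: "\<And>L x. x \<in> U \<Longrightarrow> \<sigma> L x \<in> W"
  shows "semisimple_quotient \<sigma> U W"
  unfolding semisimple_quotient_iff
proof (intro allI impI, elim conjE)
  fix V assume V: "submodule \<sigma> V" "W \<subseteq> V" "V \<subseteq> U"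
  note sV = V(1)[THEN submodule_subspace]
  obtain g where g: "linear g" "\<And>x. g x \<in> V" "\<And>x. x \<in> V \<Longrightarrow> g x = x"
    using subspace_projection[OF sV] by blast
  define C where "C = {x \<in> U. g x = 0}"
  have sC: "subspace C" unfolding C_def real_vector.subspace_def
    using U by (auto simp: linear_0[OF g(1)] linear_add[OF g(1)] linear_cmul[OF g(1)] real_vector.subspace_0
        real_vector.subspace_add real_vector.subspace_scale)
  define V' where "V' = ssum W C"
  have sV': "subspace V'" unfolding V'_def using W sC by (simp add: subspace_ssum)
  have WV': "W \<subseteq> V'" and CV': "C \<subseteq> V'" unfolding V'_def using W sC by (simp_all add: ssum_upper1 ssum_upper2)
  have V'U: "V' \<subseteq> U" unfolding V'_def using W U by (intro ssum_least) (auto simp: C_def)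
  have "submodule \<sigma> V'"
    unfolding submodule_def using sV' WV' V'U t by blast
  moreover have "ssum V V' = U"
  proof
    show "ssum V V' \<subseteq> U" using U V V'U by (intro ssum_least)
    show "U \<subseteq> ssum V V'"
    proof
      fix x assume x: "x \<in> U"
      have "g (x - g x) = 0" using g by (simp add: linear_diff[OF g(1)])
      then have "x - g x \<in> C" using x U V g unfolding C_def by (auto intro!: real_vector.subspace_diff)
      then have "g x + (x - g x) \<in> ssum V V'" using CV' g(2) by (intro ssumI) auto
      then show "x \<in> ssum V V'" by simp
    qed
  qed
  moreover have "V \<inter> V' = W"
  proof
    show "W \<subseteq> V \<inter> V'" using V WV' by blast
    have "V \<inter> V' \<subseteq> ssum W (V \<inter> C)" unfolding V'_def by (rule submodule_modular_law[OF W(1) sV V(2)])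
    also have "\<dots> \<subseteq> W" using W g(3) by (intro ssum_least) (auto simp: C_def real_vector.subspace_0)
    finally show "V \<inter> V' \<subseteq> W" .
  qed
  ultimately show "\<exists>V'. submodule \<sigma> V' \<and> W \<subseteq> V' \<and> V' \<subseteq> U \<and> ssum V V' = U \<and> V \<inter> V' = W"
    using WV' V'U by blast
qed

text \<open>This lemma and the next one transport semi-simplicity along the isomorphism
  \<open>U / (U \<inter> V) \<cong> (U + V) / V\<close>.\<close>

lemma semisimple_quotient_second_iso:
  assumes "submodule \<sigma> U" "submodule \<sigma> V" "semisimple_quotient \<sigma> U (U \<inter> V)"
  shows "semisimple_quotient \<sigma> (ssum U V) V"
  unfolding semisimple_quotient_iff
proof (intro allI impI, elim conjE)
  fix X assume X: "submodule \<sigma> X" "V \<subseteq> X" "X \<subseteq> ssum U V"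
  note sub = X(1)[THEN submodule_subspace] assms(1)[THEN submodule_subspace] assms(2)[THEN submodule_subspace]
  obtain Y where Y: "submodule \<sigma> Y" "U \<inter> V \<subseteq> Y" "Y \<subseteq> U" "ssum (X \<inter> U) Y = U" "X \<inter> U \<inter> Y = U \<inter> V"
    by (rule semisimple_quotientE[OF assms(3) submodule_Int[OF X(1) assms(1)]]) (use X in auto)
  note sY = Y(1)[THEN submodule_subspace]
  define Y' where "Y' = ssum Y V"
  have "submodule \<sigma> Y'" "V \<subseteq> Y'" "Y' \<subseteq> ssum U V"
    unfolding Y'_def
    by (rule submodule_ssum[OF Y(1) assms(2)], rule ssum_upper2[OF sY], rule ssum_mono[OF Y(3) subset_refl])
  moreover have "ssum X Y' = ssum U V"
  proof
    show "ssum X Y' \<subseteq> ssum U V" using X calculation sub by (intro ssum_least subspace_ssum)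
    have s: "subspace (ssum X Y')" using sub calculation submodule_subspace by (blast intro: subspace_ssum)
    have "ssum (X \<inter> U) Y \<subseteq> ssum X Y'"
      unfolding Y'_def using ssum_upper1[OF sub(3), of Y] by (intro ssum_mono) auto
    then show "ssum U V \<subseteq> ssum X Y'"
      using s Y(4) ssum_upper1[OF submodule_subspace[OF calculation(1)], of X] X(2)
      by (intro ssum_least) blast+
  qed
  moreover have "X \<inter> Y' = V"
  proof
    show "V \<subseteq> X \<inter> Y'" using X calculation by blast
    show "X \<inter> Y' \<subseteq> V"
    proof
      fix x assume x: "x \<in> X \<inter> Y'"
      then obtain y v where yv: "y \<in> Y" "v \<in> V" "x = y + v" unfolding Y'_def by (auto elim: ssumE)
      have "x - v \<in> X" using x yv(2) X sub by (intro real_vector.subspace_diff) auto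
      then have "y \<in> X" using yv by simp
      then have "y \<in> V" using Y yv by blast
      then show "x \<in> V" unfolding yv(3) using yv(2) sub by (intro real_vector.subspace_add) auto
    qed
  qed
  ultimately show "\<exists>V'. submodule \<sigma> V' \<and> V \<subseteq> V' \<and> V' \<subseteq> ssum U V \<and> ssum X V' = ssum U V \<and> X \<inter> V' = V"
    by blast
qed

lemma semisimple_quotient_second_iso':
  assumes "submodule \<sigma> U" "submodule \<sigma> V" "semisimple_quotient \<sigma> (ssum U V) V"
  shows "semisimple_quotient \<sigma> U (U \<inter> V)"
  unfolding semisimple_quotient_iff
proof (intro allI impI, elim conjE)
  fix X assume X: "submodule \<sigma> X" "U \<inter> V \<subseteq> X" "X \<subseteq> U"
  note sub = X(1)[THEN submodule_subspace] assms(1)[THEN submodule_subspace] assms(2)[THEN submodule_subspace]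
  have "ssum X V \<subseteq> ssum U V" using X by (intro ssum_mono) auto
  then obtain Y where Y: "submodule \<sigma> Y" "V \<subseteq> Y" "Y \<subseteq> ssum U V" "ssum (ssum X V) Y = ssum U V" "ssum X V \<inter> Y = V"
    by (rule semisimple_quotientE[OF assms(3) submodule_ssum[OF X(1) assms(2)] ssum_upper2[OF sub(1)]])
  note sY = Y(1)[THEN submodule_subspace]
  have "ssum X (U \<inter> Y) = U"
  proof
    show "ssum X (U \<inter> Y) \<subseteq> U" using X sub by (intro ssum_least) auto
    have "ssum (ssum X V) Y \<subseteq> ssum X Y"
      using sub sY Y(2) ssum_upper1[OF sY, of X] ssum_upper2[of X Y] by (intro ssum_least subspace_ssum) auto
    then have "U \<subseteq> ssum X Y" using Y(4) ssum_upper1[OF sub(3), of U] by blast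
    then show "U \<subseteq> ssum X (U \<inter> Y)" using submodule_modular_law[OF sub(1,2) X(3), of Y] by blast
  qed
  moreover have "X \<inter> (U \<inter> Y) = U \<inter> V"
    using X(2,3) Y(2,5) ssum_upper1[OF sub(3), of X] by blast
  ultimately show "\<exists>V'. submodule \<sigma> V' \<and> U \<inter> V \<subseteq> V' \<and> V' \<subseteq> U \<and> ssum X V' = U \<and> X \<inter> V' = U \<inter> V"
    using Y assms by (intro exI[of _ "U \<inter> Y"]) (auto intro: submodule_Int)
qed

lemma exists_simple_submodule:
  assumes fd: "fin_dim TYPE('v)" and U: "submodule \<sigma> U" "U \<noteq> {0}"
  shows "\<exists>S. submodule \<sigma> S \<and> S \<subseteq> U \<and> S \<noteq> {0} \<and> (\<forall>V. submodule \<sigma> V \<and> V \<subseteq> S \<longrightarrow> V = {0} \<or> V = S)"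
proof -
  let ?P = "\<lambda>V. submodule \<sigma> V \<and> V \<subseteq> U \<and> V \<noteq> {0}"
  have "\<exists>S. ?P S \<and> (\<forall>V. ?P V \<longrightarrow> V \<subseteq> S \<longrightarrow> V = S)"
    by (rule fin_dim_minimal[OF fd, of _ U]) (use U submodule_subspace in auto)
  then obtain S where S: "?P S" "\<And>V. ?P V \<Longrightarrow> V \<subseteq> S \<Longrightarrow> V = S" by auto
  have "V = {0} \<or> V = S" if "submodule \<sigma> V" "V \<subseteq> S" for V
    using S(1) S(2)[of V] that by auto
  then show ?thesis using S(1) by blast
qed

lemma exists_maximal_submodule:
  assumes fd: "fin_dim TYPE('v)" and U: "submodule \<sigma> U" "U \<noteq> {0}"
  shows "\<exists>S. submodule \<sigma> S \<and> S \<subseteq> U \<and> S \<noteq> U \<and> semisimple_quotient \<sigma> U S"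
proof -
  let ?P = "\<lambda>V. submodule \<sigma> V \<and> V \<subseteq> U \<and> V \<noteq> U"
  have "\<exists>S. ?P S \<and> (\<forall>V. ?P V \<longrightarrow> S \<subseteq> V \<longrightarrow> V = S)"
    by (rule fin_dim_maximal[OF fd, of _ "{0}"])
      (use U submodule_0 real_vector.subspace_0[OF submodule_subspace[OF U(1)]] in \<open>auto dest: submodule_subspace\<close>)
  then obtain S where S: "?P S" "\<And>V. ?P V \<Longrightarrow> S \<subseteq> V \<Longrightarrow> V = S" by auto
  have "semisimple_quotient \<sigma> U S"
    unfolding semisimple_quotient_iff
  proof (intro allI impI, elim conjE)
    fix V assume V: "submodule \<sigma> V" "S \<subseteq> V" "V \<subseteq> U"
    then have "V = S \<or> V = U" using S(1) S(2)[of V] by auto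
    then consider "V = S" | "V = U" by auto
    then show "\<exists>V'. submodule \<sigma> V' \<and> S \<subseteq> V' \<and> V' \<subseteq> U \<and> ssum V V' = U \<and> V \<inter> V' = S"
    proof cases
      case 1
      have "ssum S U = U"
        using ssum_upper2[of S U] ssum_least[of U S U] S(1) U submodule_subspace by blast
      then show ?thesis using 1 U S by (intro exI[of _ U]) auto
    next
      case 2
      have "ssum U S = U"
        using ssum_upper1[of S U] ssum_least[of U U S] S(1) U submodule_subspace by blast
      then show ?thesis using 2 U S by (intro exI[of _ S]) auto
    qed
  qed
  then show ?thesis using S by blast
qed

lemma exists_greatest_semisimple:
  assumes fd: "fin_dim TYPE('v)" and W: "submodule \<sigma> W"
  shows "\<exists>J. (submodule \<sigma> J \<and> W \<subseteq> J \<and> semisimple_quotient \<sigma> J W) \<and>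
    (\<forall>V. submodule \<sigma> V \<and> W \<subseteq> V \<and> semisimple_quotient \<sigma> V W \<longrightarrow> V \<subseteq> J)"
proof (rule fin_dim_greatest[OF fd])
  show "submodule \<sigma> W \<and> W \<subseteq> W \<and> semisimple_quotient \<sigma> W W"
    using W semisimple_quotient_refl by blast
  show "submodule \<sigma> (ssum U V) \<and> W \<subseteq> ssum U V \<and> semisimple_quotient \<sigma> (ssum U V) W"
    if "submodule \<sigma> U \<and> W \<subseteq> U \<and> semisimple_quotient \<sigma> U W" "submodule \<sigma> V \<and> W \<subseteq> V \<and> semisimple_quotient \<sigma> V W"
    for U V
  proof (intro conjI)
    show "submodule \<sigma> (ssum U V)" using that by (intro submodule_ssum) auto
    show "W \<subseteq> ssum U V" using that ssum_upper1[OF submodule_subspace, of \<sigma> V U] by auto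
    show "semisimple_quotient \<sigma> (ssum U V) W" using that W by (intro semisimple_quotient_sum) auto
  qed
qed (auto dest: submodule_subspace)

lemma exists_least_semisimple:
  assumes fd: "fin_dim TYPE('v)" and U: "submodule \<sigma> U"
  shows "\<exists>J. (submodule \<sigma> J \<and> J \<subseteq> U \<and> semisimple_quotient \<sigma> U J) \<and>
    (\<forall>V. submodule \<sigma> V \<and> V \<subseteq> U \<and> semisimple_quotient \<sigma> U V \<longrightarrow> J \<subseteq> V)"
proof (rule fin_dim_least[OF fd])
  show "submodule \<sigma> U \<and> U \<subseteq> U \<and> semisimple_quotient \<sigma> U U"
    using U semisimple_quotient_refl by blast
  show "submodule \<sigma> (V \<inter> W) \<and> V \<inter> W \<subseteq> U \<and> semisimple_quotient \<sigma> U (V \<inter> W)"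
    if "submodule \<sigma> V \<and> V \<subseteq> U \<and> semisimple_quotient \<sigma> U V" "submodule \<sigma> W \<and> W \<subseteq> U \<and> semisimple_quotient \<sigma> U W"
    for V W
  proof (intro conjI)
    show "submodule \<sigma> (V \<inter> W)" using that by (intro submodule_Int) auto
    show "V \<inter> W \<subseteq> U" using that by auto
    show "semisimple_quotient \<sigma> U (V \<inter> W)" using that U by (intro semisimple_quotient_inter) auto
  qed
qed (auto dest: submodule_subspace)

end

section \<open>Traces and matrices of operators\<close>

definition coord :: "'v::real_vector set \<Rightarrow> 'v \<Rightarrow> 'v \<Rightarrow> real" where
  "coord B = Real_Vector_Spaces.representation B"

lemma coord_add: "independent B \<Longrightarrow> x \<in> span B \<Longrightarrow> y \<in> span B \<Longrightarrow> coord B (x + y) b = coord B x b + coord B y b"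
  by (simp add: coord_def real_vector.representation_add)

lemma coord_scale: "independent B \<Longrightarrow> x \<in> span B \<Longrightarrow> coord B (r *\<^sub>R x) b = r * coord B x b"
  by (simp add: coord_def real_vector.representation_scale)

lemma coord_sum: "independent B \<Longrightarrow> (\<And>i. i \<in> I \<Longrightarrow> f i \<in> span B) \<Longrightarrow>
    coord B (\<Sum>i\<in>I. f i) b = (\<Sum>i\<in>I. coord B (f i) b)"
  by (simp add: coord_def real_vector.representation_sum)

lemma coord_expand: "independent B \<Longrightarrow> finite B \<Longrightarrow> x \<in> span B \<Longrightarrow> (\<Sum>b\<in>B. coord B x b *\<^sub>R b) = x"
  by (simp add: coord_def real_vector.sum_representation_eq)

text \<open>The trace of the restriction of \<open>f\<close> to the subspace \<open>span B\<close>. Traces are needed on submodules, which are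
  not types of their own.\<close>

definition trace_on :: "'v::real_vector set \<Rightarrow> ('v \<Rightarrow> 'v) \<Rightarrow> real" where
  "trace_on B f = (\<Sum>b\<in>B. coord B (f b) b)"

lemma coord_comp:
  assumes B: "independent B" "finite B" and g: "g b \<in> span B" and f: "linear f" "\<And>x. x \<in> span B \<Longrightarrow> f x \<in> span B"
  shows "coord B (f (g b)) c = (\<Sum>d\<in>B. coord B (g b) d * coord B (f d) c)"
proof -
  have fd: "f d \<in> span B" if "d \<in> B" for d using f(2) that real_vector.span_base by blast
  have "f (g b) = f (\<Sum>d\<in>B. coord B (g b) d *\<^sub>R d)" using coord_expand[OF B g] by simp
  also have "\<dots> = (\<Sum>d\<in>B. coord B (g b) d *\<^sub>R f d)" by (simp add: linear_sum[OF f(1)] linear_cmul[OF f(1)])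
  finally have "coord B (f (g b)) c = coord B (\<Sum>d\<in>B. coord B (g b) d *\<^sub>R f d) c" by simp
  also have "\<dots> = (\<Sum>d\<in>B. coord B (coord B (g b) d *\<^sub>R f d) c)"
    by (rule coord_sum[OF B(1)]) (simp add: fd real_vector.span_scale)
  also have "\<dots> = (\<Sum>d\<in>B. coord B (g b) d * coord B (f d) c)"
    by (intro sum.cong refl coord_scale[OF B(1)] fd)
  finally show ?thesis .
qed

lemma trace_on_commute:
  assumes B: "independent B" "finite B" and f: "linear f" "\<And>x. x \<in> span B \<Longrightarrow> f x \<in> span B"
    and g: "linear g" "\<And>x. x \<in> span B \<Longrightarrow> g x \<in> span B"
  shows "trace_on B (\<lambda>x. f (g x)) = trace_on B (\<lambda>x. g (f x))"
proof -
  have s: "b \<in> B \<Longrightarrow> b \<in> span B" for b by (rule real_vector.span_base)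
  have "trace_on B (\<lambda>x. f (g x)) = (\<Sum>b\<in>B. \<Sum>d\<in>B. coord B (g b) d * coord B (f d) b)"
    unfolding trace_on_def
    by (intro sum.cong refl) (rule coord_comp[where f = f and g = g, OF B g(2)[OF s] f])
  also have "\<dots> = (\<Sum>d\<in>B. \<Sum>b\<in>B. coord B (f d) b * coord B (g b) d)"
    by (subst sum.swap) (simp add: mult.commute)
  also have "\<dots> = trace_on B (\<lambda>x. g (f x))"
    unfolding trace_on_def
    by (intro sum.cong refl) (rule coord_comp[where f = g and g = f, OF B f(2)[OF s] g, symmetric])
  finally show ?thesis .
qed

lemma trace_on_add:
  assumes B: "independent B" and "\<And>x. x \<in> span B \<Longrightarrow> f x \<in> span B" "\<And>x. x \<in> span B \<Longrightarrow> g x \<in> span B"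
  shows "trace_on B (\<lambda>x. f x + g x) = trace_on B f + trace_on B g"
proof -
  have "coord B (f b + g b) b = coord B (f b) b + coord B (g b) b" if "b \<in> B" for b
    by (intro coord_add B assms(2,3) real_vector.span_base that)
  then show ?thesis unfolding trace_on_def by (simp add: sum.distrib)
qed

lemma trace_on_scale:
  assumes B: "independent B" and "\<And>x. x \<in> span B \<Longrightarrow> f x \<in> span B"
  shows "trace_on B (\<lambda>x. r *\<^sub>R f x) = r * trace_on B f"
proof -
  have "coord B (r *\<^sub>R f b) b = r * coord B (f b) b" if "b \<in> B" for b
    by (intro coord_scale B assms(2) real_vector.span_base that)
  then show ?thesis unfolding trace_on_def by (simp add: sum_distrib_left)
qed

lemma trace_on_diff:
  assumes B: "independent B" and f: "\<And>x. x \<in> span B \<Longrightarrow> f x \<in> span B" and g: "\<And>x. x \<in> span B \<Longrightarrow> g x \<in> span B"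
  shows "trace_on B (\<lambda>x. f x - g x) = trace_on B f - trace_on B g"
proof -
  have "trace_on B (\<lambda>x. f x + (-1) *\<^sub>R g x) = trace_on B f + trace_on B (\<lambda>x. (-1) *\<^sub>R g x)"
    by (rule trace_on_add[OF B f]) (auto intro: real_vector.span_neg[OF g])
  also have "trace_on B (\<lambda>x. (-1) *\<^sub>R g x) = (-1) * trace_on B g"
    by (rule trace_on_scale[OF B g])
  finally show ?thesis by simp
qed

lemma trace_on_cong: "(\<And>x. x \<in> B \<Longrightarrow> f x = g x) \<Longrightarrow> trace_on B f = trace_on B g"
  by (simp add: trace_on_def)

text \<open>Complex entries, because the nilpotency of an operator will be read off a Jordan normal form.\<close>

definition op_mat :: "'v::real_vector list \<Rightarrow> ('v \<Rightarrow> 'v) \<Rightarrow> complex mat" where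
  "op_mat vs f = Matrix.mat (length vs) (length vs) (\<lambda>(p, q). of_real (coord (set vs) (f (vs ! q)) (vs ! p)))"

lemma linear_funpow: "linear (f :: 'v::real_vector \<Rightarrow> 'v) \<Longrightarrow> linear (f ^^ k)"
  by (induction k) (auto simp: real_vector.linear_id intro: linear_compose)

context
  fixes vs :: "'v::real_vector list"
  assumes d: "distinct vs" and ind: "independent (set vs)"
begin

lemma op_mat_carrier: "op_mat vs f \<in> carrier_mat (length vs) (length vs)"
  by (simp add: op_mat_def)

lemma sum_vs: "(\<Sum>b\<in>set vs. h b) = (\<Sum>i<length vs. h (vs ! i))"
proof -
  have "bij_betw ((!) vs) {..<length vs} (set vs)" by (rule bij_betw_nth[OF d]) simp_all
  from sum.reindex_bij_betw[OF this, of h] show ?thesis by simp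
qed

lemma op_mat_comp:
  assumes f: "linear f" "\<And>x. x \<in> span (set vs) \<Longrightarrow> f x \<in> span (set vs)"
    and g: "\<And>x. x \<in> span (set vs) \<Longrightarrow> g x \<in> span (set vs)"
  shows "op_mat vs (\<lambda>x. f (g x)) = op_mat vs f * op_mat vs g"
proof (rule eq_matI)
  fix p q assume pq: "p < dim_row (op_mat vs f * op_mat vs g)" "q < dim_col (op_mat vs f * op_mat vs g)"
  then have p: "p < length vs" "q < length vs" by (auto simp: op_mat_def)
  have "g (vs ! q) \<in> span (set vs)" using g p(2) by (simp add: real_vector.span_base)
  from coord_comp[where f = f and g = g, OF ind _ this f]
  have "coord (set vs) (f (g (vs ! q))) (vs ! p)
      = (\<Sum>i<length vs. coord (set vs) (g (vs ! q)) (vs ! i) * coord (set vs) (f (vs ! i)) (vs ! p))"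
    by (simp add: sum_vs)
  then show "op_mat vs (\<lambda>x. f (g x)) $$ (p, q) = (op_mat vs f * op_mat vs g) $$ (p, q)"
    using p by (simp add: op_mat_def scalar_prod_def lessThan_atLeast0 mult.commute)
qed (simp_all add: op_mat_def)

lemma op_mat_diff:
  assumes "\<And>x. x \<in> span (set vs) \<Longrightarrow> f x \<in> span (set vs)" "\<And>x. x \<in> span (set vs) \<Longrightarrow> g x \<in> span (set vs)"
  shows "op_mat vs (\<lambda>x. f x - g x) = op_mat vs f - op_mat vs g"
proof -
  have "coord (set vs) (f b - g b) c = coord (set vs) (f b) c - coord (set vs) (g b) c" if "b \<in> set vs" for b c
    using real_vector.representation_diff[OF ind assms(2) assms(1), of b b] that
    by (simp add: coord_def real_vector.span_base)
  then show ?thesis by (intro eq_matI) (auto simp: op_mat_def)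
qed

lemma mat_trace_op_mat: "mat_trace (length vs) (op_mat vs f) = of_real (trace_on (set vs) f)"
  by (simp add: mat_trace_def op_mat_def trace_on_def sum_vs)

lemma op_mat_id: "op_mat vs (\<lambda>x. x) = 1\<^sub>m (length vs)"
  using d by (intro eq_matI) (auto simp: op_mat_def coord_def real_vector.representation_basis[OF ind] nth_eq_iff_index_eq)

lemma op_mat_pow:
  assumes f: "linear f" "\<And>x. x \<in> span (set vs) \<Longrightarrow> f x \<in> span (set vs)"
  shows "(\<forall>x\<in>span (set vs). (f ^^ k) x \<in> span (set vs)) \<and> op_mat vs (f ^^ k) = op_mat vs f ^\<^sub>m k"
proof (induction k)
  case 0
  then show ?case by (simp add: id_def op_mat_id) (simp add: op_mat_def)
next
  case (Suc k)
  have "op_mat vs (\<lambda>x. (f ^^ k) (f x)) = op_mat vs (f ^^ k) * op_mat vs f"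
    by (rule op_mat_comp) (use Suc f linear_funpow[OF f(1)] in auto)
  then show ?case using Suc f(2) by (auto simp: funpow_swap1 o_def)
qed

lemma op_mat_zeroD:
  assumes f: "linear f" "\<And>x. x \<in> span (set vs) \<Longrightarrow> f x \<in> span (set vs)"
    and z: "op_mat vs f = 0\<^sub>m (length vs) (length vs)" and x: "x \<in> span (set vs)"
  shows "f x = 0"
proof (rule linear_eq_0_on_span[OF f(1) _ x])
  fix b assume b: "b \<in> set vs"
  then obtain q where q: "q < length vs" "vs ! q = b" by (auto simp: in_set_conv_nth)
  have fb: "f b \<in> span (set vs)" using f(2) b real_vector.span_base by blast
  have "coord (set vs) (f b) c = 0" if c: "c \<in> set vs" for c
  proof -
    obtain p where p: "p < length vs" "vs ! p = c" using c by (auto simp: in_set_conv_nth)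
    have "op_mat vs f $$ (p, q) = 0" using z p q by simp
    then show ?thesis using p q by (simp add: op_mat_def)
  qed
  then show "f b = 0" using coord_expand[OF ind _ fb] by simp
qed

end

section \<open>Sums of commutators in a representation\<close>

lemma alternating_bilinear_antisym:
  assumes h: "bilinear (h :: 'l::real_vector \<Rightarrow> 'l \<Rightarrow> 'w::real_vector)" "\<And>x. h x x = 0" shows "h x y = - h y x"
proof -
  have "h (x + y) (x + y) = 0" by (rule h(2))
  then have "h x y + h y x = 0"
    by (simp add: bilinear_ladd[OF h(1)] bilinear_radd[OF h(1)] h(2)[of x] h(2)[of y] add.commute)
  then show ?thesis by (rule eq_neg_iff_add_eq_0[THEN iffD2])
qed

lemma adjoint_representation:
  assumes la: "lie_algebra br" shows "Defs.representation br br"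
  unfolding Defs.representation_def
proof (intro conjI allI)
  show bil: "bilinear br" using la by (simp add: lie_algebra_def)
  fix x y z
  have j: "br x (br y z) + br y (br z x) + br z (br x y) = 0" and s: "\<And>x. br x x = 0"
    using la by (auto simp: lie_algebra_def)
  show "br (br x y) z = br x (br y z) - br y (br x z)"
    using j alternating_bilinear_antisym[of br z x, OF bil s] alternating_bilinear_antisym[of br z "br x y", OF bil s]
    by (simp add: bilinear_rneg[OF bil] algebra_simps)
qed

locale lie_rep =
  fixes br :: "'l::real_vector \<Rightarrow> 'l \<Rightarrow> 'l" and \<sigma> :: "'l \<Rightarrow> 'v::real_vector \<Rightarrow> 'v"
  assumes la: "lie_algebra br" and rep: "Defs.representation br \<sigma>" and fdv: "fin_dim TYPE('v)"
begin

lemma fdl: "fin_dim TYPE('l)" and bil_br: "bilinear br" and br_self: "br x x = 0"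
  and jacobi: "br x (br y z) + br y (br z x) + br z (br x y) = 0"
  using la by (auto simp: lie_algebra_def)

lemma bil_\<sigma>: "bilinear \<sigma>" and \<sigma>_br: "\<sigma> (br L L') A = \<sigma> L (\<sigma> L' A) - \<sigma> L' (\<sigma> L A)"
  using rep by (auto simp: Defs.representation_def)

sublocale module_action \<sigma>
  by (rule module_action.intro) (use bil_\<sigma> in \<open>auto simp: bilinear_def\<close>)

sublocale ad: module_action br
  by (rule module_action.intro) (use bil_br in \<open>auto simp: bilinear_def\<close>)

lemmas \<sigma>_simps = bilinear_ladd[OF bil_\<sigma>] bilinear_radd[OF bil_\<sigma>] bilinear_lsub[OF bil_\<sigma>] bilinear_rsub[OF bil_\<sigma>]
  bilinear_lmul[OF bil_\<sigma>] bilinear_rmul[OF bil_\<sigma>] bilinear_lzero[OF bil_\<sigma>] bilinear_rzero[OF bil_\<sigma>]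
  bilinear_lneg[OF bil_\<sigma>] bilinear_rneg[OF bil_\<sigma>]

lemmas br_simps = bilinear_ladd[OF bil_br] bilinear_radd[OF bil_br] bilinear_lsub[OF bil_br] bilinear_rsub[OF bil_br]
  bilinear_lmul[OF bil_br] bilinear_rmul[OF bil_br] bilinear_lzero[OF bil_br] bilinear_rzero[OF bil_br]
  bilinear_lneg[OF bil_br] bilinear_rneg[OF bil_br]

lemma br_anti: "br x y = - br y x"
  by (rule alternating_bilinear_antisym[OF bil_br br_self])

lemma linear_\<sigma>: "linear (\<sigma> x)" by (rule lin)

text \<open>Since \<open>\<sigma>\<close> is a representation, \<open>(br x ^^ k) c\<close> acts by the iterated commutator that the corresponding
  statement on matrices requires.\<close>

lemma commutator_sum_nilpotent:
  assumes B: "finite B" "independent B" "submodule \<sigma> (span B)"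
    and x: "\<And>u. u \<in> span B \<Longrightarrow> \<sigma> x u = (\<Sum>(a, c)\<leftarrow>ps. \<sigma> (br a c) u)"
    and tr: "\<And>a c k. (a, c) \<in> set ps \<Longrightarrow> k \<ge> 1 \<Longrightarrow> trace_on B (\<lambda>u. \<sigma> a (\<sigma> ((br x ^^ k) c) u)) = 0"
  shows "\<exists>n. \<forall>u\<in>span B. (\<sigma> x ^^ n) u = 0"
proof -
  obtain vs where vs: "set vs = B" "distinct vs" using finite_distinct_list[OF B(1)] by blast
  define n where "n = length vs"
  note V = vs(2) B(2)[folded vs(1)]
  define M where "M y = op_mat vs (\<sigma> y)" for y
  have invM: "\<sigma> y u \<in> span (set vs)" if "u \<in> span (set vs)" for y u
    using B(3) that unfolding vs(1) by (simp add: submodule_def)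
  have Mc: "M y \<in> carrier_mat n n" for y unfolding M_def n_def by (rule op_mat_carrier[OF V])
  have Mprod: "op_mat vs (\<lambda>u. \<sigma> a (\<sigma> c u)) = M a * M c" for a c
    unfolding M_def by (rule op_mat_comp[OF V linear_\<sigma> invM invM])
  have Mbr: "M (br a c) = M a * M c - M c * M a" for a c
  proof -
    have "M (br a c) = op_mat vs (\<lambda>u. \<sigma> a (\<sigma> c u) - \<sigma> c (\<sigma> a u))"
      unfolding M_def by (simp add: \<sigma>_br[abs_def])
    also have "\<dots> = op_mat vs (\<lambda>u. \<sigma> a (\<sigma> c u)) - op_mat vs (\<lambda>u. \<sigma> c (\<sigma> a u))"
      by (rule op_mat_diff[OF V]) (auto intro: invM)
    finally show ?thesis by (simp add: Mprod)
  qed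
  have comm: "(mat_commutator (M x) ^^ k) (M c) = M ((br x ^^ k) c)" for k c
    by (induction k) (auto simp: mat_commutator_def Mbr)
  define qs where "qs = map (\<lambda>(a, c). (M a, M c)) ps"
  have "M x ^\<^sub>m n = 0\<^sub>m n n"
  proof (rule commutator_sum_nilpotent_mat[where ps = qs])
    show "M x \<in> carrier_mat n n" by (rule Mc)
    show "A \<in> carrier_mat n n \<and> C \<in> carrier_mat n n" if "(A, C) \<in> set qs" for A C
      using that Mc by (auto simp: qs_def)
    show "M x $$ (p, q) = (\<Sum>(A, C)\<leftarrow>qs. (A * C - C * A) $$ (p, q))" if pq: "p < n" "q < n" for p q
    proof -
      have q: "vs ! q \<in> span (set vs)" using pq n_def by (simp add: real_vector.span_base)
      have lst: "coord (set vs) (\<Sum>(a, c)\<leftarrow>rs. \<sigma> (br a c) (vs ! q)) (vs ! p)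
          = (\<Sum>(a, c)\<leftarrow>rs. coord (set vs) (\<sigma> (br a c) (vs ! q)) (vs ! p)) \<and>
          (\<Sum>(a, c)\<leftarrow>rs. \<sigma> (br a c) (vs ! q)) \<in> span (set vs)" for rs
      proof (induction rs)
        case Nil
        show ?case by (simp add: coord_def real_vector.representation_zero real_vector.span_zero)
      next
        case (Cons r rs)
        obtain a c where r: "r = (a, c)" by force
        show ?case using Cons invM[OF q, of "br a c"]
          by (simp add: r coord_add[OF V(2)] real_vector.span_add)
      qed
      have "M x $$ (p, q) = of_real (coord (set vs) (\<sigma> x (vs ! q)) (vs ! p))"
        using pq by (simp add: M_def op_mat_def n_def)
      also have "\<sigma> x (vs ! q) = (\<Sum>(a, c)\<leftarrow>ps. \<sigma> (br a c) (vs ! q))"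
        using x q vs(1) by simp
      also have "coord (set vs) \<dots> (vs ! p) = (\<Sum>(a, c)\<leftarrow>ps. coord (set vs) (\<sigma> (br a c) (vs ! q)) (vs ! p))"
        using lst by blast
      also have "complex_of_real \<dots> = (\<Sum>(a, c)\<leftarrow>ps. M (br a c) $$ (p, q))"
        using pq by (induction ps) (auto simp: M_def op_mat_def n_def)
      also have "\<dots> = (\<Sum>(A, C)\<leftarrow>qs. (A * C - C * A) $$ (p, q))"
        by (simp add: qs_def o_def case_prod_unfold Mbr)
      finally show ?thesis .
    qed
    show "mat_trace n (A * (mat_commutator (M x) ^^ k) C) = 0" if AC: "(A, C) \<in> set qs" and k: "k \<ge> 1" for A C and k :: nat
    proof -
      obtain a c where ac: "(a, c) \<in> set ps" "A = M a" "C = M c" using AC by (auto simp: qs_def)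
      have "mat_trace n (A * (mat_commutator (M x) ^^ k) C) = mat_trace n (op_mat vs (\<lambda>u. \<sigma> a (\<sigma> ((br x ^^ k) c) u)))"
        by (simp add: ac comm Mprod)
      also have "\<dots> = 0" using tr[OF ac(1) k] by (simp add: n_def mat_trace_op_mat[OF V] vs(1))
      finally show ?thesis .
    qed
  qed
  then have z: "op_mat vs (\<sigma> x ^^ n) = 0\<^sub>m n n"
    using op_mat_pow[OF V, where f = "\<sigma> x" and k = n, OF linear_\<sigma> invM] by (simp add: M_def)
  have "(\<sigma> x ^^ n) u = 0" if "u \<in> span B" for u
  proof (rule op_mat_zeroD[OF V, where f = "\<sigma> x ^^ n"])
    show "linear (\<sigma> x ^^ n)" by (rule linear_funpow[OF linear_\<sigma>])
    show "(\<sigma> x ^^ n) w \<in> span (set vs)" if "w \<in> span (set vs)" for w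
      using op_mat_pow[OF V, where f = "\<sigma> x" and k = n, OF linear_\<sigma> invM] that by blast
  qed (use z that vs n_def in auto)
  then show ?thesis by blast
qed

section \<open>Engel's theorem\<close>

text \<open>The subspace \<open>M\<^sup>j S\<close> spanned by all \<open>j\<close>-fold products of operators from \<open>M\<close> applied to \<open>S\<close>. Engel's
  theorem is proved in the form that \<open>N\<^sup>k S = 0\<close> for some \<open>k\<close>.\<close>

primrec flag :: "'l set \<Rightarrow> 'v set \<Rightarrow> nat \<Rightarrow> 'v set" where
  "flag M S 0 = S"
| "flag M S (Suc j) = span {\<sigma> m u | m u. m \<in> M \<and> u \<in> flag M S j}"

lemma subspace_flag: "subspace S \<Longrightarrow> subspace (flag M S j)"
  by (cases j) (simp_all add: real_vector.subspace_span)

lemma flag_step: "m \<in> M \<Longrightarrow> u \<in> flag M S j \<Longrightarrow> \<sigma> m u \<in> flag M S (Suc j)"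
  by (auto intro: real_vector.span_base)

lemma flag_Suc_subset:
  assumes S: "submodule \<sigma> S" shows "flag M S (Suc j) \<subseteq> flag M S j"
proof (induction j)
  case 0
  have "{\<sigma> m u | m u. m \<in> M \<and> u \<in> S} \<subseteq> S" using S by (auto simp: submodule_def)
  then show ?case using real_vector.span_minimal submodule_subspace[OF S] by simp
next
  case (Suc j)
  have "{\<sigma> m u | m u. m \<in> M \<and> u \<in> flag M S (Suc j)} \<subseteq> {\<sigma> m u | m u. m \<in> M \<and> u \<in> flag M S j}"
    using Suc by blast
  then show ?case using real_vector.span_mono by (simp only: flag.simps(2)[of _ _ "Suc j"] flag.simps(2)[of _ _ j])
qed

lemma flag_antimono:
  assumes S: "submodule \<sigma> S" and "i \<le> j" shows "flag M S j \<subseteq> flag M S i"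
  using assms(2) by (induction j rule: dec_induct) (use flag_Suc_subset[OF S] in blast)+

text \<open>If \<open>x\<close> preserves the flag of \<open>M\<close>, then a product with factors in \<open>M\<close> and \<open>x\<close> descends a step of the
  flag whenever a factor from \<open>M\<close> occurs, and is zero when it contains \<open>n\<close> consecutive factors \<open>x\<close>.\<close>

lemma flag_extend:
  assumes S: "submodule \<sigma> S" and M: "subspace M"
    and x: "\<And>j u. u \<in> flag M S j \<Longrightarrow> \<sigma> x u \<in> flag M S j"
    and n: "\<And>u. u \<in> S \<Longrightarrow> (\<sigma> x ^^ n) u = 0"
  shows "flag (ssum M (range (\<lambda>c. c *\<^sub>R x))) S (j * n) \<subseteq> flag M S j"
proof (induction j)
  case 0 then show ?case by simp
next
  case (Suc j)
  let ?M' = "ssum M (range (\<lambda>c. c *\<^sub>R x))"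
  let ?U = "flag M S j" and ?V = "flag M S (Suc j)"
  have sf: "subspace (flag M S i)" for i using subspace_flag submodule_subspace[OF S] by blast
  have xi: "(\<sigma> x ^^ i) u \<in> ?U" if "u \<in> ?U" for u i using that x by (induction i) auto
  have "flag ?M' S (j * n + i) \<subseteq> ssum ((\<sigma> x ^^ i) ` ?U) ?V" for i
  proof (induction i)
    case 0
    then show ?case using Suc ssum_upper1[OF sf, of ?U "Suc j"] by (simp add: image_id id_def del: flag.simps(2))
  next
    case (Suc i)
    let ?T = "ssum ((\<sigma> x ^^ Suc i) ` ?U) ?V"
    have T: "subspace ?T"
      by (intro subspace_ssum sf linear_subspace_image linear_funpow linear_\<sigma>)
    have T1: "(\<sigma> x ^^ Suc i) u \<in> ?T" if "u \<in> ?U" for u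
      using ssum_upper1[OF sf, of "(\<sigma> x ^^ Suc i) ` ?U" "Suc j"] that by blast
    have T2: "w \<in> ?T" if "w \<in> ?V" for w
    proof -
      have "subspace ((\<sigma> x ^^ Suc i) ` ?U)" by (intro sf linear_subspace_image linear_funpow linear_\<sigma>)
      from ssum_upper2[OF this, of ?V] show ?thesis using that by blast
    qed
    have gen: "\<sigma> m v \<in> ?T" if m: "m \<in> ?M'" and v: "v \<in> flag ?M' S (j * n + i)" for m v
    proof -
      obtain a c where a: "a \<in> M" "m = a + c *\<^sub>R x" using m by (auto elim!: ssumE)
      obtain u w where u: "u \<in> ?U" "w \<in> ?V" "v = (\<sigma> x ^^ i) u + w"
        using subsetD[OF Suc v] by (auto elim!: ssumE simp del: flag.simps)
      have "\<sigma> m v = \<sigma> a ((\<sigma> x ^^ i) u) + \<sigma> a w + c *\<^sub>R (\<sigma> x ^^ Suc i) u + c *\<^sub>R \<sigma> x w"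
        by (simp add: a(2) u(3) \<sigma>_simps algebra_simps)
      moreover have "\<sigma> a ((\<sigma> x ^^ i) u) \<in> ?T" by (rule T2[OF flag_step[OF a(1) xi[OF u(1)]]])
      moreover have "\<sigma> a w \<in> ?T"
        using T2 flag_step[OF a(1) u(2)] flag_Suc_subset[OF S, of M "Suc j"] by blast
      moreover have "(\<sigma> x ^^ Suc i) u \<in> ?T" by (rule T1[OF u(1)])
      moreover have "\<sigma> x w \<in> ?T" by (rule T2[OF x[OF u(2)]])
      ultimately show ?thesis using T by (simp add: real_vector.subspace_add real_vector.subspace_scale)
    qed
    have "{\<sigma> m u | m u. m \<in> ?M' \<and> u \<in> flag ?M' S (j * n + i)} \<subseteq> ?T" using gen by blast
    from real_vector.span_minimal[OF this T] show ?case by simp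
  qed
  from this[of n] have "flag ?M' S (j * n + n) \<subseteq> ssum ((\<sigma> x ^^ n) ` ?U) ?V" .
  also have "\<dots> \<subseteq> ?V"
  proof (rule ssum_least[OF sf])
    have "?U \<subseteq> S" using flag_antimono[OF S, of 0 j M] by simp
    then have "(\<sigma> x ^^ n) ` ?U \<subseteq> {0}" using n by blast
    moreover have "{0} \<subseteq> ?V" using real_vector.subspace_0[OF sf, of "Suc j"] by (simp del: flag.simps)
    ultimately show "(\<sigma> x ^^ n) ` ?U \<subseteq> ?V" by (rule subset_trans)
  qed simp
  finally show ?case by (simp add: add.commute)
qed

text \<open>Let \<open>M\<close> be a maximal subspace of \<open>N\<close> with terminating flag. By maximality and \<open>flag_extend\<close>, no element
  of \<open>N\<close> outside \<open>M\<close> preserves this flag; in particular none normalises \<open>M\<close>. Starting outside \<open>M\<close>,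
  one can therefore take brackets with elements of \<open>M\<close> forever without entering \<open>M\<close>. But each such bracket
  moves the flag one step further, until it acts by zero, and then it does preserve the flag.\<close>

lemma engel:
  assumes S: "submodule \<sigma> S" and N: "subspace N" "\<And>x y. x \<in> N \<Longrightarrow> y \<in> N \<Longrightarrow> br x y \<in> N"
    and nil: "\<And>x. x \<in> N \<Longrightarrow> \<exists>n. \<forall>u\<in>S. (\<sigma> x ^^ n) u = 0"
  shows "\<exists>k. flag N S k \<subseteq> {0}"
proof -
  let ?P = "\<lambda>M. subspace M \<and> M \<subseteq> N \<and> (\<exists>k. flag M S k \<subseteq> {0})"
  have sf: "subspace (flag M S i)" for M i using subspace_flag submodule_subspace[OF S] by blast
  have "flag {0} S (Suc 0) \<subseteq> {0}"
    using real_vector.span_minimal[of "{\<sigma> m u | m u. m \<in> {0} \<and> u \<in> S}" "{0}"]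
    by (auto simp: \<sigma>_simps)
  then have P0: "?P {0}"
    using real_vector.subspace_0[OF N(1)] by (intro conjI exI[of _ "Suc 0"]) auto
  have "\<exists>M. ?P M \<and> (\<forall>V. ?P V \<longrightarrow> M \<subseteq> V \<longrightarrow> V = M)"
    by (rule fin_dim_maximal[where P = ?P, OF fdl P0]) simp
  then obtain M where MM: "?P M \<and> (\<forall>V. ?P V \<longrightarrow> M \<subseteq> V \<longrightarrow> V = M)" by (elim exE)
  have M: "?P M" by (rule conjunct1[OF MM])
  have max: "?P V \<Longrightarrow> M \<subseteq> V \<Longrightarrow> V = M" for V using conjunct2[OF MM] by simp
  have MN: "M \<subseteq> N" using M by simp
  from M obtain k where k: "flag M S k \<subseteq> {0}" by blast
  have no: False if x: "x \<in> N" "x \<notin> M" and pres: "\<And>j u. u \<in> flag M S j \<Longrightarrow> \<sigma> x u \<in> flag M S j" for x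
  proof -
    obtain n where n: "\<forall>u\<in>S. (\<sigma> x ^^ n) u = 0" using nil x by blast
    let ?R = "range (\<lambda>c. c *\<^sub>R x)"
    let ?M' = "ssum M ?R"
    have R: "subspace ?R" by (simp add: real_vector.span_singleton[symmetric] real_vector.subspace_span)
    have sM: "subspace M" using M by (rule conjunct1)
    have 1: "flag ?M' S (k * n) \<subseteq> {0}"
      by (rule subset_trans[OF flag_extend[OF S sM pres] k]) (use n in auto)
    have 2: "subspace ?M'" by (rule subspace_ssum[OF sM R])
    have 3: "?M' \<subseteq> N" using M x N(1) by (intro ssum_least) (auto intro: real_vector.subspace_scale)
    have "?M' = M" by (rule max[OF _ ssum_upper1[OF R]]) (intro conjI exI[of _ "k * n"] 1 2 3)
    moreover have "1 *\<^sub>R x \<in> ?M'" by (rule subsetD[OF ssum_upper2[OF sM]]) (rule rangeI)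
    ultimately show False using x by simp
  qed
  have "M = N"
  proof (rule ccontr)
    assume "M \<noteq> N"
    then obtain x0 where x0: "x0 \<in> N" "x0 \<notin> M" using MN by blast
    \<comment> \<open>an element that normalises \<open>M\<close> preserves the flag\<close>
    have norm: "\<exists>m\<in>M. br m x \<notin> M" if x: "x \<in> N" "x \<notin> M" for x
    proof (rule ccontr)
      assume "\<not> (\<exists>m\<in>M. br m x \<notin> M)"
      then have c: "br m x \<in> M" if "m \<in> M" for m using that by blast
      have "\<sigma> x u \<in> flag M S j" if "u \<in> flag M S j" for j u
        using that
      proof (induction j arbitrary: u)
        case 0
        then show ?case using S by (simp add: submodule_def)
      next
        case (Suc j)
        have "subspace {u. \<sigma> x u \<in> flag M S (Suc j)}"
          using sf[of M "Suc j"] unfolding real_vector.subspace_def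
          by (simp add: \<sigma>_simps del: flag.simps)
        note A = this
        have "{\<sigma> m u | m u. m \<in> M \<and> u \<in> flag M S j} \<subseteq> {u. \<sigma> x u \<in> flag M S (Suc j)}"
        proof
          fix v assume "v \<in> {\<sigma> m u | m u. m \<in> M \<and> u \<in> flag M S j}"
          then obtain m u where m: "m \<in> M" "u \<in> flag M S j" "v = \<sigma> m u" by blast
          have "\<sigma> x v = \<sigma> m (\<sigma> x u) - \<sigma> (br m x) u" by (simp add: m(3) \<sigma>_br)
          moreover have "\<sigma> m (\<sigma> x u) \<in> flag M S (Suc j)" by (rule flag_step[OF m(1) Suc.IH[OF m(2)]])
          moreover have "\<sigma> (br m x) u \<in> flag M S (Suc j)" by (rule flag_step[OF c[OF m(1)] m(2)])
          ultimately show "v \<in> {u. \<sigma> x u \<in> flag M S (Suc j)}"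
            using real_vector.subspace_diff[OF sf] by (simp del: flag.simps)
        qed
        from real_vector.span_minimal[OF this A]
        have "flag M S (Suc j) \<subseteq> {u. \<sigma> x u \<in> flag M S (Suc j)}"
          by (simp only: flag.simps(2))
        from subsetD[OF this Suc.prems] show ?case by (simp del: flag.simps)
      qed
      from no[OF x this] show False .
    qed
    \<comment> \<open>the truncated subtraction expresses that \<open>x0\<close> need not preserve the flag: at the start
      (\<open>r = 0\<close>) it is only known to map the first \<open>k\<close> steps to \<open>S\<close>, the later ones being zero\<close>
    have "\<exists>y. y \<in> N \<and> y \<notin> M \<and> (\<forall>j. \<forall>u\<in>flag M S j. \<sigma> y u \<in> flag M S (j + r + 1 - k))" for r
    proof (induction r)
      case 0
      have "\<sigma> x0 u \<in> flag M S (j + 0 + 1 - k)" if u: "u \<in> flag M S j" for j u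
      proof (cases "j < k")
        case True
        then have "j + 0 + 1 - k = 0" by simp
        moreover have "u \<in> S" using u flag_antimono[OF S, of 0 j M] by auto
        ultimately show ?thesis using S by (simp add: submodule_def)
      next
        case False
        then have "u = 0" using u flag_antimono[OF S, of k j M] k by auto
        then show ?thesis using real_vector.subspace_0[OF sf] by (simp add: \<sigma>_simps)
      qed
      then show ?case using x0 by blast
    next
      case (Suc r)
      then obtain y where y: "y \<in> N" "y \<notin> M" "\<And>j u. u \<in> flag M S j \<Longrightarrow> \<sigma> y u \<in> flag M S (j + r + 1 - k)"
        by blast
      obtain m where m: "m \<in> M" "br m y \<notin> M" using norm y by blast
      have "\<sigma> (br m y) u \<in> flag M S (j + Suc r + 1 - k)" if u: "u \<in> flag M S j" for j u
      proof -
        have "\<sigma> m (\<sigma> y u) \<in> flag M S (Suc (j + r + 1 - k))" by (rule flag_step[OF m(1) y(3)[OF u]])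
        then have 1: "\<sigma> m (\<sigma> y u) \<in> flag M S (j + Suc r + 1 - k)"
        proof (rule subsetD[OF flag_antimono[OF S], rotated])
          show "j + Suc r + 1 - k \<le> Suc (j + r + 1 - k)" by arith
        qed
        have 2: "\<sigma> y (\<sigma> m u) \<in> flag M S (j + Suc r + 1 - k)"
          using y(3)[OF flag_step[OF m(1) u]] by simp
        show ?thesis using real_vector.subspace_diff[OF sf 1 2] by (simp add: \<sigma>_br)
      qed
      moreover have "br m y \<in> N" by (rule N(2)[OF subsetD[OF MN m(1)] y(1)])
      ultimately show ?case using m by blast
    qed
    \<comment> \<open>any \<open>r\<close> with \<open>r + 1 - k \<ge> k\<close> would do\<close>
    from this[of "2 * k"] obtain y where y: "y \<in> N" "y \<notin> M"
      "\<And>j u. u \<in> flag M S j \<Longrightarrow> \<sigma> y u \<in> flag M S (j + 2 * k + 1 - k)" by blast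
    have y0: "\<sigma> y u = 0" if "u \<in> S" for u
    proof -
      have "\<sigma> y u \<in> flag M S (0 + 2 * k + 1 - k)" by (rule y(3)) (use that in simp)
      then show ?thesis using flag_antimono[OF S, of k "0 + 2 * k + 1 - k" M] k by auto
    qed
    have "\<sigma> y u \<in> flag M S j" if "u \<in> flag M S j" for j u
    proof -
      have "u \<in> S" using that flag_antimono[OF S, of 0 j M] by auto
      then show ?thesis using y0 real_vector.subspace_0[OF sf] by simp
    qed
    from no[OF y(1,2) this] show False .
  qed
  then show ?thesis using k by blast
qed

definition simple_submodule :: "'v set \<Rightarrow> bool" where
  "simple_submodule S \<longleftrightarrow> submodule \<sigma> S \<and> S \<noteq> {0} \<and> (\<forall>V. submodule \<sigma> V \<and> V \<subseteq> S \<longrightarrow> V = {0} \<or> V = S)"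

definition annihilator :: "'v set \<Rightarrow> 'l set" where
  "annihilator S = {x. \<forall>u\<in>S. \<sigma> x u = 0}"

lemma annihilator_ideal: assumes S: "submodule \<sigma> S" shows "lie_ideal br (annihilator S)"
  unfolding submodule_def annihilator_def real_vector.subspace_def
  using S by (auto simp: \<sigma>_simps \<sigma>_br submodule_def)

lemma submodule_ideal_span:
  assumes N: "lie_ideal br N" and S: "submodule \<sigma> S"
  shows "submodule \<sigma> (span {\<sigma> m u | m u. m \<in> N \<and> u \<in> S})" (is "submodule \<sigma> (span ?G)")
  unfolding submodule_def
proof (intro conjI allI ballI)
  show "subspace (span ?G)" by (rule real_vector.subspace_span)
  fix L x assume x: "x \<in> span ?G"
  have "subspace {x. \<sigma> L x \<in> span ?G}"
    using real_vector.subspace_span[of ?G] unfolding real_vector.subspace_def by (simp add: \<sigma>_simps)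
  moreover have "?G \<subseteq> {x. \<sigma> L x \<in> span ?G}"
  proof
    fix v assume "v \<in> ?G"
    then obtain m u where m: "m \<in> N" "u \<in> S" "v = \<sigma> m u" by blast
    have "\<sigma> L v = \<sigma> m (\<sigma> L u) + \<sigma> (br L m) u" by (simp add: m(3) \<sigma>_br)
    moreover have "\<sigma> m (\<sigma> L u) \<in> ?G" "\<sigma> (br L m) u \<in> ?G"
      using m N S unfolding submodule_def by blast+
    ultimately show "v \<in> {x. \<sigma> L x \<in> span ?G}"
      by (simp add: real_vector.span_add real_vector.span_base)
  qed
  ultimately show "\<sigma> L x \<in> span ?G" using real_vector.span_minimal x by blast
qed

text \<open>The submodule \<open>N S\<close> of the simple module \<open>S\<close> is either zero or everything, and the second case
  contradicts Engel's theorem.\<close>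

lemma nilpotent_ideal_annihilates_simple:
  assumes S: "simple_submodule S" and N: "lie_ideal br N"
    and nil: "\<And>x. x \<in> N \<Longrightarrow> \<exists>n. \<forall>u\<in>S. (\<sigma> x ^^ n) u = 0"
  shows "N \<subseteq> annihilator S"
proof -
  have sS: "submodule \<sigma> S" and S0: "S \<noteq> {0}" using S by (auto simp: simple_submodule_def)
  have "\<exists>k. flag N S k \<subseteq> {0}"
    by (rule engel[OF sS submodule_subspace[OF N] _ nil]) (use N in \<open>auto simp: submodule_def\<close>)
  then obtain k where k: "flag N S k \<subseteq> {0}" by (elim exE)
  let ?T = "flag N S (Suc 0)"
  have "submodule \<sigma> ?T" using submodule_ideal_span[OF N sS] by simp
  moreover have "?T \<subseteq> S" using flag_Suc_subset[OF sS, of N 0] by simp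
  ultimately consider "?T = {0}" | "?T = S" using S unfolding simple_submodule_def by blast
  then show ?thesis
  proof cases
    case 1
    have "\<sigma> x u = 0" if "x \<in> N" "u \<in> S" for x u
      using flag_step[of x N u S 0] that 1 by auto
    then show ?thesis by (auto simp: annihilator_def)
  next
    case 2
    then have "flag N S j = S" for j by (induction j) auto
    then have "S \<subseteq> {0}" using k by simp
    then show ?thesis using S0 real_vector.subspace_0[OF submodule_subspace[OF sS]] by auto
  qed
qed

section \<open>The trace form of a simple module\<close>

lemma sum_list_\<sigma>: "\<sigma> (\<Sum>(a, c)\<leftarrow>ps. br a c) u = (\<Sum>(a, c)\<leftarrow>ps. \<sigma> (br a c) u)"
  by (induction ps) (auto simp: \<sigma>_simps)

lemma span_brackets_list:
  assumes U: "subspace U" and x: "x \<in> span {br a c | a c. a \<in> U \<and> c \<in> V}"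
  shows "\<exists>ps. set ps \<subseteq> U \<times> V \<and> x = (\<Sum>(a, c)\<leftarrow>ps. br a c)"
  using x
proof (induction rule: real_vector.span_induct_alt)
  case base
  show ?case by (intro exI[of _ "[]"]) simp
next
  case (step r x y)
  then obtain ps a c where ps: "set ps \<subseteq> U \<times> V" "y = (\<Sum>(a, c)\<leftarrow>ps. br a c)" and ac: "a \<in> U" "c \<in> V" "x = br a c"
    by blast
  show ?case
    using ps ac U by (intro exI[of _ "(r *\<^sub>R a, c) # ps"]) (auto simp: br_simps real_vector.subspace_scale)
qed

lemma ideal_span_brackets:
  assumes N: "lie_ideal br N" and M: "lie_ideal br M"
  shows "lie_ideal br (span {br a c | a c. a \<in> M \<and> c \<in> N})"
proof -
  interpret adj: lie_rep br br
    by unfold_locales (rule la adjoint_representation[OF la] fdl)+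
  show ?thesis using adj.submodule_ideal_span[OF M N] .
qed

definition trace_form :: "'v set \<Rightarrow> 'l \<Rightarrow> 'l \<Rightarrow> real" where
  "trace_form B x y = trace_on B (\<lambda>u. \<sigma> x (\<sigma> y u))"

context
  fixes S B
  assumes S: "simple_submodule S" and B: "finite B" "independent B" "span B = S"
begin

lemma submodule_S: "submodule \<sigma> S"
  using S by (simp add: simple_submodule_def)

lemma span_invariant: "u \<in> span B \<Longrightarrow> \<sigma> x u \<in> span B"
  using submodule_S B(3) by (simp add: submodule_def)

lemma trace_form_sym: "trace_form B x y = trace_form B y x"
  unfolding trace_form_def by (rule trace_on_commute[OF B(2,1) linear_\<sigma> span_invariant linear_\<sigma> span_invariant])

lemma trace_form_bilinear: "bilinear (trace_form B)"
proof -
  have 1: "trace_form B (x + y) z = trace_form B x z + trace_form B y z" for x y z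
    unfolding trace_form_def by (simp add: \<sigma>_simps trace_on_add[OF B(2)] span_invariant)
  have 2: "trace_form B (r *\<^sub>R x) z = r * trace_form B x z" for r x z
    unfolding trace_form_def by (simp add: \<sigma>_simps trace_on_scale[OF B(2)] span_invariant)
  have "linear (\<lambda>x. trace_form B x z)" for z by (rule linearI) (simp_all add: 1 2)
  moreover have "linear (\<lambda>x. trace_form B z x)" for z using calculation[of z] by (simp add: trace_form_sym[of z])
  ultimately show ?thesis by (simp add: bilinear_def)
qed

lemma trace_form_invariant: "trace_form B (br x y) z = trace_form B x (br y z)"
proof -
  have lc: "linear (\<lambda>u. \<sigma> x (\<sigma> z u))" using linear_compose[OF linear_\<sigma>[of z] linear_\<sigma>[of x]] by (simp add: o_def)
  have "trace_form B (br x y) z = trace_on B (\<lambda>u. \<sigma> x (\<sigma> y (\<sigma> z u))) - trace_on B (\<lambda>u. \<sigma> y (\<sigma> x (\<sigma> z u)))"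
    unfolding trace_form_def \<sigma>_br by (rule trace_on_diff[OF B(2)]) (simp_all add: span_invariant)
  moreover have "trace_form B x (br y z) = trace_on B (\<lambda>u. \<sigma> x (\<sigma> y (\<sigma> z u))) - trace_on B (\<lambda>u. \<sigma> x (\<sigma> z (\<sigma> y u)))"
    unfolding trace_form_def \<sigma>_br bilinear_rsub[OF bil_\<sigma>] by (rule trace_on_diff[OF B(2)]) (simp_all add: span_invariant)
  moreover have "trace_on B (\<lambda>u. \<sigma> y (\<sigma> x (\<sigma> z u))) = trace_on B (\<lambda>u. \<sigma> x (\<sigma> z (\<sigma> y u)))"
    by (rule trace_on_commute[OF B(2,1) linear_\<sigma> span_invariant lc]) (auto intro: span_invariant)
  ultimately show ?thesis by simp
qed

lemma trace_form_annihilator: "y \<in> annihilator S \<Longrightarrow> trace_form B x y = 0"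
proof -
  assume y: "y \<in> annihilator S"
  have "trace_form B x y = trace_on B (\<lambda>u. 0)"
    unfolding trace_form_def
  proof (rule trace_on_cong)
    fix u assume "u \<in> B"
    then have "u \<in> S" using B(3) real_vector.span_base by blast
    then have "\<sigma> y u = 0" using y by (simp add: annihilator_def)
    then show "\<sigma> x (\<sigma> y u) = 0" by (simp add: \<sigma>_simps)
  qed
  then show ?thesis by (simp add: trace_on_def coord_def real_vector.representation_zero)
qed

text \<open>The combination of the trace criterion with Engel's theorem. On \<open>S\<close> the elements of \<open>N\<close> only have to
  agree with sums of brackets.\<close>

lemma commutator_ideal_annihilates:
  assumes N: "lie_ideal br N"
    and ps: "\<And>x. x \<in> N \<Longrightarrow> \<exists>ps. (\<forall>u\<in>S. \<sigma> x u = (\<Sum>(a, c)\<leftarrow>ps. \<sigma> (br a c) u)) \<and>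
      (\<forall>(a, c)\<in>set ps. \<forall>k\<ge>1. trace_form B a ((br x ^^ k) c) = 0)"
  shows "N \<subseteq> annihilator S"
proof (rule nilpotent_ideal_annihilates_simple[OF S N])
  fix x assume "x \<in> N"
  then obtain ps where ps: "\<forall>u\<in>S. \<sigma> x u = (\<Sum>(a, c)\<leftarrow>ps. \<sigma> (br a c) u)"
    "\<forall>(a, c)\<in>set ps. \<forall>k\<ge>1. trace_form B a ((br x ^^ k) c) = 0" using assms(2) by blast
  have "\<exists>n. \<forall>u\<in>span B. (\<sigma> x ^^ n) u = 0"
    by (rule commutator_sum_nilpotent[OF B(1,2), where ps = ps])
      (use ps B(3) submodule_S in \<open>auto simp: trace_form_def\<close>)
  then show "\<exists>n. \<forall>u\<in>S. (\<sigma> x ^^ n) u = 0" using B(3) by simp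
qed

text \<open>The criterion is applied three times: to \<open>[N, N]\<close>, whose elements are sums of brackets of elements of
  the isotropic ideal \<open>N\<close>; to \<open>[\<ll>, N]\<close>, where the traces vanish because \<open>[N, N]\<close> acts trivially; and
  finally to \<open>N\<close> itself, where they vanish because \<open>[\<ll>, N]\<close> acts trivially.\<close>

lemma isotropic_ideal_annihilates:
  assumes N: "lie_ideal br N" and D: "N \<subseteq> ssum (span {br a c | a c. a \<in> UNIV \<and> c \<in> UNIV}) (annihilator S)"
    and iso: "\<And>x y. x \<in> N \<Longrightarrow> y \<in> N \<Longrightarrow> trace_form B x y = 0"
  shows "N \<subseteq> annihilator S"
proof -
  have K: "lie_ideal br (annihilator S)" by (rule annihilator_ideal[OF submodule_S])
  have powN: "(br x ^^ k) c \<in> J" if "lie_ideal br J" "c \<in> J" for x c k J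
    using that by (induction k) (auto simp: submodule_def)
  have pow1: "(br x ^^ k) c \<in> annihilator S" if "br x c \<in> annihilator S" "k \<ge> 1" for x c k
  proof -
    obtain j where "k = Suc j" using \<open>k \<ge> 1\<close> by (cases k) auto
    then show ?thesis using powN[OF K that(1), of j x] by (simp add: funpow_swap1)
  qed
  have sN: "subspace N" by (rule submodule_subspace[OF N])
  let ?N1 = "span {br a c | a c. a \<in> N \<and> c \<in> N}"
  have N1: "?N1 \<subseteq> annihilator S"
  proof (rule commutator_ideal_annihilates[OF ideal_span_brackets[OF N N]])
    fix x assume x: "x \<in> ?N1"
    obtain ps where ps: "set ps \<subseteq> N \<times> N" "x = (\<Sum>(a, c)\<leftarrow>ps. br a c)"
      using span_brackets_list[OF sN x] by blast
    have "trace_form B a ((br x ^^ k) c) = 0" if "(a, c) \<in> set ps" for a c k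
      using iso powN[OF N] ps(1) that by blast
    then show "\<exists>ps. (\<forall>u\<in>S. \<sigma> x u = (\<Sum>(a, c)\<leftarrow>ps. \<sigma> (br a c) u)) \<and>
      (\<forall>(a, c)\<in>set ps. \<forall>k\<ge>1. trace_form B a ((br x ^^ k) c) = 0)"
      using ps(2) sum_list_\<sigma> by (intro exI[of _ ps]) auto
  qed
  let ?N2 = "span {br a c | a c. a \<in> UNIV \<and> c \<in> N}"
  have N2N: "?N2 \<subseteq> N" by (rule real_vector.span_minimal[OF _ sN]) (use N in \<open>auto simp: submodule_def\<close>)
  have N2: "?N2 \<subseteq> annihilator S"
  proof (rule commutator_ideal_annihilates[OF ideal_span_brackets[OF N submodule_UNIV]])
    fix x assume x: "x \<in> ?N2"
    obtain ps where ps: "set ps \<subseteq> UNIV \<times> N" "x = (\<Sum>(a, c)\<leftarrow>ps. br a c)"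
      using span_brackets_list[OF real_vector.subspace_UNIV x] by blast
    have "trace_form B a ((br x ^^ k) c) = 0" if "(a, c) \<in> set ps" "k \<ge> 1" for a c k
    proof (rule trace_form_annihilator, rule pow1)
      have "x \<in> N" "c \<in> N" using N2N x ps(1) that by auto
      then have "br x c \<in> ?N1" by (intro real_vector.span_base) blast
      then show "br x c \<in> annihilator S" using N1 by blast
    qed (rule that)
    then show "\<exists>ps. (\<forall>u\<in>S. \<sigma> x u = (\<Sum>(a, c)\<leftarrow>ps. \<sigma> (br a c) u)) \<and>
      (\<forall>(a, c)\<in>set ps. \<forall>k\<ge>1. trace_form B a ((br x ^^ k) c) = 0)"
      using ps(2) sum_list_\<sigma> by (intro exI[of _ ps]) auto
  qed
  show ?thesis
  proof (rule commutator_ideal_annihilates[OF N])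
    fix x assume x: "x \<in> N"
    obtain d \<kappa> where d: "d \<in> span {br a c | a c. a \<in> UNIV \<and> c \<in> UNIV}" "\<kappa> \<in> annihilator S" "x = d + \<kappa>"
      using subsetD[OF D x] by (elim ssumE)
    obtain ps where ps: "d = (\<Sum>(a, c)\<leftarrow>ps. br a c)"
      using span_brackets_list[OF real_vector.subspace_UNIV d(1)] by blast
    have "trace_form B a ((br x ^^ k) c) = 0" if "k \<ge> 1" for a c k
    proof (rule trace_form_annihilator, rule pow1)
      have "br c x \<in> ?N2" using x by (intro real_vector.span_base) blast
      then have "br c x \<in> annihilator S" using N2 by blast
      then show "br x c \<in> annihilator S"
        using br_anti[of x c] real_vector.subspace_neg[OF submodule_subspace[OF K]] by simp
    qed (rule that)
    moreover have "\<sigma> x u = (\<Sum>(a, c)\<leftarrow>ps. \<sigma> (br a c) u)" if "u \<in> S" for u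
      using d that by (simp add: \<sigma>_simps annihilator_def ps sum_list_\<sigma>)
    ultimately show "\<exists>ps. (\<forall>u\<in>S. \<sigma> x u = (\<Sum>(a, c)\<leftarrow>ps. \<sigma> (br a c) u)) \<and>
      (\<forall>(a, c)\<in>set ps. \<forall>k\<ge>1. trace_form B a ((br x ^^ k) c) = 0)"
      by (intro exI[of _ ps]) auto
  qed
qed

lemma perp_ideal:
  assumes J: "lie_ideal br J" shows "lie_ideal br (perp (trace_form B) J)"
proof -
  have "br L x \<in> perp (trace_form B) J" if "x \<in> perp (trace_form B) J" for L x
  proof -
    have "trace_form B (br L x) y = 0" if y: "y \<in> J" for y
    proof -
      have "trace_form B (br L x) y = - trace_form B (br x L) y"
        by (subst br_anti) (simp add: bilinear_lneg[OF trace_form_bilinear])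
      also have "\<dots> = - trace_form B x (br L y)" by (simp add: trace_form_invariant)
      also have "\<dots> = 0" using \<open>x \<in> perp (trace_form B) J\<close> J y by (simp add: perp_def submodule_def)
      finally show ?thesis .
    qed
    then show ?thesis by (simp add: perp_def)
  qed
  then show ?thesis using subspace_perp[OF trace_form_bilinear] by (simp add: submodule_def)
qed

text \<open>Let \<open>s = [\<ll>, \<ll>] + ann(S)\<close>. For ideals \<open>J \<subseteq> s\<close> the intersection of \<open>J\<close> with its orthogonal for
  the trace form is isotropic, hence contained in the annihilator, so that \<open>J\<close> and its orthogonal together span \<open>\<ll>\<close>.
  Thus \<open>s / ann(S)\<close> is semi-simple. The orthogonal of \<open>s\<close> is a trivial module modulo the annihilator, and both
  together give all of \<open>\<ll>\<close>.\<close>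

lemma adjoint_semisimple_mod_annihilator: "semisimple_quotient br UNIV (annihilator S)"
proof -
  let ?D = "span {br a c | a c. a \<in> UNIV \<and> c \<in> UNIV}"
  let ?s = "ssum ?D (annihilator S)"
  let ?K = "annihilator S"
  have K: "lie_ideal br ?K" by (rule annihilator_ideal[OF submodule_S])
  have D: "lie_ideal br ?D" by (rule ideal_span_brackets[OF submodule_UNIV submodule_UNIV])
  have s: "lie_ideal br ?s" by (rule ad.submodule_ssum[OF D K])
  have Ks: "?K \<subseteq> ?s" by (rule ssum_upper2[OF submodule_subspace[OF D]])
  have Ds: "?D \<subseteq> ?s" by (rule ssum_upper1[OF submodule_subspace[OF K]])
  have Kp: "?K \<subseteq> perp (trace_form B) J" for J
  proof
    fix x assume "x \<in> ?K"
    then have "trace_form B x y = 0" for y by (subst trace_form_sym) (rule trace_form_annihilator)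
    then show "x \<in> perp (trace_form B) J" by (simp add: perp_def)
  qed
  have rad: "J \<inter> perp (trace_form B) J \<subseteq> ?K" if J: "lie_ideal br J" "J \<subseteq> ?s" for J
  proof (rule isotropic_ideal_annihilates)
    show "lie_ideal br (J \<inter> perp (trace_form B) J)" by (rule submodule_Int[OF J(1) perp_ideal[OF J(1)]])
  qed (use J(2) in \<open>auto simp: perp_def\<close>)
  have dec: "ssum J (perp (trace_form B) J) = UNIV" if J: "lie_ideal br J" "J \<subseteq> ?s" for J
  proof (rule orthogonal_decomposition[OF fdl trace_form_bilinear trace_form_sym submodule_subspace[OF J(1)]])
    fix x z assume "z \<in> J" "z \<in> perp (trace_form B) J"
    then have "z \<in> ?K" using rad[OF J] by blast
    then show "trace_form B x z = 0" by (rule trace_form_annihilator)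
  qed
  have 1: "semisimple_quotient br (perp (trace_form B) ?s) ?K"
  proof (rule ad.semisimple_quotient_trivial)
    show "subspace (perp (trace_form B) ?s)" by (rule subspace_perp[OF trace_form_bilinear])
    show "subspace ?K" by (rule submodule_subspace[OF K])
    show "?K \<subseteq> perp (trace_form B) ?s" by (rule Kp)
    fix L x assume "x \<in> perp (trace_form B) ?s"
    then have "br L x \<in> perp (trace_form B) ?s" using perp_ideal[OF s] by (simp add: submodule_def)
    moreover have "br L x \<in> ?D" by (rule real_vector.span_base) blast
    ultimately show "br L x \<in> ?K" using rad[OF s subset_refl] Ds by blast
  qed
  have 2: "semisimple_quotient br ?s ?K"
    unfolding semisimple_quotient_iff
  proof (intro allI impI, elim conjE)
    fix J assume J: "lie_ideal br J" "?K \<subseteq> J" "J \<subseteq> ?s"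
    let ?J' = "?s \<inter> perp (trace_form B) J"
    have "lie_ideal br ?J'" by (rule submodule_Int[OF s perp_ideal[OF J(1)]])
    moreover have "?K \<subseteq> ?J'" using Ks Kp by blast
    moreover have "ssum J ?J' = ?s"
    proof
      show "ssum J ?J' \<subseteq> ?s" by (rule ssum_least[OF submodule_subspace[OF s] J(3)]) blast
      have "?s \<inter> ssum J (perp (trace_form B) J) \<subseteq> ssum J ?J'"
        by (rule submodule_modular_law[OF submodule_subspace[OF J(1)] submodule_subspace[OF s] J(3)])
      then show "?s \<subseteq> ssum J ?J'" using dec[OF J(1,3)] by simp
    qed
    moreover have "J \<inter> ?J' = ?K" using rad[OF J(1,3)] J(2) Ks Kp by blast
    ultimately show "\<exists>V'. lie_ideal br V' \<and> ?K \<subseteq> V' \<and> V' \<subseteq> ?s \<and> ssum J V' = ?s \<and> J \<inter> V' = ?K"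
      by blast
  qed
  have "semisimple_quotient br (ssum ?s (perp (trace_form B) ?s)) ?K"
    by (rule ad.semisimple_quotient_sum[OF 2 1 s perp_ideal[OF s] K Ks Kp])
  then show ?thesis using dec[OF s subset_refl] by simp
qed

end

end

section \<open>The canonical filtrations\<close>

locale lie_alg =
  fixes br :: "'g::real_vector \<Rightarrow> 'g \<Rightarrow> 'g"
  assumes la: "lie_algebra br"
begin

lemma fd: "fin_dim TYPE('g)" and bil: "bilinear br"
  using la by (auto simp: lie_algebra_def)

sublocale lie_rep br br
  by unfold_locales (rule la adjoint_representation[OF la] fd)+

text \<open>\<open>S\<^sub>k\<close> and \<open>R\<^sub>k\<close> have the properties that their definitions by \<^const>\<open>Greatest\<close> and
  \<^const>\<open>Least\<close> ask for, since the extremal ideals exist.\<close>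

lemma S_ideal_ideal: "lie_ideal br (S_ideal br k)"
  and S_ideal_Suc:
    "S_ideal br k \<subseteq> S_ideal br (Suc k)" "semisimple_quotient br (S_ideal br (Suc k)) (S_ideal br k)"
    "lie_ideal br V \<Longrightarrow> S_ideal br k \<subseteq> V \<Longrightarrow> semisimple_quotient br V (S_ideal br k) \<Longrightarrow> V \<subseteq> S_ideal br (Suc k)"
proof -
  have step: "lie_ideal br (S_ideal br (Suc k)) \<and> S_ideal br k \<subseteq> S_ideal br (Suc k) \<and>
      semisimple_quotient br (S_ideal br (Suc k)) (S_ideal br k) \<and>
      (\<forall>V. lie_ideal br V \<and> S_ideal br k \<subseteq> V \<and> semisimple_quotient br V (S_ideal br k) \<longrightarrow> V \<subseteq> S_ideal br (Suc k))"
    if Sk: "lie_ideal br (S_ideal br k)" for k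
  proof -
    obtain J where J: "lie_ideal br J \<and> S_ideal br k \<subseteq> J \<and> semisimple_quotient br J (S_ideal br k)"
      "\<And>V. lie_ideal br V \<and> S_ideal br k \<subseteq> V \<and> semisimple_quotient br V (S_ideal br k) \<Longrightarrow> V \<subseteq> J"
      using exists_greatest_semisimple[OF fd Sk] by blast
    have "S_ideal br (Suc k) = J"
      unfolding S_ideal.simps by (rule Greatest_equality) (use J in auto)
    then show ?thesis using J by blast
  qed
  have id: "lie_ideal br (S_ideal br k)" for k
    by (induction k) (use submodule_0 step in auto)
  show "lie_ideal br (S_ideal br k)" by (rule id)
  show "S_ideal br k \<subseteq> S_ideal br (Suc k)" "semisimple_quotient br (S_ideal br (Suc k)) (S_ideal br k)"
    "lie_ideal br V \<Longrightarrow> S_ideal br k \<subseteq> V \<Longrightarrow> semisimple_quotient br V (S_ideal br k) \<Longrightarrow> V \<subseteq> S_ideal br (Suc k)"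
    using step[OF id] by blast+
qed

lemma R_ideal_ideal: "lie_ideal br (R_ideal br k)"
  and R_ideal_Suc:
    "R_ideal br (Suc k) \<subseteq> R_ideal br k" "semisimple_quotient br (R_ideal br k) (R_ideal br (Suc k))"
    "lie_ideal br V \<Longrightarrow> V \<subseteq> R_ideal br k \<Longrightarrow> semisimple_quotient br (R_ideal br k) V \<Longrightarrow> R_ideal br (Suc k) \<subseteq> V"
proof -
  have step: "lie_ideal br (R_ideal br (Suc k)) \<and> R_ideal br (Suc k) \<subseteq> R_ideal br k \<and>
      semisimple_quotient br (R_ideal br k) (R_ideal br (Suc k)) \<and>
      (\<forall>V. lie_ideal br V \<and> V \<subseteq> R_ideal br k \<and> semisimple_quotient br (R_ideal br k) V \<longrightarrow> R_ideal br (Suc k) \<subseteq> V)"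
    if Rk: "lie_ideal br (R_ideal br k)" for k
  proof -
    obtain J where J: "lie_ideal br J \<and> J \<subseteq> R_ideal br k \<and> semisimple_quotient br (R_ideal br k) J"
      "\<And>V. lie_ideal br V \<and> V \<subseteq> R_ideal br k \<and> semisimple_quotient br (R_ideal br k) V \<Longrightarrow> J \<subseteq> V"
      using exists_least_semisimple[OF fd Rk] by blast
    have "R_ideal br (Suc k) = J"
      unfolding R_ideal.simps by (rule Least_equality) (use J in auto)
    then show ?thesis using J by blast
  qed
  have id: "lie_ideal br (R_ideal br k)" for k
    by (induction k) (use submodule_UNIV step in auto)
  show "lie_ideal br (R_ideal br k)" by (rule id)
  show "R_ideal br (Suc k) \<subseteq> R_ideal br k" "semisimple_quotient br (R_ideal br k) (R_ideal br (Suc k))"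
    "lie_ideal br V \<Longrightarrow> V \<subseteq> R_ideal br k \<Longrightarrow> semisimple_quotient br (R_ideal br k) V \<Longrightarrow> R_ideal br (Suc k) \<subseteq> V"
    using step[OF id] by blast+
qed

lemma S_ideal_mono: "i \<le> j \<Longrightarrow> S_ideal br i \<subseteq> S_ideal br j"
  by (rule lift_Suc_mono_le) (rule S_ideal_Suc(1))

lemma R_ideal_antimono: "i \<le> j \<Longrightarrow> R_ideal br j \<subseteq> R_ideal br i"
  by (rule lift_Suc_antimono_le) (rule R_ideal_Suc(1))

lemma subset_S_ideal_Suc:
  assumes V: "lie_ideal br V" and N: "lie_ideal br N" "N \<subseteq> V" "N \<subseteq> S_ideal br k" and ss: "semisimple_quotient br V N"
  shows "V \<subseteq> S_ideal br (Suc k)"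
proof -
  let ?S = "S_ideal br k"
  note S = S_ideal_ideal[of k]
  have "semisimple_quotient br V (V \<inter> ?S)"
    by (rule semisimple_quotient_interval[OF ss V submodule_Int[OF V S]]) (use N in auto)
  then have "semisimple_quotient br (ssum V ?S) ?S"
    by (rule semisimple_quotient_second_iso[OF V S])
  then have "ssum V ?S \<subseteq> S_ideal br (Suc k)"
    by (rule S_ideal_Suc(3)[OF submodule_ssum[OF V S] ssum_upper2[OF submodule_subspace[OF V]]])
  then show ?thesis using ssum_upper1[OF submodule_subspace[OF S], of V] by blast
qed

text \<open>A non-zero \<open>R\<^sub>k\<close> has a maximal proper submodule, with simple quotient; so the dimension drops at each step.\<close>

lemma R_ideal_vanishes: "\<exists>m. R_ideal br m = {0}"
proof -
  have lt: "dim (R_ideal br (Suc k)) < dim (R_ideal br k)" if k: "R_ideal br k \<noteq> {0}" for k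
  proof -
    obtain J where J: "lie_ideal br J" "J \<subseteq> R_ideal br k" "J \<noteq> R_ideal br k" "semisimple_quotient br (R_ideal br k) J"
      using exists_maximal_submodule[OF fd R_ideal_ideal k] by blast
    then have sub: "R_ideal br (Suc k) \<subseteq> J" by (intro R_ideal_Suc(3))
    then have ne: "R_ideal br (Suc k) \<noteq> R_ideal br k" using J by blast
    have "\<not> dim (R_ideal br k) \<le> dim (R_ideal br (Suc k))"
      using fin_dim_subspace_eqI[OF fd submodule_subspace[OF R_ideal_ideal] submodule_subspace[OF R_ideal_ideal] R_ideal_Suc(1)] ne
      by blast
    then show ?thesis by simp
  qed
  show ?thesis
  proof (rule ccontr)
    assume n: "\<nexists>m. R_ideal br m = {0}"
    have "dim (R_ideal br k) + k \<le> dim (UNIV :: 'g set)" for k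
    proof (induction k)
      case (Suc k)
      then show ?case using lt[of k] n by fastforce
    qed simp
    from this[of "Suc (dim (UNIV :: 'g set))"] show False by simp
  qed
qed

end

context lie_rep
begin

text \<open>On a simple module \<open>S\<close> this holds because \<open>\<ll> / ann(S)\<close> is semi-simple, so that \<open>R\<^sub>1(\<ll>)\<close> is contained in
  the annihilator by minimality. In general, a complement of the vectors killed by \<open>R\<^sub>1(\<ll>)\<close> cannot contain
  a simple submodule.\<close>

lemma R1_annihilates_semisimple:
  assumes U: "submodule \<sigma> U" and ss: "semisimple_quotient \<sigma> U {0}" and x: "x \<in> R_ideal br 1" and u: "u \<in> U"
  shows "\<sigma> x u = 0"
proof -
  interpret l: lie_alg br using la by unfold_locales
  let ?R = "R_ideal br 1"
  let ?U' = "{u \<in> U. \<forall>x\<in>?R. \<sigma> x u = 0}"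
  have sub: "submodule \<sigma> ?U'"
  proof -
    have "\<sigma> x (\<sigma> L u) = 0" if "x \<in> ?R" "\<forall>x\<in>?R. \<sigma> x u = 0" for x L u
    proof -
      have "br L x \<in> ?R" using l.R_ideal_ideal[of 1] that by (simp add: submodule_def)
      then show ?thesis using that \<sigma>_br[of L x u] by (simp add: \<sigma>_simps)
    qed
    then show ?thesis using U unfolding submodule_def real_vector.subspace_def by (auto simp: \<sigma>_simps)
  qed
  have z: "{0} \<subseteq> ?U'" using submodule_subspace[OF U] by (auto simp: \<sigma>_simps real_vector.subspace_0)
  have U'U: "?U' \<subseteq> U" by blast
  obtain V where V: "submodule \<sigma> V" "{0} \<subseteq> V" "V \<subseteq> U" "ssum ?U' V = U" "?U' \<inter> V = {0}"
    by (rule semisimple_quotientE[OF ss sub z U'U])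
  have "V = {0}"
  proof (rule ccontr)
    assume "V \<noteq> {0}"
    then obtain S where S: "submodule \<sigma> S" "S \<subseteq> V" "S \<noteq> {0}" "\<forall>W. submodule \<sigma> W \<and> W \<subseteq> S \<longrightarrow> W = {0} \<or> W = S"
      using exists_simple_submodule[OF fdv V(1)] by blast
    then have simp: "simple_submodule S" by (simp add: simple_submodule_def)
    obtain B where B: "finite B" "independent B" "span B = S" using fin_dim_basis[OF fdv submodule_subspace[OF S(1)]] by blast
    have "semisimple_quotient br (R_ideal br 0) (annihilator S)" using adjoint_semisimple_mod_annihilator[OF simp B] by simp
    then have "?R \<subseteq> annihilator S"
      using l.R_ideal_Suc(3)[of "annihilator S" 0] annihilator_ideal[OF S(1)] by simp
    then have "S \<subseteq> ?U'" using S(2) V(3) by (auto simp: annihilator_def)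
    then have "S \<subseteq> {0}" using S(2) V(5) by blast
    then show False using S(3) real_vector.subspace_0[OF submodule_subspace[OF S(1)]] by blast
  qed
  then have "U \<subseteq> ?U'" using V(4) ssum_least[OF submodule_subspace[OF sub], of ?U' V] z by blast
  then show ?thesis using x u by blast
qed

end

text \<open>From here on the ideals are accessed through their extremality, not through the recursion.\<close>

declare S_ideal.simps(2) [simp del] R_ideal.simps(2) [simp del]

section \<open>Equivariant maps\<close>

text \<open>An equivariant linear map on a submodule \<open>D\<close> along a surjection \<open>\<pi>\<close> of the acting Lie algebras. With
  \<open>\<pi> = f\<close> this covers homomorphisms of Lie algebras, and restricting to \<open>D\<close> covers the map
  \<open>(Z, A, 0) \<mapsto> A\<close> of the standard model, which is equivariant only on \<open>\<ll>\<^sup>* \<oplus> \<aa>\<close>.\<close>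

locale module_hom_on = src: module_action \<sigma> + tgt: module_action \<sigma>'
  for \<sigma> :: "'l \<Rightarrow> 'v::real_vector \<Rightarrow> 'v" and \<sigma>' :: "'k \<Rightarrow> 'w::real_vector \<Rightarrow> 'w" +
  fixes D :: "'v set" and f :: "'v \<Rightarrow> 'w" and \<pi> :: "'l \<Rightarrow> 'k"
  assumes D: "submodule \<sigma> D" and f: "linear f" and surj: "surj \<pi>"
    and hom: "v \<in> D \<Longrightarrow> f (\<sigma> L v) = \<sigma>' (\<pi> L) (f v)"
begin

lemma submodule_image:
  assumes U: "submodule \<sigma> U" "U \<subseteq> D" shows "submodule \<sigma>' (f ` U)"
  unfolding submodule_def
proof (intro conjI allI ballI)
  show "subspace (f ` U)" by (rule linear_subspace_image[OF f submodule_subspace[OF U(1)]])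
  fix K x assume "x \<in> f ` U"
  then obtain u where u: "u \<in> U" "x = f u" by blast
  obtain L where "K = \<pi> L" using surj by (metis surjD)
  then have "\<sigma>' K x = f (\<sigma> L u)" using hom[of u L] u U by auto
  then show "\<sigma>' K x \<in> f ` U" using U u by (simp add: submodule_def)
qed

lemma submodule_vimage:
  assumes U: "submodule \<sigma>' U" shows "submodule \<sigma> (D \<inter> f -` U)"
proof -
  have "subspace (f -` U)" by (rule linear_subspace_vimage[OF f submodule_subspace[OF U]])
  then have "subspace (D \<inter> f -` U)" using submodule_subspace[OF D] by (simp add: real_vector.subspace_inter)
  then show ?thesis using D U hom by (auto simp: submodule_def)
qed

lemma semisimple_quotient_image:
  assumes U: "submodule \<sigma> U" "U \<subseteq> D" and W: "submodule \<sigma> W" "W \<subseteq> U" and ss: "semisimple_quotient \<sigma> U W"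
  shows "semisimple_quotient \<sigma>' (f ` U) (f ` W)"
  unfolding semisimple_quotient_iff
proof (intro allI impI, elim conjE)
  fix V' assume V': "submodule \<sigma>' V'" "f ` W \<subseteq> V'" "V' \<subseteq> f ` U"
  let ?V = "U \<inter> (D \<inter> f -` V')"
  have sV: "submodule \<sigma> ?V" by (rule submodule_Int[OF U(1) submodule_vimage[OF V'(1)]])
  have WV: "W \<subseteq> ?V" using W U V' by blast
  have VU: "?V \<subseteq> U" by blast
  obtain X where X: "submodule \<sigma> X" "W \<subseteq> X" "X \<subseteq> U" "ssum ?V X = U" "?V \<inter> X = W"
    by (rule semisimple_quotientE[OF ss sV WV VU])
  have XD: "X \<subseteq> D" using X U by blast
  have "ssum V' (f ` X) = f ` U"
  proof
    show "ssum V' (f ` X) \<subseteq> f ` U"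
      using X V' by (intro ssum_least submodule_subspace[OF submodule_image[OF U]]) auto
    show "f ` U \<subseteq> ssum V' (f ` X)"
    proof
      fix y assume "y \<in> f ` U"
      then obtain u where u: "u \<in> U" "y = f u" by blast
      have "u \<in> ssum ?V X" using u X(4) by simp
      then obtain v x where vx: "v \<in> ?V" "x \<in> X" "u = v + x" by (elim ssumE)
      have "y = f v + f x" by (simp add: u vx(3) linear_add[OF f])
      then show "y \<in> ssum V' (f ` X)" using vx by (auto intro: ssumI)
    qed
  qed
  moreover have "V' \<inter> f ` X = f ` W"
  proof
    show "f ` W \<subseteq> V' \<inter> f ` X" using V' X by blast
    show "V' \<inter> f ` X \<subseteq> f ` W"
    proof
      fix y assume "y \<in> V' \<inter> f ` X"
      then obtain x where x: "x \<in> X" "y = f x" "f x \<in> V'" by blast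
      then have "x \<in> ?V \<inter> X" using X(3) XD by auto
      then have "x \<in> W" using X(5) by simp
      then show "y \<in> f ` W" using x by blast
    qed
  qed
  moreover have "submodule \<sigma>' (f ` X)" by (rule submodule_image[OF X(1) XD])
  ultimately show "\<exists>X'. submodule \<sigma>' X' \<and> f ` W \<subseteq> X' \<and> X' \<subseteq> f ` U \<and> ssum V' X' = f ` U \<and> V' \<inter> X' = f ` W"
    using X(2,3) by (intro exI[of _ "f ` X"]) blast
qed

lemma semisimple_quotient_vimage:
  assumes U: "submodule \<sigma>' U" "U \<subseteq> f ` D" and W: "submodule \<sigma>' W" "W \<subseteq> U" and ss: "semisimple_quotient \<sigma>' U W"
  shows "semisimple_quotient \<sigma> (D \<inter> f -` U) (D \<inter> f -` W)"
  unfolding semisimple_quotient_iff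
proof (intro allI impI, elim conjE)
  fix V assume V: "submodule \<sigma> V" "D \<inter> f -` W \<subseteq> V" "V \<subseteq> D \<inter> f -` U"
  have VD: "V \<subseteq> D" using V by blast
  note sV = submodule_subspace[OF V(1)]
  have fV: "submodule \<sigma>' (f ` V)" by (rule submodule_image[OF V(1) VD])
  have WfV: "W \<subseteq> f ` V"
  proof
    fix w assume w: "w \<in> W"
    then obtain d where "d \<in> D" "w = f d" using W U by blast
    then show "w \<in> f ` V" using w V by blast
  qed
  have fVU: "f ` V \<subseteq> U" using V by blast
  obtain X where X: "submodule \<sigma>' X" "W \<subseteq> X" "X \<subseteq> U" "ssum (f ` V) X = U" "f ` V \<inter> X = W"
    by (rule semisimple_quotientE[OF ss fV WfV fVU])
  have "ssum V (D \<inter> f -` X) = D \<inter> f -` U"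
  proof
    show "ssum V (D \<inter> f -` X) \<subseteq> D \<inter> f -` U"
      using V X by (intro ssum_least submodule_subspace[OF submodule_vimage[OF U(1)]]) auto
    show "D \<inter> f -` U \<subseteq> ssum V (D \<inter> f -` X)"
    proof
      fix d assume d: "d \<in> D \<inter> f -` U"
      then have "f d \<in> ssum (f ` V) X" using X(4) by simp
      then obtain v x where vx: "v \<in> V" "x \<in> X" "f d = f v + x" by (elim ssumE) blast
      have "f (d - v) = x" using vx by (simp add: linear_diff[OF f])
      moreover have "d - v \<in> D" using d vx VD submodule_subspace[OF D] by (intro real_vector.subspace_diff) auto
      ultimately have "v + (d - v) \<in> ssum V (D \<inter> f -` X)" using vx by (intro ssumI) auto
      then show "d \<in> ssum V (D \<inter> f -` X)" by simp
    qed
  qed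
  moreover have "V \<inter> (D \<inter> f -` X) = D \<inter> f -` W"
  proof
    show "D \<inter> f -` W \<subseteq> V \<inter> (D \<inter> f -` X)" using V X by blast
    show "V \<inter> (D \<inter> f -` X) \<subseteq> D \<inter> f -` W"
    proof
      fix v assume v: "v \<in> V \<inter> (D \<inter> f -` X)"
      then have "f v \<in> f ` V \<inter> X" by blast
      then have "f v \<in> W" using X(5) by simp
      then show "v \<in> D \<inter> f -` W" using v by blast
    qed
  qed
  moreover have "submodule \<sigma> (D \<inter> f -` X)" by (rule submodule_vimage[OF X(1)])
  ultimately show "\<exists>X'. submodule \<sigma> X' \<and> D \<inter> f -` W \<subseteq> X' \<and> X' \<subseteq> D \<inter> f -` U \<and> ssum V X' = D \<inter> f -` U \<and> V \<inter> X' = D \<inter> f -` W"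
    using X(2,3) by (intro exI[of _ "D \<inter> f -` X"]) blast
qed

end

text \<open>Images and preimages of semi-simple sections are semi-simple, which gives the two inclusions.\<close>

lemma R_ideal_image:
  assumes g: "lie_algebra br" and h: "lie_algebra br'" and f: "linear f" "surj f" "\<And>x y. f (br x y) = br' (f x) (f y)"
  shows "R_ideal br' k = f ` R_ideal br k"
proof -
  interpret g: lie_alg br using g by unfold_locales
  interpret h: lie_alg br' using h by unfold_locales
  have hom: "module_hom_on br br' D f f" if "lie_ideal br D" for D
    using that by (intro module_hom_on.intro module_hom_on_axioms.intro g.module_action_axioms h.module_action_axioms f)
  interpret F: module_hom_on br br' UNIV f f by (rule hom[OF submodule_UNIV])
  show ?thesis
  proof (induction k)
    case 0
    then show ?case using f by simp
  next
    case (Suc k)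
    let ?R = "R_ideal br k" and ?R1 = "R_ideal br (Suc k)" and ?Q = "R_ideal br' k" and ?Q1 = "R_ideal br' (Suc k)"
    have "semisimple_quotient br' ?Q (f ` ?R1)"
      unfolding Suc
      by (rule F.semisimple_quotient_image[OF g.R_ideal_ideal subset_UNIV g.R_ideal_ideal g.R_ideal_Suc(1,2)])
    then have 1: "?Q1 \<subseteq> f ` ?R1"
      by (rule h.R_ideal_Suc(3)[OF F.submodule_image[OF g.R_ideal_ideal subset_UNIV], rotated])
        (use Suc g.R_ideal_Suc(1)[of k] in blast)
    interpret F': module_hom_on br br' ?R f f by (rule hom[OF g.R_ideal_ideal])
    let ?J = "?R \<inter> f -` ?Q1"
    have "semisimple_quotient br (?R \<inter> f -` ?Q) ?J"
      by (rule F'.semisimple_quotient_vimage[OF h.R_ideal_ideal _ h.R_ideal_ideal h.R_ideal_Suc(1,2)]) (simp add: Suc)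
    moreover have "?R \<inter> f -` ?Q = ?R" using Suc by blast
    ultimately have "semisimple_quotient br ?R ?J" by simp
    then have "?R1 \<subseteq> ?J"
      by (rule g.R_ideal_Suc(3)[OF F'.submodule_vimage[OF h.R_ideal_ideal] Int_lower1])
    then show ?case using 1 by blast
  qed
qed

section \<open>Invariant scalar products\<close>

locale metric_lie = lie_alg br + form: fin_scalar_product b
  for br :: "'g::real_vector \<Rightarrow> 'g \<Rightarrow> 'g" and b :: "'g \<Rightarrow> 'g \<Rightarrow> real" +
  assumes invariant: "b (br x y) z = - b y (br x z)"
begin

lemma perp_is_ideal: "lie_ideal br U \<Longrightarrow> lie_ideal br (perp b U)"
  using subspace_perp[OF form.bil] by (auto simp: submodule_def perp_def invariant)

text \<open>Orthogonal complements invert the lattice of ideals and exchange sums with intersections.\<close>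

lemma semisimple_quotient_perp:
  assumes U: "lie_ideal br U" and W: "lie_ideal br W" and WU: "W \<subseteq> U" and ss: "semisimple_quotient br U W"
  shows "semisimple_quotient br (perp b W) (perp b U)"
  unfolding semisimple_quotient_iff
proof (intro allI impI, elim conjE)
  note sU = submodule_subspace[OF U] and sW = submodule_subspace[OF W]
  fix V assume V: "lie_ideal br V" "perp b U \<subseteq> V" "V \<subseteq> perp b W"
  note sV = submodule_subspace[OF V(1)]
  have 1: "W \<subseteq> perp b V" using perp_antimono[OF V(3), of b] form.perp_perp[OF sW] by simp
  have 2: "perp b V \<subseteq> U" using perp_antimono[OF V(2), of b] form.perp_perp[OF sU] by simp
  obtain X where X: "lie_ideal br X" "W \<subseteq> X" "X \<subseteq> U" "ssum (perp b V) X = U" "perp b V \<inter> X = W"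
    by (rule semisimple_quotientE[OF ss perp_is_ideal[OF V(1)] 1 2])
  note sX = submodule_subspace[OF X(1)]
  have a: "V \<inter> perp b X = perp b U"
    using form.perp_ssum[OF subspace_perp[OF form.bil] sX, of V] X(4) form.perp_perp[OF sV] by simp
  have c: "ssum V (perp b X) = perp b W"
    using form.perp_Int[OF subspace_perp[OF form.bil] sX, of V] X(5) form.perp_perp[OF sV] by simp
  show "\<exists>V'. lie_ideal br V' \<and> perp b U \<subseteq> V' \<and> V' \<subseteq> perp b W \<and> ssum V V' = perp b W \<and> V \<inter> V' = perp b U"
    using perp_is_ideal[OF X(1)] perp_antimono[OF X(2)] perp_antimono[OF X(3)] a c by blast
qed

lemma S_ideal_perp: "S_ideal br k = perp b (R_ideal br k)"
proof (induction k)
  case 0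
  show ?case using form.nondeg by (auto simp: perp_def bilinear_lzero[OF form.bil])
next
  case (Suc k)
  let ?R = "R_ideal br k" and ?R1 = "R_ideal br (Suc k)" and ?S = "S_ideal br k" and ?S1 = "S_ideal br (Suc k)"
  have "semisimple_quotient br (perp b ?R1) ?S"
    unfolding Suc by (rule semisimple_quotient_perp[OF R_ideal_ideal R_ideal_ideal R_ideal_Suc(1,2)])
  then have 1: "perp b ?R1 \<subseteq> ?S1"
    by (rule S_ideal_Suc(3)[OF perp_is_ideal[OF R_ideal_ideal], rotated])
      (simp only: Suc perp_antimono[OF R_ideal_Suc(1)])
  have RS: "perp b ?S = ?R" using Suc form.perp_perp submodule_subspace[OF R_ideal_ideal] by simp
  have "semisimple_quotient br ?R (perp b ?S1)"
    using semisimple_quotient_perp[OF S_ideal_ideal S_ideal_ideal S_ideal_Suc(1,2), of k] by (simp only: RS)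
  moreover have "perp b ?S1 \<subseteq> ?R" using perp_antimono[OF S_ideal_Suc(1), of b k] by (simp only: RS)
  ultimately have "?R1 \<subseteq> perp b ?S1"
    by (intro R_ideal_Suc(3)[OF perp_is_ideal[OF S_ideal_ideal]])
  from perp_antimono[OF this, of b] have "?S1 \<subseteq> perp b ?R1"
    by (simp only: form.perp_perp[OF submodule_subspace[OF S_ideal_ideal]])
  then show ?case using 1 by blast
qed

text \<open>Dualising the sum of the \<open>S\<^sub>k \<inter> R\<^sub>k\<close> with \<open>S_ideal_perp\<close>. The index \<open>k = 0\<close>, which does not
  occur in the canonical ideal, imposes nothing as \<open>R\<^sub>0\<close> is the whole algebra.\<close>

lemma canonical_perp: "x \<in> perp b (canonical_ideal br) \<longleftrightarrow> (\<forall>k. x \<in> ssum (S_ideal br k) (R_ideal br k))"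
proof -
  note sS = submodule_subspace[OF S_ideal_ideal] and sR = submodule_subspace[OF R_ideal_ideal]
  have sp: "perp b (span U) = perp b U" for U
  proof
    show "perp b (span U) \<subseteq> perp b U" by (rule perp_antimono) (rule real_vector.span_superset)
    show "perp b U \<subseteq> perp b (span U)"
    proof
      fix x assume "x \<in> perp b U"
      then have "b x y = 0" if "y \<in> U" for y using that by (simp add: perp_def)
      moreover have "linear (b x)" using form.bil by (simp add: bilinear_def)
      ultimately have "b x y = 0" if "y \<in> span U" for y using linear_eq_0_on_span that by blast
      then show "x \<in> perp b (span U)" by (simp add: perp_def)
    qed
  qed
  have RS: "perp b (S_ideal br k) = R_ideal br k" for k
    using form.perp_perp[OF sR, of k] by (simp add: S_ideal_perp)
  have k: "perp b (S_ideal br k \<inter> R_ideal br k) = ssum (S_ideal br k) (R_ideal br k)" for k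
  proof -
    have "perp b (S_ideal br k \<inter> R_ideal br k) = ssum (R_ideal br k) (S_ideal br k)"
      by (simp only: form.perp_Int[OF sS sR] RS S_ideal_perp[symmetric])
    also have "\<dots> = ssum (S_ideal br k) (R_ideal br k)"
      by (rule ssum_commute)
    finally show ?thesis .
  qed
  have "x \<in> perp b (canonical_ideal br) \<longleftrightarrow> (\<forall>k\<in>{1..}. x \<in> perp b (S_ideal br k \<inter> R_ideal br k))"
    unfolding canonical_ideal_def sp by (auto simp: perp_def)
  also have "\<dots> \<longleftrightarrow> (\<forall>k. x \<in> ssum (S_ideal br k) (R_ideal br k))"
  proof -
    have "x \<in> ssum (S_ideal br 0) (R_ideal br 0)" by (auto simp: ssum_def)
    then show ?thesis unfolding k by (metis One_nat_def Suc_leI atLeast_iff neq0_conv)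
  qed
  finally show ?thesis .
qed

lemma filtration_in_canonical_perp:
  assumes "y \<in> S_ideal br (Suc n)" "y \<in> R_ideal br n"
  shows "y \<in> perp b (canonical_ideal br)"
  unfolding canonical_perp
proof
  note sS = submodule_subspace[OF S_ideal_ideal] and sR = submodule_subspace[OF R_ideal_ideal]
  fix k
  show "y \<in> ssum (S_ideal br k) (R_ideal br k)"
  proof (cases "k \<le> n")
    case True
    then have "y \<in> R_ideal br k" using assms R_ideal_antimono by blast
    then show ?thesis using ssum_upper2[OF sS] by blast
  next
    case False
    then have "y \<in> S_ideal br k" using assms S_ideal_mono[of "Suc n" k] by auto
    then show ?thesis using ssum_upper1[OF sR] by blast
  qed
qed

text \<open>An element of \<open>\<ii>\<^sup>\<bottom> \<inter> R\<^sub>n\<close> is the sum of an element of \<open>S\<^bsub>n+1\<^esub> \<inter> R\<^sub>n\<close>, which is in \<open>\<ii>\<^sup>\<bottom>\<close>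
  again, and one of \<open>\<ii>\<^sup>\<bottom> \<inter> R\<^bsub>n+1\<^esub>\<close>; the \<open>R\<^sub>n\<close> eventually vanish.\<close>

lemma perp_canonical_subset:
  assumes T: "subspace T" and W: "\<And>k. S_ideal br (Suc k) \<inter> R_ideal br k \<subseteq> T"
  shows "perp b (canonical_ideal br) \<subseteq> T"
proof
  note sS = submodule_subspace[OF S_ideal_ideal] and sR = submodule_subspace[OF R_ideal_ideal]
  fix x assume x: "x \<in> perp b (canonical_ideal br)"
  obtain m where m: "R_ideal br m = {0}" using R_ideal_vanishes by blast
  have "n \<le> m \<Longrightarrow> y \<in> R_ideal br n \<Longrightarrow> y \<in> perp b (canonical_ideal br) \<Longrightarrow> y \<in> T" for n y
  proof (induction "m - n" arbitrary: n y)
    case 0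
    then show ?case using m real_vector.subspace_0[OF T] by auto
  next
    case (Suc d)
    have "y \<in> ssum (S_ideal br (Suc n)) (R_ideal br (Suc n))" using Suc.prems(3) canonical_perp by blast
    then obtain s r where sr: "s \<in> S_ideal br (Suc n)" "r \<in> R_ideal br (Suc n)" "y = s + r" by (elim ssumE)
    have "y - r \<in> R_ideal br n"
      using Suc.prems(2) sr(2) R_ideal_Suc(1)[of n] by (intro real_vector.subspace_diff[OF sR]) auto
    then have s: "s \<in> R_ideal br n" using sr by simp
    then have sT: "s \<in> T" using W sr(1) by blast
    have "y - s \<in> perp b (canonical_ideal br)"
      by (rule real_vector.subspace_diff[OF subspace_perp[OF form.bil] Suc.prems(3) filtration_in_canonical_perp[OF sr(1) s]])
    then have "r \<in> perp b (canonical_ideal br)" using sr by simp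
    then have "r \<in> T" using Suc.hyps(2) sr(2) by (intro Suc.hyps(1)[of "Suc n"]) auto
    then show ?case unfolding sr(3) using sT by (intro real_vector.subspace_add[OF T])
  qed
  from this[of 0 x] x show "x \<in> T" by simp
qed

lemma S_perp_R: "x \<in> S_ideal br k \<Longrightarrow> y \<in> R_ideal br k \<Longrightarrow> b y x = 0"
  unfolding S_ideal_perp using form.sym by (auto simp: perp_def)

lemma semisimple_filtration_section:
  assumes W: "lie_ideal br W" "W \<subseteq> S_ideal br (Suc k)"
  shows "semisimple_quotient br W (W \<inter> S_ideal br k)"
proof (rule semisimple_quotient_second_iso'[OF W(1) S_ideal_ideal])
  note sS = submodule_subspace[OF S_ideal_ideal] and sW = submodule_subspace[OF W(1)]
  show "semisimple_quotient br (ssum W (S_ideal br k)) (S_ideal br k)"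
  proof (rule semisimple_quotient_interval[OF S_ideal_Suc(2) _ S_ideal_ideal subset_refl])
    show "lie_ideal br (ssum W (S_ideal br k))" by (rule submodule_ssum[OF W(1) S_ideal_ideal])
    show "S_ideal br k \<subseteq> ssum W (S_ideal br k)" by (rule ssum_upper2[OF sW])
    show "ssum W (S_ideal br k) \<subseteq> S_ideal br (Suc k)" by (rule ssum_least[OF sS W(2) S_ideal_Suc(1)])
  qed
qed

end

section \<open>The standard model\<close>

lemma dual_app_of_linear: "linear f \<Longrightarrow> dual_app (dual_of f) x = f x"
  by (simp add: dual_app_dual_of)

lemma dual_eq_iff: "Z = Z' \<longleftrightarrow> (\<forall>x. dual_app Z x = dual_app Z' x)"
  by (metis dual_app_inject ext)

lemma dual_app_sum: "dual_app (\<Sum>i\<in>I. f i) x = (\<Sum>i\<in>I. dual_app (f i) x)"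
  by (induction I rule: infinite_finite_induct) (simp_all add: dual_app_0 dual_app_add)

lemma dual_separates:
  assumes "\<And>Z :: 'l::real_vector dual. dual_app Z v = 0" shows "v = 0"
proof (rule ccontr)
  assume "v \<noteq> 0"
  then have "independent {v}" by simp
  then obtain g :: "'l \<Rightarrow> real" where g: "linear g" "\<forall>y\<in>{v}. g y = 1"
    using real_vector.linear_independent_extend[of "{v}" "\<lambda>_. 1 :: real"] by blast
  then show False using assms[of "dual_of g"] by (simp add: dual_app_of_linear)
qed

lemma fin_dim_dual:
  assumes fd: "fin_dim TYPE('l::real_vector)" shows "fin_dim TYPE('l dual)"
proof -
  obtain B :: "'l set" where B: "finite B" "independent B" "span B = UNIV"
    using fin_dim_basis[OF fd real_vector.subspace_UNIV] by blast
  have lin: "linear (\<lambda>x. coord B x b)" for b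
    by (rule linearI) (simp_all add: coord_add[OF B(2)] coord_scale[OF B(2)] B(3))
  let ?D = "(\<lambda>b. dual_of (\<lambda>x. coord B x b)) ` B"
  have "Z \<in> span ?D" for Z :: "'l dual"
  proof -
    have "Z = (\<Sum>b\<in>B. dual_app Z b *\<^sub>R dual_of (\<lambda>x. coord B x b))"
    proof -
      have e: "dual_app Z x = (\<Sum>b\<in>B. dual_app Z b * coord B x b)" for x
      proof -
        have "dual_app Z (\<Sum>b\<in>B. coord B x b *\<^sub>R b) = (\<Sum>b\<in>B. coord B x b * dual_app Z b)"
          by (simp add: linear_sum[OF linear_dual_app] linear_cmul[OF linear_dual_app])
        then show ?thesis using coord_expand[OF B(2,1), of x] B(3) by (simp add: mult.commute)
      qed
      show ?thesis
        unfolding dual_eq_iff dual_app_sum dual_app_scaleR dual_app_of_linear[OF lin]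
        by (intro allI e)
    qed
    moreover have "(\<Sum>b\<in>B. dual_app Z b *\<^sub>R dual_of (\<lambda>x. coord B x b)) \<in> span ?D"
      by (intro real_vector.span_sum real_vector.span_scale real_vector.span_base imageI)
    ultimately show ?thesis by simp
  qed
  then have "span ?D = UNIV" by blast
  then show ?thesis unfolding fin_dim_def using B(1) by (intro exI[of _ ?D]) simp
qed

lemma fin_dim_prod:
  assumes "fin_dim TYPE('v::real_vector)" "fin_dim TYPE('w::real_vector)" shows "fin_dim TYPE('v \<times> 'w)"
proof -
  obtain B :: "'v set" and C :: "'w set" where B: "finite B" "span B = UNIV" and C: "finite C" "span C = UNIV"
    using assms unfolding fin_dim_def by blast
  let ?E = "(\<lambda>x. (x, 0)) ` B \<union> (\<lambda>y. (0, y)) ` C"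
  have l1: "linear (\<lambda>x::'v. (x, 0::'w))" and l2: "linear (\<lambda>y::'w. (0::'v, y))"
    by (auto intro!: linearI)
  have "z \<in> span ?E" for z :: "'v \<times> 'w"
  proof -
    obtain x y where z: "z = (x, y)" by force
    have "(x, 0) \<in> span ((\<lambda>x. (x, 0::'w)) ` B)" using B linear_span_image[OF l1, of B] by auto
    moreover have "(0, y) \<in> span ((\<lambda>y. (0::'v, y)) ` C)" using C linear_span_image[OF l2, of C] by auto
    ultimately have "(x, 0) + (0, y) \<in> span ?E"
      by (meson real_vector.span_add real_vector.span_mono Un_upper1 Un_upper2 subsetD)
    then show ?thesis using z by simp
  qed
  then have "span ?E = UNIV" by blast
  then show ?thesis unfolding fin_dim_def using B(1) C(1) by (intro exI[of _ ?E]) simp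
qed

locale quad_ext =
  fixes br :: "'l::real_vector \<Rightarrow> 'l \<Rightarrow> 'l"
    and \<theta>l :: "'l \<Rightarrow> 'l"
    and \<rho> :: "'l \<Rightarrow> 'a::real_vector \<Rightarrow> 'a"
    and ip :: "'a \<Rightarrow> 'a \<Rightarrow> real"
    and \<theta>a :: "'a \<Rightarrow> 'a"
    and \<alpha> :: "'l \<Rightarrow> 'l \<Rightarrow> 'a"
    and \<gamma> :: "'l \<Rightarrow> 'l \<Rightarrow> 'l \<Rightarrow> real"
  assumes lai: "lie_algebra_with_involution br \<theta>l"
    and om: "orthogonal_module br \<theta>l \<rho> ip \<theta>a"
    and z2: "(\<alpha>, \<gamma>) \<in> Z2Q_plus br \<theta>l \<rho> ip \<theta>a"
begin

sublocale L: lie_alg br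
  using lai by unfold_locales (simp add: lie_algebra_with_involution_def)

sublocale rho: lie_rep br \<rho>
  using om L.la by unfold_locales (simp_all add: orthogonal_module_def)

sublocale A: fin_scalar_product ip
  using om by unfold_locales (simp_all add: orthogonal_module_def)

lemma ip_skew: "ip (\<rho> X a) c = - ip a (\<rho> X c)"
  using om by (simp add: orthogonal_module_def)

lemma \<theta>l: "linear \<theta>l" "\<theta>l (\<theta>l x) = x" "\<theta>l (br x y) = br (\<theta>l x) (\<theta>l y)"
  using lai by (auto simp: lie_algebra_with_involution_def involution_def)

lemma \<theta>a: "linear \<theta>a" "\<theta>a (\<theta>a a) = a" "ip (\<theta>a a) (\<theta>a c) = ip a c" "\<theta>a (\<rho> (\<theta>l X) a) = \<rho> X (\<theta>a a)"
  using om by (auto simp: orthogonal_module_def involution_def)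

lemma \<alpha>: "bilinear \<alpha>" "\<alpha> x x = 0" "\<theta>a (\<alpha> (\<theta>l x) (\<theta>l y)) = \<alpha> x y" "ce_d2 br \<rho> \<alpha> x y z = 0"
  using z2 by (auto simp: Z2Q_plus_def C2_plus_def)

lemma \<gamma>: "bilinear (\<gamma> x)" "linear (\<lambda>x. \<gamma> x y z)" "\<gamma> x x y = 0" "\<gamma> x y y = 0" "\<gamma> (\<theta>l x) (\<theta>l y) (\<theta>l z) = \<gamma> x y z"
  "ce_d3 br triv_rep \<gamma> x y z w = (1/2) * wedge_22 ip \<alpha> \<alpha> x y z w"
  using z2 by (auto simp: Z2Q_plus_def C3_plus_def)

lemmas lin_simps =
  bilinear_ladd[OF L.bil] bilinear_radd[OF L.bil] bilinear_lsub[OF L.bil] bilinear_rsub[OF L.bil]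
  bilinear_lmul[OF L.bil] bilinear_rmul[OF L.bil] bilinear_lzero[OF L.bil] bilinear_rzero[OF L.bil]
  bilinear_lneg[OF L.bil] bilinear_rneg[OF L.bil]
  rho.\<sigma>_simps
  bilinear_ladd[OF A.bil] bilinear_radd[OF A.bil] bilinear_lsub[OF A.bil] bilinear_rsub[OF A.bil]
  bilinear_lmul[OF A.bil] bilinear_rmul[OF A.bil] bilinear_lzero[OF A.bil] bilinear_rzero[OF A.bil]
  bilinear_lneg[OF A.bil] bilinear_rneg[OF A.bil]
  bilinear_ladd[OF \<alpha>(1)] bilinear_radd[OF \<alpha>(1)] bilinear_lsub[OF \<alpha>(1)] bilinear_rsub[OF \<alpha>(1)]
  bilinear_lmul[OF \<alpha>(1)] bilinear_rmul[OF \<alpha>(1)] bilinear_lzero[OF \<alpha>(1)] bilinear_rzero[OF \<alpha>(1)]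
  bilinear_lneg[OF \<alpha>(1)] bilinear_rneg[OF \<alpha>(1)]
  bilinear_ladd[OF \<gamma>(1)] bilinear_radd[OF \<gamma>(1)] bilinear_lsub[OF \<gamma>(1)] bilinear_rsub[OF \<gamma>(1)]
  bilinear_lmul[OF \<gamma>(1)] bilinear_rmul[OF \<gamma>(1)] bilinear_lzero[OF \<gamma>(1)] bilinear_rzero[OF \<gamma>(1)]
  bilinear_lneg[OF \<gamma>(1)] bilinear_rneg[OF \<gamma>(1)]
  linear_add[OF \<gamma>(2)] linear_cmul[OF \<gamma>(2)] linear_diff[OF \<gamma>(2)] linear_neg[OF \<gamma>(2)] linear_0[OF \<gamma>(2)]
  linear_add[OF linear_dual_app] linear_cmul[OF linear_dual_app] linear_diff[OF linear_dual_app]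
  linear_neg[OF linear_dual_app] linear_0[OF linear_dual_app]
  dual_app_0 dual_app_add dual_app_diff dual_app_uminus dual_app_scaleR

lemma \<alpha>_anti: "\<alpha> x y = - \<alpha> y x"
  by (rule alternating_bilinear_antisym[OF \<alpha>(1,2)])

lemma \<gamma>_anti23: "\<gamma> x y z = - \<gamma> x z y"
  by (rule alternating_bilinear_antisym[OF \<gamma>(1,4)])

lemma \<gamma>_anti12: "\<gamma> x y z = - \<gamma> y x z"
proof -
  have l: "linear (\<lambda>y. \<gamma> x y z)" for x using \<gamma>(1)[of x] by (simp add: bilinear_def)
  have "bilinear (\<lambda>x y. \<gamma> x y z)" unfolding bilinear_def using l \<gamma>(2) by blast
  from alternating_bilinear_antisym[OF this \<gamma>(3)] show ?thesis .
qed

lemma \<gamma>_cycle: "\<gamma> x y z = \<gamma> z x y"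
  using \<gamma>_anti12[of z x y] \<gamma>_anti23[of x z y] by simp

text \<open>The three components of an element of \<open>\<ll>\<^sup>* \<oplus> \<aa> \<oplus> \<ll>\<close>, the first one as a functional. Equations in
  the model are checked componentwise by \<open>model_eq_iff\<close> and the formulas for the components.\<close>

abbreviation zc :: "'l dual \<times> 'a \<times> 'l \<Rightarrow> 'l \<Rightarrow> real" where "zc x \<equiv> dual_app (fst x)"
abbreviation ac :: "'l dual \<times> 'a \<times> 'l \<Rightarrow> 'a" where "ac x \<equiv> fst (snd x)"
abbreviation lc :: "'l dual \<times> 'a \<times> 'l \<Rightarrow> 'l" where "lc x \<equiv> snd (snd x)"

abbreviation G where "G \<equiv> model_bracket br \<rho> ip \<alpha> \<gamma>"
abbreviation T where "T \<equiv> model_involution \<theta>l \<theta>a"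
abbreviation P :: "'l dual \<times> 'a \<times> 'l \<Rightarrow> 'l dual \<times> 'a \<times> 'l \<Rightarrow> real" where "P \<equiv> model_product ip"

lemma model_eq_iff: "x = y \<longleftrightarrow> (\<forall>X. zc x X = zc y X) \<and> ac x = ac y \<and> lc x = lc y"
  by (auto simp: dual_eq_iff prod_eq_iff)

lemma lc_G: "lc (G x y) = br (lc x) (lc y)"
  by (simp add: model_bracket_def case_prod_unfold)

lemma ac_G: "ac (G x y) = \<alpha> (lc x) (lc y) + \<rho> (lc x) (ac y) - \<rho> (lc y) (ac x)"
  by (simp add: model_bracket_def case_prod_unfold)

lemma zc_G: "zc (G x y) X = \<gamma> (lc x) (lc y) X - ip (ac y) (\<alpha> (lc x) X) + ip (ac x) (\<alpha> (lc y) X)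
    - zc y (br (lc x) X) + zc x (br (lc y) X) + ip (\<rho> X (ac x)) (ac y)"
proof -
  have "linear (\<lambda>L. \<gamma> (lc x) (lc y) L - ip (ac y) (\<alpha> (lc x) L) + ip (ac x) (\<alpha> (lc y) L)
    - zc y (br (lc x) L) + zc x (br (lc y) L) + ip (\<rho> L (ac x)) (ac y))"
    by (rule linearI) (simp_all add: lin_simps algebra_simps)
  from dual_app_of_linear[OF this, of X] show ?thesis
    by (simp add: model_bracket_def case_prod_unfold)
qed

lemma lc_T: "lc (T x) = \<theta>l (lc x)" and ac_T: "ac (T x) = \<theta>a (ac x)"
  by (simp_all add: model_involution_def case_prod_unfold)

lemma zc_T: "zc (T x) X = zc x (\<theta>l X)"
proof -
  have "linear (\<lambda>X. zc x (\<theta>l X))"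
    using linear_compose[OF \<theta>l(1) linear_dual_app[of "fst x"]] by (simp add: o_def)
  from dual_app_of_linear[OF this, of X] show ?thesis by (simp add: model_involution_def case_prod_unfold)
qed

lemma P_eq: "P x y = ip (ac x) (ac y) + zc x (lc y) + zc y (lc x)"
  by (simp add: model_product_def case_prod_unfold)

lemmas comp_simps = zc_G ac_G lc_G zc_T ac_T lc_T

lemma bilinear_G: "bilinear G"
  unfolding bilinear_def
  by (intro conjI allI linearI; unfold model_eq_iff)
    (simp_all add: comp_simps lin_simps algebra_simps)

lemma G_self: "G x x = 0"
  unfolding model_eq_iff using A.sym[of "\<rho> X (ac x)" "ac x" for X] ip_skew[of X "ac x" "ac x" for X]
  by (simp add: comp_simps lin_simps \<alpha>(2) \<gamma>(3) L.br_self)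

lemma jacobi_l: "br x (br y z) = br (br x y) z + br y (br x z)"
  using L.\<sigma>_br[of x y z] by (simp add: algebra_simps)

text \<open>Evaluated at \<open>X \<in> \<ll>\<close>, the \<open>\<ll>\<^sup>*\<close>-component of the Jacobi identity collects: \<open>d\<gamma> = 1/2 \<langle>\<alpha> \<and> \<alpha>\<rangle>\<close> at the
  \<open>\<ll>\<close>-components, \<open>d\<alpha> = 0\<close> paired with each of the \<open>\<aa>\<close>-components, skewness of \<open>\<rho>\<close> and the Jacobi identity of
  \<open>\<ll>\<close>. The facts below bring all terms into a common form, in which the identity is linear.\<close>

lemma G_jacobi_z: "zc (G x (G y z) + G y (G z x) + G z (G x y)) X = 0"
proof -
  define Z1 Z2 Z3 A1 A2 A3 a b c where d: "Z1 = zc x" "Z2 = zc y" "Z3 = zc z" "A1 = ac x" "A2 = ac y" "A3 = ac z"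
    "a = lc x" "b = lc y" "c = lc z"
  have zadd: "zc w (u + v) = zc w u + zc w v" "zc w (u - v) = zc w u - zc w v" for w u v
    by (simp_all add: lin_simps)
  have J: "br (br u v) X = br u (br v X) - br v (br u X)" for u v by (rule L.\<sigma>_br)
  have dg: "- \<gamma> (br a b) c X + \<gamma> (br a c) b X - \<gamma> (br a X) b c - \<gamma> (br b c) a X + \<gamma> (br b X) a c - \<gamma> (br c X) a b
    = ip (\<alpha> a b) (\<alpha> c X) - ip (\<alpha> a c) (\<alpha> b X) + ip (\<alpha> a X) (\<alpha> b c)"
    using \<gamma>(6)[of a b c X]
    by (simp add: ce_d3_def triv_rep_def wedge_22_def A.sym[of "\<alpha> c X" "\<alpha> a b"] A.sym[of "\<alpha> b X" "\<alpha> a c"] A.sym[of "\<alpha> a X" "\<alpha> b c"])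
  have gs: "\<gamma> a (br b c) X = - \<gamma> (br b c) a X" "\<gamma> b (br c a) X = \<gamma> (br a c) b X" "\<gamma> c (br a b) X = - \<gamma> (br a b) c X"
    "\<gamma> b c (br a X) = \<gamma> (br a X) b c" "\<gamma> c a (br b X) = - \<gamma> (br b X) a c" "\<gamma> a b (br c X) = \<gamma> (br c X) a b"
    using \<gamma>_anti12[of a "br b c" X] \<gamma>_anti12[of b "br c a" X] \<gamma>_anti12[of c "br a b" X] L.br_anti[of c a]
      \<gamma>_cycle[of b c "br a X"] \<gamma>_cycle[of c a "br b X"] \<gamma>_anti23[of "br b X" c a] \<gamma>_cycle[of a b "br c X"]
    by (simp_all add: lin_simps)
  have da: "ip u (\<rho> p (\<alpha> q X)) - ip u (\<rho> q (\<alpha> p X)) + ip u (\<rho> X (\<alpha> p q)) - ip u (\<alpha> (br p q) X)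
      - ip u (\<alpha> q (br p X)) + ip u (\<alpha> p (br q X)) = 0" for u p q
  proof -
    have "ip u (ce_d2 br \<rho> \<alpha> p q X) = 0" by (simp add: \<alpha>(4) lin_simps)
    then show ?thesis using \<alpha>_anti[of "br p X" q] \<alpha>_anti[of "br q X" p] by (simp add: ce_d2_def lin_simps)
  qed
  note da3 = da[of A1 b c] da[of A2 c a] da[of A3 a b]
  have sk: "ip (\<rho> p u) v = - ip u (\<rho> p v)" for p u v by (rule ip_skew)
  have sk2: "ip u (\<rho> p (\<rho> q v)) = ip v (\<rho> q (\<rho> p u))" for p q u v
    using ip_skew[of p u "\<rho> q v"] ip_skew[of q "\<rho> p u" v] A.sym[of v "\<rho> q (\<rho> p u)"] by simp
  have rb: "ip u (\<rho> (br p X) v) = ip u (\<rho> p (\<rho> X v)) - ip u (\<rho> X (\<rho> p v))" for p u v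
    by (simp add: rho.\<sigma>_br lin_simps)
  have ca: "br c a = - br a c" by (rule L.br_anti)
  have aca: "\<alpha> c a = - \<alpha> a c" by (rule \<alpha>_anti)
  note s = sk2[of A1 X b A3] sk2[of A1 b X A3] sk2[of A1 X c A2] sk2[of A1 c X A2] sk2[of A2 X c A1] sk2[of A2 c X A1]
    sk2[of A2 X a A3] sk2[of A2 a X A3] sk2[of A3 X a A2] sk2[of A3 a X A2] sk2[of A3 X b A1] sk2[of A3 b X A1]
  note sym = A.sym[of "\<alpha> b c" "\<alpha> a X"] A.sym[of "\<alpha> a c" "\<alpha> b X"] A.sym[of "\<alpha> a b" "\<alpha> c X"]
  have zd: "Z1 (u - v) = Z1 u - Z1 v" "Z2 (u - v) = Z2 u - Z2 v" "Z3 (u - v) = Z3 u - Z3 v" for u v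
    by (simp_all add: d lin_simps)
  show ?thesis
    using dg gs da3 s sym
    by (simp add: comp_simps lin_simps d[symmetric] sk rb J aca ca zd; linarith?)
qed

lemma lie_algebra_G: "lie_algebra G"
  unfolding lie_algebra_def
proof (intro conjI allI)
  show "fin_dim TYPE('l dual \<times> 'a \<times> 'l)"
    by (intro fin_dim_prod fin_dim_dual rho.fdl rho.fdv)
  show "G x (G y z) + G y (G z x) + G z (G x y) = 0" for x y z
  proof -
    have 1: "lc (G x (G y z) + G y (G z x) + G z (G x y)) = 0"
      using rho.jacobi[of "lc x" "lc y" "lc z"] by (simp add: comp_simps)
    have 2: "ac (G x (G y z) + G y (G z x) + G z (G x y)) = 0"
      using \<alpha>(4)[of "lc x" "lc y" "lc z"] \<alpha>_anti[of "lc x" "br (lc y) (lc z)"] \<alpha>_anti[of "lc y" "br (lc z) (lc x)"]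
        \<alpha>_anti[of "lc z" "br (lc x) (lc y)"] L.br_anti[of "lc z" "lc x"] \<alpha>_anti[of "lc z" "lc x"]
      by (simp add: comp_simps lin_simps ce_d2_def rho.\<sigma>_br algebra_simps)
    show ?thesis unfolding model_eq_iff using 1 2 G_jacobi_z[of x y z] by (simp add: dual_app_0)
  qed
qed (rule bilinear_G G_self)+

lemma G_invariant: "P (G x y) z = - P y (G x z)"
  using \<gamma>_anti23[of "lc x" "lc y" "lc z"] \<alpha>_anti[of "lc y" "lc z"] ip_skew[of "lc x" "ac y" "ac z"]
    ip_skew[of "lc y" "ac x" "ac z"] ip_skew[of "lc z" "ac x" "ac y"]
    A.sym[of "ac z" "\<alpha> (lc x) (lc y)"] A.sym[of "ac x" "\<alpha> (lc y) (lc z)"] A.sym[of "\<rho> (lc y) (ac x)" "ac z"]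
    L.br_anti[of "lc z" "lc y"]
    A.sym[of "ac y" "\<rho> (lc z) (ac x)"]
  by (simp add: P_eq comp_simps lin_simps)

lemma scalar_product_P: "scalar_product P"
proof -
  have b: "bilinear P"
    unfolding bilinear_def
    by (intro conjI allI linearI) (simp_all add: P_eq lin_simps algebra_simps)
  have s: "P x y = P y x" for x y by (simp add: P_eq A.sym[of "ac x" "ac y"])
  have n: "x = 0" if "\<And>y. P x y = 0" for x
  proof -
    have l: "zc x L = 0" for L using that[of "(0, 0, L)"] by (simp add: P_eq lin_simps)
    have "ip (ac x) a = 0" for a using that[of "(0, a, 0)"] by (simp add: P_eq lin_simps)
    then have a: "ac x = 0" by (rule A.nondeg)
    have z: "dual_app Z (lc x) = 0" for Z using that[of "(Z, 0, 0)"] by (simp add: P_eq lin_simps)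
    from dual_separates[OF z] have "lc x = 0" .
    then show ?thesis using l a by (simp add: model_eq_iff dual_app_0)
  qed
  show ?thesis unfolding scalar_product_def nondegenerate_on_def using b s n by auto
qed

sublocale M: metric_lie G P
proof unfold_locales
  show "lie_algebra G" by (rule lie_algebra_G)
  then show "fin_dim TYPE('l dual \<times> 'a \<times> 'l)" by (simp add: lie_algebra_def)
qed (rule scalar_product_P G_invariant)+

lemma T_aut: "T (G x y) = G (T x) (T y)"
proof -
  have a1: "\<theta>a (\<alpha> u v) = \<alpha> (\<theta>l u) (\<theta>l v)" for u v using \<alpha>(3)[of "\<theta>l u" "\<theta>l v"] by (simp add: \<theta>l)
  have r1: "\<theta>a (\<rho> u v) = \<rho> (\<theta>l u) (\<theta>a v)" for u v using \<theta>a(4)[of "\<theta>l u" v] by (simp add: \<theta>l)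
  have i1: "ip (\<theta>a u) (\<alpha> (\<theta>l v) X) = ip u (\<alpha> v (\<theta>l X))" for u v X
    using \<theta>a(3)[of u "\<alpha> v (\<theta>l X)"] by (simp add: a1 \<theta>l)
  have i2: "ip (\<rho> X (\<theta>a u)) (\<theta>a v) = ip (\<rho> (\<theta>l X) u) v" for u v X
    using \<theta>a(3)[of "\<rho> (\<theta>l X) u" v] by (simp add: r1 \<theta>l)
  have g1: "\<gamma> (\<theta>l u) (\<theta>l v) X = \<gamma> u v (\<theta>l X)" for u v X using \<gamma>(5)[of u v "\<theta>l X"] by (simp add: \<theta>l)
  show ?thesis
    unfolding model_eq_iff
    by (simp add: comp_simps linear_add[OF \<theta>a(1)] linear_diff[OF \<theta>a(1)] a1 r1 i1 i2 g1 \<theta>l(2,3))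
qed

lemma linear_T: "linear T" 
  by (rule linearI; unfold model_eq_iff)
    (simp_all add: comp_simps linear_add[OF \<theta>a(1)] linear_add[OF \<theta>l(1)] linear_cmul[OF \<theta>a(1)] linear_cmul[OF \<theta>l(1)] dual_app_add dual_app_scaleR)

lemma T_T: "T (T x) = x"
  unfolding model_eq_iff by (simp add: comp_simps \<theta>l \<theta>a)

lemma P_T: "P (T x) (T y) = P x y"
  by (simp add: P_eq comp_simps \<theta>l \<theta>a)

lemma metric_model: "metric_lie_algebra_with_involution G T P"
  unfolding metric_lie_algebra_with_involution_def lie_algebra_with_involution_def involution_def
  using lie_algebra_G linear_T T_T T_aut scalar_product_P G_invariant P_T by blast

end

section \<open>Balancedness of the standard model\<close>

lemma linear_onD:
  assumes "linear_on U f" "subspace U"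
  shows "x \<in> U \<Longrightarrow> y \<in> U \<Longrightarrow> f (x + y) = f x + f y" "x \<in> U \<Longrightarrow> f (r *\<^sub>R x) = r *\<^sub>R f x" "f 0 = 0"
proof -
  show "x \<in> U \<Longrightarrow> y \<in> U \<Longrightarrow> f (x + y) = f x + f y" "x \<in> U \<Longrightarrow> f (r *\<^sub>R x) = r *\<^sub>R f x"
    using assms(1) by (auto simp: linear_on_def)
  have "f (0 *\<^sub>R 0) = 0 *\<^sub>R f 0" using assms(1) real_vector.subspace_0[OF assms(2)] unfolding linear_on_def by blast
  then show "f 0 = 0" by simp
qed

lemma linear_imp_linear_on: "linear f \<Longrightarrow> linear_on U f"
  by (simp add: linear_on_def linear_add linear_cmul)

lemma linear_on_extends:
  assumes U: "subspace U" and f: "linear_on U f"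
  shows "\<exists>g. linear g \<and> (\<forall>x\<in>U. g x = f x)"
proof -
  obtain p where p: "linear p" "\<And>x. p x \<in> U" "\<And>x. x \<in> U \<Longrightarrow> p x = x" using subspace_projection[OF U] by blast
  have "linear (\<lambda>x. f (p x))"
    by (rule linearI) (simp_all add: linear_add[OF p(1)] linear_cmul[OF p(1)] p(2) linear_onD[OF f U])
  then show ?thesis using p(3) by (intro exI[of _ "\<lambda>x. f (p x)"]) simp
qed

context quad_ext
begin

text \<open>\<open>Lstar\<close> is the isotropic ideal \<open>\<ll>\<^sup>*\<close>, and \<open>Lstar_perp\<close> the ideal \<open>\<ll>\<^sup>* \<oplus> \<aa>\<close>.\<close>

abbreviation SG where "SG \<equiv> S_ideal G"
abbreviation RG where "RG \<equiv> R_ideal G"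
abbreviation RL where "RL \<equiv> R_ideal br"

definition Lstar_perp :: "('l dual \<times> 'a \<times> 'l) set" where "Lstar_perp = {x. lc x = 0}"

abbreviation Lstar :: "('l dual \<times> 'a \<times> 'l) set" where "Lstar \<equiv> model_ideal"

lemma Lstar_iff: "x \<in> Lstar \<longleftrightarrow> lc x = 0 \<and> ac x = 0"
  by (cases x) (auto simp: model_ideal_def)

lemma Lstar_perp_iff: "x \<in> Lstar_perp \<longleftrightarrow> lc x = 0"
  by (simp add: Lstar_perp_def)

lemma linear_lc: "linear (\<lambda>x :: 'l dual \<times> 'a \<times> 'l. lc x)" and linear_ac: "linear (\<lambda>x :: 'l dual \<times> 'a \<times> 'l. ac x)"
  by (auto intro!: linearI)

lemma Lstar_perp_ideal: "lie_ideal G Lstar_perp"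
  unfolding submodule_def real_vector.subspace_def by (simp add: Lstar_perp_iff lc_G lin_simps)

lemma Lstar_ideal: "lie_ideal G Lstar"
  unfolding submodule_def real_vector.subspace_def by (simp add: Lstar_iff lc_G ac_G lin_simps)

lemma perp_of_Lstar: "perp P Lstar = Lstar_perp"
proof -
  have "lc x = 0" if "\<And>y. y \<in> Lstar \<Longrightarrow> P x y = 0" for x
  proof (rule dual_separates)
    fix Z
    have "P x (Z, 0, 0) = 0" by (rule that) (simp add: Lstar_iff)
    then show "dual_app Z (lc x) = 0" by (simp add: P_eq lin_simps)
  qed
  then have "x \<in> Lstar_perp" if "x \<in> perp P Lstar" for x using that by (simp add: perp_def Lstar_perp_iff)
  then have "perp P Lstar \<subseteq> Lstar_perp" by (rule subsetI)
  moreover have "Lstar_perp \<subseteq> perp P Lstar" by (auto simp: perp_def Lstar_perp_iff Lstar_iff P_eq lin_simps)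
  ultimately show ?thesis by blast
qed

lemma perp_of_Lstar_perp: "perp P Lstar_perp = Lstar"
  using M.form.perp_perp[OF submodule_subspace[OF Lstar_ideal]] by (simp add: perp_of_Lstar)

lemma surj_lc: "surj (\<lambda>x :: 'l dual \<times> 'a \<times> 'l. lc x)"
  by (rule surjI[of _ "\<lambda>L. (0, 0, L)"]) simp

lemma lc_hom: "lie_ideal G D \<Longrightarrow> module_hom_on G br D (\<lambda>x. lc x) (\<lambda>x. lc x)"
  by (intro module_hom_on.intro module_hom_on_axioms.intro M.module_action_axioms L.module_action_axioms linear_lc surj_lc)
    (assumption, rule lc_G)

lemma ac_hom: "lie_ideal G D \<Longrightarrow> D \<subseteq> Lstar_perp \<Longrightarrow> module_hom_on G \<rho> D (\<lambda>x. ac x) (\<lambda>x. lc x)"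
  by (intro module_hom_on.intro module_hom_on_axioms.intro M.module_action_axioms rho.module_action_axioms linear_ac surj_lc)
    (assumption, simp add: ac_G Lstar_perp_iff lin_simps subset_eq)

lemma R_ideal_projection: "RL k = (\<lambda>x. lc x) ` RG k"
  by (rule R_ideal_image[where f = "\<lambda>x. lc x", OF lie_algebra_G L.la linear_lc surj_lc]) (rule lc_G)

text \<open>\<open>S\<^sub>k(\<dd>)\<close> is the orthogonal of \<open>R\<^sub>k(\<dd>)\<close>, which projects onto \<open>R\<^sub>k(\<ll>)\<close>.\<close>

lemma S_ideal_Lstar_iff: "x \<in> Lstar \<Longrightarrow> x \<in> SG k \<longleftrightarrow> (\<forall>X\<in>RL k. zc x X = 0)"
proof -
  assume x: "x \<in> Lstar"
  have "P x y = zc x (lc y)" for y using x by (simp add: Lstar_iff P_eq lin_simps)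
  then show ?thesis by (simp add: M.S_ideal_perp R_ideal_projection perp_def)
qed

lemma balanced_perp:
  "balanced G Lstar \<longleftrightarrow> perp P (canonical_ideal G) = Lstar_perp"
proof
  assume "balanced G Lstar"
  then have "canonical_ideal G = Lstar" unfolding balanced_def by (rule sym)
  then show "perp P (canonical_ideal G) = Lstar_perp" by (simp only: perp_of_Lstar)
next
  have s: "subspace (canonical_ideal G)" unfolding canonical_ideal_def by (rule real_vector.subspace_span)
  assume "perp P (canonical_ideal G) = Lstar_perp"
  then have "perp P (perp P (canonical_ideal G)) = Lstar" by (simp only: perp_of_Lstar_perp)
  then show "balanced G Lstar" unfolding balanced_def M.form.perp_perp[OF s] by (rule sym)
qed

text \<open>The statements \<open>P\<^sub>k\<close> and \<open>Q\<^sub>k\<close> of the proof idea above.\<close>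

definition steps_project_to_zero :: "nat \<Rightarrow> bool" where "steps_project_to_zero k \<longleftrightarrow> SG (Suc k) \<inter> RG k \<subseteq> Lstar_perp"
definition diagonal_in_Lstar :: "nat \<Rightarrow> bool" where "diagonal_in_Lstar k \<longleftrightarrow> SG k \<inter> RG k \<subseteq> Lstar"

text \<open>\<open>P\<^sub>k\<close> for all \<open>k\<close> means \<open>\<ii>(\<dd>)\<^sup>\<bottom> \<subseteq> (\<ll>\<^sup>*)\<^sup>\<bottom>\<close>, as \<open>\<ii>(\<dd>)\<^sup>\<bottom>\<close> is spanned by the
  \<open>S\<^bsub>k+1\<^esub> \<inter> R\<^sub>k\<close>, and \<open>Q\<^sub>k\<close> for all \<open>k\<close> means \<open>\<ii>(\<dd>) \<subseteq> \<ll>\<^sup>*\<close>.\<close>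

lemma balanced_iff: "balanced G Lstar \<longleftrightarrow> (\<forall>k. steps_project_to_zero k) \<and> (\<forall>k. diagonal_in_Lstar k)"
proof
  assume bal: "balanced G Lstar"
  then have c: "canonical_ideal G = Lstar" unfolding balanced_def by (rule sym)
  have pc: "perp P (canonical_ideal G) = Lstar_perp" using bal unfolding balanced_perp .
  have "steps_project_to_zero k" for k
    unfolding steps_project_to_zero_def using M.filtration_in_canonical_perp[of _ k] unfolding pc by blast
  moreover have "diagonal_in_Lstar k" for k
  proof (cases "k = 0")
    case True
    then show ?thesis by (auto simp: diagonal_in_Lstar_def Lstar_iff)
  next
    case False
    then have "SG k \<inter> RG k \<subseteq> (\<Union>k\<in>{1..}. SG k \<inter> RG k)" by (intro UN_upper) auto
    then have "SG k \<inter> RG k \<subseteq> canonical_ideal G"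
      unfolding canonical_ideal_def using real_vector.span_superset by (rule subset_trans)
    then show ?thesis using c by (simp add: diagonal_in_Lstar_def)
  qed
  ultimately show "(\<forall>k. steps_project_to_zero k) \<and> (\<forall>k. diagonal_in_Lstar k)" by blast
next
  assume PQ: "(\<forall>k. steps_project_to_zero k) \<and> (\<forall>k. diagonal_in_Lstar k)"
  have "canonical_ideal G \<subseteq> Lstar"
    unfolding canonical_ideal_def
    by (rule real_vector.span_minimal[OF _ submodule_subspace[OF Lstar_ideal]]) (use PQ in \<open>auto simp: diagonal_in_Lstar_def\<close>)
  from perp_antimono[OF this, of P] have 1: "Lstar_perp \<subseteq> perp P (canonical_ideal G)" by (simp only: perp_of_Lstar)
  have "perp P (canonical_ideal G) \<subseteq> Lstar_perp"
    by (rule M.perp_canonical_subset[OF submodule_subspace[OF Lstar_perp_ideal]]) (use PQ in \<open>simp add: steps_project_to_zero_def\<close>)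
  then show "balanced G Lstar" unfolding balanced_perp using 1 by (rule subset_antisym)
qed

subsection \<open>Central elements\<close>

text \<open>The equations in \<open>A\<^sub>0\<close> say that \<open>(Z\<^sub>0, -A\<^sub>0, L\<^sub>0)\<close> commutes with all of \<open>\<dd>\<close>.\<close>

lemma cond_A0_iff: "cond_A0 br \<rho> ip \<alpha> \<gamma> \<longleftrightarrow> (\<forall>x. (\<forall>y. G y x = 0) \<longrightarrow> lc x = 0)"
proof
  assume A0: "cond_A0 br \<rho> ip \<alpha> \<gamma>"
  show "\<forall>x. (\<forall>y. G y x = 0) \<longrightarrow> lc x = 0"
  proof (intro allI impI)
    fix x assume c: "\<forall>y. G y x = 0"
    have 1: "br L (lc x) = 0" for L using c[rule_format, of "(0, 0, L)"] lc_G[of "(0, 0, L)" x] by simp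
    have 2: "\<rho> (lc x) a = 0" for a
      using c[rule_format, of "(0, a, 0)"] ac_G[of "(0, a, 0)" x] by (simp add: lin_simps)
    have 3: "\<alpha> L (lc x) = \<rho> L (- ac x)" for L
      using c[rule_format, of "(0, 0, L)"] ac_G[of "(0, 0, L)" x] by (simp add: lin_simps eq_neg_iff_add_eq_0)
    have 4: "\<gamma> L (lc x) X = - ip (- ac x) (\<alpha> L X) + zc x (br L X)" for L X
      using c[rule_format, of "(0, 0, L)"] zc_G[of "(0, 0, L)" x X] by (simp add: lin_simps)
    show "lc x = 0"
      using A0[unfolded cond_A0_def, rule_format, of "lc x"] 1 2 3 4 by blast
  qed
next
  assume c: "\<forall>x. (\<forall>y. G y x = 0) \<longrightarrow> lc x = 0"
  show "cond_A0 br \<rho> ip \<alpha> \<gamma>"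
    unfolding cond_A0_def
  proof (intro allI impI, elim conjE exE)
    fix L0 A0 and Z0 :: "'l dual"
    assume 1: "\<forall>L. br L L0 = 0" and 2: "\<forall>A. \<rho> L0 A = 0"
      and 3: "\<forall>L. \<alpha> L L0 = \<rho> L A0 \<and> (\<forall>X. \<gamma> L L0 X = - ip A0 (\<alpha> L X) + dual_app Z0 (br L X))"
    have "G y (Z0, - A0, L0) = 0" for y
      unfolding model_eq_iff
      using 1 2 3 \<alpha>_anti[of L0] ip_skew[of _ "ac y" A0] L.br_anti[of L0]
      by (simp add: comp_simps lin_simps)
    then show "L0 = 0" using c[rule_format, of "(Z0, - A0, L0)"] by simp
  qed
qed

text \<open>Brackets of \<open>V\<close> with \<open>\<ll>\<^sup>*\<close> lie in \<open>V \<inter> \<ll>\<^sup>* = 0\<close>; by duality the \<open>\<ll>\<close>-components of \<open>V\<close> are central,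
  whence all brackets lie in \<open>V \<inter> (\<ll>\<^sup>* \<oplus> \<aa>) = 0\<close>.\<close>

lemma ideal_disjoint_from_Lstar_perp_central:
  assumes V: "lie_ideal G V" and d: "V \<inter> Lstar_perp \<subseteq> {0}" and x: "x \<in> V"
  shows "G y x = 0"
proof -
  have z: "G y x = 0" if "lc (G y x) = 0" for y
    using submoduleD[OF V x, of y] d that by (auto simp: Lstar_perp_iff)
  have "br (lc x) X = 0" for X
  proof (rule dual_separates)
    fix Z
    have "G (Z, 0, 0) x = 0" by (rule z) (simp add: lc_G lin_simps)
    then show "dual_app Z (br (lc x) X) = 0" using zc_G[of "(Z, 0, 0)" x X] by (simp add: lin_simps)
  qed
  then have "lc (G y x) = 0" using L.br_anti[of "lc y" "lc x"] by (simp add: lc_G)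
  then show ?thesis by (rule z)
qed

text \<open>In the semi-simple ideal \<open>S\<^sub>1(\<dd>)\<close> there is an ideal complementary to \<open>S\<^sub>1(\<dd>) \<inter> (\<ll>\<^sup>* \<oplus> \<aa>)\<close>. It is
  central, so it projects to zero by \<open>A\<^sub>0\<close>.\<close>

lemma steps_project_to_zero_0: assumes A0: "cond_A0 br \<rho> ip \<alpha> \<gamma>" shows "steps_project_to_zero 0"
proof -
  let ?S = "SG (Suc 0)"
  have ss: "semisimple_quotient G ?S {0}" using M.S_ideal_Suc(2)[of 0] by simp
  have sub: "lie_ideal G (?S \<inter> Lstar_perp)" by (rule submodule_Int[OF M.S_ideal_ideal Lstar_perp_ideal])
  have z: "{0} \<subseteq> ?S \<inter> Lstar_perp" using real_vector.subspace_0[OF submodule_subspace[OF sub]] by simp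
  obtain V where V: "lie_ideal G V" "{0} \<subseteq> V" "V \<subseteq> ?S" "ssum (?S \<inter> Lstar_perp) V = ?S" "?S \<inter> Lstar_perp \<inter> V = {0}"
    by (rule semisimple_quotientE[OF ss sub z Int_lower1])
  have d: "V \<inter> Lstar_perp \<subseteq> {0}" using V(3,5) by blast
  have "V \<subseteq> Lstar_perp"
  proof
    fix x assume "x \<in> V"
    then have "\<forall>y. G y x = 0" using ideal_disjoint_from_Lstar_perp_central[OF V(1) d] by blast
    then show "x \<in> Lstar_perp" using A0 unfolding cond_A0_iff Lstar_perp_iff by blast
  qed
  then have "?S \<subseteq> Lstar_perp"
    using V(4) ssum_least[OF submodule_subspace[OF Lstar_perp_ideal], of "?S \<inter> Lstar_perp" V] by blast
  then show ?thesis by (auto simp: steps_project_to_zero_def)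
qed

subsection \<open>Ideals with given projection to \<open>\<ll>\<close>\<close>

text \<open>Modulo \<open>S\<^sub>k\<close> take an ideal \<open>V\<close> complementary to the kernel of the projection of
  \<open>S\<^bsub>k+1\<^esub> \<inter> R\<^sub>k\<close> to \<open>\<ll>\<close>. Its image is an ideal in \<open>S\<^sub>1(\<ll>) \<inter> R\<^sub>k(\<ll>)\<close>, and a linear section \<open>s\<close> of
  the projection of \<open>V\<close> is equivariant up to elements of \<open>\<ll>\<^sup>* \<inter> S\<^sub>k\<close>, which vanish on
  \<open>R\<^sub>k(\<ll>)\<close>. The components of this equivariance are the equations of \<open>A\<^sub>k\<close>.\<close>

lemma steps_project_to_zero_from_cond_A:
  assumes A: "cond_A br \<rho> ip \<alpha> \<gamma> k" and Q: "diagonal_in_Lstar k"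
  shows "steps_project_to_zero k"
proof -
  let ?W = "SG (Suc k) \<inter> RG k"
  have W: "lie_ideal G ?W" by (rule submodule_Int[OF M.S_ideal_ideal M.R_ideal_ideal])
  have W0: "?W \<inter> SG k = SG k \<inter> RG k" using M.S_ideal_Suc(1)[of k] by blast
  have ss: "semisimple_quotient G ?W (?W \<inter> SG k)"
    by (rule M.semisimple_filtration_section[OF W Int_lower1])
  have W0i: "?W \<inter> SG k \<subseteq> Lstar" using Q W0 by (simp add: diagonal_in_Lstar_def)
  have Lstar_subset: "Lstar \<subseteq> Lstar_perp" by (auto simp: Lstar_iff Lstar_perp_iff)
  have Wj: "lie_ideal G (?W \<inter> Lstar_perp)" by (rule submodule_Int[OF W Lstar_perp_ideal])
  have WW: "?W \<inter> SG k \<subseteq> ?W \<inter> Lstar_perp" using W0i Lstar_subset by blast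
  obtain V where V: "lie_ideal G V" "?W \<inter> SG k \<subseteq> V" "V \<subseteq> ?W" "ssum (?W \<inter> Lstar_perp) V = ?W" "?W \<inter> Lstar_perp \<inter> V = ?W \<inter> SG k"
    by (rule semisimple_quotientE[OF ss Wj WW Int_lower1])
  have Vj: "x \<in> Lstar \<and> x \<in> SG k" if "x \<in> V" "lc x = 0" for x
  proof -
    have "x \<in> ?W \<inter> Lstar_perp \<inter> V" using that V(3) by (auto simp: Lstar_perp_iff)
    then have "x \<in> ?W \<inter> SG k" using V(5) by simp
    then show ?thesis using W0i by blast
  qed
  interpret H: module_hom_on G br UNIV "\<lambda>x. lc x" "\<lambda>x. lc x" by (rule lc_hom[OF submodule_UNIV])
  let ?k = "(\<lambda>x. lc x) ` V"
  have lcW: "lc x \<in> ?k" if x: "x \<in> ?W" for x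
  proof -
    have "x \<in> ssum (?W \<inter> Lstar_perp) V" using V(4) x by simp
    then obtain w v where "w \<in> ?W \<inter> Lstar_perp" "v \<in> V" "x = w + v" by (elim ssumE)
    then have "lc x = lc v" by (simp add: Lstar_perp_iff)
    then show ?thesis using \<open>v \<in> V\<close> by blast
  qed
  have kid: "lie_ideal br ?k" by (rule H.submodule_image[OF V(1) subset_UNIV])
  note sk = submodule_subspace[OF kid] and sV = submodule_subspace[OF V(1)]
  have kR: "?k \<subseteq> RL k" unfolding R_ideal_projection using V(3) by blast
  have "semisimple_quotient G V (?W \<inter> SG k)"
    by (rule M.semisimple_quotient_interval[OF ss V(1) submodule_Int[OF W M.S_ideal_ideal] subset_refl V(2,3)])
  then have "semisimple_quotient br ?k ((\<lambda>x. lc x) ` (?W \<inter> SG k))"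
    by (rule H.semisimple_quotient_image[OF V(1) subset_UNIV submodule_Int[OF W M.S_ideal_ideal] V(2)])
  moreover have "(\<lambda>x. lc x) ` (?W \<inter> SG k) = {0}"
  proof -
    have "0 \<in> ?W \<inter> SG k" by (rule real_vector.subspace_0[OF submodule_subspace[OF submodule_Int[OF W M.S_ideal_ideal]]])
    then have "0 \<in> (\<lambda>x. lc x) ` (?W \<inter> SG k)" by (intro image_eqI[of _ _ 0]) simp_all
    moreover have "(\<lambda>x. lc x) ` (?W \<inter> SG k) \<subseteq> {0}" using W0i by (auto simp: Lstar_iff)
    ultimately show ?thesis by blast
  qed
  ultimately have "semisimple_quotient br ?k (S_ideal br 0)" by simp
  then have kS: "?k \<subseteq> S_ideal br 1"
    using L.S_ideal_Suc(3)[OF kid, of 0] real_vector.subspace_0[OF sk] by simp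
  obtain s where s0: "range s \<subseteq> V \<and> linear s \<and> (\<forall>v\<in>?k. lc (s v) = v)"
    using real_vector.linear_exists_right_inverse_on[OF linear_lc sV] by (elim exE)
  then have s: "\<And>K. s K \<in> V" "linear s" "\<And>K. K \<in> ?k \<Longrightarrow> lc (s K) = K" by auto
  have eq: "\<alpha> L K = \<rho> L (- ac (s K)) - - ac (s (br L K)) \<and>
     (\<forall>X\<in>RL k. \<gamma> L K X = - ip (- ac (s K)) (\<alpha> L X) + zc (s K) (br L X) + zc (s (br L K)) X)"
    if K: "K \<in> ?k" for L K
  proof -
    have bk: "br L K \<in> ?k" by (rule submoduleD[OF kid K])
    \<comment> \<open>the failure of \<open>s\<close> to be equivariant\<close>
    let ?d = "G (0, 0, L) (s K) - s (br L K)"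
    have "?d \<in> V" by (intro real_vector.subspace_diff[OF sV] submoduleD[OF V(1)] s(1))
    moreover have "lc ?d = 0" by (simp add: lc_G s(3)[OF K] s(3)[OF bk])
    ultimately have d: "?d \<in> Lstar \<and> ?d \<in> SG k" by (rule Vj)
    then have d0: "ac ?d = 0" by (simp add: Lstar_iff)
    have dz: "\<forall>X\<in>RL k. zc ?d X = 0" using d S_ideal_Lstar_iff by blast
    have 1: "\<alpha> L K + \<rho> L (ac (s K)) - ac (s (br L K)) = 0"
      using d0 by (simp add: ac_G s(3)[OF K] lin_simps)
    have 2: "\<gamma> L K X - ip (ac (s K)) (\<alpha> L X) - zc (s K) (br L X) - zc (s (br L K)) X = 0" if "X \<in> RL k" for X
      using dz[rule_format, OF that] by (simp add: zc_G s(3)[OF K] lin_simps)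
    show ?thesis
    proof
      show "\<alpha> L K = \<rho> L (- ac (s K)) - - ac (s (br L K))" using 1 by (simp add: lin_simps algebra_simps)
      show "\<forall>X\<in>RL k. \<gamma> L K X = - ip (- ac (s K)) (\<alpha> L X) + zc (s K) (br L X) + zc (s (br L K)) X"
        using 2 by (auto simp: lin_simps algebra_simps)
    qed
  qed
  have "?k = {0}"
  proof (rule A[unfolded cond_A_def, rule_format])
    show "lie_ideal br ?k \<and> ?k \<subseteq> S_ideal br 1 \<inter> RL k \<and>
      (\<exists>\<Phi>\<^sub>1::'l \<Rightarrow> 'a. \<exists>\<Phi>\<^sub>2::'l \<Rightarrow> 'l \<Rightarrow> real.
        linear_on ?k \<Phi>\<^sub>1 \<and> (\<forall>K\<in>?k. linear_on (RL k) (\<Phi>\<^sub>2 K)) \<and> (\<forall>X\<in>RL k. linear_on ?k (\<lambda>K. \<Phi>\<^sub>2 K X)) \<and>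
        (\<forall>L. \<forall>K\<in>?k. \<alpha> L K = \<rho> L (\<Phi>\<^sub>1 K) - \<Phi>\<^sub>1 (br L K) \<and>
          (\<forall>X\<in>RL k. \<gamma> L K X = - ip (\<Phi>\<^sub>1 K) (\<alpha> L X) + \<Phi>\<^sub>2 K (br L X) + \<Phi>\<^sub>2 (br L K) X)))"
    proof (intro conjI exI[of _ "\<lambda>K. - ac (s K)"] exI[of _ "\<lambda>K X. zc (s K) X"])
      show "?k \<subseteq> S_ideal br 1 \<inter> RL k" using kS kR by blast
      show "linear_on ?k (\<lambda>K. - ac (s K))"
        by (simp add: linear_on_def linear_add[OF s(2)] linear_cmul[OF s(2)])
      show "\<forall>K\<in>?k. linear_on (RL k) (\<lambda>X. zc (s K) X)"
        using linear_imp_linear_on[OF linear_dual_app] by blast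
      show "\<forall>X\<in>RL k. linear_on ?k (\<lambda>K. zc (s K) X)"
        by (simp add: linear_on_def linear_add[OF s(2)] linear_cmul[OF s(2)] lin_simps)
    qed (use kid eq in blast)+
  qed
  then show ?thesis unfolding steps_project_to_zero_def using lcW by (auto simp: Lstar_perp_iff)
qed

text \<open>The maps \<open>\<Phi>\<^sub>1\<close>, \<open>\<Phi>\<^sub>2\<close> define a subspace \<open>V\<close> of \<open>\<dd>\<close> with image \<open>\<kk>\<close>. It is an ideal
  because \<open>R\<^sub>k(\<ll>) \<subseteq> R\<^sub>1(\<ll>)\<close> acts trivially on \<open>\<aa>\<close> and on \<open>S\<^sub>1(\<ll>)\<close>, and it lies in
  \<open>S\<^bsub>k+1\<^esub>(\<dd>)\<close> because its part in \<open>\<ll>\<^sup>*\<close> lies in \<open>S\<^sub>k(\<dd>)\<close> and \<open>\<kk>\<close> is semi-simple. Modulo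
  \<open>\<ll>\<^sup>* \<oplus> \<aa> = \<ii>(\<dd>)\<^sup>\<bottom>\<close> it also lies in \<open>R\<^sub>k(\<dd>)\<close>. Together this puts it into every
  \<open>S\<^sub>i + R\<^sub>i\<close>, that is, into \<open>\<ll>\<^sup>* \<oplus> \<aa>\<close>.\<close>

lemma cond_A_from_balanced:
  assumes bal: "balanced G Lstar" and ss: "semisimple \<rho>" and k: "k \<ge> 1"
  shows "cond_A br \<rho> ip \<alpha> \<gamma> k"
  unfolding cond_A_def
proof (intro allI impI, elim conjE exE)
  fix kk :: "'l set" and \<Phi>1 :: "'l \<Rightarrow> 'a" and \<Phi>2 :: "'l \<Rightarrow> 'l \<Rightarrow> real"
  assume kid: "lie_ideal br kk" and kSR: "kk \<subseteq> S_ideal br 1 \<inter> RL k"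
    and l1: "linear_on kk \<Phi>1" and l2: "\<forall>K\<in>kk. linear_on (RL k) (\<Phi>2 K)" and l3: "\<forall>X\<in>RL k. linear_on kk (\<lambda>K. \<Phi>2 K X)"
    and eq: "\<forall>L. \<forall>K\<in>kk. \<alpha> L K = \<rho> L (\<Phi>1 K) - \<Phi>1 (br L K) \<and>
          (\<forall>X\<in>RL k. \<gamma> L K X = - ip (\<Phi>1 K) (\<alpha> L X) + \<Phi>2 K (br L X) + \<Phi>2 (br L K) X)"
  note sk = submodule_subspace[OF kid] and sR = submodule_subspace[OF L.R_ideal_ideal]
  note L1 = linear_onD[OF l1 sk] and L3 = linear_onD[OF l3[rule_format] sk]
  have R1: "X \<in> RL 1" if "X \<in> RL k" for X using L.R_ideal_antimono[OF k] that by blast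
  have rho_vanishes: "\<rho> X a = 0" if "X \<in> RL k" for X a
    by (rule rho.R1_annihilates_semisimple[OF submodule_UNIV ss[unfolded semisimple_def] R1[OF that] UNIV_I])
  have br_vanishes: "br X K = 0" if "X \<in> RL k" "K \<in> kk" for X K
  proof (rule L.R1_annihilates_semisimple[OF L.S_ideal_ideal _ R1[OF that(1)]])
    show "semisimple_quotient br (S_ideal br 1) {0}" using L.S_ideal_Suc(2)[of 0] by simp
    show "K \<in> S_ideal br 1" using that kSR by blast
  qed
  have kR: "K \<in> RL k" if "K \<in> kk" for K using kSR that by blast
  define V where "V = {x. lc x \<in> kk \<and> ac x = - \<Phi>1 (lc x) \<and> (\<forall>X\<in>RL k. zc x X = \<Phi>2 (lc x) X)}"
  have V: "lie_ideal G V"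
    unfolding submodule_def
  proof (intro conjI allI ballI)
    show "subspace V"
      unfolding V_def real_vector.subspace_def
      using L1 L3 real_vector.subspace_0[OF sk] real_vector.subspace_add[OF sk] real_vector.subspace_scale[OF sk]
      by (auto simp: lin_simps)
    fix y x assume "x \<in> V"
    then have x: "lc x \<in> kk" "ac x = - \<Phi>1 (lc x)" "\<And>X. X \<in> RL k \<Longrightarrow> zc x X = \<Phi>2 (lc x) X" by (auto simp: V_def)
    have 1: "lc (G y x) \<in> kk" unfolding lc_G by (rule submoduleD[OF kid x(1)])
    have 2: "ac (G y x) = - \<Phi>1 (lc (G y x))"
      using eq x(1) by (simp add: ac_G lc_G x(2) rho_vanishes[OF kR[OF x(1)]] lin_simps)
    have 3: "zc (G y x) X = \<Phi>2 (lc (G y x)) X" if X: "X \<in> RL k" for X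
    proof -
      have bX: "br (lc y) X \<in> RL k" by (rule submoduleD[OF L.R_ideal_ideal X])
      have alpha_zero: "\<alpha> (lc x) X = 0"
        using \<alpha>_anti[of "lc x" X] eq[rule_format, OF x(1), of X] by (simp add: rho_vanishes[OF X] br_vanishes[OF X x(1)] L1(3))
      have br_zero: "br (lc x) X = 0" using L.br_anti[of "lc x" X] by (simp add: br_vanishes[OF X x(1)])
      have "\<gamma> (lc y) (lc x) X = - ip (\<Phi>1 (lc x)) (\<alpha> (lc y) X) + \<Phi>2 (lc x) (br (lc y) X) + \<Phi>2 (br (lc y) (lc x)) X"
        using eq x(1) X by blast
      then show ?thesis by (simp add: zc_G lc_G x(2) x(3)[OF bX] alpha_zero br_zero rho_vanishes[OF X] lin_simps)
    qed
    show "G y x \<in> V" using 1 2 3 by (simp add: V_def)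
  qed
  interpret H: module_hom_on G br V "\<lambda>x. lc x" "\<lambda>x. lc x" by (rule lc_hom[OF V])
  have kV: "kk = (\<lambda>x. lc x) ` V"
  proof
    show "(\<lambda>x. lc x) ` V \<subseteq> kk" by (auto simp: V_def)
    show "kk \<subseteq> (\<lambda>x. lc x) ` V"
    proof
      fix K assume K: "K \<in> kk"
      obtain g where g: "linear g" "\<forall>X\<in>RL k. g X = \<Phi>2 K X" using linear_on_extends[OF sR l2[rule_format, OF K]] by blast
      have "(dual_of g, - \<Phi>1 K, K) \<in> V" using K g by (simp add: V_def dual_app_of_linear)
      then show "K \<in> (\<lambda>x. lc x) ` V" by (rule rev_image_eqI) simp
    qed
  qed
  have "semisimple_quotient br kk {0}"
  proof (rule L.semisimple_quotient_interval[OF _ kid L.submodule_0 subset_refl])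
    show "semisimple_quotient br (S_ideal br 1) {0}" using L.S_ideal_Suc(2)[of 0] by simp
    show "{0} \<subseteq> kk" using real_vector.subspace_0[OF sk] by simp
    show "kk \<subseteq> S_ideal br 1" using kSR by blast
  qed
  then have ssV: "semisimple_quotient G (V \<inter> (\<lambda>x. lc x) -` kk) (V \<inter> (\<lambda>x. lc x) -` {0})"
    by (intro H.semisimple_quotient_vimage kid L.submodule_0)
      (use kV real_vector.subspace_0[OF sk] in auto)
  have VS: "V \<subseteq> SG (Suc k)"
  proof (rule M.subset_S_ideal_Suc[OF V H.submodule_vimage[OF L.submodule_0] Int_lower1])
    show "V \<inter> (\<lambda>x. lc x) -` {0} \<subseteq> SG k"
    proof
      fix x assume x: "x \<in> V \<inter> (\<lambda>x. lc x) -` {0}"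
      then have x0: "lc x = 0" "ac x = 0" using L1(3) by (auto simp: V_def)
      have "zc x X = 0" if "X \<in> RL k" for X using x x0 that L3(3)[OF that] by (auto simp: V_def)
      then show "x \<in> SG k" using S_ideal_Lstar_iff[of x k] x0 by (simp add: Lstar_iff)
    qed
    have "V \<inter> (\<lambda>x. lc x) -` kk = V" by (auto simp: V_def)
    then show "semisimple_quotient G V (V \<inter> (\<lambda>x. lc x) -` {0})" using ssV by simp
  qed
  have pc: "perp P (canonical_ideal G) = Lstar_perp" using bal unfolding balanced_perp .
  have "V \<subseteq> Lstar_perp"
  proof
    fix x assume x: "x \<in> V"
    have "x \<in> ssum (SG i) (RG i)" for i
    proof (cases "i \<le> k")
      case True
      have "lc x \<in> RL k" using x kR by (auto simp: V_def)
      then obtain r where r: "r \<in> RG k" "lc x = lc r" unfolding R_ideal_projection by blast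
      have "x - r \<in> perp P (canonical_ideal G)" using r by (simp add: pc Lstar_perp_iff)
      then have 1: "x - r \<in> ssum (SG i) (RG i)" using M.canonical_perp by blast
      have "r \<in> RG i" using r M.R_ideal_antimono[OF True] by blast
      then have 2: "r \<in> ssum (SG i) (RG i)"
        using ssum_upper2[OF submodule_subspace[OF M.S_ideal_ideal]] by blast
      have s: "subspace (ssum (SG i) (RG i))"
        by (intro subspace_ssum submodule_subspace[OF M.S_ideal_ideal] submodule_subspace[OF M.R_ideal_ideal])
      show ?thesis using real_vector.subspace_add[OF s 1 2] by simp
    next
      case False
      then have "x \<in> SG i" using x VS M.S_ideal_mono[of "Suc k" i] by auto
      then show ?thesis using ssum_upper1[OF submodule_subspace[OF M.R_ideal_ideal]] by blast
    qed
    then have "x \<in> perp P (canonical_ideal G)" using M.canonical_perp by blast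
    then show "x \<in> Lstar_perp" by (simp add: pc)
  qed
  then have "kk \<subseteq> {0}" unfolding kV by (auto simp: Lstar_perp_iff)
  then show "kk = {0}" using real_vector.subspace_0[OF sk] by blast
qed

subsection \<open>Semi-simplicity of the module\<close>

lemma image_ac_zero:
  assumes U: "lie_ideal G U" and "U \<subseteq> Lstar" shows "(\<lambda>x. ac x) ` U = {0}"
proof -
  have "0 \<in> U" by (rule real_vector.subspace_0[OF submodule_subspace[OF U]])
  then have "0 \<in> (\<lambda>x. ac x) ` U" by (intro image_eqI[of _ _ 0]) simp_all
  moreover have "(\<lambda>x. ac x) ` U \<subseteq> {0}" using assms(2) by (auto simp: Lstar_iff)
  ultimately show ?thesis by blast
qed

text \<open>The ideals \<open>S\<^bsub>k+1\<^esub> \<inter> R\<^sub>k\<close> span \<open>\<ll>\<^sup>* \<oplus> \<aa>\<close> by balancedness. Each of them is semi-simple modulo a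
  subspace of \<open>\<ll>\<^sup>*\<close>, so its \<open>\<aa>\<close>-components are contained in the largest semi-simple submodule \<open>T\<close>.\<close>

lemma semisimple_from_balanced:
  assumes bal: "balanced G Lstar" shows "semisimple \<rho>"
proof -
  have PQ: "steps_project_to_zero k" "diagonal_in_Lstar k" for k using bal unfolding balanced_iff by blast+
  have pc: "perp P (canonical_ideal G) = Lstar_perp" using bal unfolding balanced_perp .
  obtain T where T0: "(submodule \<rho> T \<and> {0} \<subseteq> T \<and> semisimple_quotient \<rho> T {0}) \<and>
    (\<forall>V. submodule \<rho> V \<and> {0} \<subseteq> V \<and> semisimple_quotient \<rho> V {0} \<longrightarrow> V \<subseteq> T)"
    using rho.exists_greatest_semisimple[OF rho.fdv rho.submodule_0] by (elim exE)
  then have T: "submodule \<rho> T" "{0} \<subseteq> T" "semisimple_quotient \<rho> T {0}"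
    "\<And>V. submodule \<rho> V \<Longrightarrow> {0} \<subseteq> V \<Longrightarrow> semisimple_quotient \<rho> V {0} \<Longrightarrow> V \<subseteq> T" by simp_all
  interpret H: module_hom_on G \<rho> Lstar_perp "\<lambda>x. ac x" "\<lambda>x. lc x" by (rule ac_hom[OF Lstar_perp_ideal subset_refl])
  have sub: "subspace (Lstar_perp \<inter> (\<lambda>x. ac x) -` T)"
    by (rule submodule_subspace[OF H.submodule_vimage[OF T(1)]])
  have "SG (Suc k) \<inter> RG k \<subseteq> Lstar_perp \<inter> (\<lambda>x. ac x) -` T" for k
  proof -
    let ?W = "SG (Suc k) \<inter> RG k"
    have W: "lie_ideal G ?W" by (rule submodule_Int[OF M.S_ideal_ideal M.R_ideal_ideal])
    have Wj: "?W \<subseteq> Lstar_perp" using PQ(1)[of k] by (simp add: steps_project_to_zero_def)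
    have W0: "?W \<inter> SG k \<subseteq> Lstar" using PQ(2)[of k] by (auto simp: diagonal_in_Lstar_def)
    have W0id: "lie_ideal G (?W \<inter> SG k)" by (rule submodule_Int[OF W M.S_ideal_ideal])
    have "semisimple_quotient G ?W (?W \<inter> SG k)"
      by (rule M.semisimple_filtration_section[OF W Int_lower1])
    then have "semisimple_quotient \<rho> ((\<lambda>x. ac x) ` ?W) ((\<lambda>x. ac x) ` (?W \<inter> SG k))"
      by (rule H.semisimple_quotient_image[OF W Wj W0id Int_lower1])
    then have "semisimple_quotient \<rho> ((\<lambda>x. ac x) ` ?W) {0}" by (simp only: image_ac_zero[OF W0id W0])
    moreover have aW: "submodule \<rho> ((\<lambda>x. ac x) ` ?W)" by (rule H.submodule_image[OF W Wj])
    moreover have "{0} \<subseteq> (\<lambda>x. ac x) ` ?W" using real_vector.subspace_0[OF submodule_subspace[OF aW]] by simp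
    ultimately have "(\<lambda>x. ac x) ` ?W \<subseteq> T" by (intro T(4))
    then show ?thesis using Wj by blast
  qed
  then have "Lstar_perp \<subseteq> Lstar_perp \<inter> (\<lambda>x. ac x) -` T"
    using M.perp_canonical_subset[OF sub] unfolding pc by blast
  moreover have "(0, a, 0) \<in> Lstar_perp" for a by (simp add: Lstar_perp_iff)
  ultimately have "a \<in> T" for a by fastforce
  then have "T = UNIV" by blast
  then show ?thesis using T(3) by (simp add: semisimple_def)
qed

subsection \<open>Submodules on which the cocycle becomes exact\<close>

text \<open>The submodules among which \<^const>\<open>b_submodule\<close> is the greatest.\<close>

definition b_candidate :: "nat \<Rightarrow> 'a set \<Rightarrow> bool" where
  "b_candidate k b \<longleftrightarrow> submodule \<rho> b \<and> (\<exists>\<Phi>::'l \<Rightarrow> 'a. linear_on (RL k) \<Phi> \<and>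
        (\<forall>L. \<forall>K\<in>RL k. \<forall>B\<in>b. ip (\<alpha> L K) B = ip (\<rho> L (\<Phi> K) - \<Phi> (br L K)) B))"

lemma riesz_family:
  assumes U: "subspace U" and f: "\<And>x. x \<in> U \<Longrightarrow> linear (f x)" and l: "\<And>a. linear_on U (\<lambda>x. f x a)"
  shows "\<exists>\<Phi>. linear_on U \<Phi> \<and> (\<forall>x\<in>U. \<forall>a. ip (\<Phi> x) a = f x a)"
proof -
  have "\<forall>x\<in>U. \<exists>y. \<forall>a. f x a = ip y a" using A.riesz f by blast
  then have "\<exists>\<Phi>. \<forall>x\<in>U. \<forall>a. f x a = ip (\<Phi> x) a" by (rule bchoice)
  then obtain \<Phi> where P0: "\<forall>x\<in>U. \<forall>a. f x a = ip (\<Phi> x) a" by (elim exE)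
  then have P: "ip (\<Phi> x) a = f x a" if "x \<in> U" for x a using that by simp
  have eq: "u = v" if "\<And>a. ip u a = ip v a" for u v
  proof -
    have "u - v = 0" by (rule A.nondeg) (simp add: that lin_simps)
    then show ?thesis by simp
  qed
  have "linear_on U \<Phi>"
    unfolding linear_on_def
  proof (intro conjI ballI allI)
    fix x y assume xy: "x \<in> U" "y \<in> U"
    show "\<Phi> (x + y) = \<Phi> x + \<Phi> y"
      by (rule eq) (simp add: P xy real_vector.subspace_add[OF U xy] lin_simps linear_onD[OF l U])
  next
    fix r x assume x: "x \<in> U"
    show "\<Phi> (r *\<^sub>R x) = r *\<^sub>R \<Phi> x"
      by (rule eq) (simp add: P x real_vector.subspace_scale[OF U x] lin_simps linear_onD[OF l U])
  qed
  then show ?thesis using P by blast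
qed

text \<open>Let \<open>d\<close> be a complement of \<open>b \<inter> c\<close> in \<open>c\<close>. The map for \<open>b + c = b \<oplus> d\<close> is pieced together from those for
  \<open>b\<close> and \<open>c\<close>, using the functionals that they induce on the two summands.\<close>

lemma b_candidate_sum:
  assumes ss: "semisimple \<rho>" and b: "b_candidate k b" and c: "b_candidate k c"
  shows "b_candidate k (ssum b c)"
proof -
  have sb: "submodule \<rho> b" and sc: "submodule \<rho> c" using b c by (auto simp: b_candidate_def)
  note sub_b = submodule_subspace[OF sb] and sub_c = submodule_subspace[OF sc] and sR = submodule_subspace[OF L.R_ideal_ideal]
  obtain \<Phi> where \<Phi>: "linear_on (RL k) \<Phi>"
    "\<And>L K B. K \<in> RL k \<Longrightarrow> B \<in> b \<Longrightarrow> ip (\<alpha> L K) B = ip (\<rho> L (\<Phi> K) - \<Phi> (br L K)) B"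
    using b unfolding b_candidate_def by blast
  obtain \<Psi> where \<Psi>: "linear_on (RL k) \<Psi>"
    "\<And>L K B. K \<in> RL k \<Longrightarrow> B \<in> c \<Longrightarrow> ip (\<alpha> L K) B = ip (\<rho> L (\<Psi> K) - \<Psi> (br L K)) B"
    using c unfolding b_candidate_def by blast
  have z: "{0} \<subseteq> b \<inter> c" using real_vector.subspace_0[OF sub_b] real_vector.subspace_0[OF sub_c] by simp
  have ssc: "semisimple_quotient \<rho> c {0}"
    by (rule rho.semisimple_quotient_interval[OF ss[unfolded semisimple_def] sc rho.submodule_0 subset_refl _ subset_UNIV])
      (use z in blast)
  obtain d where d: "submodule \<rho> d" "{0} \<subseteq> d" "d \<subseteq> c" "ssum (b \<inter> c) d = c" "b \<inter> c \<inter> d = {0}"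
    by (rule semisimple_quotientE[OF ssc submodule_Int[OF sb sc] z Int_lower2])
  note sub_d = submodule_subspace[OF d(1)]
  have bd: "b \<inter> d = {0}" using d(3,5) by blast
  obtain g where g: "linear g" "\<forall>x\<in>b. g x = x" "\<forall>x\<in>d. g x = 0" using disjoint_projection[OF sub_b sub_d bd] by blast
  define f where "f K a = ip (\<Phi> K) (g a) + ip (\<Psi> K) (a - g a)" for K a
  have "\<exists>\<Xi>. linear_on (RL k) \<Xi> \<and> (\<forall>x\<in>RL k. \<forall>a. ip (\<Xi> x) a = f x a)"
  proof (rule riesz_family[OF sR])
    show "linear (f x)" for x
      by (rule linearI) (simp_all add: f_def linear_add[OF g(1)] linear_cmul[OF g(1)] lin_simps algebra_simps)
    show "linear_on (RL k) (\<lambda>x. f x a)" for a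
      by (simp add: linear_on_def f_def linear_onD[OF \<Phi>(1) sR] linear_onD[OF \<Psi>(1) sR] lin_simps algebra_simps)
  qed
  then obtain \<Xi> where \<Xi>: "linear_on (RL k) \<Xi>" "\<And>x a. x \<in> RL k \<Longrightarrow> ip (\<Xi> x) a = f x a" by blast
  have bc: "ssum b c \<subseteq> ssum b d"
  proof (rule ssum_least)
    show s: "subspace (ssum b d)" using sub_b sub_d by (rule subspace_ssum)
    show "b \<subseteq> ssum b d" using sub_d by (rule ssum_upper1)
    show "c \<subseteq> ssum b d" using ssum_mono[of "b \<inter> c" b d d] d(4) by blast
  qed
  have "ip (\<alpha> L K) B = ip (\<rho> L (\<Xi> K) - \<Xi> (br L K)) B" if K: "K \<in> RL k" and B: "B \<in> ssum b c" for L K B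
  proof -
    have bK: "br L K \<in> RL k" by (rule submoduleD[OF L.R_ideal_ideal K])
    obtain u v where uv: "u \<in> b" "v \<in> d" "B = u + v" using subsetD[OF bc B] by (elim ssumE)
    have ru: "\<rho> L u \<in> b" by (rule submoduleD[OF sb uv(1)])
    have rv: "\<rho> L v \<in> d" by (rule submoduleD[OF d(1) uv(2)])
    have gs: "g u = u" "g v = 0" "g (\<rho> L u) = \<rho> L u" "g (\<rho> L v) = 0" using g ru rv uv by auto
    have 1: "ip (\<rho> L (\<Xi> K) - \<Xi> (br L K)) u = ip (\<alpha> L K) u"
      unfolding \<Phi>(2)[OF K uv(1)] by (simp add: lin_simps ip_skew \<Xi>(2)[OF K] \<Xi>(2)[OF bK] f_def gs)
    have "v \<in> c" using uv d by blast
    then have 2: "ip (\<rho> L (\<Xi> K) - \<Xi> (br L K)) v = ip (\<alpha> L K) v"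
      unfolding \<Psi>(2)[OF K \<open>v \<in> c\<close>] by (simp add: lin_simps ip_skew \<Xi>(2)[OF K] \<Xi>(2)[OF bK] f_def gs)
    show ?thesis unfolding uv(3) bilinear_radd[OF A.bil] 1 2 ..
  qed
  then show ?thesis unfolding b_candidate_def using rho.submodule_ssum[OF sb sc] \<Xi>(1) by blast
qed

lemma b_submodule_greatest:
  assumes ss: "semisimple \<rho>"
  shows "b_candidate k (b_submodule br \<rho> ip \<alpha> k)" "b_candidate k b \<Longrightarrow> b \<subseteq> b_submodule br \<rho> ip \<alpha> k"
proof -
  have l0: "linear_on (RL k) (\<lambda>_. 0)" by (simp add: linear_on_def)
  have "b_candidate k {0}"
    unfolding b_candidate_def using rho.submodule_0 l0 by (auto simp: lin_simps)
  then have "\<exists>U. b_candidate k U \<and> (\<forall>V. b_candidate k V \<longrightarrow> V \<subseteq> U)"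
    by (rule fin_dim_greatest[where P = "b_candidate k", OF rho.fdv _ _ b_candidate_sum[OF ss]])
      (auto simp: b_candidate_def intro: submodule_subspace)
  then obtain U where "b_candidate k U \<and> (\<forall>V. b_candidate k V \<longrightarrow> V \<subseteq> U)" by (elim exE)
  then have U: "b_candidate k U" "\<And>V. b_candidate k V \<Longrightarrow> V \<subseteq> U" by simp_all
  have "b_submodule br \<rho> ip \<alpha> k = U"
    unfolding b_submodule_def b_candidate_def[symmetric] by (rule Greatest_equality) (use U in auto)
  then show "b_candidate k (b_submodule br \<rho> ip \<alpha> k)" "b_candidate k b \<Longrightarrow> b \<subseteq> b_submodule br \<rho> ip \<alpha> k"
    using U by auto
qed

text \<open>A linear section \<open>s\<close> of the \<open>\<aa>\<close>-components of \<open>U\<close> is equivariant up to elements of \<open>U \<inter> \<ll>\<^sup>*\<close>, which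
  vanish on \<open>R\<^sub>k(\<ll>)\<close>. The map \<open>\<Phi>\<close> is the adjoint of the \<open>\<ll>\<^sup>*\<close>-component of \<open>s\<close>.\<close>

lemma b_candidate_from_ideal:
  assumes U: "lie_ideal G U" "U \<subseteq> Lstar_perp" and z: "\<And>x X. x \<in> U \<Longrightarrow> x \<in> Lstar \<Longrightarrow> X \<in> RL k \<Longrightarrow> zc x X = 0"
  shows "b_candidate k ((\<lambda>x. ac x) ` U)"
proof -
  note sU = submodule_subspace[OF U(1)] and sR = submodule_subspace[OF L.R_ideal_ideal]
  interpret H: module_hom_on G \<rho> U "\<lambda>x. ac x" "\<lambda>x. lc x" by (rule ac_hom[OF U])
  let ?b = "(\<lambda>x. ac x) ` U"
  have sb: "submodule \<rho> ?b" by (rule H.submodule_image[OF U(1) subset_refl])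
  obtain s where s0: "range s \<subseteq> U \<and> linear s \<and> (\<forall>v\<in>?b. ac (s v) = v)"
    using real_vector.linear_exists_right_inverse_on[OF linear_ac sU] by (elim exE)
  then have s: "\<And>B. s B \<in> U" "linear s" "\<And>B. B \<in> ?b \<Longrightarrow> ac (s B) = B" by auto
  have "\<exists>\<Phi>. linear_on (RL k) \<Phi> \<and> (\<forall>K\<in>RL k. \<forall>B. ip (\<Phi> K) B = zc (s B) K)"
  proof (rule riesz_family[OF sR])
    show "linear (\<lambda>B. zc (s B) K)" for K
      by (rule linearI) (simp_all add: linear_add[OF s(2)] linear_cmul[OF s(2)] lin_simps)
    show "linear_on (RL k) (\<lambda>K. zc (s B) K)" for B by (rule linear_imp_linear_on[OF linear_dual_app])
  qed
  then obtain \<Phi> where \<Phi>: "linear_on (RL k) \<Phi>" "\<And>K B. K \<in> RL k \<Longrightarrow> ip (\<Phi> K) B = zc (s B) K" by blast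
  have "ip (\<alpha> L K) B = ip (\<rho> L (\<Phi> K) - \<Phi> (br L K)) B" if K: "K \<in> RL k" and B: "B \<in> ?b" for L K B
  proof -
    have bK: "br L K \<in> RL k" by (rule submoduleD[OF L.R_ideal_ideal K])
    have rB: "\<rho> L B \<in> ?b" by (rule submoduleD[OF sb B])
    have lcs: "lc (s C) = 0" for C using subsetD[OF U(2) s(1)[of C]] by (simp add: Lstar_perp_iff)
    let ?d = "G (0, 0, L) (s B) - s (\<rho> L B)"
    have dU: "?d \<in> U" by (intro real_vector.subspace_diff[OF sU] submoduleD[OF U(1)] s(1))
    have "?d \<in> Lstar" by (simp add: Lstar_iff lc_G ac_G lcs s(3)[OF B] s(3)[OF rB] lin_simps)
    from z[OF dU this K] have "- ip B (\<alpha> L K) - zc (s B) (br L K) - zc (s (\<rho> L B)) K = 0"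
      by (simp add: zc_G lcs s(3)[OF B] lin_simps)
    then show ?thesis
      by (simp add: lin_simps ip_skew \<Phi>(2)[OF K] \<Phi>(2)[OF bK] A.sym[of "\<alpha> L K" B])
  qed
  then show ?thesis unfolding b_candidate_def using sb \<Phi>(1) by blast
qed

text \<open>The converse construction. The set \<open>U\<close> is an ideal because \<open>R\<^sub>k(\<ll>)\<close> acts trivially on \<open>\<aa>\<close>, and its
  \<open>\<aa>\<close>-part is semi-simple while its part in \<open>\<ll>\<^sup>*\<close> lies in \<open>S\<^sub>k(\<dd>)\<close>.\<close>

lemma ideal_from_b_candidate:
  assumes ss: "semisimple \<rho>" and k: "k \<ge> 1" and b: "b_candidate k b"
  shows "\<exists>U. lie_ideal G U \<and> U \<subseteq> Lstar_perp \<and> U \<subseteq> SG (Suc k) \<and> (\<lambda>x. ac x) ` U = b"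
proof -
  have sb: "submodule \<rho> b" using b by (auto simp: b_candidate_def)
  note sub_b = submodule_subspace[OF sb] and sR = submodule_subspace[OF L.R_ideal_ideal]
  obtain \<Phi> where \<Phi>: "linear_on (RL k) \<Phi>"
    "\<And>L K B. K \<in> RL k \<Longrightarrow> B \<in> b \<Longrightarrow> ip (\<alpha> L K) B = ip (\<rho> L (\<Phi> K) - \<Phi> (br L K)) B"
    using b unfolding b_candidate_def by blast
  have rho0: "\<rho> X a = 0" if "X \<in> RL k" for X a
  proof (rule rho.R1_annihilates_semisimple[OF submodule_UNIV ss[unfolded semisimple_def] _ UNIV_I])
    show "X \<in> RL 1" using L.R_ideal_antimono[OF k] that by blast
  qed
  define U where "U = {x. lc x = 0 \<and> ac x \<in> b \<and> (\<forall>X\<in>RL k. zc x X = ip (\<Phi> X) (ac x))}"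
  have U: "lie_ideal G U"
    unfolding submodule_def
  proof (intro conjI allI ballI)
    show "subspace U"
      unfolding U_def real_vector.subspace_def
      using real_vector.subspace_0[OF sub_b] real_vector.subspace_add[OF sub_b] real_vector.subspace_scale[OF sub_b]
      by (auto simp: lin_simps)
    fix y x assume "x \<in> U"
    then have x: "lc x = 0" "ac x \<in> b" "\<And>X. X \<in> RL k \<Longrightarrow> zc x X = ip (\<Phi> X) (ac x)" by (auto simp: U_def)
    have 1: "lc (G y x) = 0" by (simp add: lc_G x(1) lin_simps)
    have ag: "ac (G y x) = \<rho> (lc y) (ac x)" by (simp add: ac_G x(1) lin_simps)
    have 2: "ac (G y x) \<in> b" unfolding ag by (rule submoduleD[OF sb x(2)])
    have 3: "zc (G y x) X = ip (\<Phi> X) (ac (G y x))" if X: "X \<in> RL k" for X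
    proof -
      have bX: "br (lc y) X \<in> RL k" by (rule submoduleD[OF L.R_ideal_ideal X])
      have "ip (ac x) (\<alpha> (lc y) X) = - ip (\<Phi> X) (\<rho> (lc y) (ac x)) - ip (\<Phi> (br (lc y) X)) (ac x)"
        using \<Phi>(2)[OF X x(2), of "lc y"] by (simp add: A.sym[of "ac x"] lin_simps ip_skew)
      then show ?thesis by (simp add: zc_G ag x(1) x(3)[OF bX] rho0[OF X] lin_simps)
    qed
    show "G y x \<in> U" using 1 2 3 by (simp add: U_def)
  qed
  have Uj: "U \<subseteq> Lstar_perp" by (auto simp: U_def Lstar_perp_iff)
  interpret H: module_hom_on G \<rho> U "\<lambda>x. ac x" "\<lambda>x. lc x" by (rule ac_hom[OF U Uj])
  have im: "(\<lambda>x. ac x) ` U = b"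
  proof
    show "(\<lambda>x. ac x) ` U \<subseteq> b" by (auto simp: U_def)
    show "b \<subseteq> (\<lambda>x. ac x) ` U"
    proof
      fix B assume B: "B \<in> b"
      have "linear_on (RL k) (\<lambda>X. ip (\<Phi> X) B)"
        by (simp add: linear_on_def linear_onD[OF \<Phi>(1) sR] lin_simps)
      then obtain g where g: "linear g" "\<forall>X\<in>RL k. g X = ip (\<Phi> X) B" using linear_on_extends[OF sR] by blast
      have "(dual_of g, B, 0) \<in> U" using B g by (simp add: U_def dual_app_of_linear)
      then show "B \<in> (\<lambda>x. ac x) ` U" by (rule rev_image_eqI) simp
    qed
  qed
  have z: "{0} \<subseteq> b" using real_vector.subspace_0[OF sub_b] by simp
  have ssb: "semisimple_quotient \<rho> b {0}"
    by (rule rho.semisimple_quotient_interval[OF ss[unfolded semisimple_def] sb rho.submodule_0 subset_refl z subset_UNIV])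
  have "semisimple_quotient G (U \<inter> (\<lambda>x. ac x) -` b) (U \<inter> (\<lambda>x. ac x) -` {0})"
    by (rule H.semisimple_quotient_vimage[OF sb _ rho.submodule_0 z ssb]) (simp add: im)
  moreover have "U \<inter> (\<lambda>x. ac x) -` b = U" by (auto simp: U_def)
  ultimately have ssU: "semisimple_quotient G U (U \<inter> (\<lambda>x. ac x) -` {0})" by simp
  have "U \<subseteq> SG (Suc k)"
  proof (rule M.subset_S_ideal_Suc[OF U H.submodule_vimage[OF rho.submodule_0] Int_lower1 _ ssU])
    show "U \<inter> (\<lambda>x. ac x) -` {0} \<subseteq> SG k"
    proof
      fix x assume x: "x \<in> U \<inter> (\<lambda>x. ac x) -` {0}"
      then have x0: "x \<in> Lstar" by (auto simp: U_def Lstar_iff)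
      have "zc x X = 0" if "X \<in> RL k" for X using x that by (auto simp: U_def lin_simps)
      then show "x \<in> SG k" using S_ideal_Lstar_iff[OF x0] by blast
    qed
  qed
  then show ?thesis using U Uj im by blast
qed

text \<open>Modulo \<open>S\<^sub>k\<close> the ideal \<open>W\<close> is semi-simple, and \<open>V\<close> is a complement of \<open>W \<inter> \<ll>\<^sup>*\<close> in it.\<close>

lemma filtration_lift:
  assumes W: "lie_ideal G W" "W \<subseteq> SG (Suc k)" "W \<subseteq> Lstar_perp" and W0: "W \<inter> SG k \<subseteq> Lstar"
  shows "\<exists>V. lie_ideal G V \<and> V \<subseteq> W \<and> V \<inter> Lstar \<subseteq> SG k \<and> (\<lambda>x. ac x) ` V = (\<lambda>x. ac x) ` W"
proof -
  have ss: "semisimple_quotient G W (W \<inter> SG k)" by (rule M.semisimple_filtration_section[OF W(1,2)])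
  have Wi: "lie_ideal G (W \<inter> Lstar)" by (rule submodule_Int[OF W(1) Lstar_ideal])
  have WW: "W \<inter> SG k \<subseteq> W \<inter> Lstar" using W0 by blast
  obtain V where V: "lie_ideal G V" "W \<inter> SG k \<subseteq> V" "V \<subseteq> W" "ssum (W \<inter> Lstar) V = W" "W \<inter> Lstar \<inter> V = W \<inter> SG k"
    by (rule semisimple_quotientE[OF ss Wi WW Int_lower1])
  have "ac x \<in> (\<lambda>x. ac x) ` V" if x: "x \<in> W" for x
  proof -
    have "x \<in> ssum (W \<inter> Lstar) V" using V(4) x by simp
    then obtain w v where "w \<in> W \<inter> Lstar" "v \<in> V" "x = w + v" by (elim ssumE)
    then have "ac x = ac v" by (simp add: Lstar_iff)
    then show ?thesis using \<open>v \<in> V\<close> by blast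
  qed
  then have "(\<lambda>x. ac x) ` V = (\<lambda>x. ac x) ` W" using V(3) by blast
  moreover have "V \<inter> Lstar \<subseteq> SG k" using V(3,5) by blast
  ultimately show ?thesis using V by blast
qed

lemma b_candidate_filtration:
  assumes W: "lie_ideal G W" "W \<subseteq> SG (Suc i)" "W \<subseteq> Lstar_perp" and W0: "W \<inter> SG i \<subseteq> Lstar" and ik: "i \<le> k"
  shows "b_candidate k ((\<lambda>x. ac x) ` W)"
proof -
  obtain V where V: "lie_ideal G V" "V \<subseteq> W" "V \<inter> Lstar \<subseteq> SG i" "(\<lambda>x. ac x) ` V = (\<lambda>x. ac x) ` W"
    using filtration_lift[OF W W0] by blast
  have "b_candidate k ((\<lambda>x. ac x) ` V)"
  proof (rule b_candidate_from_ideal[OF V(1)])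
    show "V \<subseteq> Lstar_perp" using V W by blast
    fix x X assume x: "x \<in> V" "x \<in> Lstar" and X: "X \<in> RL k"
    have "X \<in> RL i" using L.R_ideal_antimono[OF ik] X by blast
    moreover have "x \<in> SG i" using x V(3) by blast
    ultimately show "zc x X = 0" using S_ideal_Lstar_iff[OF x(2), of i] by blast
  qed
  then show ?thesis using V(4) by simp
qed

text \<open>The \<open>\<aa>\<close>-components of \<open>S\<^bsub>k+1\<^esub> \<inter> R\<^bsub>k+1\<^esub>\<close> lie in \<open>\<bb>\<^sub>k\<close>. They are orthogonal to \<open>\<bb>\<^sub>k\<close>, since \<open>\<bb>\<^sub>k\<close>
  is the \<open>\<aa>\<close>-part of an ideal in \<open>S\<^bsub>k+1\<^esub>\<close>, which is orthogonal to \<open>R\<^bsub>k+1\<^esub>\<close>.\<close>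

lemma diagonal_in_Lstar_Suc:
  assumes ss: "semisimple \<rho>" and k: "k \<ge> 1" and B: "cond_B br \<rho> ip \<alpha> k" and Pk: "steps_project_to_zero k" and Qk: "diagonal_in_Lstar k"
  shows "diagonal_in_Lstar (Suc k)"
proof -
  let ?W = "SG (Suc k) \<inter> RG (Suc k)" and ?b = "b_submodule br \<rho> ip \<alpha> k"
  have W: "lie_ideal G ?W" by (rule submodule_Int[OF M.S_ideal_ideal M.R_ideal_ideal])
  have Wj: "?W \<subseteq> Lstar_perp" using Pk M.R_ideal_Suc(1)[of k] by (auto simp: steps_project_to_zero_def)
  have W0: "?W \<inter> SG k \<subseteq> Lstar" using Qk M.R_ideal_Suc(1)[of k] by (auto simp: diagonal_in_Lstar_def)
  have aW: "(\<lambda>x. ac x) ` ?W \<subseteq> ?b"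
    by (rule b_submodule_greatest(2)[OF ss b_candidate_filtration[OF W Int_lower1 Wj W0 le_refl]])
  obtain U where U: "lie_ideal G U" "U \<subseteq> Lstar_perp" "U \<subseteq> SG (Suc k)" "(\<lambda>x. ac x) ` U = ?b"
    using ideal_from_b_candidate[OF ss k b_submodule_greatest(1)[OF ss]] by blast
  show ?thesis
    unfolding diagonal_in_Lstar_def
  proof
    fix x assume x: "x \<in> ?W"
    have xb: "ac x \<in> ?b" using aW x by blast
    have "ip (ac x) y = 0" if y: "y \<in> ?b" for y
    proof -
      obtain u where u: "u \<in> U" "y = ac u" using y U(4) by blast
      have "P x u = 0" by (rule M.S_perp_R[of u "Suc k"]) (use u U x in auto)
      moreover have "lc x = 0" "lc u = 0" using x Wj u U(2) by (auto simp: Lstar_perp_iff)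
      ultimately show ?thesis by (simp add: P_eq u lin_simps)
    qed
    then have "ac x = 0" using B xb unfolding cond_B_def nondegenerate_on_def by blast
    then show "x \<in> Lstar" using x Wj by (auto simp: Lstar_iff Lstar_perp_iff)
  qed
qed

lemma orthogonal_to_filtration_in_Lstar:
  assumes bal: "balanced G Lstar" and o: "\<And>i w. w \<in> SG (Suc i) \<Longrightarrow> w \<in> RG i \<Longrightarrow> P w u = 0"
  shows "u \<in> Lstar"
proof -
  have pc: "perp P (canonical_ideal G) = Lstar_perp" using bal unfolding balanced_perp .
  have "SG (Suc i) \<inter> RG i \<subseteq> perp P {u}" for i by (auto simp: perp_def intro: o)
  then have j: "Lstar_perp \<subseteq> perp P {u}"
    using M.perp_canonical_subset[OF subspace_perp[OF M.form.bil], of "{u}"] unfolding pc by blast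
  have "u \<in> perp P Lstar_perp"
    unfolding perp_def
  proof (intro CollectI ballI)
    fix y assume "y \<in> Lstar_perp"
    then have "P y u = 0" using j by (auto simp: perp_def)
    then show "P u y = 0" using M.form.sym[of u y] by simp
  qed
  then show ?thesis unfolding perp_of_Lstar_perp .
qed

text \<open>A vector in the radical of \<open>\<bb>\<^sub>k\<close> is the \<open>\<aa>\<close>-component of some \<open>u\<close> in an ideal inside \<open>S\<^bsub>k+1\<^esub>(\<dd>)\<close>. For
  \<open>i > k\<close>, \<open>u\<close> is orthogonal to \<open>R\<^sub>i \<subseteq> R\<^bsub>k+1\<^esub>\<close>; for \<open>i \<le> k\<close> it is orthogonal to
  \<open>S\<^bsub>i+1\<^esub> \<inter> R\<^sub>i\<close>, whose \<open>\<aa>\<close>-components lie in \<open>\<bb>\<^sub>k\<close>. Hence \<open>u\<close> is in \<open>\<ll>\<^sup>*\<close>.\<close>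

lemma cond_B_from_balanced:
  assumes bal: "balanced G Lstar" and k: "k \<ge> 1"
  shows "cond_B br \<rho> ip \<alpha> k"
  unfolding cond_B_def nondegenerate_on_def
proof (intro ballI impI)
  let ?b = "b_submodule br \<rho> ip \<alpha> k"
  have ss: "semisimple \<rho>" by (rule semisimple_from_balanced[OF bal])
  have PQ: "steps_project_to_zero k" "diagonal_in_Lstar k" for k using bal unfolding balanced_iff by blast+
  obtain U where U: "lie_ideal G U" "U \<subseteq> Lstar_perp" "U \<subseteq> SG (Suc k)" "(\<lambda>x. ac x) ` U = ?b"
    using ideal_from_b_candidate[OF ss k b_submodule_greatest(1)[OF ss]] by blast
  fix x assume x: "x \<in> ?b" and o: "\<forall>y\<in>?b. ip x y = 0"
  obtain u where u: "u \<in> U" "x = ac u" using x U(4) by blast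
  have uj: "lc u = 0" using u U(2) by (auto simp: Lstar_perp_iff)
  have "u \<in> Lstar"
  proof (rule orthogonal_to_filtration_in_Lstar[OF bal])
    fix i w assume "w \<in> SG (Suc i)" "w \<in> RG i"
    then have w: "w \<in> SG (Suc i) \<inter> RG i" by simp
    show "P w u = 0"
    proof (cases "i \<le> k")
      case True
      let ?W = "SG (Suc i) \<inter> RG i"
      have W: "lie_ideal G ?W" by (rule submodule_Int[OF M.S_ideal_ideal M.R_ideal_ideal])
      have Wj: "?W \<subseteq> Lstar_perp" using PQ(1)[of i] by (simp add: steps_project_to_zero_def)
      have W0: "?W \<inter> SG i \<subseteq> Lstar" using PQ(2)[of i] by (auto simp: diagonal_in_Lstar_def)
      have "(\<lambda>x. ac x) ` ?W \<subseteq> ?b"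
        by (rule b_submodule_greatest(2)[OF ss b_candidate_filtration[OF W Int_lower1 Wj W0 True]])
      then have "ac w \<in> ?b" using w by blast
      then have "ip (ac w) x = 0" using o A.sym[of x "ac w"] by simp
      moreover have "lc w = 0" using w Wj by (auto simp: Lstar_perp_iff)
      ultimately show ?thesis using uj u by (simp add: P_eq lin_simps)
    next
      case False
      then have "w \<in> RG (Suc k)" using w M.R_ideal_antimono[of "Suc k" i] by auto
      then show ?thesis using M.S_perp_R[of u "Suc k" w] u U(3) by blast
    qed
  qed
  then show "x = 0" unfolding u(2) by (simp add: Lstar_iff)
qed

subsection \<open>Central elements in \<open>\<ll>\<^sup>* \<oplus> \<aa>\<close>\<close>

text \<open>The \<open>\<aa>\<close>-components of the central elements of \<open>\<dd>\<close> that lie in \<open>\<ll>\<^sup>* \<oplus> \<aa>\<close>. It plays the role of \<open>\<bb>\<^sub>0\<close>: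
  for semi-simple \<open>\<rho>\<close>, condition \<open>B\<^sub>0\<close> says that it is non-degenerate.\<close>

definition central_part :: "'a set" where
  "central_part = {B. (\<forall>X. \<rho> X B = 0) \<and> (\<exists>Z::'l dual. \<forall>L X. ip B (\<alpha> L X) + dual_app Z (br L X) = 0)}"

lemma central_part_lifts:
  assumes "B \<in> central_part" shows "\<exists>u. (\<forall>y. G y u = 0) \<and> lc u = 0 \<and> ac u = B"
proof -
  obtain Z :: "'l dual" where 1: "\<And>X. \<rho> X B = 0" and 2: "\<And>L X. ip B (\<alpha> L X) + dual_app Z (br L X) = 0"
    using assms unfolding central_part_def by blast
  have 3: "dual_app Z (br L X) = - ip B (\<alpha> L X)" for L X using 2[of L X] by simp
  have 4: "ip (\<rho> X a) B = 0" for X a using ip_skew[of X a B] by (simp add: 1 lin_simps)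
  have "G y (Z, B, 0) = 0" for y
    unfolding model_eq_iff by (simp add: comp_simps 1 3 4 lin_simps)
  then show ?thesis by (intro exI[of _ "(Z, B, 0)"]) simp
qed

text \<open>As for \<open>ideal_disjoint_from_Lstar_perp_central\<close>, brackets of \<open>V\<close> with \<open>\<aa>\<close> lie in \<open>V \<inter> \<ll>\<^sup>* = 0\<close>, so that
  \<open>\<rho>\<close> kills the \<open>\<aa>\<close>-components by duality, and then \<open>V\<close> is central.\<close>

lemma ac_in_central_part:
  assumes V: "lie_ideal G V" "V \<subseteq> Lstar_perp" "V \<inter> Lstar \<subseteq> {0}" and x: "x \<in> V"
  shows "ac x \<in> central_part"
proof -
  have l: "lc x = 0" using x V(2) by (auto simp: Lstar_perp_iff)
  have z: "G y x = 0" if "ac (G y x) = 0" for y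
  proof -
    have "lc (G y x) = 0" by (simp add: lc_G l lin_simps)
    then have "G y x \<in> V \<inter> Lstar" using that submoduleD[OF V(1) x] by (simp add: Lstar_iff)
    then show ?thesis using V(3) by blast
  qed
  have 1: "\<rho> X (ac x) = 0" for X
  proof (rule A.nondeg)
    fix a
    have "G (0, a, 0) x = 0" by (rule z) (simp add: ac_G l lin_simps)
    then have "ip (\<rho> X a) (ac x) = 0" using zc_G[of "(0, a, 0)" x X] by (simp add: l lin_simps)
    then show "ip (\<rho> X (ac x)) a = 0" using ip_skew[of X a "ac x"] A.sym[of a "\<rho> X (ac x)"] by simp
  qed
  have 2: "ip (ac x) (\<alpha> L X) + zc x (br L X) = 0" for L X
  proof -
    have "G (0, 0, L) x = 0" by (rule z) (simp add: ac_G l 1 lin_simps)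
    then show ?thesis using zc_G[of "(0, 0, L)" x X] by (simp add: l lin_simps)
  qed
  show ?thesis unfolding central_part_def using 1 2 by blast
qed

lemma central_in_SG1:
  assumes u: "\<forall>y. G y u = 0" shows "u \<in> SG 1"
proof -
  have s: "subspace (span {u})" by (rule real_vector.subspace_span)
  have t: "G y x = 0" if "x \<in> span {u}" for y x
    by (rule linear_eq_0_on_span[OF M.linear_\<sigma> _ that]) (simp add: u[rule_format])
  have id: "lie_ideal G (span {u})"
    unfolding submodule_def using s t real_vector.subspace_0[OF s] by simp
  have "semisimple_quotient G (span {u}) {0}"
    by (rule M.semisimple_quotient_trivial[OF s]) (use t real_vector.subspace_0[OF s] in \<open>simp_all add: real_vector.subspace_single_0\<close>)
  then have "span {u} \<subseteq> SG (Suc 0)"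
    by (intro M.S_ideal_Suc(3)[OF id]) (use real_vector.subspace_0[OF s] in simp_all)
  then show ?thesis using real_vector.span_base[of u "{u}"] by auto
qed

text \<open>As \<open>diagonal_in_Lstar_Suc\<close>, with central elements in place of the ideal belonging to \<open>\<bb>\<^sub>k\<close>.\<close>

lemma diagonal_in_Lstar_1:
  assumes nd: "nondegenerate_on ip central_part" and P0: "steps_project_to_zero 0" shows "diagonal_in_Lstar 1"
proof -
  let ?W = "SG (Suc 0) \<inter> RG (Suc 0)"
  have W: "lie_ideal G ?W" by (rule submodule_Int[OF M.S_ideal_ideal M.R_ideal_ideal])
  have Wj: "?W \<subseteq> Lstar_perp" using P0 by (auto simp: steps_project_to_zero_def)
  have W0: "?W \<inter> SG 0 \<subseteq> Lstar" by (auto simp: Lstar_iff)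
  obtain V where V: "lie_ideal G V" "V \<subseteq> ?W" "V \<inter> Lstar \<subseteq> SG 0" "(\<lambda>x. ac x) ` V = (\<lambda>x. ac x) ` ?W"
    using filtration_lift[OF W Int_lower1 Wj W0] by blast
  have Vj: "V \<subseteq> Lstar_perp" using V(2) Wj by blast
  have V0: "V \<inter> Lstar \<subseteq> {0}" using V(3) by simp
  have aW: "(\<lambda>x. ac x) ` ?W \<subseteq> central_part" unfolding V(4)[symmetric] using ac_in_central_part[OF V(1) Vj V0] by blast
  have "diagonal_in_Lstar (Suc 0)"
    unfolding diagonal_in_Lstar_def
  proof
    fix x assume x: "x \<in> ?W"
    have xb: "ac x \<in> central_part" using aW x by blast
    have lx: "lc x = 0" using x Wj by (auto simp: Lstar_perp_iff)
    have "ip (ac x) y = 0" if y: "y \<in> central_part" for y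
    proof -
      obtain u where u: "\<forall>y. G y u = 0" "lc u = 0" "ac u = y" using central_part_lifts[OF y] by blast
      have "P x u = 0" using M.S_perp_R[of u "Suc 0" x] central_in_SG1[OF u(1)] x by simp
      then show ?thesis by (simp add: P_eq u lx lin_simps)
    qed
    then have "ac x = 0" using nd xb unfolding nondegenerate_on_def by blast
    then show "x \<in> Lstar" using lx by (simp add: Lstar_iff)
  qed
  then show ?thesis by simp
qed

lemma central_part_nondegenerate:
  assumes bal: "balanced G Lstar" shows "nondegenerate_on ip central_part"
  unfolding nondegenerate_on_def
proof (intro ballI impI)
  have PQ: "steps_project_to_zero k" "diagonal_in_Lstar k" for k using bal unfolding balanced_iff by blast+
  fix x assume x: "x \<in> central_part" and o: "\<forall>y\<in>central_part. ip x y = 0"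
  obtain u where u: "\<forall>y. G y u = 0" "lc u = 0" "ac u = x" using central_part_lifts[OF x] by blast
  have uS: "u \<in> SG 1" by (rule central_in_SG1[OF u(1)])
  have "u \<in> Lstar"
  proof (rule orthogonal_to_filtration_in_Lstar[OF bal])
    fix i w assume "w \<in> SG (Suc i)" "w \<in> RG i"
    then have w: "w \<in> SG (Suc i) \<inter> RG i" by simp
    show "P w u = 0"
    proof (cases "i = 0")
      case True
      let ?W = "SG (Suc 0)"
      have W: "lie_ideal G ?W" by (rule M.S_ideal_ideal)
      have Wj: "?W \<subseteq> Lstar_perp" using PQ(1)[of 0] by (simp add: steps_project_to_zero_def)
      have W0: "?W \<inter> SG 0 \<subseteq> Lstar" by (auto simp: Lstar_iff)
      obtain V where V: "lie_ideal G V" "V \<subseteq> ?W" "V \<inter> Lstar \<subseteq> SG 0" "(\<lambda>x. ac x) ` V = (\<lambda>x. ac x) ` ?W"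
        using filtration_lift[OF W subset_refl Wj W0] by blast
      have Vj: "V \<subseteq> Lstar_perp" using V(2) Wj by blast
      have V0: "V \<inter> Lstar \<subseteq> {0}" using V(3) by simp
      have "(\<lambda>x. ac x) ` ?W \<subseteq> central_part" unfolding V(4)[symmetric] using ac_in_central_part[OF V(1) Vj V0] by blast
      then have "ac w \<in> central_part" using w True by blast
      then have "ip (ac w) x = 0" using o A.sym[of x "ac w"] by simp
      moreover have "lc w = 0" using w Wj True by (auto simp: Lstar_perp_iff)
      ultimately show ?thesis using u by (simp add: P_eq lin_simps)
    next
      case False
      then have "w \<in> RG 1" using w M.R_ideal_antimono[of 1 i] by auto
      then show ?thesis using M.S_perp_R[of u 1 w] uS by blast
    qed
  qed
  then show "x = 0" unfolding u(3)[symmetric] by (simp add: Lstar_iff)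
qed

end

section \<open>The invariant component of the cocycle\<close>

lemma ext_lift_Nil: "ext_lift \<beta> [] = 0"
  and ext_lift_Cons: "ext_lift \<beta> ((x, y) # ps) = \<beta> x y + ext_lift \<beta> ps"
  and ext_lift_append: "ext_lift \<beta> (ps @ qs) = ext_lift \<beta> ps + ext_lift \<beta> qs"
  by (simp_all add: ext_lift_def)

lemma ext_lift_linear:
  assumes "linear f" shows "f (ext_lift \<beta> ps) = ext_lift (\<lambda>x y. f (\<beta> x y)) ps"
  by (induction ps) (auto simp: ext_lift_def linear_0[OF assms] linear_add[OF assms])

lemma ext_lift_cong:
  "(\<And>x y. (x, y) \<in> set ps \<Longrightarrow> \<beta> x y = \<beta>' x y) \<Longrightarrow> ext_lift \<beta> ps = ext_lift \<beta>' ps"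
  by (induction ps) (auto simp: ext_lift_def)

lemma ext_lift_scale:
  assumes "bilinear \<beta>"
  shows "ext_lift \<beta> (map (\<lambda>(x, y). (r *\<^sub>R x, y)) ps) = r *\<^sub>R ext_lift \<beta> ps"
  by (induction ps) (auto simp: ext_lift_def bilinear_lmul[OF assms] algebra_simps)

lemma ext_lift_map:
  "ext_lift \<beta> (map (\<lambda>(x, y). (f x, g y)) ps) = ext_lift (\<lambda>x y. \<beta> (f x) (g y)) ps"
  by (induction ps) (auto simp: ext_lift_def)

lemma ext_lift_in_span:
  "set ps \<subseteq> U \<times> U \<Longrightarrow> ext_lift \<beta> ps \<in> span {\<beta> x y | x y. x \<in> U \<and> y \<in> U}"
proof (induction ps)
  case Nil
  show ?case by (simp add: ext_lift_def real_vector.span_zero)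
next
  case (Cons p ps)
  obtain x y where p: "p = (x, y)" by force
  have "\<beta> x y \<in> span {\<beta> x y | x y. x \<in> U \<and> y \<in> U}" using Cons.prems p by (intro real_vector.span_base) auto
  then show ?case using Cons by (simp add: p ext_lift_Cons real_vector.span_add)
qed

text \<open>The hypothesis says that every relation between brackets is respected by \<open>\<beta>\<close>, so the functional can be
  defined on a basis of the span that consists of brackets.\<close>

lemma functional_on_brackets:
  assumes br: "bilinear br" and \<beta>: "bilinear (\<beta> :: 'l::real_vector \<Rightarrow> 'l \<Rightarrow> real)"
    and z: "\<And>ps. ps \<in> ext_ker UNIV br \<Longrightarrow> ext_lift \<beta> ps = 0"
  shows "\<exists>g. linear g \<and> (\<forall>x y. g (br x y :: 'g::real_vector) = \<beta> x y)"
proof -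
  let ?D = "{br x y | x y. True}"
  obtain C where C: "C \<subseteq> ?D" "independent C" "?D \<subseteq> span C"
    using real_vector.maximal_independent_subset[of ?D] by blast
  have "\<forall>c\<in>C. \<exists>p. c = br (fst p) (snd p)" using C(1) by fastforce
  then have "\<exists>h. \<forall>c\<in>C. c = br (fst (h c)) (snd (h c))" by (rule bchoice)
  then obtain h where h: "\<forall>c\<in>C. c = br (fst (h c)) (snd (h c))" by (elim exE)
  obtain g where g: "linear g" "\<forall>c\<in>C. g c = \<beta> (fst (h c)) (snd (h c))"
    using real_vector.linear_independent_extend[OF C(2), of "\<lambda>c. \<beta> (fst (h c)) (snd (h c))"] by blast
  have "g (br x y) = \<beta> x y" for x y
  proof -
    have "br x y \<in> span C" using C(3) by blast
    then obtain t r where t: "finite t" "t \<subseteq> C" "br x y = (\<Sum>c\<in>t. r c *\<^sub>R c)"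
      unfolding real_vector.span_explicit by blast
    obtain cs where cs: "set cs = t" "distinct cs" using finite_distinct_list[OF t(1)] by blast
    let ?qs = "map (\<lambda>c. ((- r c) *\<^sub>R fst (h c), snd (h c))) cs"
    have lst: "ext_lift b ?qs = - (\<Sum>c\<in>t. r c *\<^sub>R b (fst (h c)) (snd (h c)))" if "bilinear b"
      for b :: "'l \<Rightarrow> 'l \<Rightarrow> 'w::real_vector"
    proof -
      have "ext_lift b ?qs = (\<Sum>c\<leftarrow>cs. - (r c *\<^sub>R b (fst (h c)) (snd (h c))))"
        by (simp add: ext_lift_def o_def bilinear_lmul[OF that] bilinear_lneg[OF that])
      also have "\<dots> = (\<Sum>c\<in>t. - (r c *\<^sub>R b (fst (h c)) (snd (h c))))"
        using sum.distinct_set_conv_list[OF cs(2), of "\<lambda>c. - (r c *\<^sub>R b (fst (h c)) (snd (h c)))"] cs(1) by simp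
      finally show ?thesis by (simp add: sum_negf)
    qed
    have "(\<Sum>c\<in>t. r c *\<^sub>R br (fst (h c)) (snd (h c))) = (\<Sum>c\<in>t. r c *\<^sub>R c)"
      by (rule sum.cong[OF refl]) (use h t(2) in \<open>metis subsetD\<close>)
    then have e: "ext_lift br ((x, y) # ?qs) = 0"
      unfolding ext_lift_Cons lst[OF br] t(3) by simp
    have "(x, y) # ?qs \<in> ext_ker UNIV br"
      unfolding ext_ker_def by (rule CollectI, rule conjI[OF _ e]) simp
    from z[OF this] have "\<beta> x y = (\<Sum>c\<in>t. r c *\<^sub>R \<beta> (fst (h c)) (snd (h c)))"
      unfolding ext_lift_Cons lst[OF \<beta>] by simp
    also have "\<dots> = (\<Sum>c\<in>t. r c *\<^sub>R g c)"
      by (rule sum.cong[OF refl]) (use g(2) t(2) in auto)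
    also have "\<dots> = g (br x y)"
      unfolding t(3) by (simp only: linear_sum[OF g(1)] linear_cmul[OF g(1)])
    finally show ?thesis by simp
  qed
  then show ?thesis using g(1) by blast
qed

lemma subspace_minus_space: "linear f \<Longrightarrow> subspace (minus_space f)"
  and subspace_plus_space: "linear f \<Longrightarrow> subspace (plus_space f)"
  by (simp_all add: minus_space_def plus_space_def real_vector.subspace_def linear_0 linear_add linear_cmul)

context quad_ext
begin

definition action_image :: "'a set" where "action_image = span {\<rho> L B | L B. True}"

abbreviation ainv where "ainv \<equiv> invariants \<rho>"

lemma ainv_iff: "A \<in> ainv \<longleftrightarrow> (\<forall>L. \<rho> L A = 0)"
  by (simp add: invariants_def)

lemma submodule_ainv: "submodule \<rho> ainv"
  unfolding submodule_def real_vector.subspace_def by (auto simp: ainv_iff lin_simps)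

lemma subspace_action_image: "subspace action_image"
  unfolding action_image_def by (rule real_vector.subspace_span)

lemma perp_action_image: "perp ip action_image = ainv"
proof
  show "perp ip action_image \<subseteq> ainv"
  proof
    fix x assume x: "x \<in> perp ip action_image"
    have "\<rho> L x = 0" for L
    proof (rule A.nondeg)
      fix y
      have "\<rho> L y \<in> action_image" unfolding action_image_def by (rule real_vector.span_base) blast
      then have "ip x (\<rho> L y) = 0" using x by (simp add: perp_def)
      then show "ip (\<rho> L x) y = 0" by (simp add: ip_skew)
    qed
    then show "x \<in> ainv" by (simp add: ainv_iff)
  qed
  show "ainv \<subseteq> perp ip action_image"
  proof
    fix x assume x: "x \<in> ainv"
    have "ip x y = 0" if "y \<in> action_image" for y
    proof (rule linear_eq_0_on_span[OF _ _ that[unfolded action_image_def]])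
      show "linear (ip x)" using A.bil by (simp add: bilinear_def)
      fix z assume "z \<in> {\<rho> L B | L B. True}"
      then obtain L B where "z = \<rho> L B" by blast
      then show "ip x z = 0" using ip_skew[of L x B] x by (simp add: ainv_iff lin_simps)
    qed
    then show "x \<in> perp ip action_image" by (simp add: perp_def)
  qed
qed

text \<open>The projection to the first summand of \<open>\<aa> = \<aa>\<^sup>\<ll> \<oplus> \<rho>(\<ll>)\<aa>\<close>, which exists if \<open>\<rho>\<close> is semi-simple.\<close>

definition inv_proj :: "'a \<Rightarrow> 'a" where
  "inv_proj v = (THE A. A \<in> ainv \<and> v - A \<in> action_image)"

lemma alpha0_eq: "alpha0 \<rho> \<alpha> x y = inv_proj (\<alpha> x y)"
  by (simp add: alpha0_def inv_proj_def action_image_def)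

context
  assumes ss: "semisimple \<rho>"
begin

lemma ainv_action_image: "ainv \<inter> action_image = {0}"
proof -
  note sub_ainv = submodule_subspace[OF submodule_ainv]
  have z: "{0} \<subseteq> ainv" using real_vector.subspace_0[OF sub_ainv] by simp
  obtain C where C: "submodule \<rho> C" "{0} \<subseteq> C" "C \<subseteq> UNIV" "ssum ainv C = UNIV" "ainv \<inter> C = {0}"
    by (rule semisimple_quotientE[OF ss[unfolded semisimple_def] submodule_ainv z subset_UNIV])
  have "{\<rho> L B | L B. True} \<subseteq> C"
  proof
    fix z assume "z \<in> {\<rho> L B | L B. True}"
    then obtain L B where zz: "z = \<rho> L B" by blast
    have "B \<in> ssum ainv C" using C(4) by simp
    then obtain i c where "i \<in> ainv" "c \<in> C" "B = i + c" by (elim ssumE)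
    then show "z \<in> C" using submoduleD[OF C(1), of c L] by (simp add: zz lin_simps ainv_iff)
  qed
  then have "action_image \<subseteq> C" unfolding action_image_def by (rule real_vector.span_minimal[OF _ submodule_subspace[OF C(1)]])
  then have "ainv \<inter> action_image \<subseteq> {0}" using C(5) by blast
  then show ?thesis using z real_vector.subspace_0[OF subspace_action_image] by blast
qed

lemma ainv_plus_action_image: "ssum ainv action_image = UNIV"
proof -
  note sub_ainv = submodule_subspace[OF submodule_ainv]
  have pi: "perp ip ainv = action_image" unfolding perp_action_image[symmetric] by (rule A.perp_perp[OF subspace_action_image])
  have s: "subspace (ssum ainv action_image)" by (rule subspace_ssum[OF sub_ainv subspace_action_image])
  have "perp ip (ssum ainv action_image) = {0}"
    unfolding A.perp_ssum[OF sub_ainv subspace_action_image] pi perp_action_image using ainv_action_image by blast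
  then have "perp ip (perp ip (ssum ainv action_image)) = UNIV" by (simp add: perp_def lin_simps)
  then show ?thesis by (simp only: A.perp_perp[OF s])
qed

lemma inv_proj_unique: assumes "A \<in> ainv" "v - A \<in> action_image" shows "inv_proj v = A"
  unfolding inv_proj_def
proof (rule the_equality)
  show "A \<in> ainv \<and> v - A \<in> action_image" using assms by blast
  fix A' assume A': "A' \<in> ainv \<and> v - A' \<in> action_image"
  have "A' - A \<in> ainv" using A' assms by (intro real_vector.subspace_diff[OF submodule_subspace[OF submodule_ainv]]) auto
  moreover have "(v - A) - (v - A') \<in> action_image" by (rule real_vector.subspace_diff[OF subspace_action_image assms(2) conjunct2[OF A']])
  then have "A' - A \<in> action_image" by simp
  ultimately have "A' - A \<in> ainv \<inter> action_image" by blast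
  then show "A' = A" unfolding ainv_action_image by simp
qed

lemma inv_proj_in: "inv_proj v \<in> ainv" "v - inv_proj v \<in> action_image"
proof -
  have "v \<in> ssum ainv action_image" using ainv_plus_action_image by simp
  then obtain A c where A: "A \<in> ainv" "c \<in> action_image" "v = A + c" by (elim ssumE)
  then have "inv_proj v = A" by (intro inv_proj_unique) simp_all
  then show "inv_proj v \<in> ainv" "v - inv_proj v \<in> action_image" using A by simp_all
qed

lemma inv_proj_linear: "linear inv_proj"
proof (rule linearI)
  note si = submodule_subspace[OF submodule_ainv]
  show "inv_proj (x + y) = inv_proj x + inv_proj y" for x y
  proof (rule inv_proj_unique)
    show "inv_proj x + inv_proj y \<in> ainv" by (intro real_vector.subspace_add[OF si] inv_proj_in)
    have "(x - inv_proj x) + (y - inv_proj y) \<in> action_image" by (intro real_vector.subspace_add[OF subspace_action_image] inv_proj_in)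
    then show "x + y - (inv_proj x + inv_proj y) \<in> action_image" by (simp add: algebra_simps)
  qed
  show "inv_proj (r *\<^sub>R x) = r *\<^sub>R inv_proj x" for r x
  proof (rule inv_proj_unique)
    show "r *\<^sub>R inv_proj x \<in> ainv" by (intro real_vector.subspace_scale[OF si] inv_proj_in)
    have "r *\<^sub>R (x - inv_proj x) \<in> action_image" by (intro real_vector.subspace_scale[OF subspace_action_image] inv_proj_in)
    then show "r *\<^sub>R x - r *\<^sub>R inv_proj x \<in> action_image" by (simp add: algebra_simps)
  qed
qed

lemma ip_inv_proj: "B \<in> ainv \<Longrightarrow> ip B (inv_proj v) = ip B v"
proof -
  assume "B \<in> ainv"
  then have "B \<in> perp ip action_image" by (simp only: perp_action_image)
  then have "ip B (v - inv_proj v) = 0" using inv_proj_in(2) unfolding perp_def by blast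
  then show ?thesis by (simp add: lin_simps)
qed

lemma ainv_nondegenerate: assumes "x \<in> ainv" "\<And>y. y \<in> ainv \<Longrightarrow> ip x y = 0" shows "x = 0"
proof (rule A.nondeg)
  show "ip x y = 0" for y using assms(2)[OF inv_proj_in(1)] ip_inv_proj[OF assms(1)] by simp
qed

lemma \<theta>a_rho: "\<theta>a (\<rho> X v) = \<rho> (\<theta>l X) (\<theta>a v)"
  using \<theta>a(4)[of "\<theta>l X" v] by (simp add: \<theta>l)

lemma inv_proj_\<theta>a: "inv_proj (\<theta>a v) = \<theta>a (inv_proj v)"
proof (rule inv_proj_unique)
  show "\<theta>a (inv_proj v) \<in> ainv"
    using inv_proj_in(1)[of v] \<theta>a(4)[of _ "inv_proj v"] by (simp add: ainv_iff \<theta>a(4)[symmetric] linear_0[OF \<theta>a(1)])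
  have "\<theta>a ` action_image \<subseteq> action_image"
  proof -
    have "\<theta>a ` {\<rho> L B | L B. True} \<subseteq> {\<rho> L B | L B. True}" using \<theta>a_rho by blast
    then show ?thesis
      unfolding action_image_def linear_span_image[OF \<theta>a(1), symmetric] by (rule real_vector.span_mono)
  qed
  then have "\<theta>a (v - inv_proj v) \<in> action_image" using inv_proj_in(2) by blast
  then show "\<theta>a v - \<theta>a (inv_proj v) \<in> action_image" by (simp add: linear_diff[OF \<theta>a(1)])
qed

lemma ext_lift_alpha0: "ext_lift (alpha0 \<rho> \<alpha>) ps = inv_proj (ext_lift \<alpha> ps)"
proof -
  have "alpha0 \<rho> \<alpha> = (\<lambda>x y. inv_proj (\<alpha> x y))" by (intro ext) (rule alpha0_eq)
  then show ?thesis by (simp add: ext_lift_linear[OF inv_proj_linear])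
qed

definition alpha0_image where "alpha0_image U = ext_lift (alpha0 \<rho> \<alpha>) ` ext_ker U br"

lemma alpha0_image_invariant: "alpha0_image U \<subseteq> ainv"
  unfolding alpha0_image_def ext_lift_alpha0 using inv_proj_in by blast

lemma ip_ext_lift: "ip B (ext_lift \<beta> ps) = ext_lift (\<lambda>x y. ip B (\<beta> x y)) ps"
  by (rule ext_lift_linear) (use A.bil in \<open>simp add: bilinear_def\<close>)

text \<open>An invariant vector \<open>B\<close> is the component of a central element if and only if \<open>ip B (\<alpha> x y)\<close> is a functional of
  the bracket of \<open>x\<close> and \<open>y\<close>.\<close>

lemma central_part_eq: "central_part = {B \<in> ainv. \<forall>e\<in>alpha0_image UNIV. ip B e = 0}"
proof
  show "central_part \<subseteq> {B \<in> ainv. \<forall>e\<in>alpha0_image UNIV. ip B e = 0}"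
  proof
    fix B assume "B \<in> central_part"
    then obtain Z :: "'l dual" where 1: "\<And>X. \<rho> X B = 0" and 2: "\<And>L X. ip B (\<alpha> L X) + dual_app Z (br L X) = 0"
      unfolding central_part_def by blast
    have Bi: "B \<in> ainv" using 1 by (simp add: ainv_iff)
    have "ip B (ext_lift (alpha0 \<rho> \<alpha>) ps) = 0" if "ps \<in> ext_ker UNIV br" for ps
    proof -
      have "ip B (ext_lift \<alpha> ps) = ext_lift (\<lambda>x y. - dual_app Z (br x y)) ps"
        unfolding ip_ext_lift by (rule ext_lift_cong) (use 2 in \<open>simp add: eq_neg_iff_add_eq_0\<close>)
      also have "\<dots> = - dual_app Z (ext_lift br ps)"
        using ext_lift_linear[of "\<lambda>x. - dual_app Z x" br ps, OF linear_compose_neg[OF linear_dual_app]] by simp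
      finally show ?thesis using that by (simp add: ext_lift_alpha0 ip_inv_proj[OF Bi] ext_ker_def lin_simps)
    qed
    then show "B \<in> {B \<in> ainv. \<forall>e\<in>alpha0_image UNIV. ip B e = 0}" using Bi by (auto simp: alpha0_image_def)
  qed
  show "{B \<in> ainv. \<forall>e\<in>alpha0_image UNIV. ip B e = 0} \<subseteq> central_part"
  proof
    fix B assume "B \<in> {B \<in> ainv. \<forall>e\<in>alpha0_image UNIV. ip B e = 0}"
    then have B: "B \<in> ainv" "\<And>ps. ps \<in> ext_ker UNIV br \<Longrightarrow> ip B (ext_lift (alpha0 \<rho> \<alpha>) ps) = 0"
      by (auto simp: alpha0_image_def)
    have bl: "bilinear (\<lambda>x y. ip B (\<alpha> x y))"
      unfolding bilinear_def by (intro conjI allI linearI) (simp_all add: lin_simps)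
    have "\<exists>g. linear g \<and> (\<forall>x y. g (br x y) = ip B (\<alpha> x y))"
    proof (rule functional_on_brackets[OF L.bil bl])
      fix ps assume "ps \<in> ext_ker UNIV br"
      from B(2)[OF this] show "ext_lift (\<lambda>x y. ip B (\<alpha> x y)) ps = 0"
        by (simp add: ext_lift_alpha0 ip_inv_proj[OF B(1)] ip_ext_lift)
    qed
    then obtain g where g: "linear g" "\<And>x y. g (br x y) = ip B (\<alpha> x y)" by blast
    have "ip B (\<alpha> L X) + dual_app (- dual_of g) (br L X) = 0" for L X
      by (simp add: dual_app_uminus dual_app_of_linear[OF g(1)] g(2))
    then show "B \<in> central_part" unfolding central_part_def using B(1) ainv_iff by blast
  qed
qed

lemma subspace_alpha0_image: "subspace (alpha0_image UNIV)"
  unfolding real_vector.subspace_def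
proof (intro conjI ballI allI)
  have "[] \<in> ext_ker UNIV br" by (simp add: ext_ker_def ext_lift_Nil)
  then show "0 \<in> alpha0_image UNIV" unfolding alpha0_image_def by (rule rev_image_eqI) (simp add: ext_lift_Nil)
  fix x y assume "x \<in> alpha0_image UNIV" "y \<in> alpha0_image UNIV"
  then obtain ps qs where p: "ps \<in> ext_ker UNIV br" "x = ext_lift (alpha0 \<rho> \<alpha>) ps"
    "qs \<in> ext_ker UNIV br" "y = ext_lift (alpha0 \<rho> \<alpha>) qs" unfolding alpha0_image_def by blast
  have "ps @ qs \<in> ext_ker UNIV br" using p by (simp add: ext_ker_def ext_lift_append)
  then show "x + y \<in> alpha0_image UNIV" unfolding alpha0_image_def by (rule rev_image_eqI) (simp add: p ext_lift_append)
next
  fix r x assume "x \<in> alpha0_image UNIV"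
  then obtain ps where p: "ps \<in> ext_ker UNIV br" "x = ext_lift (alpha0 \<rho> \<alpha>) ps" unfolding alpha0_image_def by blast
  let ?q = "map (\<lambda>(x, y). (r *\<^sub>R x, y)) ps"
  have "?q \<in> ext_ker UNIV br" using p by (simp add: ext_ker_def ext_lift_scale[OF L.bil])
  then show "r *\<^sub>R x \<in> alpha0_image UNIV"
    unfolding alpha0_image_def
    by (rule rev_image_eqI) (simp add: p(2) ext_lift_alpha0 ext_lift_scale[OF \<alpha>(1)] linear_cmul[OF inv_proj_linear])
qed

text \<open>By \<open>central_part_eq\<close> the two subspaces are orthogonal complements of each other in \<open>\<aa>\<^sup>\<ll>\<close>.\<close>

lemma cond_B0_iff: "cond_B0 br \<rho> ip \<alpha> \<longleftrightarrow> nondegenerate_on ip central_part"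
proof
  assume "cond_B0 br \<rho> ip \<alpha>"
  then have nd: "x = 0" if "x \<in> alpha0_image UNIV" "\<forall>y\<in>alpha0_image UNIV. ip x y = 0" for x
    using that unfolding cond_B0_def nondegenerate_on_def alpha0_image_def by blast
  have dec: "ssum (alpha0_image UNIV) (perp ip (alpha0_image UNIV)) = UNIV"
  proof (rule orthogonal_decomposition[OF A.fd A.bil A.sym subspace_alpha0_image])
    fix x z assume "z \<in> alpha0_image UNIV" "z \<in> perp ip (alpha0_image UNIV)"
    then have "z = 0" using nd by (simp add: perp_def)
    then show "ip x z = 0" by (simp add: lin_simps)
  qed
  show "nondegenerate_on ip central_part"
    unfolding nondegenerate_on_def
  proof (intro ballI impI)
    fix x assume x: "x \<in> central_part" and o: "\<forall>y\<in>central_part. ip x y = 0"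
    have xi: "x \<in> ainv" "\<And>e. e \<in> alpha0_image UNIV \<Longrightarrow> ip x e = 0" using x unfolding central_part_eq by auto
    show "x = 0"
    proof (rule ainv_nondegenerate[OF xi(1)])
      fix y assume y: "y \<in> ainv"
      have "y \<in> ssum (alpha0_image UNIV) (perp ip (alpha0_image UNIV))" using dec by simp
      then obtain e f where ef: "e \<in> alpha0_image UNIV" "f \<in> perp ip (alpha0_image UNIV)" "y = e + f" by (elim ssumE)
      have "y - e \<in> ainv"
        using y ef(1) alpha0_image_invariant by (intro real_vector.subspace_diff[OF submodule_subspace[OF submodule_ainv]]) auto
      then have "f \<in> central_part" unfolding central_part_eq using ef by (auto simp: perp_def)
      then show "ip x y = 0" using o xi(2)[OF ef(1)] by (simp add: ef(3) lin_simps)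
    qed
  qed
next
  assume nd: "nondegenerate_on ip central_part"
  show "cond_B0 br \<rho> ip \<alpha>"
    unfolding cond_B0_def alpha0_image_def[symmetric] nondegenerate_on_def
  proof (intro ballI impI)
    fix e assume e: "e \<in> alpha0_image UNIV" "\<forall>y\<in>alpha0_image UNIV. ip e y = 0"
    then have "e \<in> central_part" unfolding central_part_eq using alpha0_image_invariant by blast
    moreover have "ip e y = 0" if "y \<in> central_part" for y
      using that e(1) A.sym[of e y] unfolding central_part_eq by auto
    ultimately show "e = 0" using nd unfolding nondegenerate_on_def by blast
  qed
qed

lemma alpha0_image_minus_subset: "alpha0_image (minus_space \<theta>l) \<subseteq> ainv \<inter> plus_space \<theta>a"
proof
  fix e assume "e \<in> alpha0_image (minus_space \<theta>l)"
  then obtain ps where ps: "ps \<in> ext_ker (minus_space \<theta>l) br" "e = ext_lift (alpha0 \<rho> \<alpha>) ps"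
    unfolding alpha0_image_def by blast
  have "\<theta>a (ext_lift \<alpha> ps) = ext_lift (\<lambda>x y. \<theta>a (\<alpha> x y)) ps" by (rule ext_lift_linear[OF \<theta>a(1)])
  also have "\<dots> = ext_lift \<alpha> ps"
  proof (rule ext_lift_cong)
    fix x y assume "(x, y) \<in> set ps"
    then have "\<theta>l x = - x" "\<theta>l y = - y" using ps(1) by (auto simp: ext_ker_def minus_space_def)
    then show "\<theta>a (\<alpha> x y) = \<alpha> x y" using \<alpha>(3)[of x y] by (simp add: lin_simps)
  qed
  finally have "\<theta>a e = e" unfolding ps(2) ext_lift_alpha0 inv_proj_\<theta>a[symmetric] by simp
  then show "e \<in> ainv \<inter> plus_space \<theta>a"
    using \<open>e \<in> alpha0_image _\<close> alpha0_image_invariant by (auto simp: plus_space_def)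
qed

lemma cond_T2_iff: "cond_T2 br \<theta>l \<rho> \<theta>a \<alpha> \<longleftrightarrow> ainv \<inter> plus_space \<theta>a \<subseteq> alpha0_image (minus_space \<theta>l)"
  unfolding cond_T2_def alpha0_image_def[symmetric] using alpha0_image_minus_subset by blast

end

section \<open>Symmetric triples\<close>

lemma minus_T: "x \<in> minus_space T \<longleftrightarrow> (\<forall>X. zc x (\<theta>l X) = - zc x X) \<and> \<theta>a (ac x) = - ac x \<and> \<theta>l (lc x) = - lc x"
  unfolding minus_space_def mem_Collect_eq model_eq_iff by (simp add: comp_simps dual_app_uminus)

lemma plus_T: "x \<in> plus_space T \<longleftrightarrow> (\<forall>X. zc x (\<theta>l X) = zc x X) \<and> \<theta>a (ac x) = ac x \<and> \<theta>l (lc x) = lc x"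
  unfolding plus_space_def mem_Collect_eq model_eq_iff by (simp add: comp_simps)

lemma lie_span_minus_subset: "lie_span br (minus_space \<theta>l) \<subseteq> plus_space \<theta>l"
  unfolding lie_span_def
proof (rule real_vector.span_minimal[OF _ subspace_plus_space[OF \<theta>l(1)]])
  show "{br x y | x y. x \<in> minus_space \<theta>l \<and> y \<in> minus_space \<theta>l} \<subseteq> plus_space \<theta>l"
    by (auto simp: minus_space_def plus_space_def \<theta>l(3) lin_simps)
qed

lemma lie_span_G_minus_subset: "lie_span G (minus_space T) \<subseteq> plus_space T"
  unfolding lie_span_def
proof (rule real_vector.span_minimal[OF _ subspace_plus_space[OF linear_T]])
  show "{G x y | x y. x \<in> minus_space T \<and> y \<in> minus_space T} \<subseteq> plus_space T"
  proof
    fix z assume "z \<in> {G x y | x y. x \<in> minus_space T \<and> y \<in> minus_space T}"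
    then obtain x y where "z = G x y" "T x = - x" "T y = - y" unfolding minus_space_def by blast
    then have "T z = z" by (simp add: T_aut bilinear_lneg[OF bilinear_G] bilinear_rneg[OF bilinear_G])
    then show "z \<in> plus_space T" unfolding plus_space_def by blast
  qed
qed

lemma lie_span_G_bracket_list:
  "x \<in> lie_span G (minus_space T) \<Longrightarrow> \<exists>qs. set qs \<subseteq> minus_space T \<times> minus_space T \<and> x = ext_lift G qs"
  unfolding lie_span_def ext_lift_def
  by (rule M.span_brackets_list[OF subspace_minus_space[OF linear_T]])

lemma lc_bracket_list:
  assumes "set qs \<subseteq> minus_space T \<times> minus_space T"
  shows "set (map (\<lambda>(x, y). (lc x, lc y)) qs) \<subseteq> minus_space \<theta>l \<times> minus_space \<theta>l"
    and "ext_lift br (map (\<lambda>(x, y). (lc x, lc y)) qs) = lc (ext_lift G qs)"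
proof -
  have "lc x \<in> minus_space \<theta>l" if "x \<in> minus_space T" for x
    using that unfolding minus_T by (simp add: minus_space_def)
  then show "set (map (\<lambda>(x, y). (lc x, lc y)) qs) \<subseteq> minus_space \<theta>l \<times> minus_space \<theta>l"
    using assms by fastforce
  show "ext_lift br (map (\<lambda>(x, y). (lc x, lc y)) qs) = lc (ext_lift G qs)"
    unfolding ext_lift_map ext_lift_linear[OF linear_lc] lc_G ..
qed

text \<open>Write \<open>(0, 0, L)\<close>, respectively \<open>(0, A, 0)\<close>, as a sum of brackets of elements of \<open>\<dd>\<^sub>-\<close>. The
  \<open>\<ll>\<close>-components of these elements give a sum of brackets in \<open>\<ll>\<^sub>-\<close>, and the \<open>\<aa>\<close>-component of the sum differs
  from that of \<open>\<alpha>\<close> only by elements of \<open>\<rho>(\<ll>)\<aa>\<close>.\<close>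

lemma conditions_from_symmetric:
  assumes s: "lie_span G (minus_space T) = plus_space T"
  shows "lie_span br (minus_space \<theta>l) = plus_space \<theta>l"
    and "semisimple \<rho> \<Longrightarrow> cond_T2 br \<theta>l \<rho> \<theta>a \<alpha>"
proof -
  show "lie_span br (minus_space \<theta>l) = plus_space \<theta>l"
  proof (rule subset_antisym[OF lie_span_minus_subset])
    show "plus_space \<theta>l \<subseteq> lie_span br (minus_space \<theta>l)"
    proof
      fix L assume "L \<in> plus_space \<theta>l"
      then have "(0, 0, L) \<in> plus_space T"
        unfolding plus_T by (simp add: dual_app_0 linear_0[OF \<theta>a(1)] plus_space_def)
      then obtain qs where qs: "set qs \<subseteq> minus_space T \<times> minus_space T" "(0, 0, L) = ext_lift G qs"
        using lie_span_G_bracket_list s by blast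
      have "L = ext_lift br (map (\<lambda>(x, y). (lc x, lc y)) qs)"
        unfolding lc_bracket_list(2)[OF qs(1)] qs(2)[symmetric] by simp
      then show "L \<in> lie_span br (minus_space \<theta>l)"
        unfolding lie_span_def using ext_lift_in_span[OF lc_bracket_list(1)[OF qs(1)], of br] by simp
    qed
  qed
  show "cond_T2 br \<theta>l \<rho> \<theta>a \<alpha>" if ss: "semisimple \<rho>"
    unfolding cond_T2_iff[OF ss]
  proof
    fix A assume A: "A \<in> ainv \<inter> plus_space \<theta>a"
    then have "(0, A, 0) \<in> plus_space T"
      unfolding plus_T by (simp add: dual_app_0 linear_0[OF \<theta>l(1)] plus_space_def)
    then obtain qs where qs: "set qs \<subseteq> minus_space T \<times> minus_space T" "(0, A, 0) = ext_lift G qs"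
      using lie_span_G_bracket_list s by blast
    let ?ps = "map (\<lambda>(x, y). (lc x, lc y)) qs"
    have "ext_lift br ?ps = 0" unfolding lc_bracket_list(2)[OF qs(1)] qs(2)[symmetric] by simp
    then have ps: "?ps \<in> ext_ker (minus_space \<theta>l) br"
      using lc_bracket_list(1)[OF qs(1)] unfolding ext_ker_def by blast
    have "ext_lift \<alpha> (map (\<lambda>(x, y). (lc x, lc y)) rs) - ac (ext_lift G rs) \<in> action_image" for rs
    proof (induction rs)
      case Nil
      then show ?case by (simp add: ext_lift_Nil real_vector.subspace_0[OF subspace_action_image])
    next
      case (Cons r rs)
      obtain x y where r: "r = (x, y)" by (cases r)
      have ru: "\<rho> u v \<in> action_image" for u v unfolding action_image_def by (rule real_vector.span_base) blast
      have "(ext_lift \<alpha> (map (\<lambda>(x, y). (lc x, lc y)) rs) - ac (ext_lift G rs)) + (\<rho> (lc y) (ac x) - \<rho> (lc x) (ac y)) \<in> action_image"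
        by (rule real_vector.subspace_add[OF subspace_action_image Cons real_vector.subspace_diff[OF subspace_action_image ru ru]])
      then show ?case by (simp add: r ext_lift_Cons ac_G algebra_simps)
    qed
    from this[of qs] have "ext_lift \<alpha> ?ps - A \<in> action_image" unfolding qs(2)[symmetric] by simp
    then have "inv_proj (ext_lift \<alpha> ?ps) = A" using A by (intro inv_proj_unique[OF ss]) auto
    then show "A \<in> alpha0_image (minus_space \<theta>l)"
      unfolding alpha0_image_def[OF ss] using ps by (intro image_eqI[OF _ ps]) (simp add: ext_lift_alpha0[OF ss])
  qed
qed

text \<open>The bracket of \<open>x = (Z, a, K)\<close> is shown to vanish on one component of \<open>\<dd>\<close> after the other. On each of
  them the minus part is given, possibly after dualising, and the plus part of \<open>\<ll>\<close> is reached through \<open>[\<ll>\<^sub>-, \<ll>\<^sub>-] = \<ll>\<^sub>+\<close>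
  (the local fact \<open>decomp\<close>). On \<open>\<aa>\<^sub>+\<close> one uses in addition that \<open>\<rho>(K)v\<close> is invariant, and that
  \<open>\<aa>\<^sup>\<ll> \<inter> \<rho>(\<ll>)\<aa> = 0\<close>.\<close>

lemma centralizer_of_minus:
  assumes i: "lie_span br (minus_space \<theta>l) = plus_space \<theta>l" and ss: "semisimple \<rho>"
    and x: "x \<in> plus_space T" and c: "\<And>u. u \<in> minus_space T \<Longrightarrow> G u x = 0"
  shows "G y x = 0"
proof -
  have half: "X = (1/2) *\<^sub>R (X + f X) + (1/2) *\<^sub>R (X - f X)" for X :: "'w::real_vector" and f
    by (simp add: algebra_simps flip: scaleR_add_left)
  have pm: "X + \<theta>l X \<in> plus_space \<theta>l" "X - \<theta>l X \<in> minus_space \<theta>l" for X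
    by (simp_all add: plus_space_def minus_space_def linear_add[OF \<theta>l(1)] linear_diff[OF \<theta>l(1)] \<theta>l(2))
  have pma: "a + \<theta>a a \<in> plus_space \<theta>a" "a - \<theta>a a \<in> minus_space \<theta>a" for a
    by (simp_all add: plus_space_def minus_space_def linear_add[OF \<theta>a(1)] linear_diff[OF \<theta>a(1)] \<theta>a(2))
  have decomp: "Q X" if s: "subspace {X. Q X}" and m: "\<And>X. X \<in> minus_space \<theta>l \<Longrightarrow> Q X"
    and b: "\<And>p q. p \<in> minus_space \<theta>l \<Longrightarrow> q \<in> minus_space \<theta>l \<Longrightarrow> Q (br p q)" for Q X
  proof -
    have "plus_space \<theta>l \<subseteq> {X. Q X}"
      unfolding i[symmetric] lie_span_def by (rule real_vector.span_minimal[OF _ s]) (use b in blast)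
    then have 1: "X + \<theta>l X \<in> {X. Q X}" using pm(1) by blast
    have 2: "X - \<theta>l X \<in> {X. Q X}" using pm(2) m by blast
    have "(1/2) *\<^sub>R (X + \<theta>l X) + (1/2) *\<^sub>R (X - \<theta>l X) \<in> {X. Q X}"
      by (intro real_vector.subspace_add[OF s] real_vector.subspace_scale[OF s] 1 2)
    then show ?thesis using half[of X \<theta>l] by simp
  qed
  let ?K = "lc x" and ?a = "ac x"
  have xp: "\<And>X. zc x (\<theta>l X) = zc x X" "\<theta>a ?a = ?a" "\<theta>l ?K = ?K" using x unfolding plus_T by auto
  have brm: "br ?K X = 0" if X: "X \<in> minus_space \<theta>l" for X
  proof (rule dual_separates)
    fix Z :: "'l dual"
    define Z' where "Z' = dual_of (\<lambda>X. dual_app Z X - dual_app Z (\<theta>l X))"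
    have "linear (\<lambda>X. dual_app Z X - dual_app Z (\<theta>l X))"
      by (rule linearI) (simp_all add: lin_simps linear_add[OF \<theta>l(1)] linear_cmul[OF \<theta>l(1)] algebra_simps)
    then have Z': "dual_app Z' X = dual_app Z X - dual_app Z (\<theta>l X)" for X
      unfolding Z'_def by (rule dual_app_of_linear)
    have "(Z', 0, 0) \<in> minus_space T"
      unfolding minus_T by (simp add: Z' \<theta>l(2) linear_0[OF \<theta>l(1)] linear_0[OF \<theta>a(1)])
    from c[OF this] have "dual_app Z' (br ?K X) = 0"
      using zc_G[of "(Z', 0, 0)" x X] by (simp add: lin_simps)
    moreover have "\<theta>l (br ?K X) = - br ?K X"
      using X by (simp add: \<theta>l(3) xp(3) minus_space_def lin_simps)
    ultimately show "dual_app Z (br ?K X) = 0" by (simp add: Z' lin_simps)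
  qed
  have brK: "br ?K X = 0" for X
  proof (rule decomp[of "\<lambda>X. br ?K X = 0"])
    show "subspace {X. br ?K X = 0}" by (simp add: real_vector.subspace_def lin_simps)
    show "br ?K (br p q) = 0" if "p \<in> minus_space \<theta>l" "q \<in> minus_space \<theta>l" for p q
      using jacobi_l[of ?K p q] brm[OF that(1)] brm[OF that(2)] by (simp add: lin_simps)
  qed (rule brm)
  have brK': "br X ?K = 0" for X using L.br_anti[of X ?K] by (simp add: brK)
  have rm: "\<rho> ?K v = 0" if v: "v \<in> minus_space \<theta>a" for v
  proof -
    have "(0, v, 0) \<in> minus_space T"
      using v unfolding minus_T by (simp add: linear_0[OF \<theta>l(1)] dual_app_0 minus_space_def)
    from c[OF this] show ?thesis using ac_G[of "(0, v, 0)" x] by (simp add: lin_simps)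
  qed
  have rcomm: "\<rho> X (\<rho> ?K v) = \<rho> ?K (\<rho> X v)" for X v
    using rho.\<sigma>_br[of X ?K v] by (simp add: brK' lin_simps)
  have rp: "\<rho> ?K v = 0" if v: "v \<in> plus_space \<theta>a" for v
  proof -
    have m: "\<rho> X (\<rho> ?K v) = 0" if X: "X \<in> minus_space \<theta>l" for X
    proof -
      have "\<theta>a (\<rho> X v) = - \<rho> X v"
        using X v by (simp add: \<theta>a_rho[OF ss] minus_space_def plus_space_def lin_simps)
      then show ?thesis unfolding rcomm by (intro rm) (simp add: minus_space_def)
    qed
    have "\<rho> X (\<rho> ?K v) = 0" for X
    proof (rule decomp[of "\<lambda>X. \<rho> X (\<rho> ?K v) = 0"])
      show "subspace {X. \<rho> X (\<rho> ?K v) = 0}" by (simp add: real_vector.subspace_def lin_simps)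
      show "\<rho> (br p q) (\<rho> ?K v) = 0" if "p \<in> minus_space \<theta>l" "q \<in> minus_space \<theta>l" for p q
        using m[OF that(1)] m[OF that(2)] by (simp add: rho.\<sigma>_br lin_simps)
    qed (rule m)
    then have "\<rho> ?K v \<in> ainv" by (simp add: ainv_iff)
    moreover have "\<rho> ?K v \<in> action_image" unfolding action_image_def by (rule real_vector.span_base) blast
    ultimately show ?thesis using ainv_action_image[OF ss] by blast
  qed
  have rK: "\<rho> ?K v = 0" for v
  proof -
    have "\<rho> ?K ((1/2) *\<^sub>R (v + \<theta>a v) + (1/2) *\<^sub>R (v - \<theta>a v)) = 0"
      unfolding bilinear_radd[OF rho.bil_\<sigma>, of ?K "(1/2) *\<^sub>R (v + \<theta>a v)"] bilinear_rmul[OF rho.bil_\<sigma>]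
      using rm[OF pma(2)] rp[OF pma(1)] by simp
    then show ?thesis using half[of v \<theta>a] by simp
  qed
  have am: "\<alpha> X ?K + \<rho> X ?a = 0" if X: "X \<in> minus_space \<theta>l" for X
  proof -
    have "(0, 0, X) \<in> minus_space T"
      using X unfolding minus_T by (simp add: linear_0[OF \<theta>a(1)] dual_app_0 minus_space_def)
    from c[OF this] show ?thesis using ac_G[of "(0, 0, X)" x] by (simp add: lin_simps)
  qed
  have aK: "\<alpha> X ?K + \<rho> X ?a = 0" for X
  proof (rule decomp[of "\<lambda>X. \<alpha> X ?K + \<rho> X ?a = 0"])
    show "subspace {X. \<alpha> X ?K + \<rho> X ?a = 0}"
      unfolding real_vector.subspace_def
    proof (intro conjI ballI allI)
      fix x y assume "x \<in> {X. \<alpha> X ?K + \<rho> X ?a = 0}" "y \<in> {X. \<alpha> X ?K + \<rho> X ?a = 0}"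
      then have "(\<alpha> x ?K + \<rho> x ?a) + (\<alpha> y ?K + \<rho> y ?a) = 0" by simp
      then show "x + y \<in> {X. \<alpha> X ?K + \<rho> X ?a = 0}" by (simp add: lin_simps algebra_simps)
    next
      fix r x assume "x \<in> {X. \<alpha> X ?K + \<rho> X ?a = 0}"
      then have "r *\<^sub>R (\<alpha> x ?K + \<rho> x ?a) = 0" by simp
      then show "r *\<^sub>R x \<in> {X. \<alpha> X ?K + \<rho> X ?a = 0}" unfolding scaleR_add_right by (simp add: lin_simps)
    qed (simp add: lin_simps)
    fix p q assume "p \<in> minus_space \<theta>l" "q \<in> minus_space \<theta>l"
    then have pq: "\<alpha> p ?K = - \<rho> p ?a" "\<alpha> q ?K = - \<rho> q ?a" using am by (simp_all add: eq_neg_iff_add_eq_0)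
    have "ce_d2 br \<rho> \<alpha> p q ?K = 0" by (rule \<alpha>(4))
    then show "\<alpha> (br p q) ?K + \<rho> (br p q) ?a = 0"
      by (simp add: ce_d2_def pq brK' rK rho.\<sigma>_br lin_simps algebra_simps)
  qed (rule am)
  have cj: "G u x = 0" if u: "lc u = 0" for u
  proof -
    have "ip (ac u) (\<alpha> ?K X) + ip (\<rho> X (ac u)) ?a = 0" for X
    proof -
      have "ip (ac u) (\<alpha> X ?K + \<rho> X ?a) = 0" by (simp only: aK bilinear_rzero[OF A.bil])
      then show ?thesis using \<alpha>_anti[of ?K X] ip_skew[of X "ac u" ?a] by (simp add: lin_simps)
    qed
    then show ?thesis
      unfolding model_eq_iff by (simp add: comp_simps u brK rK lin_simps)
  qed
  have jac: "G (G p q) x = 0" if "G p x = 0" "G q x = 0" for p q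
    using M.\<sigma>_br[of p q x] that by (simp add: bilinear_rzero[OF bilinear_G])
  have cl: "G (0, 0, X) x = 0" for X
  proof (rule decomp[of "\<lambda>X. G (0, 0, X) x = 0"])
    have l: "linear (\<lambda>X. G (0, 0, X) x)"
    proof -
      have "linear (\<lambda>X. (0 :: 'l dual, 0 :: 'a, X))" by (rule linearI) simp_all
      moreover have "linear (\<lambda>y. G y x)" using bilinear_G unfolding bilinear_def by blast
      ultimately have "linear ((\<lambda>y. G y x) \<circ> (\<lambda>X. (0, 0, X)))" by (rule linear_compose)
      then show ?thesis unfolding o_def .
    qed
    show "subspace {X. G (0, 0, X) x = 0}" by (rule linear_subspace_kernel[OF l])
    show m: "G (0, 0, X) x = 0" if "X \<in> minus_space \<theta>l" for X
    proof (rule c)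
      show "(0, 0, X) \<in> minus_space T"
        unfolding minus_T using that by (simp add: linear_0[OF \<theta>a(1)] dual_app_0 minus_space_def)
    qed
    fix p q assume pq: "p \<in> minus_space \<theta>l" "q \<in> minus_space \<theta>l"
    let ?g = "G (0, 0, p) (0, 0, q)"
    have 1: "G ?g x = 0" by (rule jac[OF m[OF pq(1)] m[OF pq(2)]])
    have 2: "G ((0, 0, br p q) - ?g) x = 0" by (rule cj) (simp add: lc_G)
    have "G ((0, 0, br p q) - ?g) x = G (0, 0, br p q) x - G ?g x" by (rule bilinear_lsub[OF bilinear_G])
    then show "G (0, 0, br p q) x = 0" using 1 2 by simp
  qed
  have "y = (0, 0, lc y) + (y - (0, 0, lc y))" by simp
  then have "G y x = G (0, 0, lc y) x + G (y - (0, 0, lc y)) x"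
    using bilinear_ladd[OF bilinear_G, of "(0, 0, lc y)" "y - (0, 0, lc y)" x] by (simp only: )
  moreover have "G (y - (0, 0, lc y)) x = 0" by (rule cj) simp
  ultimately show ?thesis using cl by simp
qed

text \<open>It suffices that the orthogonal of \<open>[\<dd>\<^sub>-, \<dd>\<^sub>-]\<close> in \<open>\<dd>\<^sub>+\<close> is zero. By invariance its elements
  commute with \<open>\<dd>\<^sub>-\<close>, so they are central.\<close>

lemma symmetric_from_conditions:
  assumes i: "lie_span br (minus_space \<theta>l) = plus_space \<theta>l" and ss: "semisimple \<rho>"
    and T2: "cond_T2 br \<theta>l \<rho> \<theta>a \<alpha>" and A0: "cond_A0 br \<rho> ip \<alpha> \<gamma>"
  shows "lie_span G (minus_space T) = plus_space T"
proof (rule subset_antisym[OF lie_span_G_minus_subset])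
  let ?D = "lie_span G (minus_space T)"
  have sD: "subspace ?D" unfolding lie_span_def by (rule real_vector.subspace_span)
  have pm: "P u v = 0" if u: "u \<in> plus_space T" and v: "v \<in> minus_space T" for u v
  proof -
    have "T u = u" "T v = - v" using u v unfolding plus_space_def minus_space_def by blast+
    then have "P u v = - P u v" using P_T[of u v] by (simp add: bilinear_rneg[OF M.form.bil])
    then show ?thesis by simp
  qed
  have sp: "w + T w \<in> plus_space T" "w - T w \<in> minus_space T" for w
    unfolding plus_space_def minus_space_def by (simp_all add: linear_add[OF linear_T] linear_diff[OF linear_T] T_T add.commute)
  have half: "w = (1/2) *\<^sub>R (w + T w) + (1/2) *\<^sub>R (w - T w)" for w
    by (simp only: scaleR_right_distrib[symmetric]) (simp flip: scaleR_2)
  have zero: "x = 0" if x: "x \<in> plus_space T" and xD: "x \<in> perp P ?D" for x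
  proof -
    have cm: "G u x = 0" if u: "u \<in> minus_space T" for u
    proof (rule M.form.nondeg)
      fix v
      have Tu: "T u = - u" and Tx: "T x = x" using u x unfolding plus_space_def minus_space_def by blast+
      have Gm: "G u x \<in> minus_space T"
        unfolding minus_space_def by (simp add: T_aut Tu Tx bilinear_lneg[OF bilinear_G])
      have 1: "P (G u x) (v + T v) = 0"
        using pm[OF sp(1) Gm, of v] M.form.sym[of "G u x" "v + T v"] by simp
      have "G u (v - T v) \<in> ?D" unfolding lie_span_def by (rule real_vector.span_base) (use u sp(2) in blast)
      then have "P x (G u (v - T v)) = 0" using xD by (simp add: perp_def)
      then have 2: "P (G u x) (v - T v) = 0" by (simp add: G_invariant)
      have "P (G u x) ((1/2) *\<^sub>R (v + T v) + (1/2) *\<^sub>R (v - T v)) = 0"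
        unfolding bilinear_radd[OF M.form.bil, of _ "(1/2) *\<^sub>R (v + T v)"] bilinear_rmul[OF M.form.bil] 1 2 by simp
      then show "P (G u x) v = 0" using half[of v] by simp
    qed
    have cen: "G y x = 0" for y by (rule centralizer_of_minus[OF i ss x cm])
    \<comment> \<open>now the components of \<open>x\<close> vanish one by one: by \<open>A\<^sub>0\<close>, by \<open>T\<^sub>2\<close>, and by \<open>[\<ll>\<^sub>-, \<ll>\<^sub>-] = \<ll>\<^sub>+\<close>\<close>
    have l0: "lc x = 0" using A0 cen unfolding cond_A0_iff by blast
    have xp: "\<And>X. zc x (\<theta>l X) = zc x X" "\<theta>a (ac x) = ac x" using x unfolding plus_T by auto
    have r0: "\<rho> X (ac x) = 0" for X
      using cen[of "(0, 0, X)"] ac_G[of "(0, 0, X)" x] by (simp add: l0 lin_simps)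
    have z0: "zc x (br L X) = - ip (ac x) (\<alpha> L X)" for L X
      using cen[of "(0, 0, L)"] zc_G[of "(0, 0, L)" x X] by (simp add: l0 lin_simps)
    have ai: "ac x \<in> ainv" using r0 by (simp add: ainv_iff)
    have "ac x = 0"
    proof (rule ainv_nondegenerate[OF ss ai])
      fix v assume v: "v \<in> ainv"
      have tv: "\<theta>a v \<in> ainv" using v \<theta>a(4)[of _ v] by (simp add: ainv_iff \<theta>a(4)[symmetric] linear_0[OF \<theta>a(1)])
      have "v + \<theta>a v \<in> ainv" by (rule real_vector.subspace_add[OF submodule_subspace[OF submodule_ainv] v tv])
      moreover have "v + \<theta>a v \<in> plus_space \<theta>a"
        by (simp add: plus_space_def linear_add[OF \<theta>a(1)] \<theta>a(2) add.commute)
      ultimately have "v + \<theta>a v \<in> alpha0_image (minus_space \<theta>l)" using T2 unfolding cond_T2_iff[OF ss] by blast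
      then obtain ps where ps: "ps \<in> ext_ker (minus_space \<theta>l) br" "v + \<theta>a v = ext_lift (alpha0 \<rho> \<alpha>) ps"
        unfolding alpha0_image_def[OF ss] by blast
      have "ip (ac x) (v + \<theta>a v) = ext_lift (\<lambda>L X. ip (ac x) (\<alpha> L X)) ps"
        unfolding ps(2) ext_lift_alpha0[OF ss] ip_inv_proj[OF ss ai] ip_ext_lift[OF ss] ..
      also have "\<dots> = ext_lift (\<lambda>L X. - zc x (br L X)) ps" by (rule ext_lift_cong) (simp add: z0)
      also have "\<dots> = - zc x (ext_lift br ps)"
        using ext_lift_linear[of "\<lambda>y. - zc x y" br ps, OF linear_compose_neg[OF linear_dual_app]] by simp
      also have "\<dots> = 0" using ps(1) by (simp add: ext_ker_def lin_simps)
      finally have "ip (ac x) v + ip (ac x) (\<theta>a v) = 0" by (simp add: lin_simps)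
      moreover have "ip (ac x) (\<theta>a v) = ip (ac x) v" using \<theta>a(3)[of "ac x" v] by (simp add: xp(2))
      ultimately show "ip (ac x) v = 0" by simp
    qed
    moreover have "zc x X = 0" for X
    proof -
      have b: "zc x (br L X) = 0" for L X using z0[of L X] \<open>ac x = 0\<close> by (simp add: lin_simps)
      have "X + \<theta>l X \<in> lie_span br (minus_space \<theta>l)"
        unfolding i by (simp add: plus_space_def linear_add[OF \<theta>l(1)] \<theta>l(2) add.commute)
      then have "zc x (X + \<theta>l X) = 0"
        unfolding lie_span_def by (rule linear_eq_0_on_span[OF linear_dual_app, rotated]) (use b in blast)
      then show ?thesis using xp(1)[of X] by (simp add: lin_simps)
    qed
    ultimately show ?thesis using l0 unfolding model_eq_iff by (simp add: dual_app_0)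
  qed
  show "plus_space T \<subseteq> ?D"
  proof
    fix y assume y: "y \<in> plus_space T"
    have "P y w = 0" if w: "w \<in> perp P ?D" for w
    proof -
      have "w + T w \<in> perp P ?D"
        unfolding perp_def
      proof (intro CollectI ballI)
        fix d assume d: "d \<in> ?D"
        have dp: "T d = d" using d lie_span_G_minus_subset unfolding plus_space_def by blast
        have "P w d = 0" using w d by (simp add: perp_def)
        moreover have "P (T w) d = P w d" using P_T[of w d] by (simp add: dp)
        ultimately show "P (w + T w) d = 0" by (simp add: bilinear_ladd[OF M.form.bil])
      qed
      from zero[OF sp(1) this] have w2: "w + T w = 0" .
      have "P y (w - T w) = 0" by (rule pm[OF y sp(2)])
      moreover have "w - T w = 2 *\<^sub>R w" using w2 by (simp add: eq_neg_iff_add_eq_0[symmetric] scaleR_2)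
      ultimately show ?thesis by (simp add: bilinear_rmul[OF M.form.bil])
    qed
    then have "y \<in> perp P (perp P ?D)" by (simp add: perp_def)
    then show "y \<in> ?D" by (simp only: M.form.perp_perp[OF sD])
  qed
qed

section \<open>Admissibility in terms of one cocycle\<close>

definition sharp_conditions :: bool where
  "sharp_conditions \<longleftrightarrow> cond_T2 br \<theta>l \<rho> \<theta>a \<alpha> \<and> cond_A0 br \<rho> ip \<alpha> \<gamma> \<and> cond_B0 br \<rho> ip \<alpha> \<and>
      (\<exists>m. RL (m + 1) = {0} \<and> (\<forall>k\<in>{1..m}. cond_A br \<rho> ip \<alpha> \<gamma> k \<and> cond_B br \<rho> ip \<alpha> k))"

text \<open>The conditions for \<open>k > m\<close> hold automatically, so that the induction over \<open>k\<close> need not stop.\<close>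

lemma cond_A_vanishing: "RL k = {0} \<Longrightarrow> cond_A br \<rho> ip \<alpha> \<gamma> k"
  unfolding cond_A_def
proof (intro allI impI, elim conjE)
  fix kk assume "RL k = {0}" "kk \<subseteq> S_ideal br 1 \<inter> RL k" "lie_ideal br kk"
  then show "kk = {0}" using real_vector.subspace_0[OF submodule_subspace[of br kk]] by blast
qed

lemma cond_B_vanishing:
  assumes ss: "semisimple \<rho>" and R: "RL k = {0}" shows "cond_B br \<rho> ip \<alpha> k"
proof -
  have "b_candidate k UNIV"
    unfolding b_candidate_def R using submodule_UNIV
    by (auto intro!: exI[of _ "\<lambda>_. 0"] simp: linear_on_def lin_simps)
  then have "b_submodule br \<rho> ip \<alpha> k = UNIV" using b_submodule_greatest(2)[OF ss] by blast
  then show ?thesis unfolding cond_B_def nondegenerate_on_def using A.nondeg by simp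
qed

text \<open>For the converse, \<open>P\<^sub>0\<close> and \<open>Q\<^sub>1\<close> come from \<open>A\<^sub>0\<close> and \<open>B\<^sub>0\<close>; after that the conditions yield
  \<open>P\<^sub>1\<close>, \<open>Q\<^sub>2\<close>, \<open>P\<^sub>2\<close>, \<open>Q\<^sub>3\<close> and so on, in this order.\<close>

lemma admissible_iff:
  "admissible G T P Lstar \<longleftrightarrow> lie_span br (minus_space \<theta>l) = plus_space \<theta>l \<and> semisimple \<rho> \<and> sharp_conditions"
proof
  assume adm: "admissible G T P Lstar"
  then have bal: "balanced G Lstar" and sym: "lie_span G (minus_space T) = plus_space T"
    unfolding admissible_def symmetric_triple_def by blast+
  have PQ: "steps_project_to_zero k" "diagonal_in_Lstar k" for k using bal unfolding balanced_iff by blast+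
  have ss: "semisimple \<rho>" by (rule semisimple_from_balanced[OF bal])
  have "lc x = 0" if "\<forall>y. G y x = 0" for x
    using central_in_SG1[OF that] PQ(1)[of 0] by (auto simp: steps_project_to_zero_def Lstar_perp_iff)
  then have A0: "cond_A0 br \<rho> ip \<alpha> \<gamma>" unfolding cond_A0_iff by blast
  have B0: "cond_B0 br \<rho> ip \<alpha>" unfolding cond_B0_iff[OF ss] by (rule central_part_nondegenerate[OF bal])
  obtain m where m: "RL m = {0}" using L.R_ideal_vanishes by blast
  have "RL (m + 1) \<subseteq> {0}" using L.R_ideal_antimono[of m "m + 1"] m by simp
  then have "RL (m + 1) = {0}" using real_vector.subspace_0[OF submodule_subspace[OF L.R_ideal_ideal], of "m + 1"] by blast
  moreover have "\<forall>k\<in>{1..m}. cond_A br \<rho> ip \<alpha> \<gamma> k \<and> cond_B br \<rho> ip \<alpha> k"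
    using cond_A_from_balanced[OF bal ss] cond_B_from_balanced[OF bal] by auto
  ultimately show "lie_span br (minus_space \<theta>l) = plus_space \<theta>l \<and> semisimple \<rho> \<and> sharp_conditions"
    unfolding sharp_conditions_def by (intro conjI conditions_from_symmetric[OF sym] ss A0 B0 exI[of _ m])
next
  assume h: "lie_span br (minus_space \<theta>l) = plus_space \<theta>l \<and> semisimple \<rho> \<and> sharp_conditions"
  then have i: "lie_span br (minus_space \<theta>l) = plus_space \<theta>l" and ss: "semisimple \<rho>" and sh: sharp_conditions
    by simp_all
  note sh = sh[unfolded sharp_conditions_def]
  have T2: "cond_T2 br \<theta>l \<rho> \<theta>a \<alpha>" by (rule conjunct1[OF sh])
  note sh = conjunct2[OF sh]
  have A0: "cond_A0 br \<rho> ip \<alpha> \<gamma>" by (rule conjunct1[OF sh])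
  note sh = conjunct2[OF sh]
  have B0: "cond_B0 br \<rho> ip \<alpha>" by (rule conjunct1[OF sh])
  obtain m where m: "RL (m + 1) = {0}" "\<forall>k\<in>{1..m}. cond_A br \<rho> ip \<alpha> \<gamma> k \<and> cond_B br \<rho> ip \<alpha> k"
    using conjunct2[OF sh] by (elim exE conjE)
  have van: "RL k = {0}" if "k \<ge> m + 1" for k
  proof -
    have "RL k \<subseteq> {0}" using L.R_ideal_antimono[OF that] m(1) by simp
    then show ?thesis using real_vector.subspace_0[OF submodule_subspace[OF L.R_ideal_ideal], of k] by blast
  qed
  have A: "cond_A br \<rho> ip \<alpha> \<gamma> k" and B: "cond_B br \<rho> ip \<alpha> k" if "k \<ge> 1" for k
    using m(2) that cond_A_vanishing[OF van, of k] cond_B_vanishing[OF ss van, of k] by (cases "k \<le> m"; simp)+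
  have P0: "steps_project_to_zero 0" by (rule steps_project_to_zero_0[OF A0])
  have Q1: "diagonal_in_Lstar 1" by (rule diagonal_in_Lstar_1[OF B0[unfolded cond_B0_iff[OF ss]] P0])
  have step: "steps_project_to_zero k \<and> diagonal_in_Lstar k" if "k \<ge> 1" for k
    using that
  proof (induction k rule: dec_induct)
    case base
    then show ?case using Q1 steps_project_to_zero_from_cond_A[OF A[of 1] Q1] by simp
  next
    case (step k)
    have "diagonal_in_Lstar (Suc k)" by (rule diagonal_in_Lstar_Suc[OF ss step(1) B[OF step(1)]]) (use step in auto)
    then show ?case using steps_project_to_zero_from_cond_A[OF A, of "Suc k"] by simp
  qed
  have "steps_project_to_zero k \<and> diagonal_in_Lstar k" for k
  proof (cases "k = 0")
    case True
    then show ?thesis using P0 by (auto simp: diagonal_in_Lstar_def Lstar_iff)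
  next
    case False
    then show ?thesis using step by simp
  qed
  then have bal: "balanced G Lstar" unfolding balanced_iff by blast
  show "admissible G T P Lstar"
    unfolding admissible_def symmetric_triple_def
    using bal metric_model symmetric_from_conditions[OF i ss T2 A0] by blast
qed

end

section \<open>Change of the representing cocycle\<close>

text \<open>Isomorphisms of Lie algebras preserve the ideals \<open>R\<^sub>k\<close>, and isometric ones also \<open>S\<^sub>k = R\<^sub>k\<^sup>\<bottom>\<close>.\<close>

lemma metric_lie_iso_balanced:
  assumes g: "metric_lie br b" and h: "metric_lie br' b"
    and f: "linear f" "bij f" and hom: "\<And>x y. f (br x y) = br' (f x) (f y)" and iso: "\<And>x y. b (f x) (f y) = b x y"
    and I: "f ` I = I" and bal: "balanced br' I"
  shows "balanced br I"
proof -
  interpret g: metric_lie br b by (rule g)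
  interpret h: metric_lie br' b by (rule h)
  have surj: "surj f" and inj: "inj f" using f(2) by (auto simp: bij_def)
  have R: "R_ideal br' k = f ` R_ideal br k" for k
    by (rule R_ideal_image[where f = f, OF g.la h.la f(1) surj]) (rule hom)
  have S: "S_ideal br' k = f ` S_ideal br k" for k
  proof -
    have "perp b (f ` U) = f ` perp b U" for U
    proof
      show "f ` perp b U \<subseteq> perp b (f ` U)" by (auto simp: perp_def iso)
      show "perp b (f ` U) \<subseteq> f ` perp b U"
      proof
        fix y assume y: "y \<in> perp b (f ` U)"
        obtain x where x: "y = f x" using surj by (metis surjD)
        have "x \<in> perp b U" using y by (auto simp: perp_def x iso)
        then show "y \<in> f ` perp b U" using x by blast
      qed
    qed
    then show ?thesis unfolding h.S_ideal_perp g.S_ideal_perp R .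
  qed
  have "canonical_ideal br' = f ` canonical_ideal br"
    unfolding canonical_ideal_def R S image_Int[OF inj, symmetric] image_UN[symmetric]
    by (rule linear_span_image[OF f(1)])
  then have "f ` I = f ` canonical_ideal br" using bal I unfolding balanced_def by simp
  then show ?thesis unfolding balanced_def using inj_image_eq_iff[OF inj] by blast
qed

lemma lie_span_iso:
  assumes f: "linear f" "bij f" and hom: "\<And>x y. f (br x y) = br' (f x) (f y)" and T: "\<And>x. T (f x) = f (T x)"
    and s: "lie_span br' (minus_space T) = plus_space T"
  shows "lie_span br (minus_space T) = plus_space T"
proof -
  have surj: "surj f" and inj: "inj f" using f(2) by (auto simp: bij_def)
  have m: "f ` minus_space T = minus_space T"
  proof
    show "f ` minus_space T \<subseteq> minus_space T" by (auto simp: minus_space_def T linear_neg[OF f(1)])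
    show "minus_space T \<subseteq> f ` minus_space T"
    proof
      fix y assume y: "y \<in> minus_space T"
      obtain x where x: "y = f x" using surj by (metis surjD)
      have "f (T x) = f (- x)" using y by (simp add: minus_space_def x T linear_neg[OF f(1)])
      then have "x \<in> minus_space T" using inj by (simp add: minus_space_def inj_eq)
      then show "y \<in> f ` minus_space T" using x by blast
    qed
  qed
  have p: "f ` plus_space T = plus_space T"
  proof
    show "f ` plus_space T \<subseteq> plus_space T" by (auto simp: plus_space_def T)
    show "plus_space T \<subseteq> f ` plus_space T"
    proof
      fix y assume y: "y \<in> plus_space T"
      obtain x where x: "y = f x" using surj by (metis surjD)
      have "f (T x) = f x" using y by (simp add: plus_space_def x T)
      then have "x \<in> plus_space T" using inj by (simp add: plus_space_def inj_eq)
      then show "y \<in> f ` plus_space T" using x by blast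
    qed
  qed
  have "f ` {br x y | x y. x \<in> minus_space T \<and> y \<in> minus_space T}
      = {br' x y | x y. x \<in> f ` minus_space T \<and> y \<in> f ` minus_space T}"
  proof -
    have "f ` {br x y | x y. x \<in> minus_space T \<and> y \<in> minus_space T}
      = {f (br x y) | x y. x \<in> minus_space T \<and> y \<in> minus_space T}" by blast
    also have "\<dots> = {br' x y | x y. x \<in> f ` minus_space T \<and> y \<in> f ` minus_space T}"
      unfolding hom by blast
    finally show ?thesis .
  qed
  then have "f ` lie_span br (minus_space T) = lie_span br' (f ` minus_space T)"
    unfolding lie_span_def linear_span_image[OF f(1), symmetric] by (simp only:)
  then have "f ` lie_span br (minus_space T) = f ` plus_space T" unfolding m p s .
  then show ?thesis using inj_image_eq_iff[OF inj] by blast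
qed

text \<open>The cocycle of \<open>img\<close> results from that of \<open>src\<close> by the action of \<open>(\<tau>, \<sigma>)\<close>.\<close>

locale cohomologous = img: quad_ext br \<theta>l \<rho> ip \<theta>a \<alpha> \<gamma> + src: quad_ext br \<theta>l \<rho> ip \<theta>a \<alpha>' \<gamma>'
  for br :: "'l::real_vector \<Rightarrow> 'l \<Rightarrow> 'l" and \<theta>l and \<rho> :: "'l \<Rightarrow> 'a::real_vector \<Rightarrow> 'a" and ip and \<theta>a
    and \<alpha> :: "'l \<Rightarrow> 'l \<Rightarrow> 'a" and \<gamma> and \<alpha>' :: "'l \<Rightarrow> 'l \<Rightarrow> 'a" and \<gamma>' +
  fixes \<tau> :: "'l \<Rightarrow> 'a" and \<sigma> :: "'l \<Rightarrow> 'l \<Rightarrow> real"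
  assumes \<tau>: "\<tau> \<in> C1_plus \<theta>l \<theta>a" and \<sigma>: "\<sigma> \<in> C2_plus \<theta>l id"
    and act: "(\<alpha>, \<gamma>) = C1Q_act br \<rho> ip (\<alpha>', \<gamma>') (\<tau>, \<sigma>)"
begin

lemma tau: "linear \<tau>" "\<theta>a (\<tau> (\<theta>l x)) = \<tau> x"
  using \<tau> by (auto simp: C1_plus_def)

lemma sigma: "bilinear \<sigma>" "\<sigma> x x = 0" "\<sigma> (\<theta>l x) (\<theta>l y) = \<sigma> x y"
  using \<sigma> by (auto simp: C2_plus_def)

lemma sigma_anti: "\<sigma> x y = - \<sigma> y x"
  by (rule alternating_bilinear_antisym[OF sigma(1,2)])

lemma alpha_act: "\<alpha> x y = \<alpha>' x y + \<rho> x (\<tau> y) - \<rho> y (\<tau> x) - \<tau> (br x y)"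
  using act by (simp add: C1Q_act_def ce_d1_def)

lemma gamma_act: "\<gamma> x y z = \<gamma>' x y z + ce_d2 br triv_rep \<sigma> x y z
       + wedge_21 ip (\<lambda>u v. \<alpha>' u v + (1/2) *\<^sub>R ce_d1 br \<rho> \<tau> u v) \<tau> x y z"
  using act by (simp add: C1Q_act_def)

lemmas cochain_simps = img.lin_simps linear_add[OF tau(1)] linear_cmul[OF tau(1)] linear_diff[OF tau(1)] linear_neg[OF tau(1)] linear_0[OF tau(1)]
  bilinear_ladd[OF sigma(1)] bilinear_radd[OF sigma(1)] bilinear_lsub[OF sigma(1)] bilinear_rsub[OF sigma(1)]
  bilinear_lmul[OF sigma(1)] bilinear_rmul[OF sigma(1)] bilinear_lzero[OF sigma(1)] bilinear_rzero[OF sigma(1)]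
  bilinear_lneg[OF sigma(1)] bilinear_rneg[OF sigma(1)]

text \<open>The isometry of \<open>\<ll>\<^sup>* \<oplus> \<aa> \<oplus> \<ll>\<close> that fixes \<open>\<ll>\<^sup>*\<close>, maps \<open>L\<close> to \<open>L + \<tau> L + \<dots>\<close>, and whose
  \<open>\<ll>\<^sup>*\<close>-components are determined by this up to a two-form, for which \<open>\<sigma>\<close> is taken.\<close>

definition shear :: "'l dual \<times> 'a \<times> 'l \<Rightarrow> 'l dual \<times> 'a \<times> 'l" where
  "shear x = (dual_of (\<lambda>X. img.zc x X - ip (img.ac x) (\<tau> X) + \<sigma> (img.lc x) X - (1/2) * ip (\<tau> (img.lc x)) (\<tau> X)),
     img.ac x + \<tau> (img.lc x), img.lc x)"

lemma lc_shear: "img.lc (shear x) = img.lc x" and ac_shear: "img.ac (shear x) = img.ac x + \<tau> (img.lc x)"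
  by (simp_all add: shear_def)

lemma zc_shear: "img.zc (shear x) X = img.zc x X - ip (img.ac x) (\<tau> X) + \<sigma> (img.lc x) X - (1/2) * ip (\<tau> (img.lc x)) (\<tau> X)"
proof -
  have "linear (\<lambda>X. img.zc x X - ip (img.ac x) (\<tau> X) + \<sigma> (img.lc x) X - (1/2) * ip (\<tau> (img.lc x)) (\<tau> X))"
    by (rule linearI) (simp_all add: cochain_simps algebra_simps)
  from dual_app_of_linear[OF this, of X] show ?thesis by (simp add: shear_def)
qed

lemmas shear_simps = lc_shear ac_shear zc_shear

lemma linear_shear: "linear shear"
  by (rule linearI; unfold img.model_eq_iff) (simp_all add: shear_simps cochain_simps algebra_simps)

lemma bij_shear: "bij shear"
proof (rule bijI)
  show "inj shear"
    unfolding linear_injective_0[OF linear_shear]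
  proof (intro allI impI)
    fix x assume "shear x = 0"
    then have h: "\<forall>X. img.zc (shear x) X = 0" "img.ac (shear x) = 0" "img.lc (shear x) = 0"
      by (simp_all add: dual_app_0)
    have l: "img.lc x = 0" using h(3) by (simp add: lc_shear)
    have a: "img.ac x = 0" using h(2) by (simp add: ac_shear l cochain_simps)
    have "img.zc x X = 0" for X using h(1) by (simp add: zc_shear l a cochain_simps)
    then show "x = 0" unfolding img.model_eq_iff using l a by (simp add: dual_app_0)
  qed
  show "surj shear"
  proof
    show "UNIV \<subseteq> range shear"
    proof
      fix y :: "'l dual \<times> 'a \<times> 'l"
      define a where "a = img.ac y - \<tau> (img.lc y)"
      define h where "h X = img.zc y X + ip a (\<tau> X) - \<sigma> (img.lc y) X + (1/2) * ip (\<tau> (img.lc y)) (\<tau> X)" for X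
      have "linear h" unfolding h_def by (rule linearI) (simp_all add: cochain_simps algebra_simps)
      then have d: "dual_app (dual_of h) X = h X" for X by (rule dual_app_of_linear)
      have "shear (dual_of h, a, img.lc y) = y"
        unfolding img.model_eq_iff by (simp add: shear_simps d h_def) (simp add: a_def)
      then show "y \<in> range shear" by (metis rangeI)
    qed
  qed simp
qed

lemma shear_isometry: "img.P (shear x) (shear y) = img.P x y"
  using sigma_anti[of "img.lc x" "img.lc y"] img.A.sym[of "\<tau> (img.lc x)" "img.ac y"] img.A.sym[of "\<tau> (img.lc x)" "\<tau> (img.lc y)"]
  by (simp add: img.P_eq shear_simps cochain_simps)

lemma shear_involution: "img.T (shear x) = shear (img.T x)"
proof -
  have t1: "\<theta>a (\<tau> u) = \<tau> (\<theta>l u)" for u using tau(2)[of "\<theta>l u"] by (simp add: img.\<theta>l)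
  have i1: "ip (\<theta>a u) (\<tau> X) = ip u (\<tau> (\<theta>l X))" for u X
    using img.\<theta>a(3)[of u "\<tau> (\<theta>l X)"] by (simp add: t1 img.\<theta>l)
  have i2: "ip (\<tau> (\<theta>l u)) (\<tau> X) = ip (\<tau> u) (\<tau> (\<theta>l X))" for u X
    using i1[of "\<tau> u" X] by (simp add: t1)
  have s1: "\<sigma> (\<theta>l u) X = \<sigma> u (\<theta>l X)" for u X using sigma(3)[of u "\<theta>l X"] by (simp add: img.\<theta>l)
  show ?thesis
    unfolding img.model_eq_iff
    by (simp add: shear_simps img.zc_T img.ac_T img.lc_T linear_add[OF img.\<theta>a(1)] t1 i1 i2 s1)
qed

lemma shear_Lstar: "shear ` img.Lstar = img.Lstar"
proof
  show "shear ` img.Lstar \<subseteq> img.Lstar" by (auto simp: img.Lstar_iff shear_simps cochain_simps)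
  show "img.Lstar \<subseteq> shear ` img.Lstar"
  proof
    fix y :: "'l dual \<times> 'a \<times> 'l" assume y: "y \<in> img.Lstar"
    obtain x where x: "y = shear x" using bij_shear by (metis bij_pointE)
    have l: "img.lc x = 0" using y by (simp add: x img.Lstar_iff lc_shear)
    then have "img.ac x = 0" using y by (simp add: x img.Lstar_iff ac_shear cochain_simps)
    then have "x \<in> img.Lstar" using l by (simp add: img.Lstar_iff)
    then show "y \<in> shear ` img.Lstar" using x by blast
  qed
qed

text \<open>This is how the action of \<open>(\<tau>, \<sigma>)\<close> on cocycles arises: in the model of \<open>(\<alpha>', \<gamma>')\<close> the bracket of
  \<open>L + \<tau> L\<close> and \<open>L' + \<tau> L'\<close> has the \<open>\<aa>\<close>-component \<open>\<alpha>'(L, L') + d\<tau>(L, L') + \<tau>[L, L']\<close>, and the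
  \<open>\<ll>\<^sup>*\<close>-component yields the formula for \<open>\<gamma>\<close>. The facts collected in the proof bring all terms
  into a common form.\<close>

lemma shear_hom: "shear (img.G x y) = src.G (shear x) (shear y)"
proof -
  have z: "img.zc (shear (img.G x y)) X = img.zc (src.G (shear x) (shear y)) X" for X
  proof -
    define a b A C Z W where d: "a = img.lc x" "b = img.lc y" "A = img.ac x" "C = img.ac y" "Z = img.zc x" "W = img.zc y"
    have sk: "ip (\<rho> p u) v = - ip u (\<rho> p v)" for p u v by (rule img.ip_skew)
    have sw: "ip u (\<rho> p v) = - ip v (\<rho> p u)" for p u v
      using img.ip_skew[of p u v] img.A.sym[of v "\<rho> p u"] by simp
    note sws = sw[of C X A] sw[of "\<tau> a" X A] sw[of "\<tau> b" X A] sw[of "\<tau> X" a C] sw[of "\<tau> X" b A] sw[of "\<tau> a" X C] sw[of "\<tau> b" X C]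
      sw[of "\<tau> X" a "\<tau> b"] sw[of "\<tau> X" b "\<tau> a"] sw[of "\<tau> a" X "\<tau> b"] sw[of "\<tau> X" X A] sw[of "\<tau> X" a A] sw[of "\<tau> X" b C]
    note syms = img.A.sym[of "\<tau> X" "\<alpha>' a b"] img.A.sym[of "\<tau> b" "\<alpha>' a X"] img.A.sym[of "\<tau> a" "\<alpha>' b X"]
      img.A.sym[of "\<tau> X" "\<tau> (br a b)"] img.A.sym[of "\<tau> b" "\<tau> (br a X)"] img.A.sym[of "\<tau> a" "\<tau> (br b X)"]
    note sas = sigma_anti[of "br a X" b] sigma_anti[of "br b X" a] sigma_anti[of "br a b" X]
    show ?thesis
      using sws syms sas
      by (simp add: shear_simps img.zc_G img.ac_G img.lc_G src.zc_G src.ac_G src.lc_G cochain_simps src.lin_simps alpha_act gamma_act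
          ce_d1_def ce_d2_def wedge_21_def triv_rep_def sk d[symmetric] algebra_simps; linarith?)
  qed
  show ?thesis
    unfolding img.model_eq_iff
  proof (intro conjI allI)
    show "img.ac (shear (img.G x y)) = img.ac (src.G (shear x) (shear y))"
      by (simp add: shear_simps img.ac_G img.lc_G src.ac_G alpha_act cochain_simps)
    show "img.lc (shear (img.G x y)) = img.lc (src.G (shear x) (shear y))"
      by (simp add: shear_simps img.lc_G src.lc_G)
  qed (rule z)
qed

lemma admissible_cohomologous:
  assumes "admissible src.G img.T img.P img.Lstar" shows "admissible img.G img.T img.P img.Lstar"
proof -
  have "balanced img.G img.Lstar"
    by (rule metric_lie_iso_balanced[where f = shear, OF img.M.metric_lie_axioms src.M.metric_lie_axioms linear_shear bij_shear _ _ shear_Lstar])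
      (use assms in \<open>simp_all add: admissible_def shear_hom shear_isometry\<close>)
  moreover have "lie_span img.G (minus_space img.T) = plus_space img.T"
  proof (rule lie_span_iso[where f = shear and br' = src.G])
    show "linear shear" "bij shear" by (rule linear_shear bij_shear)+
    show "shear (img.G x y) = src.G (shear x) (shear y)" for x y by (rule shear_hom)
    show "img.T (shear x) = shear (img.T x)" for x by (rule shear_involution)
    show "lie_span src.G (minus_space img.T) = plus_space img.T"
      using assms by (simp add: admissible_def symmetric_triple_def)
  qed
  ultimately show ?thesis
    unfolding admissible_def symmetric_triple_def using img.metric_model by blast
qed

end

lemma C1Q_act_zero:
  assumes "bilinear br" "bilinear \<rho>" "bilinear ip"
  shows "C1Q_act br \<rho> ip (\<alpha>, \<gamma>) (\<lambda>_. 0, \<lambda>_ _. 0) = (\<alpha>, \<gamma>)"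
  by (simp add: C1Q_act_def ce_d1_def ce_d2_def wedge_21_def triv_rep_def
      bilinear_rzero[OF assms(2)] bilinear_rzero[OF assms(3)])

theorem theorem5p1:
  fixes br :: "'l::real_vector \<Rightarrow> 'l \<Rightarrow> 'l"
    and \<theta>l :: "'l \<Rightarrow> 'l"
    and \<rho> :: "'l \<Rightarrow> 'a::real_vector \<Rightarrow> 'a"
    and ip :: "'a \<Rightarrow> 'a \<Rightarrow> real"
    and \<theta>a :: "'a \<Rightarrow> 'a"
    and \<alpha> :: "'l \<Rightarrow> 'l \<Rightarrow> 'a"
    and \<gamma> :: "'l \<Rightarrow> 'l \<Rightarrow> 'l \<Rightarrow> real"
  assumes "lie_algebra_with_involution br \<theta>l"
    and "orthogonal_module br \<theta>l \<rho> ip \<theta>a"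
    and "(\<alpha>, \<gamma>) \<in> Z2Q_plus br \<theta>l \<rho> ip \<theta>a"
  shows "admissible (model_bracket br \<rho> ip \<alpha> \<gamma>) (model_involution \<theta>l \<theta>a)
           (model_product ip) model_ideal \<longleftrightarrow>
         lie_span br (minus_space \<theta>l) = plus_space \<theta>l \<and>
         semisimple \<rho> \<and>
         H2Q_class br \<theta>l \<rho> ip \<theta>a (\<alpha>, \<gamma>) \<in> H2Q_sharp br \<theta>l \<rho> ip \<theta>a"
proof -
  interpret Q: quad_ext br \<theta>l \<rho> ip \<theta>a \<alpha> \<gamma> using assms by unfold_locales
  show ?thesis
  proof
    assume "admissible (model_bracket br \<rho> ip \<alpha> \<gamma>) (model_involution \<theta>l \<theta>a) (model_product ip) model_ideal"
    then have h: "lie_span br (minus_space \<theta>l) = plus_space \<theta>l" "semisimple \<rho>" "Q.sharp_conditions"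
      unfolding Q.admissible_iff by blast+
    have "H2Q_class br \<theta>l \<rho> ip \<theta>a (\<alpha>, \<gamma>) \<in> H2Q_sharp br \<theta>l \<rho> ip \<theta>a"
      unfolding H2Q_sharp_def using assms(3) h(3)[unfolded Q.sharp_conditions_def] by blast
    then show "lie_span br (minus_space \<theta>l) = plus_space \<theta>l \<and> semisimple \<rho> \<and>
         H2Q_class br \<theta>l \<rho> ip \<theta>a (\<alpha>, \<gamma>) \<in> H2Q_sharp br \<theta>l \<rho> ip \<theta>a" using h by blast
  next
    assume r: "lie_span br (minus_space \<theta>l) = plus_space \<theta>l \<and> semisimple \<rho> \<and>
         H2Q_class br \<theta>l \<rho> ip \<theta>a (\<alpha>, \<gamma>) \<in> H2Q_sharp br \<theta>l \<rho> ip \<theta>a"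
    then obtain \<alpha>' \<gamma>' where eq: "H2Q_class br \<theta>l \<rho> ip \<theta>a (\<alpha>, \<gamma>) = H2Q_class br \<theta>l \<rho> ip \<theta>a (\<alpha>', \<gamma>')"
      and z: "(\<alpha>', \<gamma>') \<in> Z2Q_plus br \<theta>l \<rho> ip \<theta>a"
      and c: "cond_T2 br \<theta>l \<rho> \<theta>a \<alpha>' \<and> cond_A0 br \<rho> ip \<alpha>' \<gamma>' \<and> cond_B0 br \<rho> ip \<alpha>' \<and>
      (\<exists>m. R_ideal br (m + 1) = {0} \<and> (\<forall>k\<in>{1..m}. cond_A br \<rho> ip \<alpha>' \<gamma>' k \<and> cond_B br \<rho> ip \<alpha>' k))"
      unfolding H2Q_sharp_def by blast
    interpret Q': quad_ext br \<theta>l \<rho> ip \<theta>a \<alpha>' \<gamma>' using assms z by unfold_locales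
    \<comment> \<open>\<open>(\<alpha>, \<gamma>)\<close> belongs to its own class, so it arises from \<open>(\<alpha>', \<gamma>')\<close> by the action of some \<open>(\<tau>, \<sigma>)\<close>\<close>
    have "(\<lambda>_. 0) \<in> C1_plus \<theta>l \<theta>a" "(\<lambda>_ _. 0) \<in> C2_plus \<theta>l id"
      by (simp_all add: C1_plus_def C2_plus_def linear_0[OF Q.\<theta>a(1)] linear_zero bilinear_def)
    then have "(\<alpha>, \<gamma>) \<in> H2Q_class br \<theta>l \<rho> ip \<theta>a (\<alpha>, \<gamma>)"
      unfolding H2Q_class_def using C1Q_act_zero[OF Q.L.bil Q.rho.bil_\<sigma> Q.A.bil, of \<alpha> \<gamma>, symmetric] by blast
    then have "(\<alpha>, \<gamma>) \<in> H2Q_class br \<theta>l \<rho> ip \<theta>a (\<alpha>', \<gamma>')" unfolding eq .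
    then obtain \<tau> \<sigma> where ts: "(\<alpha>, \<gamma>) = C1Q_act br \<rho> ip (\<alpha>', \<gamma>') (\<tau>, \<sigma>)" "\<tau> \<in> C1_plus \<theta>l \<theta>a" "\<sigma> \<in> C2_plus \<theta>l id"
      unfolding H2Q_class_def by blast
    interpret C: cohomologous br \<theta>l \<rho> ip \<theta>a \<alpha> \<gamma> \<alpha>' \<gamma>' \<tau> \<sigma> using ts by unfold_locales
    have "Q'.sharp_conditions" unfolding Q'.sharp_conditions_def by (rule c)
    then have "admissible Q'.G Q'.T Q'.P Q'.Lstar" unfolding Q'.admissible_iff using r by blast
    then show "admissible (model_bracket br \<rho> ip \<alpha> \<gamma>) (model_involution \<theta>l \<theta>a) (model_product ip) model_ideal"
      by (rule C.admissible_cohomologous)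
  qed
qed

end
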